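(* Let $(Z,\mathcal{A})$ be a nonsteep tower and $T:Z\to Z$ a tower map satisfying both the admissibility condition and the bounded distortion condition. Then for any $\psi\in\mathcal{F}$ there exists an upper semicontinuous concave function $q_\psi:\mathbb{R}\to[-\infty,0]$ satisfying $$\liminf_{n\to\infty}\frac1n\log m\Bigl(\Bigl\{x\in X:\frac1n S_n\psi(x,0)>a\Bigr\}\Bigr)\ \ge\ \sup_{t>a}q_\psi(t)$$ and $$\limsup_{n\to\infty}\frac1n\log m\Bigl(\Bigl\{x\in X:\frac1n S_n\psi(x,0)\ge a\Bigr\}\Bigr)\ \le\ \max_{t\ge a}q_\psi(t)$$ for all $a\in\mathbb{R}$. Moreover, the function $q_\psi$ can be represented by $$q_\psi(t)=\lim_{\varepsilon\to0+}\sup\Bigl\{h_\nu(T)-\int\log\mathrm{Jac}(T)\,d\nu\ :\ \nu\in\mathcal{M}_T,\ \nu\Bigl(\bigsqcup_{k=0}^{K-1}X_k\times\{k\}\Bigr)=1\text{ for some }K\ge1,\ \Bigl|\int\psi\,d\nu-t\Bigr|<\varepsilon\Bigr\},$$ where $\mathcal{M}_T$ denotes the set of all $T$-invariant probability measures on $Z$ and $h_\nu(T)$ is the metric entropy of $\nu\in\mathcal{M}_T$ for $T$.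
   Context: Conventions: $\log 0=-\infty$ and $\sup\emptyset=-\infty$. **Tower.** Let $(X,\mathcal{B},m)$ be a finite measure space and $X=X_0\supset X_1\supset X_2\supset\cdots$ a decreasing sequence of (measurable) subsets of positive measure. Assume that for each integer $k\ge0$ there is a finite measurable partition $\mathcal{I}_k$ of $X_k$ such that: (1) each $J\in\mathcal{I}_k$ has positive measure; (2) if $J\in\mathcal{I}_k$ intersects $X_{k+1}$ then $J\subset X_{k+1}$; (3) for any $K\in\mathcal{I}_{k+1}$ there is $J\in\mathcal{I}_k$ with $K\subset J$. The pair $(Z,\mathcal{A})$ with $Z:=\bigsqcup_{k=0}^\infty X_k\times\{k\}$ and the countable partition $\mathcal{A}:=\{J\times\{k\}:J\in\mathcal{I}_k,\ k=0,1,2,\dots\}$ of $Z$ is called a tower. The natural $\sigma$-finite measure on $Z$ is $m_Z(A)=\sum_{k\ge0}m(A_k)$ for $A=\bigsqcup_k A_k\times\{k\}$ with $A_k\in\mathcal{B}$. **Tower map.** Let $\mathcal{D}_k:=\{J\in\mathcal{I}_{k-1}:J\cap X_k=\emptyset\}$ $(k=1,2,\dots)$ and $\mathcal{D}:=\bigsqcup_{k\ge1}\mathcal{D}_k$. For $J\in\mathcal{D}$, $k(J)$ denotes the integer $k\ge1$ with $J\in\mathcal{D}_k$. Assume a bi-nonsingular bijection $g_J:J\to X$ is given for each $J\in\mathcal{D}$ (bi-nonsingular: it and its inverse are measurable and preserve null sets). The tower map $T:Z\to Z$ induced by $\{g_J\}_{J\in\mathcal{D}}$ is $T(x,k):=(x,k+1)$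 if $x\in X_{k+1}$, and $T(x,k):=(g_J(x),0)$ if $x\in J\in\mathcal{D}_{k+1}$. **Admissibility condition.** For any sequence $\{J_n\}_{n=0}^\infty\subset\mathcal{D}$ there is a unique point $z\in J_0\times\{0\}$ such that $T^{k(J_0)+\cdots+k(J_{n-1})}z\in J_n\times\{0\}$ for all $n\ge1$. **Bounded distortion condition.** There are a version $\mathrm{Jac}(T)>0$ of the Radon–Nikodym derivative $\frac{dm_Z\circ T}{dm_Z}$, a constant $D_T\ge1$ and a sequence $\{\varepsilon_k\}_{k=0}^\infty$ of positive numbers with $\lim_{k\to\infty}\varepsilon_k=0$ such that for any integer $n\ge1$ and $A\in\bigvee_{i=0}^{n-1}T^{-i}\mathcal{A}$, $$\frac{\mathrm{Jac}(T)(z)}{\mathrm{Jac}(T)(w)}\le e^{\varepsilon_{k(A)}}\quad\text{and}\quad\frac{\prod_{i=0}^{n-1}\mathrm{Jac}(T)(T^i(z))}{\prod_{i=0}^{n-1}\mathrm{Jac}(T)(T^i(w))}\le D_T$$ whenever $z,w\in A$, where $k(A)=\sharp\{1\le j\le n:T^j(A)\subset X_0\times\{0\}\}$. This version $\mathrm{Jac}(T)$ is the one used in the claim. **Nonsteep.** The tower $(Z,\mathcal{A})$ is nonsteep if there are sequences $\{l_k\}_{k=0}^\infty\subset\mathbb{N}$ with $\lim_{k\to\infty}l_k/k=0$ and $\{\gamma_k\}_{k=0}^\infty\subset(0,1)$ with $\lim_{k\to\infty}(\log\gamma_k)/k=0$ such that $m(J\setminus X_{k+l_k})\ge\gamma_k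 m(J)$ for all $k\ge0$ and $J\in\mathcal{I}_k$. (Without loss of generality $\{l_k\}$ is taken nondecreasing and $\{\gamma_k\}$ nonincreasing.) **Observables.** For $\psi:Z\to\mathbb{R}$ and $n\ge1$ let $\mathrm{var}_n(\psi):=\sup\{|\psi(z)-\psi(w)|:z,w\in A\text{ for some }A\in\bigvee_{i=0}^{n-1}T^{-i}\mathcal{A}\}$. $\mathcal{F}$ is the set of bounded functions $\psi:Z\to\mathbb{R}$ with $\lim_{n\to\infty}\mathrm{var}_n(\psi)=0$. $S_n\psi(z):=\sum_{i=0}^{n-1}\psi(T^i(z))$.
   Formalization: The T-invariant probability measures on Z are taken on the σ-algebra generated by the partitions ⋁T^{-i}𝒜 (log Jac integrated in its completion), not the one induced by 𝓑; this agrees for standard Borel X, while e.g. for Lebesgue sets the upper bound can fail under CH. *)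

theory Defs
  imports "HOL-Probability.Probability"
begin

text \<open>The nonempty elements of the join of the preimages \<open>T\<^sup>-\<^sup>i P\<close>, \<open>0 \<le> i < n\<close>,
  where \<open>P\<close> is a partition of \<open>Z\<close>.\<close>

definition dyn_join :: "'z set \<Rightarrow> ('z \<Rightarrow> 'z) \<Rightarrow> 'z set set \<Rightarrow> nat \<Rightarrow> 'z set set" where
  "dyn_join Z T P n =
     {A. A \<noteq> {} \<and> (\<exists>B. (\<forall>i<n. B i \<in> P) \<and> A = {z \<in> Z. \<forall>i<n. (T ^^ i) z \<in> B i})}"

definition invariant_probs :: "'z measure \<Rightarrow> ('z \<Rightarrow> 'z) \<Rightarrow> 'z measure set" where
  "invariant_probs N T =
     {\<nu>. sets \<nu> = sets N \<and> prob_space \<nu> \<and> T \<in> \<nu> \<rightarrow>\<^sub>M \<nu> \<and> distr \<nu> \<nu> T = \<nu>}"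

text \<open>The convention \<open>0 log 0 = 0\<close> is built into \<^const>\<open>ln\<close>, as \<open>ln 0 = 0\<close> for reals.\<close>

definition partition_entropy :: "'z measure \<Rightarrow> 'z set set \<Rightarrow> real" where
  "partition_entropy \<nu> P = - (\<Sum>A\<in>P. measure \<nu> A * ln (measure \<nu> A))"

definition metric_entropy :: "'z measure \<Rightarrow> ('z \<Rightarrow> 'z) \<Rightarrow> ereal" where
  "metric_entropy \<nu> T =
     (SUP P \<in> {P. finite P \<and> P \<subseteq> sets \<nu> \<and> partition_on (space \<nu>) P}.
        ereal (lim (\<lambda>n. partition_entropy \<nu> (dyn_join (space \<nu>) T P n) / real n)))"

definition birkhoff_sum :: "('z \<Rightarrow> 'z) \<Rightarrow> nat \<Rightarrow> ('z \<Rightarrow> real) \<Rightarrow> 'z \<Rightarrow> real" where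
  "birkhoff_sum T n \<psi> z = (\<Sum>i<n. \<psi> ((T ^^ i) z))"

definition tower :: "'a measure \<Rightarrow> (nat \<Rightarrow> 'a set) \<Rightarrow> (nat \<Rightarrow> 'a set set) \<Rightarrow> bool" where
  "tower M X I \<longleftrightarrow>
     finite_measure M \<and> X 0 = space M \<and>
     (\<forall>k. X k \<in> sets M \<and> measure M (X k) > 0 \<and> X (Suc k) \<subseteq> X k) \<and>
     (\<forall>k. finite (I k) \<and> partition_on (X k) (I k)) \<and>
     (\<forall>k. \<forall>J\<in>I k. J \<in> sets M \<and> measure M J > 0) \<and>
     (\<forall>k. \<forall>J\<in>I k. J \<inter> X (Suc k) \<noteq> {} \<longrightarrow> J \<subseteq> X (Suc k)) \<and>
     (\<forall>k. \<forall>K\<in>I (Suc k). \<exists>J\<in>I k. K \<subseteq> J)"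

definition tower_space :: "(nat \<Rightarrow> 'a set) \<Rightarrow> ('a \<times> nat) set" where
  "tower_space X = {(x, k). x \<in> X k}"

definition tower_partition :: "(nat \<Rightarrow> 'a set set) \<Rightarrow> ('a \<times> nat) set set" where
  "tower_partition I = {J \<times> {k} | J k. J \<in> I k}"

definition tower_measure :: "'a measure \<Rightarrow> (nat \<Rightarrow> 'a set) \<Rightarrow> ('a \<times> nat) measure" where
  "tower_measure M X =
     measure_of (tower_space X)
       {A. A \<subseteq> tower_space X \<and> (\<forall>k. {x. (x, k) \<in> A} \<in> sets M)}
       (\<lambda>A. \<Sum>k. emeasure M {x. (x, k) \<in> A})"

lemma sigma_algebra_tower:
  assumes "\<And>k. X k \<in> sets M"
  shows "sigma_algebra (tower_space X)
           {A. A \<subseteq> tower_space X \<and> (\<forall>k. {x. (x, k) \<in> A} \<in> sets M)}"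
proof (rule sigma_algebra_iff2[THEN iffD2], intro conjI ballI allI impI)
  fix A assume A: "A \<in> {A. A \<subseteq> tower_space X \<and> (\<forall>k. {x. (x, k) \<in> A} \<in> sets M)}"
  have "{x. (x, k) \<in> tower_space X - A} = X k - {x. (x, k) \<in> A}" for k
    by (auto simp: tower_space_def)
  then show "tower_space X - A \<in> {A. A \<subseteq> tower_space X \<and> (\<forall>k. {x. (x, k) \<in> A} \<in> sets M)}"
    using A assms by auto
next
  fix A :: "nat \<Rightarrow> ('a \<times> nat) set"
  assume A: "range A \<subseteq> {A. A \<subseteq> tower_space X \<and> (\<forall>k. {x. (x, k) \<in> A} \<in> sets M)}"
  have "{x. (x, k) \<in> (\<Union>i. A i)} = (\<Union>i. {x. (x, k) \<in> A i})" for k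
    by auto
  moreover have "(\<Union>i. {x. (x, k) \<in> A i}) \<in> sets M" for k
    using A by (intro sets.countable_UN) auto
  ultimately show "(\<Union>i. A i) \<in> {A. A \<subseteq> tower_space X \<and> (\<forall>k. {x. (x, k) \<in> A} \<in> sets M)}"
    using A by auto
qed auto

lemma space_tower_measure [simp]: "space (tower_measure M X) = tower_space X"
  unfolding tower_measure_def by (rule space_measure_of) auto

lemma sets_tower_measure:
  assumes "\<And>k. X k \<in> sets M"
  shows "sets (tower_measure M X) =
           {A. A \<subseteq> tower_space X \<and> (\<forall>k. {x. (x, k) \<in> A} \<in> sets M)}"
  unfolding tower_measure_def
  by (subst sets_measure_of) (auto simp: sigma_algebra.sigma_sets_eq[OF sigma_algebra_tower[OF assms]])

lemma emeasure_tower_measure: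
  assumes "\<And>k. X k \<in> sets M" "A \<in> sets (tower_measure M X)"
  shows "emeasure (tower_measure M X) A = (\<Sum>k. emeasure M {x. (x, k) \<in> A})"
proof (rule emeasure_measure_of[OF tower_measure_def])
  show "positive (sets (tower_measure M X)) (\<lambda>A. \<Sum>k. emeasure M {x. (x, k) \<in> A})"
    by (simp add: positive_def)
next
  show "countably_additive (sets (tower_measure M X)) (\<lambda>A. \<Sum>k. emeasure M {x. (x, k) \<in> A})"
  proof (rule countably_additiveI)
    fix F :: "nat \<Rightarrow> ('a \<times> nat) set"
    assume F: "range F \<subseteq> sets (tower_measure M X)" "disjoint_family F"
    have "(\<Sum>i. \<Sum>k. emeasure M {x. (x, k) \<in> F i}) = (\<Sum>k. \<Sum>i. emeasure M {x. (x, k) \<in> F i})"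
      using nn_integral_suminf[of "\<lambda>i k. emeasure M {x. (x, k) \<in> F i}" "count_space UNIV"]
      by (simp add: nn_integral_count_space_nat)
    also have "\<dots> = (\<Sum>k. emeasure M {x. (x, k) \<in> (\<Union>i. F i)})"
    proof (rule suminf_cong)
      fix k
      have "(\<Sum>i. emeasure M {x. (x, k) \<in> F i}) = emeasure M (\<Union>i. {x. (x, k) \<in> F i})"
        using F by (intro suminf_emeasure)
          (auto 0 4 simp: sets_tower_measure[OF assms(1)] disjoint_family_on_def disjoint_iff)
      also have "(\<Union>i. {x. (x, k) \<in> F i}) = {x. (x, k) \<in> (\<Union>i. F i)}" by auto
      finally show "(\<Sum>i. emeasure M {x. (x, k) \<in> F i}) = emeasure M {x. (x, k) \<in> (\<Union>i. F i)}" .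
    qed
    finally show "(\<Sum>i. \<Sum>k. emeasure M {x. (x, k) \<in> F i}) = (\<Sum>k. emeasure M {x. (x, k) \<in> (\<Union>i. F i)})" .
  qed
qed (use assms in \<open>auto simp: tower_measure_def\<close>)

text \<open>The union of the families \<open>exit_at X I k\<close> over \<open>k \<ge> 1\<close> is automatically disjoint.\<close>

definition exit_at :: "(nat \<Rightarrow> 'a set) \<Rightarrow> (nat \<Rightarrow> 'a set set) \<Rightarrow> nat \<Rightarrow> 'a set set" where
  "exit_at X I k = {J \<in> I (k - 1). J \<inter> X k = {}}"

definition exits :: "(nat \<Rightarrow> 'a set) \<Rightarrow> (nat \<Rightarrow> 'a set set) \<Rightarrow> 'a set set" where
  "exits X I = (\<Union>k\<in>{1..}. exit_at X I k)"

definition return_time :: "(nat \<Rightarrow> 'a set) \<Rightarrow> (nat \<Rightarrow> 'a set set) \<Rightarrow> 'a set \<Rightarrow> nat" where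
  "return_time X I J = (THE k. 1 \<le> k \<and> J \<in> exit_at X I k)"

definition bi_nonsingular :: "'a measure \<Rightarrow> 'a set \<Rightarrow> ('a \<Rightarrow> 'a) \<Rightarrow> bool" where
  "bi_nonsingular M J g \<longleftrightarrow>
     bij_betw g J (space M) \<and>
     g \<in> restrict_space M J \<rightarrow>\<^sub>M M \<and> the_inv_into J g \<in> M \<rightarrow>\<^sub>M restrict_space M J \<and>
     (\<forall>N\<in>null_sets M. N \<subseteq> J \<longrightarrow> g ` N \<in> null_sets M) \<and>
     (\<forall>N\<in>null_sets M. the_inv_into J g ` N \<in> null_sets M)"

fun tower_map :: "(nat \<Rightarrow> 'a set) \<Rightarrow> (nat \<Rightarrow> 'a set set) \<Rightarrow> ('a set \<Rightarrow> 'a \<Rightarrow> 'a) \<Rightarrow>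
    'a \<times> nat \<Rightarrow> 'a \<times> nat" where
  "tower_map X I g (x, k) =
     (if x \<in> X (Suc k) then (x, Suc k)
      else (g (THE J. J \<in> exit_at X I (Suc k) \<and> x \<in> J) x, 0))"

definition admissible :: "(nat \<Rightarrow> 'a set) \<Rightarrow> (nat \<Rightarrow> 'a set set) \<Rightarrow> ('a set \<Rightarrow> 'a \<Rightarrow> 'a) \<Rightarrow> bool" where
  "admissible X I g \<longleftrightarrow>
     (\<forall>J :: nat \<Rightarrow> 'a set. (\<forall>n. J n \<in> exits X I) \<longrightarrow>
        (\<exists>!z. z \<in> J 0 \<times> {0} \<and>
           (\<forall>n\<ge>1. (tower_map X I g ^^ (\<Sum>i<n. return_time X I (J i))) z \<in> J n \<times> {0})))"

text \<open>\<open>T\<close> is only countable-to-one on \<open>Z\<close>, so \<open>m\<^sub>Z \<circ> T\<close> is the measure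
  \<open>B \<mapsto> (\<Sum>A\<in>\<A>. m\<^sub>Z (T (B \<inter> A)))\<close>: \<open>T\<close> is injective on each element \<open>A\<close> of the
  countable tower partition.  The sum is written as an integral over the counting measure.\<close>

definition is_jacobian :: "'a measure \<Rightarrow> (nat \<Rightarrow> 'a set) \<Rightarrow> (nat \<Rightarrow> 'a set set) \<Rightarrow>
    ('a set \<Rightarrow> 'a \<Rightarrow> 'a) \<Rightarrow> ('a \<times> nat \<Rightarrow> real) \<Rightarrow> bool" where
  "is_jacobian M X I g Jac \<longleftrightarrow>
     Jac \<in> borel_measurable (tower_measure M X) \<and> (\<forall>z\<in>tower_space X. Jac z > 0) \<and>
     (\<forall>B\<in>sets (tower_measure M X).
        (\<integral>\<^sup>+z\<in>B. ennreal (Jac z) \<partial>tower_measure M X) =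
        (\<integral>\<^sup>+A. emeasure (tower_measure M X) (tower_map X I g ` (B \<inter> A))
            \<partial>count_space (tower_partition I)))"

definition return_count :: "(nat \<Rightarrow> 'a set) \<Rightarrow> (nat \<Rightarrow> 'a set set) \<Rightarrow> ('a set \<Rightarrow> 'a \<Rightarrow> 'a) \<Rightarrow>
    nat \<Rightarrow> ('a \<times> nat) set \<Rightarrow> nat" where
  "return_count X I g n A = card {j \<in> {1..n}. (tower_map X I g ^^ j) ` A \<subseteq> X 0 \<times> {0}}"

definition tower_join :: "(nat \<Rightarrow> 'a set) \<Rightarrow> (nat \<Rightarrow> 'a set set) \<Rightarrow> ('a set \<Rightarrow> 'a \<Rightarrow> 'a) \<Rightarrow>
    nat \<Rightarrow> ('a \<times> nat) set set" where
  "tower_join X I g n = dyn_join (tower_space X) (tower_map X I g) (tower_partition I) n"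

definition bounded_distortion :: "'a measure \<Rightarrow> (nat \<Rightarrow> 'a set) \<Rightarrow> (nat \<Rightarrow> 'a set set) \<Rightarrow>
    ('a set \<Rightarrow> 'a \<Rightarrow> 'a) \<Rightarrow> ('a \<times> nat \<Rightarrow> real) \<Rightarrow> bool" where
  "bounded_distortion M X I g Jac \<longleftrightarrow>
     is_jacobian M X I g Jac \<and>
     (\<exists>D \<epsilon>. D \<ge> 1 \<and> (\<forall>k. \<epsilon> k > 0) \<and> \<epsilon> \<longlonglongrightarrow> 0 \<and>
        (\<forall>n\<ge>1. \<forall>A\<in>tower_join X I g n. \<forall>z\<in>A. \<forall>w\<in>A.
           Jac z / Jac w \<le> exp (\<epsilon> (return_count X I g n A)) \<and>
           (\<Prod>i<n. Jac ((tower_map X I g ^^ i) z)) / (\<Prod>i<n. Jac ((tower_map X I g ^^ i) w)) \<le> D))"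

definition nonsteep :: "'a measure \<Rightarrow> (nat \<Rightarrow> 'a set) \<Rightarrow> (nat \<Rightarrow> 'a set set) \<Rightarrow> bool" where
  "nonsteep M X I \<longleftrightarrow>
     (\<exists>(l :: nat \<Rightarrow> nat) (\<gamma> :: nat \<Rightarrow> real).
        (\<lambda>k. real (l k) / real k) \<longlonglongrightarrow> 0 \<and>
        (\<forall>k. 0 < \<gamma> k \<and> \<gamma> k < 1) \<and> (\<lambda>k. ln (\<gamma> k) / real k) \<longlonglongrightarrow> 0 \<and>
        (\<forall>k. \<forall>J\<in>I k. measure M (J - X (k + l k)) \<ge> \<gamma> k * measure M J))"

definition tower_var :: "(nat \<Rightarrow> 'a set) \<Rightarrow> (nat \<Rightarrow> 'a set set) \<Rightarrow> ('a set \<Rightarrow> 'a \<Rightarrow> 'a) \<Rightarrow>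
    ('a \<times> nat \<Rightarrow> real) \<Rightarrow> nat \<Rightarrow> ereal" where
  "tower_var X I g \<psi> n =
     Sup {ereal \<bar>\<psi> z - \<psi> w\<bar> | z w. \<exists>A\<in>tower_join X I g n. z \<in> A \<and> w \<in> A}"

definition observables :: "(nat \<Rightarrow> 'a set) \<Rightarrow> (nat \<Rightarrow> 'a set set) \<Rightarrow> ('a set \<Rightarrow> 'a \<Rightarrow> 'a) \<Rightarrow>
    ('a \<times> nat \<Rightarrow> real) set" where
  "observables X I g =
     {\<psi>. bounded (\<psi> ` tower_space X) \<and> (\<lambda>n. tower_var X I g \<psi> n) \<longlonglongrightarrow> 0}"

text \<open>The measurable structure of \<open>Z\<close> on which invariant measures live is the one generated by the
  tower partition and the map.  If the base is a standard Borel space, this is the same as using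
  \<^term>\<open>sets (tower_measure M X)\<close>: an invariant probability measure carried by finitely many levels
  is carried by points that return to the base infinitely often, and by admissibility the
  itineraries separate these.  For a general base the larger \<open>\<sigma>\<close>-algebra would be the
  wrong one: if it is complete (Lebesgue sets), measures singular to \<open>m\<close> need not
  extend to it, and the invariant measures carried by finitely many levels can be too few.\<close>

definition coding_algebra :: "(nat \<Rightarrow> 'a set) \<Rightarrow> (nat \<Rightarrow> 'a set set) \<Rightarrow>
    ('a set \<Rightarrow> 'a \<Rightarrow> 'a) \<Rightarrow> ('a \<times> nat) measure" where
  "coding_algebra X I g = sigma (tower_space X) (\<Union>n. tower_join X I g n)"

definition tower_invariant :: "(nat \<Rightarrow> 'a set) \<Rightarrow> (nat \<Rightarrow> 'a set set) \<Rightarrow>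
    ('a set \<Rightarrow> 'a \<Rightarrow> 'a) \<Rightarrow> ('a \<times> nat) measure set" where
  "tower_invariant X I g = invariant_probs (coding_algebra X I g) (tower_map X I g)"

text \<open>The completion below only matters on points that do not return infinitely often.  These form
  a null set for every \<open>\<nu>\<close> carried by finitely many levels, but \<open>Jac\<close> need not be
  measurable there with respect to the generated \<open>\<sigma>\<close>-algebra.\<close>

definition free_energy :: "(nat \<Rightarrow> 'a set) \<Rightarrow> (nat \<Rightarrow> 'a set set) \<Rightarrow> ('a set \<Rightarrow> 'a \<Rightarrow> 'a) \<Rightarrow>
    ('a \<times> nat \<Rightarrow> real) \<Rightarrow> ('a \<times> nat) measure \<Rightarrow> ereal" where
  "free_energy X I g Jac \<nu> =
     metric_entropy \<nu> (tower_map X I g) - ereal (\<integral>z. ln (Jac z) \<partial>completion \<nu>)"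

definition elog :: "real \<Rightarrow> ereal" where
  "elog x = (if x \<le> 0 then - \<infinity> else ereal (ln x))"

definition usc :: "(real \<Rightarrow> ereal) \<Rightarrow> bool" where
  "usc q \<longleftrightarrow> (\<forall>t. Limsup (at t) q \<le> q t)"

text \<open>Used for functions with values in \<open>[-\<infinity>, 0]\<close>, so no sum \<open>\<infinity> - \<infinity>\<close> occurs.\<close>

definition ereal_concave :: "(real \<Rightarrow> ereal) \<Rightarrow> bool" where
  "ereal_concave q \<longleftrightarrow>
     (\<forall>s t u. 0 < u \<and> u < 1 \<longrightarrow>
        ereal u * q s + ereal (1 - u) * q t \<le> q (u * s + (1 - u) * t))"

end

theory Submission
  imports Defs "HOL-Real_Asymp.Real_Asymp"
begin

text \<open>A point of the base that returns infinitely often is coded by its sequence of exits, and by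
  admissibility every sequence of exits occurs.  Bounded distortion makes the mass of a cylinder of
  exits comparable with the exponential of minus the sum of \<open>log Jac\<close> along it, so masses of
  concatenated words are multiplicative up to a constant factor per word.

  Lower bound: let \<open>\<nu>\<close> be carried by finitely many levels.  Orbit segments of a large length \<open>N\<close>
  are completed to return words; concatenating words drawn independently with the distribution
  induced by \<open>\<nu>\<close>, the weak law of large numbers selects a family of long words on which the
  averages of \<open>\<psi>\<close> are close to \<open>\<integral>\<psi> d\<nu>\<close>, and whose total mass is governed by the entropy of the
  \<open>N\<close>-segments minus the integral of \<open>log Jac\<close>.

  Upper bound: by nonsteepness the cylinders of length \<open>n\<close> that meet the deviation event extend to
  return words of length \<open>n + o(n)\<close> at a subexponential cost in mass.  Among words of one common
  length, found by pigeonhole, take the Bernoulli measure with weights proportional to the masses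
  of the cylinders and average it along the orbit.  Its free energy is at least
  \<open>(1/n) log m - o(1)\<close>, and compactness of the range of \<open>\<integral>\<psi> d\<nu>\<close> turns this into a maximum.\<close>

subsection \<open>Entropy of simple functions\<close>

text \<open>Ergodicity of \<nu> is not assumed, and neither an ergodic theorem nor a
  Shannon-McMillan theorem enters: independent sampling of segments uses only the means of \<psi>
  and of the logarithm of the Jacobian and the entropy of one partition at one block length, and
  that entropy divided by the length is never below the entropy rate. Two obstacles shape the rest.
  Segments may start at any of the first K levels, so the return words made from them can overlap;
  at most K of them cover a point, which costs a factor K per word and is negligible for long
  segments. Metric entropy is a supremum over all finite partitions; but almost every orbit stays
  below level K, where there are finitely many symbols, so the truncated symbol is a finite
  generator and both bounds work with a single entropy rate. Nonpositivity of the rate function is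
  read off from the lower bound, since a positive free energy would produce masses above the total
  mass of the base. Concavity comes from concavity of entropy under mixtures.\<close>

definition fin_ent :: "'z measure \<Rightarrow> ('z \<Rightarrow> 'b) \<Rightarrow> real" where
  "fin_ent \<nu> X = - (\<Sum>y\<in>X ` space \<nu>.
     measure \<nu> (X -` {y} \<inter> space \<nu>) * ln (measure \<nu> (X -` {y} \<inter> space \<nu>)))"

lemma fin_ent_superset:
  assumes "finite S" "X ` space \<nu> \<subseteq> S"
  shows "fin_ent \<nu> X = - (\<Sum>y\<in>S.
     measure \<nu> (X -` {y} \<inter> space \<nu>) * ln (measure \<nu> (X -` {y} \<inter> space \<nu>)))"
proof -
  have "X -` {y} \<inter> space \<nu> = {}" if "y \<in> S - X ` space \<nu>" for y
    using that by auto
  then show ?thesis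
    unfolding fin_ent_def using assms by (subst sum.mono_neutral_left[OF assms]) auto
qed

lemma integral_simple_comp:
  assumes "finite_measure \<nu>" "simple_function \<nu> V"
  shows "integrable \<nu> (\<lambda>z. \<phi> (V z) :: real)"
    and "(\<integral>z. \<phi> (V z) \<partial>\<nu>) = (\<Sum>v\<in>V ` space \<nu>. measure \<nu> (V -` {v} \<inter> space \<nu>) * \<phi> v)"
proof -
  interpret finite_measure \<nu> by fact
  have fin: "finite (V ` space \<nu>)" and V: "\<And>v. V -` {v} \<inter> space \<nu> \<in> sets \<nu>"
    using assms(2) by (auto intro: simple_functionD)
  have eq: "\<phi> (V z) = (\<Sum>v\<in>V ` space \<nu>. indicator (V -` {v} \<inter> space \<nu>) z * \<phi> v)"
    if "z \<in> space \<nu>" for z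
  proof -
    have "(\<Sum>v\<in>V ` space \<nu>. indicator (V -` {v} \<inter> space \<nu>) z * \<phi> v)
      = (\<Sum>v\<in>V ` space \<nu>. if v = V z then \<phi> v else 0)"
      using that by (intro sum.cong) (auto simp: indicator_def)
    also have "\<dots> = \<phi> (V z)" using that fin by (simp add: sum.delta)
    finally show ?thesis by simp
  qed
  have int: "integrable \<nu> (\<lambda>z. \<Sum>v\<in>V ` space \<nu>. indicator (V -` {v} \<inter> space \<nu>) z * \<phi> v)"
    using V by (intro Bochner_Integration.integrable_sum integrable_mult_left
        integrable_real_indicator) (auto simp: emeasure_eq_measure)
  then show "integrable \<nu> (\<lambda>z. \<phi> (V z))"
    using eq by (subst Bochner_Integration.integrable_cong[OF refl, of \<nu> _ "\<lambda>z. \<Sum>v\<in>V ` space \<nu>. indicator (V -` {v} \<inter> space \<nu>) z * \<phi> v"]) auto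
  have "(\<integral>z. \<phi> (V z) \<partial>\<nu>) = (\<integral>z. (\<Sum>v\<in>V ` space \<nu>. indicator (V -` {v} \<inter> space \<nu>) z * \<phi> v) \<partial>\<nu>)"
    using eq by (intro Bochner_Integration.integral_cong) auto
  also have "\<dots> = (\<Sum>v\<in>V ` space \<nu>. (\<integral>z. indicator (V -` {v} \<inter> space \<nu>) z * \<phi> v \<partial>\<nu>))"
    using V by (intro Bochner_Integration.integral_sum integrable_mult_left
        integrable_real_indicator) (auto simp: emeasure_eq_measure)
  also have "\<dots> = (\<Sum>v\<in>V ` space \<nu>. measure \<nu> (V -` {v} \<inter> space \<nu>) * \<phi> v)"
    by (intro sum.cong refl) (simp add: Int_commute)
  finally show "(\<integral>z. \<phi> (V z) \<partial>\<nu>) = (\<Sum>v\<in>V ` space \<nu>. measure \<nu> (V -` {v} \<inter> space \<nu>) * \<phi> v)" .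
qed

lemma fin_ent_integral:
  assumes "finite_measure \<nu>" "simple_function \<nu> X"
  shows "fin_ent \<nu> X = - (\<integral>z. ln (measure \<nu> (X -` {X z} \<inter> space \<nu>)) \<partial>\<nu>)"
  unfolding fin_ent_def
  by (subst integral_simple_comp(2)[OF assms, of "\<lambda>v. ln (measure \<nu> (X -` {v} \<inter> space \<nu>))"]) simp

text \<open>Writes the entropy of any coarsening of \<open>V\<close> as a sum over the range of
  \<open>V\<close> with the weights of \<open>V\<close>, so that the entropies of several
  coarsenings of one triple can be combined term by term.\<close>

lemma fin_ent_integral_comp:
  assumes "finite_measure \<nu>" "simple_function \<nu> V"
  shows "fin_ent \<nu> (\<lambda>z. f (V z)) = - (\<Sum>v\<in>V ` space \<nu>. measure \<nu> (V -` {v} \<inter> space \<nu>) *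
     ln (measure \<nu> ((\<lambda>z. f (V z)) -` {f v} \<inter> space \<nu>)))"
proof -
  have "simple_function \<nu> (\<lambda>z. f (V z))"
    using simple_function_compose[OF assms(2), of f] by (simp add: comp_def)
  then have "fin_ent \<nu> (\<lambda>z. f (V z))
    = - (\<integral>z. ln (measure \<nu> ((\<lambda>z. f (V z)) -` {f (V z)} \<inter> space \<nu>)) \<partial>\<nu>)"
    by (rule fin_ent_integral[OF assms(1)])
  then show ?thesis
    by (subst (asm) integral_simple_comp(2)[OF assms, of "\<lambda>v. ln (measure \<nu> ((\<lambda>z. f (V z)) -` {f v} \<inter> space \<nu>))"])
qed

context prob_space
begin

text \<open>With base \<open>exp 1\<close> the logarithm of the information theory of the library
  becomes \<open>ln\<close>, and its entropy inequalities transfer to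
  \<open>fin_ent\<close>.\<close>

lemma information_space_exp1: "information_space M (exp 1)"
  by unfold_locales (simp add: one_less_exp_iff)

lemma fin_ent_eq_entropy:
  assumes "simple_function M X"
  shows "fin_ent M X = entropy (exp 1) (count_space (X ` space M)) X"
proof -
  interpret information_space M "exp 1" by (rule information_space_exp1)
  show ?thesis
    by (subst entropy_simple_distributed[OF simple_distributedI[OF assms measure_nonneg refl]])
      (simp add: fin_ent_def log_def)
qed

lemma fin_ent_nonneg:
  assumes "simple_function M X"
  shows "0 \<le> fin_ent M X"
proof -
  have "measure M (X -` {y} \<inter> space M) * ln (measure M (X -` {y} \<inter> space M)) \<le> 0" for y
    by (cases "measure M (X -` {y} \<inter> space M) = 0")
      (auto intro!: mult_nonneg_nonpos simp: zero_less_measure_iff)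
  then show ?thesis unfolding fin_ent_def by (simp add: sum_nonpos)
qed

text \<open>Data processing: if equal values of \<open>Y\<close> force equal values of
  \<open>X\<close>, then \<open>X\<close> is a function of \<open>Y\<close> on the space.
  Comparisons of itineraries below mostly take this form.\<close>

lemma fin_ent_le_determined:
  assumes "simple_function M Y"
    and det: "\<And>z w. z \<in> space M \<Longrightarrow> w \<in> space M \<Longrightarrow> Y z = Y w \<Longrightarrow> X z = X w"
  shows "fin_ent M X \<le> fin_ent M Y" and "simple_function M X"
proof -
  interpret information_space M "exp 1" by (rule information_space_exp1)
  define f where "f y = X (SOME w. w \<in> space M \<and> Y w = y)" for y
  have f: "f (Y z) = X z" if "z \<in> space M" for z
  proof -
    have "(SOME w. w \<in> space M \<and> Y w = Y z) \<in> space M \<and> Y (SOME w. w \<in> space M \<and> Y w = Y z) = Y z"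
      by (rule someI[of _ z]) (use that in auto)
    then show ?thesis unfolding f_def using det[OF _ that] by auto
  qed
  have sf: "simple_function M (f \<circ> Y)" by (rule simple_function_compose[OF assms(1)])
  then show sX: "simple_function M X"
    by (subst simple_function_cong[of M _ "f \<circ> Y"]) (auto simp: f)
  have img: "X ` space M = (f \<circ> Y) ` space M" using f by (force simp: image_iff)
  have vim: "X -` {y} \<inter> space M = (f \<circ> Y) -` {y} \<inter> space M" for y using f by auto
  have "fin_ent M X = fin_ent M (f \<circ> Y)"
    unfolding fin_ent_def img vim ..
  also have "\<dots> \<le> fin_ent M Y"
    using entropy_data_processing[OF assms(1), of f]
    by (simp add: fin_ent_eq_entropy[OF sf] fin_ent_eq_entropy[OF assms(1)])
  finally show "fin_ent M X \<le> fin_ent M Y" .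
qed

lemma fin_ent_Pair_le:
  assumes "simple_function M X" "simple_function M Y"
  shows "fin_ent M (\<lambda>z. (X z, Y z)) \<le> fin_ent M X + fin_ent M Y"
proof -
  interpret information_space M "exp 1" by (rule information_space_exp1)
  show ?thesis
    using entropy_chain_rule[OF assms] conditional_entropy_less_eq_entropy[OF assms(2,1)]
    by (simp add: fin_ent_eq_entropy assms simple_function_Pair)
qed

text \<open>This is nonnegativity of the conditional mutual information of \<open>X\<close> and
  \<open>Y\<close> given \<open>Z\<close>, expanded into joint entropies.\<close>

lemma fin_ent_submodular:
  assumes X: "simple_function M X" and Y: "simple_function M Y" and Z: "simple_function M Z"
  shows "fin_ent M (\<lambda>z. (X z, Y z, Z z)) + fin_ent M Z
    \<le> fin_ent M (\<lambda>z. (X z, Z z)) + fin_ent M (\<lambda>z. (Y z, Z z))"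
proof -
  interpret information_space M "exp 1" by (rule information_space_exp1)
  note sp = simple_function_Pair
  note sd = simple_distributedI[OF _ measure_nonneg refl]
  let ?V = "\<lambda>z. (X z, Y z, Z z)"
  have V: "simple_function M ?V" by (intro sp X Y Z)
  let ?pz = "\<lambda>c. prob (Z -` {c} \<inter> space M)"
  let ?pyz = "\<lambda>c. prob ((\<lambda>z. (Y z, Z z)) -` {c} \<inter> space M)"
  let ?pxz = "\<lambda>c. prob ((\<lambda>z. (X z, Z z)) -` {c} \<inter> space M)"
  let ?p = "\<lambda>c. prob (?V -` {c} \<inter> space M)"
  have "0 \<le> conditional_mutual_information (exp 1) (count_space (X ` space M))
      (count_space (Y ` space M)) (count_space (Z ` space M)) X Y Z"
    by (rule conditional_mutual_information_nonneg[OF X Y Z])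
  also have "\<dots> = (\<Sum>(x, y, z)\<in>?V ` space M. ?p (x, y, z) *
      log (exp 1) (?p (x, y, z) / (?pxz (x, z) * (?pyz (y,z) / ?pz z))))"
    by (rule conditional_mutual_information_eq) (intro sd sp X Y Z)+
  also have "\<dots> = (\<Sum>v\<in>?V ` space M. ?p v * ln (?p v) - ?p v * ln (?pxz (fst v, snd (snd v)))
      - ?p v * ln (?pyz (snd v)) + ?p v * ln (?pz (snd (snd v))))"
  proof (intro sum.cong refl, clarify)
    fix z assume "z \<in> space M"
    let ?v = "(X z, Y z, Z z)"
    show "?p ?v * log (exp 1) (?p ?v / (?pxz (X z, Z z) * (?pyz (Y z, Z z) / ?pz (Z z))))
      = ?p ?v * ln (?p ?v) - ?p ?v * ln (?pxz (fst ?v, snd (snd ?v)))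
        - ?p ?v * ln (?pyz (snd ?v)) + ?p ?v * ln (?pz (snd (snd ?v)))"
    \<comment> \<open>Atoms of probability zero contribute zero on both sides. On the others the
      marginals are at least as large, hence positive, and the logarithm of the quotient
      splits.\<close>
    proof (cases "?p ?v = 0")
      case False
      then have p: "?p ?v > 0" by (simp add: zero_less_measure_iff)
      have a: "?p ?v \<le> ?pxz (X z, Z z)" "?p ?v \<le> ?pyz (Y z, Z z)" "?p ?v \<le> ?pz (Z z)"
        by (intro finite_measure_mono simple_functionD(2)[OF sp[OF X Z]] simple_functionD(2)[OF sp[OF Y Z]] simple_functionD(2)[OF Z]; auto)+
      then have b: "?pxz (X z, Z z) > 0" "?pyz (Y z, Z z) > 0" "?pz (Z z) > 0"
        using p by linarith+
      then show ?thesis using p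
        by (simp add: log_def ln_div ln_mult algebra_simps)
    qed simp
  qed
  also have "\<dots> = - fin_ent M ?V + fin_ent M (\<lambda>z. (X z, Z z)) + fin_ent M (\<lambda>z. (Y z, Z z)) - fin_ent M Z"
    using fin_ent_integral_comp[OF finite_measure_axioms V, of "\<lambda>v. v"]
      fin_ent_integral_comp[OF finite_measure_axioms V, of "\<lambda>v. (fst v, snd (snd v))"]
      fin_ent_integral_comp[OF finite_measure_axioms V, of "\<lambda>v. snd v"]
      fin_ent_integral_comp[OF finite_measure_axioms V, of "\<lambda>v. snd (snd v)"]
    by (simp add: sum.distrib sum_subtractf)
  finally show ?thesis by linarith
qed

end

subsection \<open>Subadditive sequences\<close>

text \<open>Fekete's lemma. The limit is the infimum \<open>L\<close> of the quotients, which gives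
  both claims.\<close>

lemma subadditive_limit:
  fixes a :: "nat \<Rightarrow> real"
  assumes nonneg: "\<And>n. 0 \<le> a n" and sub: "\<And>m n. a (m + n) \<le> a m + a n"
  shows "convergent (\<lambda>n. a n / real n)"
    and "N \<ge> 1 \<Longrightarrow> lim (\<lambda>n. a n / real n) \<le> a N / real N"
proof -
  define L where "L = Inf ((\<lambda>n. a n / real n) ` {1..})"
  have bdd: "bdd_below ((\<lambda>n. a n / real n) ` {1..})"
    using nonneg by (intro bdd_belowI[of _ 0]) auto
  have L_le: "L \<le> a n / real n" if "n \<ge> 1" for n
    unfolding L_def using that by (intro cInf_lower bdd) auto
  have mult: "a (q * n) \<le> real q * a n" if "q \<ge> 1" for q n
    using that
  proof (induction q rule: dec_induct)
    case (step q)
    have "a (Suc q * n) \<le> a n + a (q * n)" using sub[of n "q * n"] by simp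
    then show ?case using step by (simp add: algebra_simps)
  qed simp
  have lim: "(\<lambda>n. a n / real n) \<longlonglongrightarrow> L"
  proof (rule LIMSEQ_I)
    fix r :: real assume r: "r > 0"
    have "\<exists>n\<ge>1. a n / real n < L + r / 2"
    proof (rule ccontr)
      assume "\<not> ?thesis"
      then have "L + r / 2 \<le> L"
        unfolding L_def by (intro cInf_greatest) (auto simp: not_less)
      then show False using r by simp
    qed
    then obtain n where n: "n \<ge> 1" "a n / real n < L + r / 2" by blast
    \<comment> \<open>In the division of m by n, \<open>C\<close> bounds \<open>a\<close> at every
      possible remainder, independently of m.\<close>
    define C where "C = (\<Sum>k<n. a k)"
    have C: "a k \<le> C" if "k < n" for k
      unfolding C_def using that nonneg by (intro member_le_sum) auto
    obtain m0 :: nat where m0: "real m0 > 2 * C / r" using reals_Archimedean2 by blast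
    have "norm (a m / real m - L) < r" if m: "m \<ge> max (max m0 n) 1" for m
    proof -
      have q: "m div n \<ge> 1" using m n(1) by (simp add: Suc_le_eq div_greater_zero_iff)
      have "a m \<le> a (m div n * n) + a (m mod n)"
        using sub[of "m div n * n" "m mod n"] by simp
      also have "\<dots> \<le> real (m div n) * a n + C"
        using mult[OF q] C[of "m mod n"] n(1) by (intro add_mono) auto
      also have "real (m div n) * a n = real (m div n * n) * (a n / real n)" using n(1) by simp
      also have "\<dots> \<le> real m * (a n / real n)"
        using nonneg by (intro mult_right_mono of_nat_mono) auto
      finally have "a m / real m \<le> a n / real n + C / real m"
        using m by (simp add: field_simps)
      moreover have "C / real m < r / 2"
      proof -
        have "2 * C / r < real m" using m0 m by linarith
        then show ?thesis using m r by (simp add: field_simps)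
      qed
      ultimately have "a m / real m < L + r" using n(2) by linarith
      moreover have "L \<le> a m / real m" using m by (intro L_le) auto
      ultimately show ?thesis by (simp add: abs_less_iff)
    qed
    then show "\<exists>no. \<forall>n\<ge>no. norm (a n / real n - L) < r" by blast
  qed
  then show "convergent (\<lambda>n. a n / real n)" by (auto simp: convergent_def)
  show "lim (\<lambda>n. a n / real n) \<le> a N / real N" if "N \<ge> 1"
    using limI[OF lim] L_le[OF that] by simp
qed

subsection \<open>Itineraries and metric entropy\<close>

text \<open>Joined partitions are handled through the list of symbols read along the orbit, because
  lists can be concatenated and truncated directly.\<close>

definition itin :: "('z \<Rightarrow> 'z) \<Rightarrow> ('z \<Rightarrow> 'b) \<Rightarrow> nat \<Rightarrow> 'z \<Rightarrow> 'b list" where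
  "itin T X n z = map (\<lambda>i. X ((T ^^ i) z)) [0..<n]"

definition block_of :: "'z set set \<Rightarrow> 'z \<Rightarrow> 'z set" where
  "block_of P z = (THE A. A \<in> P \<and> z \<in> A)"

lemma block_of_eq:
  assumes "partition_on Z P" "A \<in> P" "z \<in> A"
  shows "block_of P z = A"
  unfolding block_of_def
  by (rule the_equality) (use assms in \<open>auto dest: disjointD[OF partition_onD2[OF assms(1)]]\<close>)

lemma block_of_in:
  assumes "partition_on Z P" "z \<in> Z"
  shows "block_of P z \<in> P" "z \<in> block_of P z"
proof -
  obtain A where "A \<in> P" "z \<in> A" using assms partition_onD1 by blast
  then show "block_of P z \<in> P" "z \<in> block_of P z" using block_of_eq[OF assms(1)] by auto
qed

lemma length_itin [simp]: "length (itin T X n z) = n"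
  by (simp add: itin_def)

lemma itin_eq_iff: "itin T X n z = itin T X n w \<longleftrightarrow> (\<forall>i<n. X ((T ^^ i) z) = X ((T ^^ i) w))"
  by (auto simp: itin_def)

lemma itin_add: "itin T X (m + n) z = itin T X m z @ itin T X n ((T ^^ m) z)"
proof (rule nth_equalityI)
  fix i assume "i < length (itin T X (m + n) z)"
  then have i: "i < m + n" by simp
  have "(T ^^ (i - m)) ((T ^^ m) z) = (T ^^ i) z" if "\<not> i < m"
    using that funpow_add[of "i - m" m T] by (simp add: fun_eq_iff)
  then show "itin T X (m + n) z ! i = (itin T X m z @ itin T X n ((T ^^ m) z)) ! i"
    using i by (simp add: nth_append itin_def)
qed simp

lemma take_itin: "m \<le> n \<Longrightarrow> take m (itin T X n z) = itin T X m z"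
  by (simp add: itin_def take_map)

lemma funpow_in: "T \<in> Z \<rightarrow> Z \<Longrightarrow> z \<in> Z \<Longrightarrow> (T ^^ i) z \<in> Z"
  by (induction i) auto

text \<open>A point lies in exactly one block, so the block at each time coordinate is forced by any
  point of the atom; the nonempty atoms are the fibres of the block itinerary.\<close>

lemma dyn_join_eq:
  assumes P: "partition_on Z P" and T: "T \<in> Z \<rightarrow> Z"
  shows "dyn_join Z T P n =
    (\<lambda>z. {w\<in>Z. itin T (block_of P) n w = itin T (block_of P) n z}) ` Z"
proof (intro set_eqI iffI)
  fix A assume "A \<in> dyn_join Z T P n"
  then obtain B where B: "\<And>i. i < n \<Longrightarrow> B i \<in> P" "A = {z \<in> Z. \<forall>i<n. (T ^^ i) z \<in> B i}" "A \<noteq> {}"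
    unfolding dyn_join_def by blast
  then obtain z where z: "z \<in> Z" "\<And>i. i < n \<Longrightarrow> (T ^^ i) z \<in> B i" by auto
  have Bi: "block_of P ((T ^^ i) z) = B i" if "i < n" for i
    by (rule block_of_eq[OF P B(1)[OF that] z(2)[OF that]])
  have "(T ^^ i) w \<in> B i \<longleftrightarrow> block_of P ((T ^^ i) w) = B i" if "i < n" "w \<in> Z" for i w
    using block_of_eq[OF P B(1)[OF that(1)]] block_of_in[OF P funpow_in[OF T that(2)]] by metis
  then have "A = {w\<in>Z. itin T (block_of P) n w = itin T (block_of P) n z}"
    using B(2) Bi by (auto simp: itin_eq_iff)
  then show "A \<in> (\<lambda>z. {w\<in>Z. itin T (block_of P) n w = itin T (block_of P) n z}) ` Z"
    using z(1) by blast
next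
  fix A assume "A \<in> (\<lambda>z. {w\<in>Z. itin T (block_of P) n w = itin T (block_of P) n z}) ` Z"
  then obtain z where z: "z \<in> Z" "A = {w\<in>Z. itin T (block_of P) n w = itin T (block_of P) n z}"
    by blast
  define B where "B i = block_of P ((T ^^ i) z)" for i
  have BP: "B i \<in> P" for i unfolding B_def by (intro block_of_in[OF P] funpow_in[OF T] z(1))
  have "(T ^^ i) w \<in> B i \<longleftrightarrow> block_of P ((T ^^ i) w) = B i" if "w \<in> Z" for i w
    using block_of_eq[OF P BP] block_of_in[OF P funpow_in[OF T that]] by metis
  then have "A = {w\<in>Z. \<forall>i<n. (T ^^ i) w \<in> B i}"
    using z(2) by (auto simp: itin_eq_iff B_def)
  moreover have "A \<noteq> {}" using z by auto
  ultimately show "A \<in> dyn_join Z T P n"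
    unfolding dyn_join_def mem_Collect_eq by (intro conjI exI[of _ B]) (use BP in auto)
qed

lemma partition_entropy_dyn_join:
  assumes P: "partition_on (space \<nu>) P" and T: "T \<in> space \<nu> \<rightarrow> space \<nu>"
  shows "partition_entropy \<nu> (dyn_join (space \<nu>) T P n) = fin_ent \<nu> (itin T (block_of P) n)"
proof -
  let ?Y = "itin T (block_of P) n"
  have "dyn_join (space \<nu>) T P n = (\<lambda>y. ?Y -` {y} \<inter> space \<nu>) ` ?Y ` space \<nu>"
    unfolding dyn_join_eq[OF P T] image_image by (intro image_cong) auto
  moreover have "inj_on (\<lambda>y. ?Y -` {y} \<inter> space \<nu>) (?Y ` space \<nu>)"
    by (auto simp: inj_on_def)
  ultimately show ?thesis
    unfolding partition_entropy_def fin_ent_def by (simp add: sum.reindex)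
qed

lemma simple_function_block_of:
  assumes "partition_on (space \<nu>) P" "finite P" "P \<subseteq> sets \<nu>"
  shows "simple_function \<nu> (block_of P)"
proof (unfold simple_function_def, intro conjI ballI)
  show "finite (block_of P ` space \<nu>)"
    by (rule finite_subset[OF _ assms(2)]) (auto intro: block_of_in[OF assms(1)])
  fix A assume A: "A \<in> block_of P ` space \<nu>"
  then have "A \<in> P" using block_of_in[OF assms(1)] by auto
  then have "block_of P -` {A} \<inter> space \<nu> = A"
    using block_of_in(2)[OF assms(1)] block_of_eq[OF assms(1)] partition_onD1[OF assms(1)] by auto
  then show "block_of P -` {A} \<inter> space \<nu> \<in> sets \<nu>" using \<open>A \<in> P\<close> assms(3) by auto
qed

locale invariant_prob = prob_space \<nu> for \<nu> :: "'z measure" +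
  fixes T :: "'z \<Rightarrow> 'z"
  assumes T_meas: "T \<in> \<nu> \<rightarrow>\<^sub>M \<nu>" and T_inv: "distr \<nu> \<nu> T = \<nu>"
begin

lemma T_space: "T \<in> space \<nu> \<rightarrow> space \<nu>"
  using measurable_space[OF T_meas] by auto

lemma funpow_meas: "(T ^^ i) \<in> \<nu> \<rightarrow>\<^sub>M \<nu>"
  by (induction i) (use T_meas in \<open>auto intro: measurable_compose simp: comp_def\<close>)

lemma funpow_inv: "distr \<nu> \<nu> (T ^^ i) = \<nu>"
proof (induction i)
  case (Suc i)
  have "distr \<nu> \<nu> (T ^^ Suc i) = distr (distr \<nu> \<nu> (T ^^ i)) \<nu> T"
    by (subst distr_distr[OF T_meas funpow_meas]) (simp add: comp_def)
  then show ?case using Suc T_inv by (simp add: comp_def)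
next
  case 0
  have "distr \<nu> \<nu> (\<lambda>x. x) = \<nu>" by (rule distr_id2) simp
  then show ?case by (simp add: id_def)
qed

lemma measure_funpow_vimage:
  assumes "A \<in> sets \<nu>" shows "measure \<nu> ((T ^^ i) -` A \<inter> space \<nu>) = measure \<nu> A"
  using measure_distr[OF funpow_meas assms, of i] funpow_inv by simp

lemma simple_function_funpow:
  assumes "simple_function \<nu> X" shows "simple_function \<nu> (\<lambda>z. X ((T ^^ i) z))"
proof (unfold simple_function_def, intro conjI ballI)
  have sub: "(\<lambda>z. X ((T ^^ i) z)) ` space \<nu> \<subseteq> X ` space \<nu>"
    using funpow_in[OF T_space] by auto
  then show "finite ((\<lambda>z. X ((T ^^ i) z)) ` space \<nu>)"
    using assms finite_subset simple_functionD(1) by blast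
  fix y assume "y \<in> (\<lambda>z. X ((T ^^ i) z)) ` space \<nu>"
  have "(\<lambda>z. X ((T ^^ i) z)) -` {y} \<inter> space \<nu> = (T ^^ i) -` (X -` {y} \<inter> space \<nu>) \<inter> space \<nu>"
    using funpow_in[OF T_space] by auto
  then show "(\<lambda>z. X ((T ^^ i) z)) -` {y} \<inter> space \<nu> \<in> sets \<nu>"
    using measurable_sets[OF funpow_meas simple_functionD(2)[OF assms]] by auto
qed

lemma simple_function_itin:
  assumes "simple_function \<nu> X" shows "simple_function \<nu> (itin T X n)"
proof (induction n)
  case (Suc n)
  have eq: "itin T X (Suc n) = (\<lambda>(l, x). l @ [x]) \<circ> (\<lambda>z. (itin T X n z, X ((T ^^ n) z)))"
    by (auto simp: itin_def fun_eq_iff)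
  show ?case unfolding eq
    by (intro simple_function_compose simple_function_Pair Suc simple_function_funpow assms)
qed (simp add: itin_def simple_function_const)

lemma fin_ent_funpow:
  assumes "simple_function \<nu> X"
  shows "fin_ent \<nu> (\<lambda>z. X ((T ^^ i) z)) = fin_ent \<nu> X"
proof -
  have sub: "(\<lambda>z. X ((T ^^ i) z)) ` space \<nu> \<subseteq> X ` space \<nu>"
    using funpow_in[OF T_space] by auto
  have "(\<lambda>z. X ((T ^^ i) z)) -` {y} \<inter> space \<nu> = (T ^^ i) -` (X -` {y} \<inter> space \<nu>) \<inter> space \<nu>" for y
    using funpow_in[OF T_space] by auto
  then have "measure \<nu> ((\<lambda>z. X ((T ^^ i) z)) -` {y} \<inter> space \<nu>) = measure \<nu> (X -` {y} \<inter> space \<nu>)" for y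
    using measure_funpow_vimage[OF simple_functionD(2)[OF assms]] by simp
  then show ?thesis
    using fin_ent_superset[OF simple_functionD(1)[OF assms] sub]
      fin_ent_superset[OF simple_functionD(1)[OF assms] subset_refl] by simp
qed

definition ent_rate :: "('z \<Rightarrow> 'b) \<Rightarrow> real" where
  "ent_rate X = lim (\<lambda>n. fin_ent \<nu> (itin T X n) / real n)"

lemma fin_ent_itin_add:
  assumes "simple_function \<nu> X"
  shows "fin_ent \<nu> (itin T X (m + n)) \<le> fin_ent \<nu> (itin T X m) + fin_ent \<nu> (itin T X n)"
proof -
  note s = simple_function_itin[OF assms]
  have s2: "simple_function \<nu> (\<lambda>z. (itin T X m z, itin T X n ((T ^^ m) z)))"
    by (intro simple_function_Pair s simple_function_funpow)
  have "fin_ent \<nu> (itin T X (m + n)) \<le> fin_ent \<nu> (\<lambda>z. (itin T X m z, itin T X n ((T ^^ m) z)))"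
    by (rule fin_ent_le_determined(1)[OF s2]) (simp add: itin_add)
  also have "\<dots> \<le> fin_ent \<nu> (itin T X m) + fin_ent \<nu> (\<lambda>z. itin T X n ((T ^^ m) z))"
    by (rule fin_ent_Pair_le[OF s simple_function_funpow[OF s]])
  finally show ?thesis by (simp add: fin_ent_funpow[OF s])
qed

text \<open>Fekete's lemma for itineraries. The second claim, at a single block length, is what the
  lower bound uses in place of a limit.\<close>

lemma
  assumes "simple_function \<nu> X"
  shows ent_rate_LIMSEQ: "(\<lambda>n. fin_ent \<nu> (itin T X n) / real n) \<longlonglongrightarrow> ent_rate X"
    and ent_rate_le: "N \<ge> 1 \<Longrightarrow> ent_rate X \<le> fin_ent \<nu> (itin T X N) / real N"
proof -
  note * = subadditive_limit[of "\<lambda>n. fin_ent \<nu> (itin T X n)",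
      OF fin_ent_nonneg[OF simple_function_itin[OF assms]] fin_ent_itin_add[OF assms]]
  show "(\<lambda>n. fin_ent \<nu> (itin T X n) / real n) \<longlonglongrightarrow> ent_rate X"
    unfolding ent_rate_def using *(1) by (simp add: convergent_LIMSEQ_iff)
  show "ent_rate X \<le> fin_ent \<nu> (itin T X N) / real N" if "N \<ge> 1"
    unfolding ent_rate_def by (rule *(2)[OF that])
qed

lemma metric_entropy_eq_SUP:
  "metric_entropy \<nu> T = (SUP P \<in> {P. finite P \<and> P \<subseteq> sets \<nu> \<and> partition_on (space \<nu>) P}.
      ereal (ent_rate (block_of P)))"
proof -
  have "partition_entropy \<nu> (dyn_join (space \<nu>) T P n) = fin_ent \<nu> (itin T (block_of P) n)"
    if "partition_on (space \<nu>) P" for P n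
    by (rule partition_entropy_dyn_join[OF that T_space])
  then show ?thesis
    unfolding metric_entropy_def ent_rate_def by (intro SUP_cong refl) simp
qed

text \<open>The fibres of \<open>X\<close> form a finite measurable partition carrying the same
  itinerary information, so this rate occurs in the supremum.\<close>

lemma ent_rate_le_metric_entropy:
  assumes X: "simple_function \<nu> X"
  shows "ereal (ent_rate X) \<le> metric_entropy \<nu> T"
proof -
  define P where "P = (\<lambda>y. X -` {y} \<inter> space \<nu>) ` X ` space \<nu>"
  have P: "partition_on (space \<nu>) P" unfolding P_def
    by (rule partition_onI) (auto simp: disjnt_def)
  have P': "finite P" "P \<subseteq> sets \<nu>" unfolding P_def using simple_functionD[OF X] by auto
  have bl: "block_of P z = X -` {X z} \<inter> space \<nu>" if "z \<in> space \<nu>" for z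
    by (rule block_of_eq[OF P]) (use that in \<open>auto simp: P_def\<close>)
  have eq: "block_of P ((T ^^ i) z) = block_of P ((T ^^ i) w) \<longleftrightarrow> X ((T ^^ i) z) = X ((T ^^ i) w)"
    if "z \<in> space \<nu>" "w \<in> space \<nu>" for i z w
    using bl[OF funpow_in[OF T_space that(1)]] bl[OF funpow_in[OF T_space that(2)]]
      funpow_in[OF T_space that(1)] by auto
  have "fin_ent \<nu> (itin T (block_of P) n) = fin_ent \<nu> (itin T X n)" for n
    by (intro antisym fin_ent_le_determined(1) simple_function_itin simple_function_block_of P P' X)
      (auto simp: itin_eq_iff eq)
  then have "ent_rate X = ent_rate (block_of P)" by (simp add: ent_rate_def)
  then show ?thesis
    unfolding metric_entropy_eq_SUP using P P' by (auto intro!: SUP_upper2[of P])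
qed

subsection \<open>Generators\<close>

text \<open>Generation modulo null sets, phrased as approximation in measure by events of finitely
  many forward symbols; this is the form that continuity of entropy consumes.\<close>

definition generating :: "('z \<Rightarrow> 'b) \<Rightarrow> bool" where
  "generating Y \<longleftrightarrow> (\<forall>B\<in>sets \<nu>. \<forall>\<delta>>0. \<exists>N S.
     measure \<nu> (sym_diff B {z\<in>space \<nu>. itin T Y N z \<in> S}) < \<delta>)"

lemma itin_set_sets:
  assumes "simple_function \<nu> Y"
  shows "{z\<in>space \<nu>. itin T Y N z \<in> S} \<in> sets \<nu>"
proof -
  have "itin T Y N -` S \<inter> space \<nu> \<in> sets \<nu>"
    by (rule simple_functionD(2)[OF simple_function_itin[OF assms]])
  moreover have "itin T Y N -` S \<inter> space \<nu> = {z\<in>space \<nu>. itin T Y N z \<in> S}" by auto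
  ultimately show ?thesis by simp
qed

text \<open>The bracket is the conditional entropy c of \<open>X\<close> given N symbols of
  \<open>Y\<close>. The values of \<open>X\<close> along the orbit are adjoined one at a time to a
  long itinerary of \<open>Y\<close>; by submodularity and invariance each of them costs at most
  c.\<close>

lemma ent_rate_le_conditional:
  assumes X: "simple_function \<nu> X" and Y: "simple_function \<nu> Y"
  shows "ent_rate X \<le> ent_rate Y + (fin_ent \<nu> (\<lambda>z. (X z, itin T Y N z)) - fin_ent \<nu> (itin T Y N))"
proof -
  define c where "c = fin_ent \<nu> (\<lambda>z. (X z, itin T Y N z)) - fin_ent \<nu> (itin T Y N)"
  note sX = simple_function_itin[OF X] and sY = simple_function_itin[OF Y]
  \<comment> \<open>The itinerary of \<open>Y\<close> is taken N symbols longer than n, so that it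
    still determines the window of length N starting at any time j < n.\<close>
  have *: "fin_ent \<nu> (\<lambda>z. (itin T X j z, itin T Y (n + N) z)) \<le> fin_ent \<nu> (itin T Y (n + N)) + real j * c"
    if "j \<le> n" for j n
    using that
  proof (induction j)
    case 0
    have "fin_ent \<nu> (\<lambda>z. (itin T X 0 z, itin T Y (n + N) z)) \<le> fin_ent \<nu> (itin T Y (n + N))"
      by (rule fin_ent_le_determined(1)[OF sY]) (auto simp: itin_def)
    then show ?case by simp
  next
    case (Suc j)
    let ?W = "itin T Y (n + N)" and ?V = "\<lambda>z. itin T Y N ((T ^^ j) z)"
    let ?U = "\<lambda>z. (itin T X j z, ?W z)" and ?Xj = "\<lambda>z. X ((T ^^ j) z)"
    have V: "simple_function \<nu> ?V" by (rule simple_function_funpow[OF sY])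
    have U: "simple_function \<nu> ?U" by (intro simple_function_Pair sX sY)
    have Xj: "simple_function \<nu> ?Xj" by (rule simple_function_funpow[OF X])
    have det: "?V z = ?V w" if "?W z = ?W w" for z w
    proof -
      have len: "n + N = j + (N + (n - j))" using Suc by simp
      show ?thesis using that unfolding len itin_add by simp
    qed
    have "fin_ent \<nu> (\<lambda>z. (itin T X (Suc j) z, ?W z)) \<le> fin_ent \<nu> (\<lambda>z. (?Xj z, ?U z, ?V z))"
      by (rule fin_ent_le_determined(1)[OF simple_function_Pair[OF Xj simple_function_Pair[OF U V]]])
        (auto simp: itin_def)
    moreover have "fin_ent \<nu> (\<lambda>z. (?Xj z, ?U z, ?V z)) + fin_ent \<nu> ?V
        \<le> fin_ent \<nu> (\<lambda>z. (?Xj z, ?V z)) + fin_ent \<nu> (\<lambda>z. (?U z, ?V z))"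
      by (rule fin_ent_submodular[OF Xj U V])
    moreover have "fin_ent \<nu> (\<lambda>z. (?U z, ?V z)) \<le> fin_ent \<nu> ?U"
      by (rule fin_ent_le_determined(1)[OF U]) (auto intro: det)
    moreover have "fin_ent \<nu> ?V = fin_ent \<nu> (itin T Y N)" by (rule fin_ent_funpow[OF sY])
    moreover have "fin_ent \<nu> (\<lambda>z. (?Xj z, ?V z)) = fin_ent \<nu> (\<lambda>z. (X z, itin T Y N z))"
      by (rule fin_ent_funpow[OF simple_function_Pair[OF X sY]])
    ultimately show ?case using Suc by (simp add: c_def algebra_simps)
  qed
  have le: "fin_ent \<nu> (itin T X n) \<le> fin_ent \<nu> (itin T Y n) + fin_ent \<nu> (itin T Y N) + real n * c" for n
  proof -
    have "fin_ent \<nu> (itin T X n) \<le> fin_ent \<nu> (\<lambda>z. (itin T X n z, itin T Y (n + N) z))"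
      by (rule fin_ent_le_determined(1)[OF simple_function_Pair[OF sX sY]]) auto
    then show ?thesis using *[of n n] fin_ent_itin_add[OF Y, of n N] by simp
  qed
  have "ent_rate X \<le> ent_rate Y + 0 + c"
  proof (rule LIMSEQ_le[OF ent_rate_LIMSEQ[OF X]])
    show "(\<lambda>n. fin_ent \<nu> (itin T Y n) / real n + fin_ent \<nu> (itin T Y N) / real n + c) \<longlonglongrightarrow> ent_rate Y + 0 + c"
      by (intro tendsto_add ent_rate_LIMSEQ[OF Y] tendsto_const lim_const_over_n)
    show "\<exists>N'. \<forall>n\<ge>N'. fin_ent \<nu> (itin T X n) / real n
        \<le> fin_ent \<nu> (itin T Y n) / real n + fin_ent \<nu> (itin T Y N) / real n + c"
    proof (intro exI[of _ 1] allI impI)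
      fix n :: nat assume "n \<ge> 1"
      then show "fin_ent \<nu> (itin T X n) / real n
        \<le> fin_ent \<nu> (itin T Y n) / real n + fin_ent \<nu> (itin T Y N) / real n + c"
        using le[of n] by (simp add: field_simps)
    qed
  qed
  then show ?thesis by (simp add: c_def)
qed

lemma x_ln_x_uniformly_continuous:
  fixes e :: real assumes "e > 0"
  obtains d where "d > 0" "\<And>x y. 0 \<le> x \<Longrightarrow> x \<le> 1 \<Longrightarrow> 0 \<le> y \<Longrightarrow> y \<le> 1 \<Longrightarrow> \<bar>x - y\<bar> < d \<Longrightarrow>
    \<bar>x * ln x - y * ln y\<bar> < e"
proof -
  have at0: "((\<lambda>x::real. x * ln x) \<longlongrightarrow> 0) (at_right 0)"
    by real_asymp
  have "continuous_on {0..1::real} (\<lambda>x. x * ln x)"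
    unfolding continuous_on_def
  proof
    fix x :: real assume x: "x \<in> {0..1}"
    show "((\<lambda>x. x * ln x) \<longlongrightarrow> x * ln x) (at x within {0..1})"
    proof (cases "x = 0")
      case True
      have "((\<lambda>x::real. x * ln x) \<longlongrightarrow> 0) (at 0 within {0..1})"
        by (rule tendsto_mono[OF _ at0]) (auto simp: at_within_def intro!: le_infI2)
      then show ?thesis using True by simp
    next
      case False
      then show ?thesis using x by (intro tendsto_intros) auto
    qed
  qed
  then have "uniformly_continuous_on {0..1::real} (\<lambda>x. x * ln x)"
    by (rule compact_uniformly_continuous) auto
  then obtain d where d: "d > 0" "\<forall>x\<in>{0..1::real}. \<forall>x'\<in>{0..1::real}. dist x' x < d \<longrightarrow> dist (x' * ln x') (x * ln x) < e"
    unfolding uniformly_continuous_on_def using assms by meson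
  show thesis
    by (rule that[OF d(1)]) (use d(2) in \<open>auto simp: dist_real_def\<close>)
qed

text \<open>\<open>X\<close> is approximated by a function \<open>X'\<close> of N symbols of
  \<open>Y\<close>. Conditioning on less can only raise the entropy, so it suffices that the entropy
  of \<open>X\<close> given \<open>X'\<close> is small, and it is because the pair is nearly
  diagonal.\<close>

lemma generating_conditional_small:
  assumes X: "simple_function \<nu> X" and Y: "simple_function \<nu> Y" and gen: "generating Y" and e: "e > 0"
  shows "\<exists>N. fin_ent \<nu> (\<lambda>z. (X z, itin T Y N z)) - fin_ent \<nu> (itin T Y N) < e"
proof -
  define V where "V = X ` space \<nu>"
  have fV: "finite V" and V0: "V \<noteq> {}"
    unfolding V_def using simple_functionD(1)[OF X] not_empty by auto
  define r where "r = real (card V)"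
  have r1: "r \<ge> 1" unfolding r_def using fV V0 by (simp add: Suc_le_eq card_gt_0_iff)
  \<comment> \<open>The entropy of a pair has r * r terms, and an error of e / (4 r r) in each of
    them sums to e / 4.\<close>
  obtain d where d: "d > 0" "\<And>x y. 0 \<le> x \<Longrightarrow> x \<le> 1 \<Longrightarrow> 0 \<le> y \<Longrightarrow> y \<le> 1 \<Longrightarrow> \<bar>x - y\<bar> < d \<Longrightarrow>
    \<bar>x * ln x - y * ln y\<bar> < e / (4 * r * r)"
    using x_ln_x_uniformly_continuous[of "e / (4 * r * r)"] e r1 by auto
  have XB: "X -` {v} \<inter> space \<nu> \<in> sets \<nu>" for v by (rule simple_functionD(2)[OF X])
  have "\<exists>N S. measure \<nu> (sym_diff (X -` {v} \<inter> space \<nu>) {z\<in>space \<nu>. itin T Y N z \<in> S}) < d / r" for v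
    by (rule gen[unfolded generating_def, rule_format, OF XB]) (use d(1) r1 in auto)
  then have "\<forall>v. \<exists>p. measure \<nu> (sym_diff (X -` {v} \<inter> space \<nu>)
      {z\<in>space \<nu>. itin T Y (fst p) z \<in> snd p}) < d / r"
    by (simp only: split_paired_Ex fst_conv snd_conv) blast
  from choice[OF this] obtain f where f: "\<And>v. measure \<nu> (sym_diff (X -` {v} \<inter> space \<nu>)
      {z\<in>space \<nu>. itin T Y (fst (f v)) z \<in> snd (f v)}) < d / r" by blast
  define Nv where "Nv v = fst (f v)" for v
  define Sv where "Sv v = snd (f v)" for v
  note S = f[folded Nv_def Sv_def]
  define N where "N = Max (Nv ` V)"
  have NvN: "Nv v \<le> N" if "v \<in> V" for v unfolding N_def using fV that by auto
  \<comment> \<open>The decoder: it picks a value whose approximating event contains the itinerary,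
    and an arbitrary value of \<open>X\<close> if there is none. Outside \<open>bad\<close> exactly
    one value qualifies.\<close>
  define \<phi> where "\<phi> l = (if \<exists>v\<in>V. take (Nv v) l \<in> Sv v then (SOME v. v \<in> V \<and> take (Nv v) l \<in> Sv v) else (SOME v. v \<in> V))" for l
  define X' where "X' = (\<lambda>z. \<phi> (itin T Y N z))"
  note sY = simple_function_itin[OF Y, of N]
  have X': "simple_function \<nu> X'" unfolding X'_def using simple_function_compose[OF sY, of \<phi>] by (simp add: comp_def)
  have \<phi>V: "\<phi> l \<in> V" for l
  proof -
    have "(SOME v. v \<in> V) \<in> V" using V0 by (simp add: some_in_eq)
    moreover have "(SOME v. v \<in> V \<and> take (Nv v) l \<in> Sv v) \<in> V" if "\<exists>v\<in>V. take (Nv v) l \<in> Sv v"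
      using someI_ex[of "\<lambda>v. v \<in> V \<and> take (Nv v) l \<in> Sv v"] that by blast
    ultimately show ?thesis unfolding \<phi>_def by auto
  qed
  let ?D = "\<lambda>v. sym_diff (X -` {v} \<inter> space \<nu>) {z\<in>space \<nu>. itin T Y (Nv v) z \<in> Sv v}"
  have Dsets: "?D v \<in> sets \<nu>" for v
    using XB itin_set_sets[OF Y] by auto
  define bad where "bad = (\<Union>v\<in>V. ?D v)"
  have bad_sets: "bad \<in> sets \<nu>" unfolding bad_def using Dsets fV by (intro sets.finite_UN) auto
  have "measure \<nu> bad \<le> (\<Sum>v\<in>V. measure \<nu> (?D v))"
    unfolding bad_def using Dsets fV by (intro finite_measure_subadditive_finite) auto
  also have "\<dots> < (\<Sum>v\<in>V. d / r)" using S fV V0 by (intro sum_strict_mono) auto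
  also have "\<dots> = d" using r1 by (simp add: r_def)
  finally have bad: "measure \<nu> bad < d" .
  have good: "X z = X' z" if z: "z \<in> space \<nu>" "z \<notin> bad" for z
  proof -
    have iff: "X z = v \<longleftrightarrow> take (Nv v) (itin T Y N z) \<in> Sv v" if "v \<in> V" for v
    proof -
      have "z \<notin> ?D v" using z(2) that unfolding bad_def by blast
      then show ?thesis using z(1) unfolding take_itin[OF NvN[OF that]] by blast
    qed
    have XV: "X z \<in> V" using z by (auto simp: V_def)
    then have ex: "\<exists>v. v \<in> V \<and> take (Nv v) (itin T Y N z) \<in> Sv v" using iff by blast
    define u where "u = (SOME v. v \<in> V \<and> take (Nv v) (itin T Y N z) \<in> Sv v)"
    have "u \<in> V \<and> take (Nv u) (itin T Y N z) \<in> Sv u"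
      unfolding u_def by (rule someI_ex[OF ex])
    then have "X z = u" using iff[of u] by simp
    moreover have "X' z = u" unfolding X'_def \<phi>_def u_def using ex by (simp add: Bex_def)
    ultimately show ?thesis by simp
  qed
  have close: "\<bar>measure \<nu> A - measure \<nu> B\<bar> < d"
    if "A \<in> sets \<nu>" "B \<in> sets \<nu>" "A - bad = B - bad" for A B
  proof -
    have "measure \<nu> A \<le> measure \<nu> (B \<union> bad)" "measure \<nu> B \<le> measure \<nu> (A \<union> bad)"
      using that bad_sets by (auto intro!: finite_measure_mono)
    moreover have "measure \<nu> (B \<union> bad) \<le> measure \<nu> B + measure \<nu> bad"
      "measure \<nu> (A \<union> bad) \<le> measure \<nu> A + measure \<nu> bad"
      using that bad_sets by (auto intro!: measure_Un_le)
    ultimately show ?thesis using bad by linarith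
  qed
  let ?\<eta> = "\<lambda>x::real. x * ln x"
  let ?q = "\<lambda>v. measure \<nu> (X -` {v} \<inter> space \<nu>)" and ?q' = "\<lambda>v. measure \<nu> (X' -` {v} \<inter> space \<nu>)"
  let ?Q = "\<lambda>v. measure \<nu> ((\<lambda>z. (X z, X' z)) -` {v} \<inter> space \<nu>)"
  have XX: "simple_function \<nu> (\<lambda>z. (X z, X' z))" by (intro simple_function_Pair X X')
  have e1: "fin_ent \<nu> X = - (\<Sum>v\<in>V. ?\<eta> (?q v))"
    by (rule fin_ent_superset[OF fV]) (auto simp: V_def)
  have e2: "fin_ent \<nu> X' = - (\<Sum>v\<in>V. ?\<eta> (?q' v))"
    by (rule fin_ent_superset[OF fV]) (use \<phi>V in \<open>auto simp: X'_def\<close>)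
  have e3: "fin_ent \<nu> (\<lambda>z. (X z, X' z)) = - (\<Sum>v\<in>V\<times>V. ?\<eta> (?Q v))"
    using fV \<phi>V by (intro fin_ent_superset) (auto simp: X'_def V_def)
  have "\<bar>?\<eta> (?q v) - ?\<eta> (?q' v)\<bar> < e / (4 * r * r)" for v
  proof (rule d(2))
    show "\<bar>?q v - ?q' v\<bar> < d"
      by (rule close[OF XB simple_functionD(2)[OF X']]) (use good in auto)
  qed auto
  then have "(\<Sum>v\<in>V. \<bar>?\<eta> (?q v) - ?\<eta> (?q' v)\<bar>) \<le> (\<Sum>v\<in>V. e / (4 * r * r))"
    by (intro sum_mono) (auto intro: less_imp_le)
  also have "\<dots> = e / (4 * r)" using r1 by (simp add: r_def)
  also have "\<dots> \<le> e / 4" using r1 e by (intro divide_left_mono) auto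
  finally have b1: "fin_ent \<nu> X - fin_ent \<nu> X' \<le> e / 4"
    unfolding e1 e2 using sum_abs[of "\<lambda>v. ?\<eta> (?q v) - ?\<eta> (?q' v)" V] by (simp add: sum_subtractf abs_le_iff)
  \<comment> \<open>Compares the law of the pair of \<open>X\<close> and \<open>X'\<close> with that
    of the diagonal pair of \<open>X\<close> and \<open>X\<close>, whose entropy is the entropy of
    \<open>X\<close>.\<close>
  define E where "E p = ?\<eta> (?Q p) - ?\<eta> (if fst p = snd p then ?q (fst p) else 0)" for p
  have E: "\<bar>E p\<bar> < e / (4 * r * r)" for p
    unfolding E_def
  proof (rule d(2))
    have m: "(if fst p = snd p then ?q (fst p) else 0)
        = measure \<nu> (if fst p = snd p then X -` {fst p} \<inter> space \<nu> else {})" by simp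
    show "\<bar>?Q p - (if fst p = snd p then ?q (fst p) else 0)\<bar> < d"
      unfolding m by (rule close[OF simple_functionD(2)[OF XX]])
        (use XB in \<open>auto simp: prod_eq_iff good intro: ccontr dest: good[rotated]\<close>)
  qed auto
  have "\<bar>\<Sum>p\<in>V\<times>V. E p\<bar> \<le> (\<Sum>p\<in>V\<times>V. \<bar>E p\<bar>)" by (rule sum_abs)
  also have "\<dots> \<le> (\<Sum>p\<in>V\<times>V. e / (4 * r * r))"
    by (intro sum_mono less_imp_le E)
  also have "\<dots> = e / 4" using r1 by (simp add: r_def card_cartesian_product)
  finally have "\<bar>\<Sum>p\<in>V\<times>V. E p\<bar> \<le> e / 4" .
  moreover have "(\<Sum>p\<in>V\<times>V. E p) = - fin_ent \<nu> (\<lambda>z. (X z, X' z)) + fin_ent \<nu> X"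
  proof -
    have "(\<Sum>p\<in>V\<times>V. ?\<eta> (if fst p = snd p then ?q (fst p) else 0))
        = (\<Sum>u\<in>V. \<Sum>v\<in>V. ?\<eta> (if u = v then ?q u else 0))"
      unfolding sum.cartesian_product by (simp add: case_prod_unfold)
    also have "\<dots> = (\<Sum>u\<in>V. \<Sum>v\<in>V. if u = v then ?\<eta> (?q u) else 0)"
      by (intro sum.cong refl) auto
    also have "\<dots> = (\<Sum>u\<in>V. ?\<eta> (?q u))" using fV by (simp add: sum.delta')
    finally show ?thesis unfolding e1 e3 E_def by (simp add: sum_subtractf)
  qed
  ultimately have b2: "fin_ent \<nu> (\<lambda>z. (X z, X' z)) \<le> fin_ent \<nu> X + e / 4" by linarith
  have "fin_ent \<nu> (\<lambda>z. (X z, itin T Y N z, X' z)) + fin_ent \<nu> X'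
      \<le> fin_ent \<nu> (\<lambda>z. (X z, X' z)) + fin_ent \<nu> (\<lambda>z. (itin T Y N z, X' z))"
    by (rule fin_ent_submodular[OF X sY X'])
  moreover have "fin_ent \<nu> (\<lambda>z. (X z, itin T Y N z)) \<le> fin_ent \<nu> (\<lambda>z. (X z, itin T Y N z, X' z))"
    by (rule fin_ent_le_determined(1)[OF simple_function_Pair[OF X simple_function_Pair[OF sY X']]]) auto
  moreover have "fin_ent \<nu> (\<lambda>z. (itin T Y N z, X' z)) \<le> fin_ent \<nu> (itin T Y N)"
    by (rule fin_ent_le_determined(1)[OF sY]) (auto simp: X'_def)
  ultimately have "fin_ent \<nu> (\<lambda>z. (X z, itin T Y N z)) - fin_ent \<nu> (itin T Y N) < e"
    using b1 b2 e by linarith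
  then show ?thesis by blast
qed

text \<open>The Kolmogorov-Sinai theorem for forward itineraries of a finite-valued
  function.\<close>

theorem metric_entropy_generator:
  assumes Y: "simple_function \<nu> Y" and gen: "generating Y"
  shows "metric_entropy \<nu> T = ereal (ent_rate Y)"
proof (rule antisym[OF _ ent_rate_le_metric_entropy[OF Y]])
  show "metric_entropy \<nu> T \<le> ereal (ent_rate Y)"
    unfolding metric_entropy_eq_SUP
  proof (rule SUP_least)
    fix P assume "P \<in> {P. finite P \<and> P \<subseteq> sets \<nu> \<and> partition_on (space \<nu>) P}"
    then have X: "simple_function \<nu> (block_of P)" by (intro simple_function_block_of) auto
    have "ent_rate (block_of P) \<le> ent_rate Y"
    proof (rule field_le_epsilon)
      fix e :: real assume "e > 0"
      from generating_conditional_small[OF X Y gen this] obtain N where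
        "fin_ent \<nu> (\<lambda>z. (block_of P z, itin T Y N z)) - fin_ent \<nu> (itin T Y N) < e" by blast
      then show "ent_rate (block_of P) \<le> ent_rate Y + e"
        using ent_rate_le_conditional[OF X Y, of N] by linarith
    qed
    then show "ereal (ent_rate (block_of P)) \<le> ereal (ent_rate Y)" by simp
  qed
qed

end

section \<open>Concavity of entropy in the measure\<close>

lemma x_ln_x_tangent:
  fixes x c :: real
  assumes "0 \<le> x" "0 < c"
  shows "- (x * ln x) \<le> c - x - x * ln c"
proof (cases "x = 0")
  case False
  then have x: "x > 0" using assms by simp
  have "ln (c / x) \<le> c / x - 1" using x assms by (intro ln_le_minus_one) auto
  then have "x * ln (c / x) \<le> x * (c / x - 1)" using x by (intro mult_left_mono) auto
  then show ?thesis using x assms by (simp add: ln_div algebra_simps)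
qed (use assms in auto)

text \<open>For each value the function -x ln x is bounded by its tangent at the probability under
  the mixture; averaging over the components cancels the terms c - x and leaves the entropy of the
  mixture.\<close>

lemma fin_ent_mixture:
  fixes \<kappa> :: "'i \<Rightarrow> 'z measure"
  assumes A: "finite A" and u: "\<And>i. i \<in> A \<Longrightarrow> 0 \<le> u i" "(\<Sum>i\<in>A. u i) = 1"
    and space: "\<And>i. i \<in> A \<Longrightarrow> space (\<kappa> i) = space \<nu>"
    and mix: "\<And>B. B \<in> sets \<nu> \<Longrightarrow> measure \<nu> B = (\<Sum>i\<in>A. u i * measure (\<kappa> i) B)"
    and X: "simple_function \<nu> X"
  shows "(\<Sum>i\<in>A. u i * fin_ent (\<kappa> i) X) \<le> fin_ent \<nu> X"
proof -
  let ?S = "X ` space \<nu>"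
  have S: "finite ?S" using simple_functionD(1)[OF X] .
  define c where "c y = measure \<nu> (X -` {y} \<inter> space \<nu>)" for y
  define x where "x i y = measure (\<kappa> i) (X -` {y} \<inter> space \<nu>)" for i y
  have c: "c y = (\<Sum>i\<in>A. u i * x i y)" for y
    unfolding c_def x_def by (rule mix[OF simple_functionD(2)[OF X]])
  have x0: "0 \<le> x i y" for i y by (simp add: x_def)
  have step: "u i * (- (x i y * ln (x i y))) \<le> u i * c y - u i * x i y - u i * x i y * ln (c y)"
    if i: "i \<in> A" for i y
  \<comment> \<open>There is no tangent at zero; but if the mixture gives probability zero, so does
    every component of positive weight.\<close>
  proof (cases "c y = 0")
    case True
    then have "\<forall>i\<in>A. u i * x i y = 0"
      unfolding c using A u(1) x0 by (subst (asm) sum_nonneg_eq_0_iff) auto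
    then have "u i = 0 \<or> x i y = 0" using i by auto
    then show ?thesis using True by auto
  next
    case False
    have "0 \<le> c y" by (simp add: c_def)
    with False have "0 < c y" by simp
    from mult_left_mono[OF x_ln_x_tangent[OF x0 this] u(1)[OF i]] show ?thesis
      by (simp add: algebra_simps)
  qed
  have "(\<Sum>i\<in>A. u i * fin_ent (\<kappa> i) X) = (\<Sum>i\<in>A. \<Sum>y\<in>?S. u i * (- (x i y * ln (x i y))))"
    by (intro sum.cong refl) (simp add: fin_ent_def space x_def sum_distrib_left sum_negf)
  also have "\<dots> \<le> (\<Sum>i\<in>A. \<Sum>y\<in>?S. u i * c y - u i * x i y - u i * x i y * ln (c y))"
    by (intro sum_mono step)
  also have "\<dots> = (\<Sum>y\<in>?S. \<Sum>i\<in>A. u i * c y - u i * x i y - u i * x i y * ln (c y))"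
    by (rule sum.swap)
  also have "\<dots> = (\<Sum>y\<in>?S. - (c y * ln (c y)))"
  proof (intro sum.cong refl)
    fix y
    have "(\<Sum>i\<in>A. u i * c y - u i * x i y - u i * x i y * ln (c y))
        = (\<Sum>i\<in>A. u i) * c y - (\<Sum>i\<in>A. u i * x i y) - (\<Sum>i\<in>A. u i * x i y) * ln (c y)"
      by (simp add: sum_subtractf sum_distrib_right)
    then show "(\<Sum>i\<in>A. u i * c y - u i * x i y - u i * x i y * ln (c y)) = - (c y * ln (c y))"
      using u(2) c[of y] by simp
  qed
  also have "\<dots> = fin_ent \<nu> X" by (simp add: fin_ent_def c_def sum_negf)
  finally show ?thesis .
qed

subsection \<open>Sums over words and the weak law of large numbers\<close>

definition words_of_length :: "'c set \<Rightarrow> nat \<Rightarrow> 'c list set" where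
  "words_of_length A m = {xs. set xs \<subseteq> A \<and> length xs = m}"

lemma words_of_length_0 [simp]: "words_of_length A 0 = {[]}"
  by (auto simp: words_of_length_def)

lemma finite_words_of_length [simp]: "finite A \<Longrightarrow> finite (words_of_length A m)"
  by (simp add: words_of_length_def finite_lists_length_eq)

lemma sum_words_Suc:
  "(\<Sum>xs\<in>words_of_length A (Suc m). F xs) = (\<Sum>x\<in>A. \<Sum>xs\<in>words_of_length A m. F (x # xs))"
proof -
  have eq: "words_of_length A (Suc m) = (\<lambda>(x, xs). x # xs) ` (A \<times> words_of_length A m)"
    by (auto simp: words_of_length_def length_Suc_conv image_iff)
  have inj: "inj_on (\<lambda>(x, xs). x # xs) (A \<times> words_of_length A m)" by (auto simp: inj_on_def)
  show ?thesis
    unfolding eq by (subst sum.reindex[OF inj]) (simp add: sum.cartesian_product case_prod_unfold)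
qed

text \<open>Weights are strictly positive so that their logarithms are usable. The product
  \<open>wt\<close> is the law of independent letters, which avoids product measures for words of
  finite length.\<close>

locale prob_weights =
  fixes A :: "'c set" and p :: "'c \<Rightarrow> real"
  assumes finite_A: "finite A" and p_pos: "\<And>x. x \<in> A \<Longrightarrow> 0 < p x" and p_sum: "(\<Sum>x\<in>A. p x) = 1"
begin

abbreviation wt :: "'c list \<Rightarrow> real" where "wt xs \<equiv> prod_list (map p xs)"

abbreviation mean :: "('c \<Rightarrow> real) \<Rightarrow> real" where "mean f \<equiv> (\<Sum>x\<in>A. p x * f x)"

lemma wt_pos: "xs \<in> words_of_length A m \<Longrightarrow> 0 < wt xs"
  by (induction xs arbitrary: m) (auto simp: words_of_length_def p_pos)

lemma sum_wt: "(\<Sum>xs\<in>words_of_length A m. wt xs) = 1"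
  by (induction m) (simp_all add: sum_words_Suc sum_distrib_left[symmetric] p_sum)

lemma sum_wt_sum_list:
  "(\<Sum>xs\<in>words_of_length A m. wt xs * sum_list (map f xs)) = real m * mean f"
proof (induction m)
  case (Suc m)
  have "(\<Sum>xs\<in>words_of_length A (Suc m). wt xs * sum_list (map f xs))
      = (\<Sum>x\<in>A. p x * f x * (\<Sum>xs\<in>words_of_length A m. wt xs)
        + p x * (\<Sum>xs\<in>words_of_length A m. wt xs * sum_list (map f xs)))"
    by (simp add: sum_words_Suc sum_distrib_left sum.distrib[symmetric] algebra_simps)
  also have "\<dots> = mean f + (\<Sum>x\<in>A. p x) * (real m * mean f)"
    unfolding Suc sum_wt by (simp add: sum.distrib sum_distrib_right)
  finally show ?case by (simp add: p_sum algebra_simps)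
qed simp

text \<open>Additivity of the variance for independent centred letters: the cross term vanishes
  because it contains the mean of \<open>f\<close>.\<close>

lemma sum_wt_sum_list_square:
  assumes "mean f = 0"
  shows "(\<Sum>xs\<in>words_of_length A m. wt xs * (sum_list (map f xs))\<^sup>2) = real m * mean (\<lambda>x. (f x)\<^sup>2)"
proof (induction m)
  case (Suc m)
  let ?W = "words_of_length A m"
  have "(\<Sum>xs\<in>words_of_length A (Suc m). wt xs * (sum_list (map f xs))\<^sup>2)
      = (\<Sum>x\<in>A. \<Sum>xs\<in>?W. p x * (f x)\<^sup>2 * wt xs + 2 * (p x * f x) * (wt xs * sum_list (map f xs))
        + p x * (wt xs * (sum_list (map f xs))\<^sup>2))"
    unfolding sum_words_Suc by (intro sum.cong refl) (simp add: power2_eq_square algebra_simps)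
  also have "\<dots> = (\<Sum>x\<in>A. p x * (f x)\<^sup>2 * (\<Sum>xs\<in>?W. wt xs)
        + 2 * (p x * f x) * (\<Sum>xs\<in>?W. wt xs * sum_list (map f xs))
        + p x * (\<Sum>xs\<in>?W. wt xs * (sum_list (map f xs))\<^sup>2))"
    by (simp add: sum.distrib sum_distrib_left)
  also have "\<dots> = mean (\<lambda>x. (f x)\<^sup>2) + (\<Sum>x\<in>A. p x) * (real m * mean (\<lambda>x. (f x)\<^sup>2))"
    unfolding Suc sum_wt sum_wt_sum_list assms by (simp add: sum.distrib sum_distrib_right)
  finally show ?case by (simp add: p_sum algebra_simps)
qed simp

lemma weak_law:
  assumes \<delta>: "\<delta> > 0"
  shows "\<exists>m0. \<forall>m\<ge>m0. (\<Sum>xs\<in>{xs\<in>words_of_length A m. sum_list (map f xs) < real m * (mean f - \<delta>)}. wt xs) \<le> 1 / 4"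
proof -
  define h where "h x = f x - mean f" for x
  have h0: "mean h = 0"
    using p_sum by (simp add: h_def algebra_simps sum_subtractf sum_distrib_right[symmetric])
  define V where "V = mean (\<lambda>x. (h x)\<^sup>2)"
  have hs: "sum_list (map f xs) - real m * mean f = sum_list (map h xs)" if "length xs = m" for xs m
    using that by (induction xs arbitrary: m) (auto simp: h_def algebra_simps)
  \<comment> \<open>Chebyshev bounds the weight of the deviating words by V / (m \<delta>^2). This
    threshold makes it at most 1/4, so that two such exceptional sets leave weight 1/2.\<close>
  obtain m0 :: nat where m0: "real m0 > 4 * V / \<delta>\<^sup>2" using reals_Archimedean2 by blast
  show ?thesis
  proof (intro exI[of _ "max m0 1"] allI impI)
    fix m assume m: "m \<ge> max m0 1"
    let ?B = "{xs\<in>words_of_length A m. sum_list (map f xs) < real m * (mean f - \<delta>)}"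
    have "(\<Sum>xs\<in>?B. wt xs) * (real m * \<delta>)\<^sup>2 = (\<Sum>xs\<in>?B. wt xs * (real m * \<delta>)\<^sup>2)"
      by (simp add: sum_distrib_right)
    also have "\<dots> \<le> (\<Sum>xs\<in>?B. wt xs * (sum_list (map h xs))\<^sup>2)"
    proof (intro sum_mono mult_left_mono)
      fix xs assume xs: "xs \<in> ?B"
      then have "sum_list (map h xs) < - (real m * \<delta>)"
        using hs[of xs m] by (auto simp: words_of_length_def algebra_simps)
      then have "real m * \<delta> \<le> \<bar>sum_list (map h xs)\<bar>" by linarith
      then have "(real m * \<delta>)\<^sup>2 \<le> \<bar>sum_list (map h xs)\<bar>\<^sup>2" using \<delta> by (intro power_mono) auto
      then show "(real m * \<delta>)\<^sup>2 \<le> (sum_list (map h xs))\<^sup>2" by simp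
      show "0 \<le> wt xs" using xs wt_pos by (auto intro: less_imp_le)
    qed
    also have "\<dots> \<le> (\<Sum>xs\<in>words_of_length A m. wt xs * (sum_list (map h xs))\<^sup>2)"
      using finite_A wt_pos by (intro sum_mono2) (auto intro!: mult_nonneg_nonneg[OF less_imp_le[OF wt_pos] zero_le_power2])
    also have "\<dots> = real m * V" unfolding V_def by (rule sum_wt_sum_list_square[OF h0])
    also have "\<dots> \<le> (1 / 4) * (real m * \<delta>)\<^sup>2"
    proof -
      have "4 * V / \<delta>\<^sup>2 \<le> real m" using m0 m by linarith
      then have "4 * V \<le> real m * \<delta>\<^sup>2" using \<delta> by (simp add: field_simps)
      then have "real m * (4 * V) \<le> real m * (real m * \<delta>\<^sup>2)" by (intro mult_left_mono) auto
      then show ?thesis by (simp add: power2_eq_square algebra_simps)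
    qed
    finally show "(\<Sum>xs\<in>?B. wt xs) \<le> 1 / 4"
      by (rule mult_right_le_imp_le) (use m \<delta> in auto)
  qed
qed

lemma typical_words:
  assumes \<delta>: "\<delta> > 0"
  shows "\<exists>m0. \<forall>m\<ge>m0. 1 / 2 \<le> (\<Sum>xs\<in>{xs\<in>words_of_length A m.
    real m * (mean f - \<delta>) \<le> sum_list (map f xs) \<and> real m * (mean s - \<delta>) \<le> sum_list (map s xs)}. wt xs)"
proof -
  obtain m1 m2 where
    m1: "\<And>m. m \<ge> m1 \<Longrightarrow> (\<Sum>xs\<in>{xs\<in>words_of_length A m. sum_list (map f xs) < real m * (mean f - \<delta>)}. wt xs) \<le> 1 / 4"
    and m2: "\<And>m. m \<ge> m2 \<Longrightarrow> (\<Sum>xs\<in>{xs\<in>words_of_length A m. sum_list (map s xs) < real m * (mean s - \<delta>)}. wt xs) \<le> 1 / 4"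
    using weak_law[OF \<delta>, of f] weak_law[OF \<delta>, of s] by auto
  show ?thesis
  proof (intro exI[of _ "max m1 m2"] allI impI)
    fix m assume m: "m \<ge> max m1 m2"
    let ?W = "words_of_length A m"
    let ?B1 = "{xs\<in>?W. sum_list (map f xs) < real m * (mean f - \<delta>)}"
    let ?B2 = "{xs\<in>?W. sum_list (map s xs) < real m * (mean s - \<delta>)}"
    let ?G = "{xs\<in>?W. real m * (mean f - \<delta>) \<le> sum_list (map f xs) \<and> real m * (mean s - \<delta>) \<le> sum_list (map s xs)}"
    have "1 = (\<Sum>xs\<in>?W. wt xs)" by (simp add: sum_wt)
    also have "?W = ?G \<union> (?B1 \<union> ?B2)" by auto
    also have "(\<Sum>xs\<in>?G \<union> (?B1 \<union> ?B2). wt xs) \<le> (\<Sum>xs\<in>?G. wt xs) + (\<Sum>xs\<in>?B1 \<union> ?B2. wt xs)"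
      using finite_A by (subst sum.union_disjoint) auto
    also have "(\<Sum>xs\<in>?B1 \<union> ?B2. wt xs) \<le> (\<Sum>xs\<in>?B1. wt xs) + (\<Sum>xs\<in>?B2. wt xs)"
    proof -
      have "(\<Sum>xs\<in>?B1 \<union> ?B2. wt xs) = (\<Sum>xs\<in>?B1. wt xs) + (\<Sum>xs\<in>?B2. wt xs) - (\<Sum>xs\<in>?B1 \<inter> ?B2. wt xs)"
        using finite_A by (intro sum_Un) auto
      moreover have "0 \<le> (\<Sum>xs\<in>?B1 \<inter> ?B2. wt xs)"
        using wt_pos by (intro sum_nonneg) (auto intro: less_imp_le)
      ultimately show ?thesis by linarith
    qed
    also have "\<dots> \<le> 1 / 4 + 1 / 4" using m1[of m] m2[of m] m by (intro add_mono) auto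
    finally show "1 / 2 \<le> (\<Sum>xs\<in>?G. wt xs)" by simp
  qed
qed

end

subsection \<open>Towers and return words\<close>

locale tower_sys =
  fixes M :: "'a measure" and X :: "nat \<Rightarrow> 'a set" and I :: "nat \<Rightarrow> 'a set set"
    and g :: "'a set \<Rightarrow> 'a \<Rightarrow> 'a"
  assumes tower: "tower M X I"
    and nonsingular: "\<And>J. J \<in> exits X I \<Longrightarrow> bi_nonsingular M J (g J)"
    and admissible: "admissible X I g"
begin

abbreviation T where "T \<equiv> tower_map X I g"
abbreviation Z where "Z \<equiv> tower_space X"
abbreviation \<A> where "\<A> \<equiv> tower_partition I"
abbreviation E where "E \<equiv> exits X I"
abbreviation \<tau> where "\<tau> \<equiv> return_time X I"
abbreviation sym where "sym \<equiv> block_of \<A>"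
abbreviation mZ where "mZ \<equiv> tower_measure M X"

lemma finite_measure_M: "finite_measure M"
  using tower by (simp add: tower_def)

sublocale finite_measure M by (rule finite_measure_M)

lemma X_0 [simp]: "X 0 = space M" using tower by (simp add: tower_def)
lemma X_sets [measurable, simp]: "X k \<in> sets M" using tower by (simp add: tower_def)
lemma X_pos: "measure M (X k) > 0" using tower by (simp add: tower_def)
lemma X_Suc: "X (Suc k) \<subseteq> X k" using tower by (simp add: tower_def)
lemma X_antimono: "i \<le> j \<Longrightarrow> X j \<subseteq> X i" by (rule lift_Suc_antimono_le[of X, OF X_Suc])
lemma I_finite: "finite (I k)" using tower by (simp add: tower_def)
lemma I_part: "partition_on (X k) (I k)" using tower by (simp add: tower_def)
lemma I_sets: "J \<in> I k \<Longrightarrow> J \<in> sets M" using tower by (simp add: tower_def)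
lemma I_up: "J \<in> I k \<Longrightarrow> J \<inter> X (Suc k) \<noteq> {} \<Longrightarrow> J \<subseteq> X (Suc k)" using tower unfolding tower_def by blast
lemma I_refine: "K \<in> I (Suc k) \<Longrightarrow> \<exists>J\<in>I k. K \<subseteq> J" using tower unfolding tower_def by blast
lemma I_sub: "J \<in> I k \<Longrightarrow> J \<subseteq> X k" using partition_onD1[OF I_part] by blast
lemma I_ne: "J \<in> I k \<Longrightarrow> J \<noteq> {}" using partition_onD3[OF I_part] by blast
lemma I_ex: "x \<in> X k \<Longrightarrow> \<exists>J\<in>I k. x \<in> J" using partition_onD1[OF I_part] by blast
lemma I_eq: "J \<in> I k \<Longrightarrow> K \<in> I k \<Longrightarrow> x \<in> J \<Longrightarrow> x \<in> K \<Longrightarrow> J = K"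
  using disjointD[OF partition_onD2[OF I_part]] by blast

lemma space_M_pos: "measure M (space M) > 0" using X_pos[of 0] by simp

lemma I_nested:
  assumes "J \<in> I k" "k \<le> l" "K \<in> I l" "x \<in> J" "x \<in> K"
  shows "K \<subseteq> J"
  using assms(2,3,5)
proof (induction l arbitrary: K rule: dec_induct)
  case base
  then show ?case using I_eq[OF assms(1) base(1) assms(4)] by simp
next
  case (step l)
  obtain K' where K': "K' \<in> I l" "K \<subseteq> K'" using I_refine[OF step.prems(1)] by blast
  have "K' \<subseteq> J" by (rule step.IH[OF K'(1)]) (use K' step.prems in auto)
  then show ?case using K' by blast
qed

lemma E_iff: "J \<in> E \<longleftrightarrow> (\<exists>k. J \<in> I k \<and> J \<inter> X (Suc k) = {})"
proof
  assume "J \<in> E"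
  then obtain k where "k \<ge> 1" "J \<in> I (k - 1)" "J \<inter> X k = {}" by (auto simp: exits_def exit_at_def)
  then show "\<exists>k. J \<in> I k \<and> J \<inter> X (Suc k) = {}" by (intro exI[of _ "k - 1"]) auto
next
  assume "\<exists>k. J \<in> I k \<and> J \<inter> X (Suc k) = {}"
  then obtain k where "J \<in> I k \<and> J \<inter> X (Suc k) = {}" by blast
  then show "J \<in> E" unfolding exits_def exit_at_def by (intro UN_I[of "Suc k"]) auto
qed

text \<open>The description picks a unique number since the sets \<open>X k\<close> decrease: a
  nonempty block cannot avoid one of them and also lie in that one or a later one.\<close>

lemma return_time_eq:
  assumes "J \<in> I k" "J \<inter> X (Suc k) = {}"
  shows "\<tau> J = Suc k"
  unfolding return_time_def
proof (rule the_equality)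
  show "1 \<le> Suc k \<and> J \<in> exit_at X I (Suc k)" using assms by (simp add: exit_at_def)
  fix l assume "1 \<le> l \<and> J \<in> exit_at X I l"
  then have l: "1 \<le> l" "J \<in> I (l - 1)" "J \<inter> X l = {}" by (auto simp: exit_at_def)
  have ne: "J \<noteq> {}" by (rule I_ne[OF assms(1)])
  show "l = Suc k"
  proof (rule ccontr)
    assume "l \<noteq> Suc k"
    then consider "l \<le> k" | "Suc k \<le> l - 1" by linarith
    then show False
    proof cases
      case 1
      then have "J \<subseteq> X l" using I_sub[OF assms(1)] X_antimono[of l k] by blast
      then show False using l(3) ne by blast
    next
      case 2
      then have "J \<subseteq> X (Suc k)" using I_sub[OF l(2)] X_antimono[of "Suc k" "l - 1"] by blast
      then show False using assms(2) ne by blast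
    qed
  qed
qed

lemma E_D:
  assumes "J \<in> E"
  shows "0 < \<tau> J" "J \<in> I (\<tau> J - 1)" "J \<inter> X (\<tau> J) = {}" "J \<subseteq> X (\<tau> J - 1)" "J \<in> sets M" "J \<subseteq> space M"
proof -
  obtain k where k: "J \<in> I k" "J \<inter> X (Suc k) = {}" using assms E_iff by blast
  have t: "\<tau> J = Suc k" by (rule return_time_eq[OF k])
  show "0 < \<tau> J" "J \<in> I (\<tau> J - 1)" "J \<inter> X (\<tau> J) = {}" using k t by auto
  show "J \<subseteq> X (\<tau> J - 1)" "J \<in> sets M" using k t I_sub I_sets by auto
  then show "J \<subseteq> space M" using sets.sets_into_space by blast
qed

text \<open>Of two exits with different return times, the earlier avoids a set of the sequence that
  contains the later; with equal return times they belong to one partition.\<close>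

lemma E_eq:
  assumes "J \<in> E" "K \<in> E" "x \<in> J" "x \<in> K"
  shows "J = K"
proof -
  have "\<tau> J = \<tau> K"
  proof (rule ccontr)
    assume "\<tau> J \<noteq> \<tau> K"
    then consider "\<tau> J \<le> \<tau> K - 1" | "\<tau> K \<le> \<tau> J - 1" by linarith
    then show False
      by cases (use E_D(3,4)[OF assms(1)] E_D(3,4)[OF assms(2)] X_antimono assms(3,4) in blast)+
  qed
  then show ?thesis using I_eq[OF E_D(2)[OF assms(1)]] E_D(2)[OF assms(2)] assms(3,4) by metis
qed

lemma E_ex:
  assumes "x \<in> X k" "x \<notin> X (Suc k)"
  shows "\<exists>J\<in>E. x \<in> J \<and> \<tau> J = Suc k"
proof -
  obtain J where J: "J \<in> I k" "x \<in> J" using I_ex[OF assms(1)] by blast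
  have "J \<inter> X (Suc k) = {}" using I_up[OF J(1)] J(2) assms(2) by blast
  then show ?thesis using J E_iff return_time_eq by blast
qed

lemma E_level:
  assumes "J \<in> E" "x \<in> J" "i < \<tau> J" shows "x \<in> X i"
proof -
  have "i \<le> \<tau> J - 1" using assms(3) by simp
  from X_antimono[OF this] E_D(4)[OF assms(1)] assms(2) show ?thesis by blast
qed

lemma finite_E_le: "finite {J\<in>E. \<tau> J \<le> n}"
proof (rule finite_subset)
  show "{J\<in>E. \<tau> J \<le> n} \<subseteq> (\<Union>k\<le>n. I k)"
  proof clarify
    fix J assume "J \<in> E" "\<tau> J \<le> n"
    then show "J \<in> (\<Union>k\<le>n. I k)" using E_D(2)[of J] by (intro UN_I[of "\<tau> J - 1"]) auto
  qed
qed (simp add: I_finite)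

lemma Z_iff: "(x, k) \<in> Z \<longleftrightarrow> x \<in> X k" by (simp add: tower_space_def)

lemma T_up: "x \<in> X (Suc k) \<Longrightarrow> T (x, k) = (x, Suc k)" by simp

lemma T_exit:
  assumes "J \<in> E" "x \<in> J" "\<tau> J = Suc k"
  shows "T (x, k) = (g J x, 0)"
proof -
  have "x \<notin> X (Suc k)" using E_D(3)[OF assms(1)] assms by auto
  moreover have "(THE J. J \<in> exit_at X I (Suc k) \<and> x \<in> J) = J"
  proof (rule the_equality)
    show "J \<in> exit_at X I (Suc k) \<and> x \<in> J" using E_D(2,3)[OF assms(1)] assms by (simp add: exit_at_def)
    fix K assume "K \<in> exit_at X I (Suc k) \<and> x \<in> K"
    then show "K = J" using E_D(2)[OF assms(1)] assms I_eq[of K k J x] by (auto simp: exit_at_def)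
  qed
  ultimately show ?thesis by simp
qed

declare tower_map.simps [simp del]

lemma g_bij: "J \<in> E \<Longrightarrow> bij_betw (g J) J (space M)"
  using nonsingular by (simp add: bi_nonsingular_def)

lemma g_in: "J \<in> E \<Longrightarrow> x \<in> J \<Longrightarrow> g J x \<in> space M"
  using bij_betw_apply[OF g_bij] .

lemma g_vimage_sets:
  assumes "J \<in> E" "A \<in> sets M"
  shows "{x\<in>J. g J x \<in> A} \<in> sets M"
proof -
  have "g J \<in> restrict_space M J \<rightarrow>\<^sub>M M" using nonsingular[OF assms(1)] by (simp add: bi_nonsingular_def)
  then have "g J -` A \<inter> space (restrict_space M J) \<in> sets (restrict_space M J)"
    by (rule measurable_sets[OF _ assms(2)])
  then have "g J -` A \<inter> J \<in> sets M"
    using E_D(5,6)[OF assms(1)] by (simp add: space_restrict_space2 sets_restrict_space_iff)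
  also have "g J -` A \<inter> J = {x\<in>J. g J x \<in> A}" by auto
  finally show ?thesis .
qed

lemma T_cases:
  assumes "(x, k) \<in> Z"
  obtains "x \<in> X (Suc k)" "T (x, k) = (x, Suc k)"
  | J where "J \<in> E" "x \<in> J" "\<tau> J = Suc k" "T (x, k) = (g J x, 0)"
  using assms E_ex[of x k] T_exit T_up unfolding Z_iff by metis

lemma T_Z: "T \<in> Z \<rightarrow> Z"
proof
  fix z assume "z \<in> Z"
  then obtain x k where z: "z = (x, k)" "(x, k) \<in> Z" by (cases z) auto
  from z(2) show "T z \<in> Z" unfolding z(1)
    by (cases rule: T_cases) (auto simp: Z_iff g_in)
qed

lemmas funpow_T_Z = funpow_in[OF T_Z]

text \<open>A step raises the level by one or drops to the base. The maximal height k + i is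
  therefore reached only without any drop, and then the first coordinate has not changed.\<close>

lemma funpow_T_level:
  assumes "(x, k) \<in> Z"
  shows "snd ((T ^^ i) (x, k)) \<le> k + i"
    and "snd ((T ^^ i) (x, k)) = k + i \<Longrightarrow> (T ^^ i) (x, k) = (x, k + i)"
proof -
  have "snd ((T ^^ i) (x, k)) \<le> k + i \<and> (snd ((T ^^ i) (x, k)) = k + i \<longrightarrow> (T ^^ i) (x, k) = (x, k + i))"
  proof (induction i)
    case (Suc i)
    obtain y l where yl: "(T ^^ i) (x, k) = (y, l)" by (cases "(T ^^ i) (x, k)")
    have "(y, l) \<in> Z" using funpow_T_Z[OF assms, of i] yl by simp
    then show ?case
      by (cases rule: T_cases) (use Suc yl in auto)
  qed simp
  then show "snd ((T ^^ i) (x, k)) \<le> k + i"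
    and "snd ((T ^^ i) (x, k)) = k + i \<Longrightarrow> (T ^^ i) (x, k) = (x, k + i)" by auto
qed

section \<open>Symbolic codes for the tower partition\<close>

lemma \<A>_part: "partition_on Z \<A>"
proof (rule partition_onI)
  show "\<Union> \<A> = Z"
  proof (intro equalityI subsetI)
    fix z assume "z \<in> \<Union> \<A>"
    then show "z \<in> Z" by (auto simp: tower_partition_def tower_space_def dest: I_sub[THEN subsetD])
  next
    fix z assume "z \<in> Z"
    then obtain x k where z: "z = (x, k)" "x \<in> X k" by (cases z) (auto simp: tower_space_def)
    then obtain J where "J \<in> I k" "x \<in> J" using I_ex by blast
    then have "J \<times> {k} \<in> \<A>" "z \<in> J \<times> {k}" using z by (auto simp: tower_partition_def)
    then show "z \<in> \<Union> \<A>" by blast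
  qed
  show "{} \<notin> \<A>" using I_ne by (auto simp: tower_partition_def)
  show "disjnt p q" if pq: "p \<in> \<A>" "q \<in> \<A>" "p \<noteq> q" for p q
  proof -
    obtain J k K l where J: "p = J \<times> {k}" "J \<in> I k" "q = K \<times> {l}" "K \<in> I l"
      using pq by (auto simp: tower_partition_def)
    show ?thesis
    proof (cases "k = l")
      case True
      then have "J \<inter> K = {}" using J pq(3) I_eq[of J k K] by blast
      then show ?thesis using J by (auto simp: disjnt_def)
    qed (use J in \<open>auto simp: disjnt_def\<close>)
  qed
qed

lemma sym_eq: "J \<in> I k \<Longrightarrow> x \<in> J \<Longrightarrow> sym (x, k) = J \<times> {k}"
  by (rule block_of_eq[OF \<A>_part]) (auto simp: tower_partition_def)

lemma sym_in: "z \<in> Z \<Longrightarrow> z \<in> sym z" "z \<in> Z \<Longrightarrow> sym z \<in> \<A>"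
  using block_of_in[OF \<A>_part] by auto

abbreviation code :: "nat \<Rightarrow> 'a \<times> nat \<Rightarrow> ('a \<times> nat) set list" where
  "code \<equiv> itin T sym"

lemma tower_join_eq: "tower_join X I g n = (\<lambda>z. {w\<in>Z. code n w = code n z}) ` Z"
  unfolding tower_join_def by (rule dyn_join_eq[OF \<A>_part T_Z])

lemma funpow_T_exit:
  assumes "J \<in> E" "x \<in> J"
  shows "i < \<tau> J \<Longrightarrow> (T ^^ i) (x, 0) = (x, i)"
    and "(T ^^ \<tau> J) (x, 0) = (g J x, 0)"
proof -
  have *: "(T ^^ i) (x, 0) = (x, i)" if "i < \<tau> J" for i
    using that
  proof (induction i)
    case (Suc i)
    then have "x \<in> X (Suc i)" using E_level[OF assms] by simp
    then show ?case using Suc by (simp add: T_up)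
  qed simp
  then show "i < \<tau> J \<Longrightarrow> (T ^^ i) (x, 0) = (x, i)" by blast
  obtain k where t: "\<tau> J = Suc k" using E_D(1)[OF assms(1)] by (cases "\<tau> J") auto
  show "(T ^^ \<tau> J) (x, 0) = (g J x, 0)"
    using *[of k] T_exit[OF assms t] t by simp
qed

section \<open>Words of exits, their cylinders and their composed branches\<close>

definition len :: "'a set list \<Rightarrow> nat" where "len w = sum_list (map \<tau> w)"

lemma len_simps [simp]: "len [] = 0" "len (J # w) = \<tau> J + len w" "len (u @ v) = len u + len v"
  by (simp_all add: len_def)

text \<open>The points of the base whose successive exits spell the word. The composed branch
  \<open>ret\<close> is meaningful only on the cylinder, which it maps onto the whole base, and
  there it is \<open>T\<close> iterated \<open>len w\<close> times.\<close>

primrec cyl :: "'a set list \<Rightarrow> 'a set" where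
  "cyl [] = space M"
| "cyl (J # w) = {x\<in>J. g J x \<in> cyl w}"

primrec ret :: "'a set list \<Rightarrow> 'a \<Rightarrow> 'a" where
  "ret [] x = x"
| "ret (J # w) x = ret w (g J x)"

definition pre :: "'a set list \<Rightarrow> 'a set \<Rightarrow> 'a set" where
  "pre w A = {x\<in>cyl w. ret w x \<in> A}"

lemma cyl_sub: "w \<in> lists E \<Longrightarrow> cyl w \<subseteq> space M"
  by (induction w) (use E_D(6) in auto)

lemma ret_in: "w \<in> lists E \<Longrightarrow> x \<in> cyl w \<Longrightarrow> ret w x \<in> space M"
  by (induction w arbitrary: x) auto

lemma cyl_append: "u \<in> lists E \<Longrightarrow> v \<in> lists E \<Longrightarrow> cyl (u @ v) = {x\<in>cyl u. ret u x \<in> cyl v}"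
  by (induction u) (use cyl_sub[of v] in auto)

lemma ret_append: "ret (u @ v) x = ret v (ret u x)"
  by (induction u arbitrary: x) auto

lemma pre_space: "w \<in> lists E \<Longrightarrow> pre w (space M) = cyl w"
  using ret_in by (auto simp: pre_def)

lemma cyl_append_pre: "u \<in> lists E \<Longrightarrow> v \<in> lists E \<Longrightarrow> cyl (u @ v) = pre u (cyl v)"
  by (simp add: cyl_append pre_def)

lemma pre_Cons: "pre (J # w) A = {x\<in>J. g J x \<in> pre w A}"
  by (auto simp: pre_def)

lemma pre_sets:
  assumes "w \<in> lists E" "A \<in> sets M"
  shows "pre w A \<in> sets M"
  using assms(1)
proof (induction w rule: list.induct)
  case Nil
  have "pre [] A = A" using sets.sets_into_space[OF assms(2)] by (auto simp: pre_def)
  then show ?case using assms(2) by simp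
next
  case (Cons J w)
  then show ?case unfolding pre_Cons by (intro g_vimage_sets) auto
qed

lemma cyl_sets: "w \<in> lists E \<Longrightarrow> cyl w \<in> sets M"
  using pre_sets[of w "space M"] by (simp add: pre_space)

lemma ret_surj: "w \<in> lists E \<Longrightarrow> y \<in> space M \<Longrightarrow> \<exists>x\<in>cyl w. ret w x = y"
proof (induction w)
  case (Cons J w)
  then obtain x where x: "x \<in> cyl w" "ret w x = y" by auto
  then have "x \<in> space M" using cyl_sub[of w] Cons by auto
  then have "x \<in> g J ` J"
    using g_bij[of J] Cons.prems by (auto simp: bij_betw_def)
  then obtain x' where "x' \<in> J" "g J x' = x" by blast
  then show ?case using x by auto
qed simp

lemma cyl_ne: "w \<in> lists E \<Longrightarrow> cyl w \<noteq> {}"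
proof -
  assume w: "w \<in> lists E"
  have "space M \<noteq> {}" using space_M_pos by auto
  then show ?thesis using ret_surj[OF w] by blast
qed

lemma funpow_T_cyl: "w \<in> lists E \<Longrightarrow> x \<in> cyl w \<Longrightarrow> (T ^^ len w) (x, 0) = (ret w x, 0)"
proof (induction w arbitrary: x)
  case (Cons J w)
  have "(T ^^ (\<tau> J + len w)) (x, 0) = (T ^^ len w) ((T ^^ \<tau> J) (x, 0))"
    by (subst add.commute) (simp add: funpow_add)
  also have "\<dots> = (T ^^ len w) (g J x, 0)"
    using funpow_T_exit(2)[of J x] Cons.prems by simp
  finally show ?case using Cons by simp
qed simp

text \<open>The partitions get finer as the level grows, so an exit lies in a single block of each
  level that it passes, and that block is the symbol read there.\<close>

lemma code_exit:
  assumes "J \<in> E" "x \<in> J" "y \<in> J" "i < \<tau> J"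
  shows "sym ((T ^^ i) (x, 0)) = sym ((T ^^ i) (y, 0))"
proof -
  have "x \<in> X i" by (rule E_level[OF assms(1,2,4)])
  then obtain K where K: "K \<in> I i" "x \<in> K" using I_ex by blast
  have "J \<subseteq> K" by (rule I_nested[OF K(1) _ E_D(2)[OF assms(1)] K(2) assms(2)]) (use assms(4) in simp)
  then show ?thesis
    using funpow_T_exit(1)[OF assms(1,2,4)] funpow_T_exit(1)[OF assms(1,3,4)] sym_eq[OF K(1)] K(2) assms(3)
    by auto
qed

lemma code_cyl:
  assumes "w \<in> lists E" "x \<in> cyl w" "y \<in> cyl w"
  shows "code (len w) (x, 0) = code (len w) (y, 0)"
  using assms
proof (induction w arbitrary: x y rule: list.induct)
  case (Cons J w)
  have 1: "code (\<tau> J) (x, 0) = code (\<tau> J) (y, 0)"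
    unfolding itin_eq_iff using code_exit[of J x y] Cons.prems by simp
  have 2: "code (len w) (g J x, 0) = code (len w) (g J y, 0)"
    using Cons by auto
  show ?case using 1 2 Cons.prems by (simp add: itin_add funpow_T_exit(2))
qed (simp add: itin_def)

text \<open>The converse of \<open>code_cyl\<close>. The symbol at time \<open>\<tau> J - 1\<close>
  is \<open>J\<close> at that level; a point whose level equals the elapsed time has not returned
  yet, so it started in \<open>J\<close> itself.\<close>

lemma cyl_of_code:
  assumes "w \<in> lists E" "x \<in> cyl w" "y \<in> space M" "len w \<le> n" "code n (x, 0) = code n (y, 0)"
  shows "y \<in> cyl w"
  using assms
proof (induction w arbitrary: x y n rule: list.induct)
  case (Cons J w)
  have J: "J \<in> E" "x \<in> J" and w: "w \<in> lists E" and gx: "g J x \<in> cyl w" using Cons.prems by auto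
  define i where "i = \<tau> J - 1"
  have i: "i < \<tau> J" "J \<in> I i" using E_D(1,2)[OF J(1)] by (auto simp: i_def)
  have yZ: "(y, 0) \<in> Z" using Cons.prems by (simp add: Z_iff)
  have "sym ((T ^^ i) (y, 0)) = sym (x, i)"
  proof -
    have "i < n" using Cons.prems(4) i(1) by simp
    then have "sym ((T ^^ i) (x, 0)) = sym ((T ^^ i) (y, 0))"
      using Cons.prems(5) unfolding itin_eq_iff by blast
    then show ?thesis using funpow_T_exit(1)[OF J i(1)] by simp
  qed
  also have "\<dots> = J \<times> {i}" by (rule sym_eq[OF i(2) J(2)])
  finally have *: "(T ^^ i) (y, 0) \<in> J \<times> {i}" using sym_in(1)[OF funpow_T_Z[OF yZ, of i]] by simp
  then have "(T ^^ i) (y, 0) = (y, 0 + i)" by (intro funpow_T_level(2)[OF yZ]) auto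
  then have yJ: "y \<in> J" using * by auto
  have n: "n = \<tau> J + (n - \<tau> J)" using Cons.prems(4) by simp
  have "code (n - \<tau> J) (g J x, 0) = code (n - \<tau> J) (g J y, 0)"
  proof -
    have "code (\<tau> J + (n - \<tau> J)) (x, 0) = code (\<tau> J + (n - \<tau> J)) (y, 0)"
      using Cons.prems(5) n by simp
    then show ?thesis
      using funpow_T_exit(2)[OF J] funpow_T_exit(2)[OF J(1) yJ] by (simp add: itin_add)
  qed
  then have "g J y \<in> cyl w"
    by (intro Cons.IH[OF w gx]) (use Cons.prems(4) g_in[OF J(1) yJ] in auto)
  then show ?case using yJ by simp
qed simp

text \<open>Exits are disjoint, and neither word can be a proper prefix of the other, since every
  exit takes positive time and the total lengths agree.\<close>

lemma cyl_disjoint: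
  assumes "u \<in> lists E" "v \<in> lists E" "len u = len v" "x \<in> cyl u" "x \<in> cyl v"
  shows "u = v"
  using assms
proof (induction u arbitrary: v x rule: list.induct)
  case Nil
  then show ?case by (cases v) (auto dest: E_D(1))
next
  case (Cons J u)
  then obtain K v' where v: "v = K # v'" using E_D(1)[of J] by (cases v) auto
  have "J = K" using Cons.prems v E_eq[of J K x] by auto
  then show ?case using Cons v by auto
qed

text \<open>An orbit up to time n consists of completed excursions followed by an unfinished climb
  of height \<open>k\<close>; arbitrary times are reduced to words in this way.\<close>

lemma parse:
  assumes "x \<in> space M"
  shows "\<exists>w k. w \<in> lists E \<and> len w + k = n \<and> x \<in> cyl w \<and> ret w x \<in> X k \<and> (T ^^ n) (x, 0) = (ret w x, k)"
proof (induction n)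
  case 0
  show ?case using assms by (intro exI[of _ "[]"] exI[of _ 0]) auto
next
  case (Suc n)
  then obtain w k where w: "w \<in> lists E" "len w + k = n" "x \<in> cyl w" "ret w x \<in> X k"
    "(T ^^ n) (x, 0) = (ret w x, k)" by blast
  have "(ret w x, k) \<in> Z" using w by (simp add: Z_iff)
  then show ?case
  proof (cases rule: T_cases)
    case 1
    then show ?thesis using w by (intro exI[of _ w] exI[of _ "Suc k"]) auto
  next
    case (2 J)
    then show ?thesis using w g_in[OF 2(1,2)]
      by (intro exI[of _ "w @ [J]"] exI[of _ 0]) (auto simp: cyl_append ret_append)
  qed
qed

subsection \<open>Coding of streams of exits\<close>

definition pt :: "'a set stream \<Rightarrow> 'a" where
  "pt s = (THE x. \<forall>n. x \<in> cyl (stake n s))"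

lemma stake_in_lists: "s \<in> streams E \<Longrightarrow> stake n s \<in> lists E"
  by (auto simp: in_set_conv_nth streams_iff_snth)

lemma len_stake: "len (stake n s) = (\<Sum>i<n. \<tau> (s !! i))"
  by (induction n) (simp_all add: stake_Suc del: stake.simps(2))

text \<open>Admissibility speaks of iterates at the return times. The auxiliary predicate
  \<open>Q\<close> is that condition verbatim, and it is equivalent to lying in all cylinders of
  finite prefixes of the stream.\<close>

lemma ex1_pt:
  assumes s: "s \<in> streams E"
  shows "\<exists>!x. \<forall>n. x \<in> cyl (stake n s)"
proof -
  have sE: "s !! n \<in> E" for n using s by (simp add: streams_iff_snth)
  define Q where "Q z \<longleftrightarrow> z \<in> s !! 0 \<times> {0} \<and> (\<forall>n\<ge>1. (T ^^ (\<Sum>i<n. \<tau> (s !! i))) z \<in> s !! n \<times> {0})" for z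
  have iff: "(\<forall>n. x \<in> cyl (stake n s)) \<longleftrightarrow> Q (x, 0)" (is "?L \<longleftrightarrow> _") for x
  proof
    assume L: ?L
    have r: "ret (stake n s) x \<in> s !! n" for n
    proof -
      have "x \<in> cyl (stake (Suc n) s)" using L by blast
      then show ?thesis using stake_in_lists[OF s, of n] sE[of n] by (simp add: stake_Suc cyl_append del: stake.simps(2))
    qed
    moreover have "(T ^^ (\<Sum>i<n. \<tau> (s !! i))) (x, 0) = (ret (stake n s) x, 0)" for n
      using funpow_T_cyl[OF stake_in_lists[OF s, of n]] L by (simp add: len_stake)
    ultimately show "Q (x, 0)" unfolding Q_def using r[of 0] by simp
  next
    assume "Q (x, 0)"
    note R = this[unfolded Q_def]
    show ?L
    proof
      fix n show "x \<in> cyl (stake n s)"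
      proof (induction n)
        case 0
        show ?case using R E_D(6)[OF sE[of 0]] by auto
      next
        case (Suc n)
        have "(T ^^ (\<Sum>i<n. \<tau> (s !! i))) (x, 0) = (ret (stake n s) x, 0)"
          using funpow_T_cyl[OF stake_in_lists[OF s, of n] Suc] by (simp add: len_stake)
        then have "ret (stake n s) x \<in> s !! n"
        proof (cases "n = 0")
          case False
          then have "n \<ge> 1" by simp
          then have "(T ^^ (\<Sum>i<n. \<tau> (s !! i))) (x, 0) \<in> s !! n \<times> {0}" using R by blast
          with \<open>(T ^^ (\<Sum>i<n. \<tau> (s !! i))) (x, 0) = (ret (stake n s) x, 0)\<close> show ?thesis by simp
        qed (use R in simp)
        then show ?case using stake_in_lists[OF s, of n] sE[of n] Suc g_in
          by (simp add: stake_Suc cyl_append del: stake.simps(2))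
      qed
    qed
  qed
  have "\<exists>!z. Q z"
    using admissible[unfolded admissible_def, rule_format, of "\<lambda>n. s !! n"] sE unfolding Q_def by blast
  then obtain z where z: "Q z" and zu: "\<And>z'. Q z' \<Longrightarrow> z' = z" by (auto elim: ex1E)
  have "snd z = 0" using z by (auto simp: Q_def)
  then obtain x where x: "z = (x, 0)" by (cases z) auto
  show ?thesis
  proof (rule ex1I[of _ x])
    show "\<forall>n. x \<in> cyl (stake n s)" using z unfolding x by (subst iff)
    show "y = x" if "\<forall>n. y \<in> cyl (stake n s)" for y
      using zu[of "(y, 0)"] that[unfolded iff] x by simp
  qed
qed

lemma pt_cyl: "s \<in> streams E \<Longrightarrow> pt s \<in> cyl (stake n s)"
  unfolding pt_def using theI'[OF ex1_pt] by blast

lemma pt_unique: "s \<in> streams E \<Longrightarrow> (\<And>n. x \<in> cyl (stake n s)) \<Longrightarrow> pt s = x"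
  using ex1_pt pt_cyl by blast

lemma pt_shift:
  assumes "w \<in> lists E" "s \<in> streams E"
  shows "pt (w @- s) \<in> cyl w" and "ret w (pt (w @- s)) = pt s"
proof -
  have ws: "w @- s \<in> streams E" using assms by (auto intro: shift_streams)
  have *: "stake (length w + n) (w @- s) = w @ stake n s" for n
    by (simp add: stake_shift)
  have "pt (w @- s) \<in> cyl (w @ stake n s)" for n
    using pt_cyl[OF ws, of "length w + n"] by (simp add: *)
  then have c: "pt (w @- s) \<in> cyl w \<and> ret w (pt (w @- s)) \<in> cyl (stake n s)" for n
    using cyl_append[OF assms(1) stake_in_lists[OF assms(2)]] by auto
  then show "pt (w @- s) \<in> cyl w" by blast
  show "ret w (pt (w @- s)) = pt s" by (rule pt_unique[OF assms(2), symmetric]) (use c in auto)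
qed

end

subsection \<open>The Jacobian along return words\<close>

locale tower_jac = tower_sys +
  fixes Jac :: "'a \<times> nat \<Rightarrow> real" and D :: real and eps :: "nat \<Rightarrow> real"
  assumes jacobian: "is_jacobian M X I g Jac"
    and D_ge: "D \<ge> 1" and eps_lim: "eps \<longlonglongrightarrow> 0"
    and distortion: "\<And>n A z w. n \<ge> 1 \<Longrightarrow> A \<in> tower_join X I g n \<Longrightarrow> z \<in> A \<Longrightarrow> w \<in> A \<Longrightarrow>
      Jac z / Jac w \<le> exp (eps (return_count X I g n A)) \<and>
      (\<Prod>i<n. Jac ((T ^^ i) z)) / (\<Prod>i<n. Jac ((T ^^ i) w)) \<le> D"
begin

lemma D_pos: "D > 0" using D_ge by simp

lemma Jac_pos: "z \<in> Z \<Longrightarrow> Jac z > 0" using jacobian by (simp add: is_jacobian_def)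
lemma Jac_meas [measurable]: "Jac \<in> borel_measurable mZ" using jacobian by (simp add: is_jacobian_def)

lemmas sets_mZ = sets_tower_measure[OF X_sets]

lemma slice_sets: "A \<in> sets mZ \<Longrightarrow> {x. (x, k) \<in> A} \<in> sets M"
  by (simp add: sets_mZ)

lemma level_sets:
  assumes "B \<in> sets M" "B \<subseteq> X k"
  shows "B \<times> {k} \<in> sets mZ" and "emeasure mZ (B \<times> {k}) = emeasure M B"
proof -
  have eq: "{x. (x, l) \<in> B \<times> {k}} = (if l = k then B else {})" for l by auto
  show B: "B \<times> {k} \<in> sets mZ" unfolding sets_mZ mem_Collect_eq eq using assms by (auto simp: tower_space_def)
  have "emeasure mZ (B \<times> {k}) = (\<Sum>l. if l = k then emeasure M B else 0)"
    unfolding emeasure_tower_measure[OF X_sets B] eq by (intro suminf_cong) auto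
  also have "\<dots> = emeasure M B" using sums_unique[OF sums_single[of k "\<lambda>l. emeasure M B"]] by simp
  finally show "emeasure mZ (B \<times> {k}) = emeasure M B" .
qed

lemma level_map_meas:
  assumes "B \<in> sets M" "B \<subseteq> X k"
  shows "(\<lambda>x. (x, k)) \<in> restrict_space M B \<rightarrow>\<^sub>M mZ"
proof (rule measurableI)
  have sp: "space (restrict_space M B) = B" using assms(1) sets.sets_into_space by (auto simp: space_restrict_space)
  show "(x, k) \<in> space mZ" if "x \<in> space (restrict_space M B)" for x
    using that assms sp by (auto simp: Z_iff)
  fix A assume "A \<in> sets mZ"
  then have "{x. (x, k) \<in> A} \<inter> B \<in> sets M" using slice_sets assms(1) by auto
  moreover have "(\<lambda>x. (x, k)) -` A \<inter> B = {x. (x, k) \<in> A} \<inter> B" by auto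
  ultimately show "(\<lambda>x. (x, k)) -` A \<inter> space (restrict_space M B) \<in> sets (restrict_space M B)"
    unfolding sp using assms(1) by (simp add: sets_restrict_space_iff)
qed

lemma slice_meas:
  fixes f :: "'a \<times> nat \<Rightarrow> ennreal"
  assumes "B \<in> sets M" "B \<subseteq> X k" "f \<in> borel_measurable mZ"
  shows "(\<lambda>x. f (x, k) * indicator B x) \<in> borel_measurable M"
    and "(\<lambda>x. f (x, k)) \<in> borel_measurable (restrict_space M B)"
proof -
  show *: "(\<lambda>x. f (x, k)) \<in> borel_measurable (restrict_space M B)"
    by (rule measurable_compose[OF level_map_meas[OF assms(1,2)] assms(3)])
  show "(\<lambda>x. f (x, k) * indicator B x) \<in> borel_measurable M"
    using * assms(1) by (subst (asm) borel_measurable_restrict_space_iff_ennreal) auto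
qed

text \<open>Restricted to \<open>B \<times> {k}\<close>, the tower measure is the image of
  \<open>M\<close> on \<open>B\<close>, so integrals over a piece of a level become integrals over
  the base.\<close>

lemma nn_integral_level:
  fixes f :: "'a \<times> nat \<Rightarrow> ennreal"
  assumes B: "B \<in> sets M" "B \<subseteq> X k" and f: "f \<in> borel_measurable mZ"
  shows "(\<integral>\<^sup>+z\<in>B \<times> {k}. f z \<partial>mZ) = (\<integral>\<^sup>+x. f (x, k) * indicator B x \<partial>M)"
proof -
  let ?N = "restrict_space M B"
  have sp: "space ?N = B" using B(1) sets.sets_into_space by (auto simp: space_restrict_space)
  have BM: "B \<inter> space M \<in> sets M" using B(1) by simp
  note [measurable] = level_sets(1)[OF B] f level_map_meas[OF B]
  have "distr ?N mZ (\<lambda>x. (x, k)) = density mZ (indicator (B \<times> {k}))"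
  proof (rule measure_eqI)
    fix A assume "A \<in> sets (distr ?N mZ (\<lambda>x. (x, k)))"
    then have A: "A \<in> sets mZ" by simp
    have AB: "{x. (x, k) \<in> A} \<inter> B \<in> sets M" using slice_sets[OF A] B(1) by auto
    have "emeasure (distr ?N mZ (\<lambda>x. (x, k))) A = emeasure ?N ({x. (x, k) \<in> A} \<inter> B)"
      using A by (subst emeasure_distr) (auto simp: sp intro!: arg_cong2[where f=emeasure])
    also have "\<dots> = emeasure M ({x. (x, k) \<in> A} \<inter> B)"
      using BM by (intro emeasure_restrict_space) auto
    also have "\<dots> = emeasure mZ (({x. (x, k) \<in> A} \<inter> B) \<times> {k})"
      using AB B(2) by (intro level_sets(2)[symmetric]) auto
    also have "({x. (x, k) \<in> A} \<inter> B) \<times> {k} = A \<inter> (B \<times> {k})" by auto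
    also have "emeasure mZ (A \<inter> (B \<times> {k})) = emeasure (density mZ (indicator (B \<times> {k}))) A"
      using A level_sets(1)[OF B]
      by (subst emeasure_density) (auto simp: indicator_inter_arith[symmetric] Int_commute)
    finally show "emeasure (distr ?N mZ (\<lambda>x. (x, k))) A = emeasure (density mZ (indicator (B \<times> {k}))) A" .
  qed simp
  then have "(\<integral>\<^sup>+z. f z \<partial>distr ?N mZ (\<lambda>x. (x, k))) = (\<integral>\<^sup>+z. f z \<partial>density mZ (indicator (B \<times> {k})))"
    by simp
  also have "\<dots> = (\<integral>\<^sup>+z\<in>B \<times> {k}. f z \<partial>mZ)" by (subst nn_integral_density) (auto simp: mult.commute)
  finally show ?thesis
    by (simp add: nn_integral_distr nn_integral_restrict_space[OF BM])
qed

text \<open>Among the partition elements in the definition of the Jacobian only the one containing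
  \<open>B \<times> {k}\<close> contributes, which turns the sum into an ordinary change of
  variables.\<close>

lemma Jac_level:
  assumes J: "J \<in> I k" and B: "B \<in> sets M" "B \<subseteq> J"
  shows "(\<integral>\<^sup>+x. ennreal (Jac (x, k)) * indicator B x \<partial>M) = emeasure mZ (T ` (B \<times> {k}))"
proof -
  have BX: "B \<subseteq> X k" using I_sub[OF J] B by auto
  have JA: "J \<times> {k} \<in> \<A>" using J by (auto simp: tower_partition_def)
  have "(\<integral>\<^sup>+x. ennreal (Jac (x, k)) * indicator B x \<partial>M) = (\<integral>\<^sup>+z\<in>B \<times> {k}. ennreal (Jac z) \<partial>mZ)"
    by (rule nn_integral_level[symmetric, OF B(1) BX]) simp
  also have "\<dots> = (\<integral>\<^sup>+A. emeasure mZ (T ` (B \<times> {k} \<inter> A)) \<partial>count_space \<A>)"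
    using jacobian level_sets(1)[OF B(1) BX] unfolding is_jacobian_def by blast
  also have "\<dots> = (\<Sum>A\<in>{J \<times> {k}}. emeasure mZ (T ` (B \<times> {k} \<inter> A)))"
  proof (rule nn_integral_count_space')
    fix A assume A: "A \<in> \<A>" "A \<notin> {J \<times> {k}}"
    have "A \<inter> (J \<times> {k}) = {}"
      using disjointD[OF partition_onD2[OF \<A>_part] A(1) JA] A(2) by auto
    then have "B \<times> {k} \<inter> A = {}" using B(2) by auto
    then show "emeasure mZ (T ` (B \<times> {k} \<inter> A)) = 0" by simp
  qed (use JA in auto)
  also have "\<dots> = emeasure mZ (T ` (B \<times> {k}))"
  proof -
    have "B \<times> {k} \<inter> J \<times> {k} = B \<times> {k}" using B(2) by auto
    then show ?thesis by simp
  qed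
  finally show ?thesis .
qed

lemma Jac_exit:
  assumes J: "J \<in> E" "\<tau> J = Suc k" and A: "A \<in> sets M"
  shows "(\<integral>\<^sup>+x. ennreal (Jac (x, k)) * indicator {x\<in>J. g J x \<in> A} x \<partial>M) = emeasure M A"
proof -
  have JI: "J \<in> I k" using E_D(2)[OF J(1)] J(2) by simp
  have A': "A \<subseteq> space M" using sets.sets_into_space[OF A] .
  have "T ` ({x\<in>J. g J x \<in> A} \<times> {k}) = (\<lambda>x. (g J x, 0)) ` {x\<in>J. g J x \<in> A}"
    using T_exit[OF J(1) _ J(2)] by force
  also have "\<dots> = A \<times> {0}"
    using g_bij[OF J(1)] A' unfolding bij_betw_def by (auto simp: image_iff)
  finally show ?thesis
    using Jac_level[OF JI g_vimage_sets[OF J(1) A]] level_sets(2)[of A 0] A A' by auto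
qed

text \<open>On blocks that continue upwards \<open>T\<close> merely relabels the level and preserves
  mass, so the density is 1 by uniqueness. This holds only almost everywhere, the Jacobian being one
  version of a density.\<close>

lemma Jac_up_AE: "AE x in M. x \<in> X (Suc k) \<longrightarrow> Jac (x, k) = 1"
proof -
  have "AE x in M. x \<in> J \<longrightarrow> Jac (x, k) = 1" if J: "J \<in> I k" "J \<subseteq> X (Suc k)" for J
  proof -
    have [measurable]: "J \<in> sets M" by (rule I_sets[OF J(1)])
    have [measurable]: "(\<lambda>x. ennreal (Jac (x, k)) * indicator J x) \<in> borel_measurable M"
      by (rule slice_meas(1)[OF I_sets[OF J(1)] I_sub[OF J(1)]]) simp
    have "density M (\<lambda>x. ennreal (Jac (x, k)) * indicator J x) = density M (indicator J)"
    proof (rule measure_eqI)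
      fix B assume "B \<in> sets (density M (\<lambda>x. ennreal (Jac (x, k)) * indicator J x))"
      then have B [measurable]: "B \<in> sets M" by simp
      have "emeasure (density M (\<lambda>x. ennreal (Jac (x, k)) * indicator J x)) B
          = (\<integral>\<^sup>+x. ennreal (Jac (x, k)) * indicator (J \<inter> B) x \<partial>M)"
        by (subst emeasure_density) (auto simp: indicator_inter_arith mult.assoc)
      also have "\<dots> = emeasure mZ (T ` ((J \<inter> B) \<times> {k}))"
        by (rule Jac_level[OF J(1)]) auto
      also have "T ` ((J \<inter> B) \<times> {k}) = (J \<inter> B) \<times> {Suc k}"
      proof -
        have "T (x, k) = (x, Suc k)" if "x \<in> J" for x using that J(2) by (intro T_up) auto
        then show ?thesis by (force simp: image_iff)
      qed
      also have "emeasure mZ ((J \<inter> B) \<times> {Suc k}) = emeasure M (J \<inter> B)"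
        by (rule level_sets(2)) (use J(2) in auto)
      also have "\<dots> = emeasure (density M (indicator J)) B"
        by (subst emeasure_density) (auto simp: indicator_inter_arith[symmetric])
      finally show "emeasure (density M (\<lambda>x. ennreal (Jac (x, k)) * indicator J x)) B
          = emeasure (density M (indicator J)) B" .
    qed simp
    then have "AE x in M. ennreal (Jac (x, k)) * indicator J x = indicator J x"
      by (subst (asm) density_unique_iff) auto
    then show ?thesis
    proof eventually_elim
      case (elim x)
      show ?case
      proof
        assume x: "x \<in> J"
        then have "(x, k) \<in> Z" using I_sub[OF J(1)] by (auto simp: Z_iff)
        then show "Jac (x, k) = 1" using elim x Jac_pos[of "(x, k)"] by (simp add: ennreal_eq_1)
      qed
    qed
  qed
  then have "AE x in M. \<forall>J\<in>{J\<in>I k. J \<subseteq> X (Suc k)}. x \<in> J \<longrightarrow> Jac (x, k) = 1"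
    by (subst AE_ball_countable) (auto intro!: countable_finite I_finite)
  then show ?thesis
  proof eventually_elim
    case (elim x)
    show ?case
    proof
      assume x: "x \<in> X (Suc k)"
      then obtain J where "J \<in> I k" "x \<in> J" using I_ex[of x k] X_Suc by blast
      then show "Jac (x, k) = 1" using elim I_up[of J k] x by blast
    qed
  qed
qed

section \<open>Products of the Jacobian along orbits\<close>

definition jprod :: "nat \<Rightarrow> 'a \<times> nat \<Rightarrow> real" where
  "jprod n z = (\<Prod>i<n. Jac ((T ^^ i) z))"

lemma jprod_add: "jprod (m + n) z = jprod m z * jprod n ((T ^^ m) z)"
proof -
  have "jprod (m + n) z = jprod m z * (\<Prod>i\<in>{m..<m + n}. Jac ((T ^^ i) z))"
    unfolding jprod_def lessThan_atLeast0
    by (rule prod.atLeastLessThan_concat[symmetric]) auto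
  also have "(\<Prod>i\<in>{m..<m + n}. Jac ((T ^^ i) z)) = (\<Prod>i\<in>{0..<n}. Jac ((T ^^ (i + m)) z))"
    using prod.shift_bounds_nat_ivl[of "\<lambda>i. Jac ((T ^^ i) z)" 0 m n] by (simp add: add.commute)
  finally show ?thesis by (simp add: jprod_def lessThan_atLeast0 funpow_add)
qed

lemma jprod_pos: "z \<in> Z \<Longrightarrow> jprod n z > 0"
  unfolding jprod_def by (intro prod_pos) (auto intro: Jac_pos funpow_T_Z)

lemma T_meas [measurable]: "T \<in> mZ \<rightarrow>\<^sub>M mZ"
proof (rule measurableI)
  show "T z \<in> space mZ" if "z \<in> space mZ" for z using that T_Z by auto
  fix A assume A: "A \<in> sets mZ"
  have "{x. (x, k) \<in> T -` A \<inter> Z} = (X (Suc k) \<inter> {x. (x, Suc k) \<in> A}) \<union>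
      (\<Union>J\<in>{J\<in>E. \<tau> J = Suc k}. {x\<in>J. g J x \<in> {x. (x, 0) \<in> A}})" for k
  proof (intro set_eqI iffI)
    fix x assume "x \<in> {x. (x, k) \<in> T -` A \<inter> Z}"
    then have x: "(x, k) \<in> Z" "T (x, k) \<in> A" by auto
    from x(1) show "x \<in> (X (Suc k) \<inter> {x. (x, Suc k) \<in> A}) \<union>
      (\<Union>J\<in>{J\<in>E. \<tau> J = Suc k}. {x\<in>J. g J x \<in> {x. (x, 0) \<in> A}})"
      by (cases rule: T_cases) (use x(2) in auto)
  next
    fix x assume "x \<in> (X (Suc k) \<inter> {x. (x, Suc k) \<in> A}) \<union>
      (\<Union>J\<in>{J\<in>E. \<tau> J = Suc k}. {x\<in>J. g J x \<in> {x. (x, 0) \<in> A}})"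
    then show "x \<in> {x. (x, k) \<in> T -` A \<inter> Z}"
    proof (elim UnE UN_E)
      assume "x \<in> X (Suc k) \<inter> {x. (x, Suc k) \<in> A}"
      then show ?thesis using X_Suc[of k] by (auto simp: Z_iff T_up)
    next
      fix J assume J: "J \<in> {J\<in>E. \<tau> J = Suc k}" "x \<in> {x\<in>J. g J x \<in> {x. (x, 0) \<in> A}}"
      then show ?thesis using T_exit[of J x k] E_D(4)[of J] by (auto simp: Z_iff)
    qed
  qed
  moreover have "finite {J\<in>E. \<tau> J = Suc k}" for k
    by (rule finite_subset[OF _ finite_E_le[of "Suc k"]]) auto
  ultimately have "{x. (x, k) \<in> T -` A \<inter> Z} \<in> sets M" for k
    using slice_sets[OF A] by (auto intro!: sets.Un sets.finite_UN g_vimage_sets[OF _ slice_sets[OF A], simplified])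
  then show "T -` A \<inter> space mZ \<in> sets mZ" by (auto simp: sets_mZ)
qed

lemma funpow_T_meas [measurable]: "(T ^^ i) \<in> mZ \<rightarrow>\<^sub>M mZ"
  by (induction i) (use T_meas in \<open>auto intro: measurable_compose simp: comp_def\<close>)

lemma jprod_meas [measurable]: "jprod n \<in> borel_measurable mZ"
  unfolding jprod_def by measurable

lemma jprod_base_meas:
  "A \<in> sets M \<Longrightarrow> (\<lambda>x. ennreal (jprod n (x, 0)) * indicator A x) \<in> borel_measurable M"
  by (rule slice_meas(1)) (auto dest: sets.sets_into_space)

text \<open>Almost everywhere all factors of \<open>jprod (\<tau> J)\<close> but the last are 1, and
  the last one is the density that transports \<open>M\<close> on \<open>J\<close> to
  \<open>M\<close> under \<open>g J\<close>.\<close>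

lemma nn_integral_exit:
  fixes f :: "'a \<Rightarrow> ennreal"
  assumes J: "J \<in> E" and f [measurable]: "f \<in> borel_measurable M"
  shows "(\<integral>\<^sup>+x. ennreal (jprod (\<tau> J) (x, 0)) * f (g J x) * indicator J x \<partial>M) = (\<integral>\<^sup>+x. f x \<partial>M)"
proof -
  define k where "k = \<tau> J - 1"
  have k: "\<tau> J = Suc k" using E_D(1)[OF J] by (simp add: k_def)
  have JX: "J \<subseteq> X k" using E_D(4)[OF J] k by simp
  have JM: "J \<in> sets M" "J \<inter> space M \<in> sets M" using E_D(5)[OF J] by auto
  let ?N = "restrict_space M J"
  have sp: "space ?N = J" using E_D(6)[OF J] by (auto simp: space_restrict_space)
  have gm [measurable]: "g J \<in> ?N \<rightarrow>\<^sub>M M" using nonsingular[OF J] by (simp add: bi_nonsingular_def)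
  have jm [measurable]: "(\<lambda>x. ennreal (Jac (x, k))) \<in> borel_measurable ?N"
    by (rule slice_meas(2)[OF JM(1) JX]) simp
  have "distr (density ?N (\<lambda>x. ennreal (Jac (x, k)))) M (g J) = M"
  proof (rule measure_eqI)
    fix A assume "A \<in> sets (distr (density ?N (\<lambda>x. ennreal (Jac (x, k)))) M (g J))"
    then have A: "A \<in> sets M" by simp
    have m: "{x\<in>J. g J x \<in> A} \<in> sets ?N"
      using g_vimage_sets[OF J A] JM by (auto simp: sets_restrict_space_iff)
    have "emeasure (distr (density ?N (\<lambda>x. ennreal (Jac (x, k)))) M (g J)) A
        = emeasure (density ?N (\<lambda>x. ennreal (Jac (x, k)))) {x\<in>J. g J x \<in> A}"
      using A by (subst emeasure_distr) (auto simp: sp vimage_def Int_def conj_commute)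
    also have "\<dots> = (\<integral>\<^sup>+x. ennreal (Jac (x, k)) * indicator {x\<in>J. g J x \<in> A} x \<partial>?N)"
      by (rule emeasure_density[OF jm m])
    also have "\<dots> = (\<integral>\<^sup>+x. ennreal (Jac (x, k)) * indicator {x\<in>J. g J x \<in> A} x * indicator J x \<partial>M)"
      by (rule nn_integral_restrict_space[OF JM(2)])
    also have "\<dots> = (\<integral>\<^sup>+x. ennreal (Jac (x, k)) * indicator {x\<in>J. g J x \<in> A} x \<partial>M)"
      by (intro nn_integral_cong) (auto simp: indicator_def)
    also have "\<dots> = emeasure M A" by (rule Jac_exit[OF J k A])
    finally show "emeasure (distr (density ?N (\<lambda>x. ennreal (Jac (x, k)))) M (g J)) A = emeasure M A" .
  qed simp
  then have "(\<integral>\<^sup>+x. f x \<partial>M) = (\<integral>\<^sup>+x. f x \<partial>distr (density ?N (\<lambda>x. ennreal (Jac (x, k)))) M (g J))"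
    by simp
  also have "\<dots> = (\<integral>\<^sup>+x. f (g J x) \<partial>density ?N (\<lambda>x. ennreal (Jac (x, k))))"
    by (rule nn_integral_distr) auto
  also have "\<dots> = (\<integral>\<^sup>+x. ennreal (Jac (x, k)) * f (g J x) \<partial>?N)"
    by (rule nn_integral_density) (auto intro: measurable_compose[OF gm])
  also have "\<dots> = (\<integral>\<^sup>+x. ennreal (Jac (x, k)) * f (g J x) * indicator J x \<partial>M)"
    by (rule nn_integral_restrict_space[OF JM(2)])
  also have "\<dots> = (\<integral>\<^sup>+x. ennreal (jprod (\<tau> J) (x, 0)) * f (g J x) * indicator J x \<partial>M)"
  proof (rule nn_integral_cong_AE)
    have "AE x in M. \<forall>i. x \<in> X (Suc i) \<longrightarrow> Jac (x, i) = 1"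
      using Jac_up_AE by (simp add: AE_all_countable)
    then show "AE x in M. ennreal (Jac (x, k)) * f (g J x) * indicator J x
        = ennreal (jprod (\<tau> J) (x, 0)) * f (g J x) * indicator J x"
    proof eventually_elim
      case (elim x)
      have "jprod (\<tau> J) (x, 0) = Jac (x, k)" if x: "x \<in> J"
      proof -
        have "Jac ((T ^^ i) (x, 0)) = 1" if "i < k" for i
        proof -
          have "x \<in> X (Suc i)" using x JX X_antimono[of "Suc i" k] that by auto
          then show ?thesis using elim funpow_T_exit(1)[OF J x, of i] that k by simp
        qed
        then show ?thesis using funpow_T_exit(1)[OF J x, of k] k by (simp add: jprod_def)
      qed
      then show ?case by (simp split: split_indicator)
    qed
  qed
  finally show ?thesis by simp
qed

lemma nn_integral_pre:
  assumes "w \<in> lists E" "A \<in> sets M"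
  shows "(\<integral>\<^sup>+x. ennreal (jprod (len w) (x, 0)) * indicator (pre w A) x \<partial>M) = emeasure M A"
  using assms(1)
proof (induction w rule: list.induct)
  case Nil
  have "pre [] A = A" using sets.sets_into_space[OF assms(2)] by (auto simp: pre_def)
  then show ?case using assms(2) by (simp add: jprod_def)
next
  case (Cons J w)
  then have J: "J \<in> E" and w: "w \<in> lists E" by auto
  let ?f = "\<lambda>y. ennreal (jprod (len w) (y, 0)) * indicator (pre w A) y"
  have "(\<integral>\<^sup>+x. ennreal (jprod (len (J # w)) (x, 0)) * indicator (pre (J # w) A) x \<partial>M)
      = (\<integral>\<^sup>+x. ennreal (jprod (\<tau> J) (x, 0)) * ?f (g J x) * indicator J x \<partial>M)"
  proof (intro nn_integral_cong)
    fix x assume x: "x \<in> space M"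
    show "ennreal (jprod (len (J # w)) (x, 0)) * indicator (pre (J # w) A) x
        = ennreal (jprod (\<tau> J) (x, 0)) * ?f (g J x) * indicator J x"
    proof (cases "x \<in> J")
      case True
      have "jprod (\<tau> J) (x, 0) \<ge> 0" "jprod (len w) (g J x, 0) \<ge> 0"
        using x g_in[OF J True] by (auto intro!: less_imp_le jprod_pos simp: Z_iff)
      moreover have "indicator (pre (J # w) A) x = (indicator (pre w A) (g J x) :: ennreal)"
        using True by (auto simp: pre_Cons indicator_def)
      ultimately show ?thesis
        using True funpow_T_exit(2)[OF J True] by (simp add: jprod_add ennreal_mult mult.assoc)
    qed (simp add: pre_Cons)
  qed
  also have "\<dots> = (\<integral>\<^sup>+x. ?f x \<partial>M)"
    by (rule nn_integral_exit[OF J jprod_base_meas[OF pre_sets[OF w assms(2)]]])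
  finally show ?case using Cons by simp
qed

lemma distortion_code:
  assumes "z \<in> Z" "w \<in> Z" "code n z = code n w"
  shows "jprod n z \<le> D * jprod n w"
proof (cases "n = 0")
  case False
  have "{v\<in>Z. code n v = code n z} \<in> tower_join X I g n"
    unfolding tower_join_eq using assms(1) by blast
  then have "jprod n z / jprod n w \<le> D"
    unfolding jprod_def using distortion[of n _ z w] False assms by auto
  then show ?thesis using jprod_pos[OF assms(2), of n] by (simp add: divide_le_eq)
qed (use D_ge in \<open>simp add: jprod_def\<close>)

text \<open>By distortion the density in \<open>nn_integral_pre\<close> is constant on the cylinder
  up to the factor \<open>D\<close>, so its value at any chosen point \<open>y\<close> may replace
  it.\<close>

lemma measure_pre_bounds:
  assumes w: "w \<in> lists E" and y: "y \<in> cyl w" and A: "A \<in> sets M"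
  shows "measure M A \<le> D * jprod (len w) (y, 0) * measure M (pre w A)"
    and "jprod (len w) (y, 0) * measure M (pre w A) \<le> D * measure M A"
proof -
  let ?P = "\<lambda>x. jprod (len w) (x, 0)"
  have ZZ: "(x, 0) \<in> Z" if "x \<in> cyl w" for x using that cyl_sub[OF w] by (auto simp: Z_iff)
  have cmp: "?P x \<le> D * ?P y" "?P y \<le> D * ?P x" if "x \<in> cyl w" for x
    using that y by (auto intro!: distortion_code ZZ code_cyl[OF w])
  have Py: "?P y > 0" using y by (intro jprod_pos ZZ)
  have pm: "pre w A \<in> sets M" by (rule pre_sets[OF w A])
  have "emeasure M A = (\<integral>\<^sup>+x. ennreal (?P x) * indicator (pre w A) x \<partial>M)"
    by (rule nn_integral_pre[symmetric, OF w A])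
  also have "\<dots> \<le> (\<integral>\<^sup>+x. ennreal (D * ?P y) * indicator (pre w A) x \<partial>M)"
    by (intro nn_integral_mono) (auto simp: pre_def cmp intro!: ennreal_leI split: split_indicator)
  also have "\<dots> = ennreal (D * ?P y * measure M (pre w A))"
    using pm D_pos Py by (simp add: nn_integral_cmult_indicator emeasure_eq_measure ennreal_mult)
  finally show "measure M A \<le> D * ?P y * measure M (pre w A)"
    using D_pos Py by (simp add: emeasure_eq_measure ennreal_le_iff)
  have "ennreal (?P y / D * measure M (pre w A)) = (\<integral>\<^sup>+x. ennreal (?P y / D) * indicator (pre w A) x \<partial>M)"
    using pm D_pos Py by (simp add: nn_integral_cmult_indicator emeasure_eq_measure ennreal_mult[symmetric])
  also have "\<dots> \<le> (\<integral>\<^sup>+x. ennreal (?P x) * indicator (pre w A) x \<partial>M)"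
    using D_pos by (intro nn_integral_mono)
      (auto simp: pre_def divide_le_eq mult.commute[of _ D] cmp intro!: ennreal_leI split: split_indicator)
  also have "\<dots> = emeasure M A" by (rule nn_integral_pre[OF w A])
  finally have "?P y / D * measure M (pre w A) \<le> measure M A"
    by (simp add: emeasure_eq_measure ennreal_le_iff)
  then show "?P y * measure M (pre w A) \<le> D * measure M A"
    using D_pos by (simp add: field_simps)
qed

lemma measure_cyl_pos: "w \<in> lists E \<Longrightarrow> measure M (cyl w) > 0"
proof -
  assume w: "w \<in> lists E"
  obtain y where y: "y \<in> cyl w" using cyl_ne[OF w] by blast
  have "0 < D * jprod (len w) (y, 0) * measure M (cyl w)"
    using measure_pre_bounds(1)[OF w y sets.top] space_M_pos by (simp add: pre_space[OF w])
  then show ?thesis using zero_less_measure_iff by force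
qed

text \<open>The value of \<open>jprod\<close> at a common point cancels between the cylinder of
  \<open>u\<close> and the cylinder of the concatenation; each of the two comparisons costs one
  factor \<open>D\<close>.\<close>

lemma measure_cyl_append:
  assumes u: "u \<in> lists E" and v: "v \<in> lists E"
  shows "measure M (cyl u) * measure M (cyl v) \<le> D\<^sup>2 * measure M (space M) * measure M (cyl (u @ v))"
proof -
  obtain y where y: "y \<in> cyl u" using cyl_ne[OF u] by blast
  let ?P = "jprod (len u) (y, 0)"
  have 1: "measure M (cyl v) \<le> D * ?P * measure M (cyl (u @ v))"
    using measure_pre_bounds(1)[OF u y cyl_sets[OF v]] by (simp add: cyl_append_pre[OF u v])
  have 2: "?P * measure M (cyl u) \<le> D * measure M (space M)"
    using measure_pre_bounds(2)[OF u y sets.top] by (simp add: pre_space[OF u])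
  have "measure M (cyl u) * measure M (cyl v) \<le> measure M (cyl u) * (D * ?P * measure M (cyl (u @ v)))"
    by (intro mult_left_mono 1) auto
  also have "\<dots> = (?P * measure M (cyl u)) * (D * measure M (cyl (u @ v)))" by (simp add: algebra_simps)
  also have "\<dots> \<le> (D * measure M (space M)) * (D * measure M (cyl (u @ v)))"
    using D_pos by (intro mult_right_mono 2) auto
  finally show ?thesis by (simp add: power2_eq_square algebra_simps)
qed

end

subsection \<open>The coding algebra\<close>

context tower_jac
begin

abbreviation N where "N \<equiv> coding_algebra X I g"

lemma tower_join_sub: "(\<Union>n. tower_join X I g n) \<subseteq> Pow Z"
  unfolding tower_join_eq by auto

lemma space_N [simp]: "space N = Z"
  unfolding coding_algebra_def by (rule space_measure_of[OF tower_join_sub])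

lemma sets_N: "sets N = sigma_sets Z (\<Union>n. tower_join X I g n)"
  unfolding coding_algebra_def by (rule sets_measure_of[OF tower_join_sub])

lemma countable_\<A>: "countable \<A>"
proof -
  have "\<A> = (\<Union>k. (\<lambda>J. J \<times> {k}) ` I k)" by (auto simp: tower_partition_def)
  then show ?thesis by (simp add: countable_finite I_finite)
qed

lemma code_in_lists: "z \<in> Z \<Longrightarrow> code n z \<in> lists \<A>"
  by (auto simp: itin_def intro!: sym_in(2) funpow_in[OF T_Z])

lemma countable_codes: "countable (code n ` Z)"
  by (rule countable_subset[OF _ countable_lists[OF countable_\<A>]]) (use code_in_lists in blast)

lemma code_fiber_sets: "z \<in> Z \<Longrightarrow> {w\<in>Z. code n w = code n z} \<in> sets N"
  unfolding sets_N by (rule sigma_sets.Basic) (auto simp: tower_join_eq)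

lemma code_sets: "{w\<in>Z. P (code n w)} \<in> sets N"
proof -
  have "{w\<in>Z. P (code n w)} = (\<Union>l\<in>{l\<in>code n ` Z. P l}. {w\<in>Z. code n w = l})" by auto
  also have "\<dots> \<in> sets N"
  proof (rule sets.countable_UN')
    show "countable {l\<in>code n ` Z. P l}" by (rule countable_subset[OF _ countable_codes]) auto
    show "(\<lambda>l. {w\<in>Z. code n w = l}) ` {l\<in>code n ` Z. P l} \<subseteq> sets N" using code_fiber_sets by auto
  qed
  finally show ?thesis .
qed

lemma code_meas: "code n \<in> N \<rightarrow>\<^sub>M count_space UNIV"
proof (rule measurableI)
  fix A
  have "code n -` A \<inter> space N = {w\<in>Z. code n w \<in> A}" by auto
  then show "code n -` A \<inter> space N \<in> sets N" using code_sets by simp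
qed simp

lemma measurable_into_N:
  assumes "f \<in> space L \<rightarrow> Z" "\<And>n l. {x\<in>space L. code n (f x) = l} \<in> sets L"
  shows "f \<in> L \<rightarrow>\<^sub>M N"
  unfolding coding_algebra_def
proof (rule measurable_measure_of[OF tower_join_sub assms(1)])
  fix A assume "A \<in> (\<Union>n. tower_join X I g n)"
  then obtain n z where A: "A = {w\<in>Z. code n w = code n z}" by (auto simp: tower_join_eq)
  have "f -` A \<inter> space L = {x\<in>space L. code n (f x) = code n z}" using A assms(1) by auto
  then show "f -` A \<inter> space L \<in> sets L" using assms(2) by simp
qed

lemma code_Suc: "code (Suc n) z = sym z # code n (T z)"
  using itin_add[of T sym 1 n z] by (simp add: itin_def)

lemma T_N: "T \<in> N \<rightarrow>\<^sub>M N"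
proof (rule measurable_into_N)
  show "T \<in> space N \<rightarrow> Z" using T_Z by simp
  fix n l
  have "{x\<in>space N. code n (T x) = l} = {w\<in>Z. tl (code (Suc n) w) = l}" by (simp add: code_Suc)
  then show "{x\<in>space N. code n (T x) = l} \<in> sets N" using code_sets by simp
qed

lemma funpow_T_N [measurable]: "(T ^^ i) \<in> N \<rightarrow>\<^sub>M N"
  by (induction i) (use T_N in \<open>auto intro: measurable_compose simp: comp_def\<close>)

text \<open>Observables are measurable for the coding algebra; this inclusion gives their deviation
  events a mass under \<open>M\<close>.\<close>

lemma N_sub_mZ: "A \<in> sets N \<Longrightarrow> A \<in> sets mZ"
proof -
  have fib: "{w\<in>Z. code n w = code n z} \<in> sets mZ" if z: "z \<in> Z" for n z
  proof -
    have "sym ((T ^^ i) z) \<in> sets mZ" for i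
    proof -
      have "sym ((T ^^ i) z) \<in> \<A>" by (rule sym_in(2)[OF funpow_T_Z[OF z]])
      then obtain J k where "sym ((T ^^ i) z) = J \<times> {k}" "J \<in> I k" by (auto simp: tower_partition_def)
      then show ?thesis using level_sets(1)[OF I_sets I_sub] by simp
    qed
    then have "(T ^^ i) -` sym ((T ^^ i) z) \<inter> Z \<in> sets mZ" for i
      using measurable_sets[OF funpow_T_meas] by simp
    then have "Z \<inter> (\<Inter>i\<in>{..<n}. (T ^^ i) -` sym ((T ^^ i) z) \<inter> Z) \<in> sets mZ" if "n \<noteq> 0"
      using that by (intro sets.Int[OF sets.top[of mZ, simplified]] sets.finite_INT) auto
    then have "{w\<in>Z. \<forall>i<n. (T ^^ i) w \<in> sym ((T ^^ i) z)} \<in> sets mZ"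
    proof (cases "n = 0")
      case False
      have "{w\<in>Z. \<forall>i<n. (T ^^ i) w \<in> sym ((T ^^ i) z)} = Z \<inter> (\<Inter>i\<in>{..<n}. (T ^^ i) -` sym ((T ^^ i) z) \<inter> Z)"
        by auto
      then show ?thesis using \<open>n \<noteq> 0 \<Longrightarrow> _\<close>[OF False] by simp
    qed (use sets.top[of mZ] in simp)
    also have "{w\<in>Z. \<forall>i<n. (T ^^ i) w \<in> sym ((T ^^ i) z)} = {w\<in>Z. code n w = code n z}"
    proof -
      have "(T ^^ i) w \<in> sym ((T ^^ i) z) \<longleftrightarrow> sym ((T ^^ i) w) = sym ((T ^^ i) z)" if "w \<in> Z" for w i
        using block_of_eq[OF \<A>_part sym_in(2)[OF funpow_T_Z[OF z]]] sym_in(1)[OF funpow_T_Z[OF that]] by metis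
      then show ?thesis by (auto simp: itin_eq_iff)
    qed
    finally show ?thesis .
  qed
  assume "A \<in> sets N"
  then show ?thesis
  proof -
    have "(\<Union>n. tower_join X I g n) \<subseteq> sets mZ" using fib unfolding tower_join_eq by blast
    from sets.sigma_sets_subset[OF this] show ?thesis
      using \<open>A \<in> sets N\<close> unfolding sets_N by auto
  qed
qed

text \<open>One point for each code of length n. Any function evaluated at it depends on the code
  alone and is therefore measurable; \<open>limit_meas\<close> obtains measurability from limits of
  such functions.\<close>

definition rep :: "nat \<Rightarrow> 'a \<times> nat \<Rightarrow> 'a \<times> nat" where
  "rep n z = (SOME w. w \<in> Z \<and> code n w = code n z)"

lemma rep: "z \<in> Z \<Longrightarrow> rep n z \<in> Z \<and> code n (rep n z) = code n z"
  unfolding rep_def by (rule someI[of _ z]) simp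

lemma rep_meas: "(\<lambda>z. h (rep n z) :: real) \<in> borel_measurable N"
proof -
  have "(\<lambda>z. (\<lambda>l. h (SOME w. w \<in> Z \<and> code n w = l)) (code n z)) \<in> borel_measurable N"
    by (rule measurable_compose[OF code_meas]) simp
  then show ?thesis by (simp add: rep_def)
qed

lemma limit_meas:
  assumes R: "R \<in> sets N" and lim: "\<And>z. z \<in> R \<Longrightarrow> (\<lambda>n. h (rep n z)) \<longlonglongrightarrow> (h z :: real)"
  shows "(\<lambda>z. if z \<in> R then h z else 0) \<in> borel_measurable N"
proof (rule borel_measurable_LIMSEQ_real)
  show "(\<lambda>n. if z \<in> R then h (rep n z) else 0) \<longlonglongrightarrow> (if z \<in> R then h z else 0)" for z
    using lim by auto
  show "(\<lambda>z. if z \<in> R then h (rep n z) else 0) \<in> borel_measurable N" for n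
    using rep_meas R sets.sets_into_space[OF R] by (intro measurable_If_set) (auto simp: Int_absorb2)
qed

lemma level_of_sym: "z \<in> Z \<Longrightarrow> w \<in> Z \<Longrightarrow> sym z = sym w \<Longrightarrow> snd z = snd w"
  using sym_in[of z] sym_in[of w] by (fastforce simp: tower_partition_def)

lemma level_sets_N: "{z\<in>Z. P (snd ((T ^^ i) z))} \<in> sets N"
proof -
  have "{z\<in>Z. P (snd ((T ^^ i) z))} = {z\<in>Z. \<exists>w\<in>Z. code (Suc i) w = code (Suc i) z \<and> P (snd ((T ^^ i) w))}"
  proof -
    have *: "snd ((T ^^ i) w) = snd ((T ^^ i) z)" if "z \<in> Z" "w \<in> Z" "code (Suc i) w = code (Suc i) z" for z w
      using that(3) by (intro level_of_sym funpow_T_Z that) (simp add: itin_eq_iff)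
    show ?thesis
    proof (intro Collect_cong iffI; elim conjE)
      fix z assume "z \<in> Z" "P (snd ((T ^^ i) z))"
      then show "z \<in> Z \<and> (\<exists>w\<in>Z. code (Suc i) w = code (Suc i) z \<and> P (snd ((T ^^ i) w)))" by blast
    next
      fix z assume z: "z \<in> Z" "\<exists>w\<in>Z. code (Suc i) w = code (Suc i) z \<and> P (snd ((T ^^ i) w))"
      then obtain w where "w \<in> Z" "code (Suc i) w = code (Suc i) z" "P (snd ((T ^^ i) w))" by blast
      then show "z \<in> Z \<and> P (snd ((T ^^ i) z))" using *[OF z(1), of w] z(1) by metis
    qed
  qed
  then show ?thesis using code_sets[of "\<lambda>l. \<exists>w\<in>Z. code (Suc i) w = l \<and> P (snd ((T ^^ i) w))" "Suc i"] by simp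
qed

definition Rec :: "('a \<times> nat) set" where
  "Rec = {z\<in>Z. \<forall>j. \<exists>i\<ge>j. snd ((T ^^ i) z) = 0}"

lemma Rec_sets: "Rec \<in> sets N"
proof -
  have "Rec = (\<Inter>j. \<Union>i\<in>{j..}. {z\<in>Z. snd ((T ^^ i) z) = 0})" by (auto simp: Rec_def)
  also have "\<dots> \<in> sets N" using level_sets_N[of "\<lambda>k. k = 0"]
    by (intro sets.countable_INT sets.countable_UN') auto
  finally show ?thesis .
qed

text \<open>A return to the base before time n is visible in the code, hence shared by all points of
  the atom, and so it is counted.\<close>

lemma return_count_at_top:
  assumes z: "z \<in> Rec"
  shows "filterlim (\<lambda>n. return_count X I g n {w\<in>Z. code n w = code n z}) at_top sequentially"
proof -
  have zZ: "z \<in> Z" using z by (simp add: Rec_def)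
  define S where "S = {j. 1 \<le> j \<and> snd ((T ^^ j) z) = 0}"
  have "infinite S"
    unfolding infinite_nat_iff_unbounded_le
  proof
    fix m
    obtain i where "i \<ge> max m 1" "snd ((T ^^ i) z) = 0" using z unfolding Rec_def by blast
    then show "\<exists>n\<ge>m. n \<in> S" by (intro exI[of _ i]) (auto simp: S_def)
  qed
  show ?thesis
    unfolding filterlim_at_top
  proof
    fix m
    obtain F where F: "finite F" "card F = m" "F \<subseteq> S"
      using infinite_arbitrarily_large[OF \<open>infinite S\<close>, of m] by blast
    show "\<forall>\<^sub>F n in sequentially. m \<le> return_count X I g n {w\<in>Z. code n w = code n z}"
    proof (rule eventually_sequentiallyI)
      \<comment> \<open>A code of length n covers only times below n, hence the successor. Inserting
        0 keeps the maximum defined when \<open>F\<close> is empty.\<close>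
      fix n assume n: "n \<ge> Suc (Max (insert 0 F))"
      have "F \<subseteq> {j\<in>{1..n}. (T ^^ j) ` {w\<in>Z. code n w = code n z} \<subseteq> X 0 \<times> {0}}"
      proof
        fix j assume j: "j \<in> F"
        then have jS: "1 \<le> j" "snd ((T ^^ j) z) = 0" using F(3) by (auto simp: S_def)
        have "j \<le> Max (insert 0 F)" using j F(1) by auto
        then have jn: "j < n" using n by simp
        have base: "(T ^^ j) w \<in> X 0 \<times> {0}" if w: "w \<in> Z" "code n w = code n z" for w
        proof -
          have "snd ((T ^^ j) w) = snd ((T ^^ j) z)"
            using w(2) jn by (intro level_of_sym funpow_T_Z zZ w(1)) (simp add: itin_eq_iff)
          then show ?thesis using jS funpow_T_Z[OF w(1), of j]
            by (cases "(T ^^ j) w") (auto simp: Z_iff)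
        qed
        show "j \<in> {j\<in>{1..n}. (T ^^ j) ` {w\<in>Z. code n w = code n z} \<subseteq> X 0 \<times> {0}}"
        proof (intro CollectI conjI image_subsetI)
          show "j \<in> {1..n}" using jS jn by simp
          fix w assume "w \<in> {w\<in>Z. code n w = code n z}"
          then show "(T ^^ j) w \<in> X 0 \<times> {0}" by (intro base) auto
        qed
      qed
      then show "m \<le> return_count X I g n {w\<in>Z. code n w = code n z}"
        unfolding return_count_def F(2)[symmetric] by (intro card_mono) auto
    qed
  qed
qed

text \<open>Cut off outside the infinitely returning points, because on these the distortion
  condition makes the logarithm a limit of functions of the code.\<close>

definition lj :: "'a \<times> nat \<Rightarrow> real" where "lj z = (if z \<in> Rec then ln (Jac z) else 0)"

text \<open>The return counts of the atoms around a point of \<open>Rec\<close> tend to infinity, so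
  the first distortion estimate, whose bounds tend to 0, makes the values at the representatives
  converge.\<close>

lemma lj_meas: "lj \<in> borel_measurable N"
proof -
  have "(\<lambda>n. ln (Jac (rep n z))) \<longlonglongrightarrow> ln (Jac z)" if z: "z \<in> Rec" for z
  proof -
    have zZ: "z \<in> Z" using z by (simp add: Rec_def)
    let ?A = "\<lambda>n. {w\<in>Z. code n w = code n z}"
    have e: "(\<lambda>n. eps (return_count X I g n (?A n))) \<longlonglongrightarrow> 0"
      by (rule filterlim_compose[OF eps_lim return_count_at_top[OF z]])
    have bound: "\<bar>ln (Jac (rep n z)) - ln (Jac z)\<bar> \<le> eps (return_count X I g n (?A n))" if n: "n \<ge> 1" for n
    proof -
      have A: "?A n \<in> tower_join X I g n" using zZ by (auto simp: tower_join_eq)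
      have in_A: "z \<in> ?A n" "rep n z \<in> ?A n" using zZ rep[OF zZ] by auto
      have pos: "Jac z > 0" "Jac (rep n z) > 0" using zZ rep[OF zZ] Jac_pos by auto
      have "ln (Jac u / Jac v) \<le> eps (return_count X I g n (?A n))"
        if "u \<in> ?A n" "v \<in> ?A n" for u v
      proof -
        have "Jac u / Jac v > 0" using that Jac_pos by auto
        moreover have "Jac u / Jac v \<le> exp (eps (return_count X I g n (?A n)))"
          using distortion[OF n A that] by simp
        ultimately show ?thesis using ln_le_cancel_iff[of "Jac u / Jac v" "exp (eps (return_count X I g n (?A n)))"] by simp
      qed
      from this[OF in_A] this[OF in_A(2,1)] pos show ?thesis by (simp add: ln_div abs_le_iff)
    qed
    have "(\<lambda>n. ln (Jac (rep n z)) - ln (Jac z)) \<longlonglongrightarrow> 0"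
      by (rule Lim_null_comparison[OF _ e]) (use bound in \<open>auto simp: eventually_sequentially\<close>)
    then show ?thesis by (rule LIM_zero_cancel)
  qed
  from limit_meas[OF Rec_sets this] show ?thesis by (simp add: lj_def[abs_def])
qed

text \<open>There are finitely many symbols below level K, and on each of them the logarithm varies
  by at most \<open>ln D\<close>, by the product estimate for a single factor.\<close>

lemma ln_Jac_bounded: "\<exists>C\<ge>0. \<forall>z\<in>Z. snd z < K \<longrightarrow> \<bar>ln (Jac z)\<bar> \<le> C"
proof -
  let ?S = "sym ` {z\<in>Z. snd z < K}"
  have "?S \<subseteq> (\<Union>k<K. (\<lambda>J. J \<times> {k}) ` I k)"
  proof clarify
    fix x k assume xk: "(x, k) \<in> Z" "snd (x, k) < K"
    then obtain J where J: "J \<in> I k" "x \<in> J" using I_ex by (auto simp: Z_iff)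
    then show "sym (x, k) \<in> (\<Union>k<K. (\<lambda>J. J \<times> {k}) ` I k)" using sym_eq[OF J] xk by auto
  qed
  then have fS: "finite ?S" by (rule finite_subset) (simp add: I_finite)
  define c where "c A = \<bar>ln (Jac (SOME w. w \<in> Z \<and> sym w = A))\<bar> + ln D" for A
  have "\<bar>ln (Jac z)\<bar> \<le> c (sym z)" if z: "z \<in> Z" for z
  proof -
    define w where "w = (SOME w. w \<in> Z \<and> sym w = sym z)"
    have w: "w \<in> Z \<and> sym w = sym z" unfolding w_def by (rule someI[of _ z]) (use z in simp)
    then have "code 1 z = code 1 w" "code 1 w = code 1 z" by (auto simp: itin_def)
    then have "Jac z \<le> D * Jac w" "Jac w \<le> D * Jac z"
      using distortion_code[of z w 1] distortion_code[of w z 1] z w by (auto simp: jprod_def)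
    then have "ln (Jac z) \<le> ln (D * Jac w)" "ln (Jac w) \<le> ln (D * Jac z)"
      using Jac_pos z w D_pos by (auto intro!: ln_mono)
    then show ?thesis using Jac_pos[OF z] Jac_pos[of w] w D_pos
      by (auto simp: c_def w_def[symmetric] ln_mult)
  qed
  moreover have "c A \<le> Max (insert 0 (c ` ?S))" if "A \<in> ?S" for A using fS that by (intro Max_ge) auto
  ultimately have "\<forall>z\<in>Z. snd z < K \<longrightarrow> \<bar>ln (Jac z)\<bar> \<le> Max (insert 0 (c ` ?S))" by fastforce
  moreover have "0 \<le> Max (insert 0 (c ` ?S))" using fS by (intro Max_ge) auto
  ultimately show ?thesis by blast
qed

subsection \<open>Invariant measures carried by finitely many levels\<close>

definition lev :: "nat \<Rightarrow> ('a \<times> nat) set" where "lev K = (\<Union>k<K. X k \<times> {k})"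

definition finlev :: "('a \<times> nat) measure \<Rightarrow> nat \<Rightarrow> bool" where
  "finlev \<nu> K \<longleftrightarrow> \<nu> \<in> tower_invariant X I g \<and> 1 \<le> K \<and> measure \<nu> (lev K) = 1"

lemma lev_eq: "lev K = {z\<in>Z. snd z < K}" by (auto simp: lev_def tower_space_def)

lemma lev_sets: "lev K \<in> sets N"
  using level_sets_N[of "\<lambda>k. k < K" 0] by (simp add: lev_eq)

text \<open>The forward invariant core of \<open>lev K\<close>: an invariant measure carried by
  \<open>lev K\<close> is carried by this set, on which all estimates hold pointwise.\<close>

definition G :: "nat \<Rightarrow> ('a \<times> nat) set" where "G K = {z\<in>Z. \<forall>i. snd ((T ^^ i) z) < K}"

lemma G_sets: "G K \<in> sets N"
proof -
  have "G K = (\<Inter>i. {z\<in>Z. snd ((T ^^ i) z) < K})" by (auto simp: G_def)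
  also have "\<dots> \<in> sets N" using level_sets_N[of "\<lambda>k. k < K"] by (intro sets.countable_INT) auto
  finally show ?thesis .
qed

lemma G_Z: "z \<in> G K \<Longrightarrow> z \<in> Z" by (simp add: G_def)

lemma G_T: "z \<in> G K \<Longrightarrow> (T ^^ i) z \<in> G K"
proof -
  assume z: "z \<in> G K"
  have "snd ((T ^^ j) ((T ^^ i) z)) < K" for j
    using z funpow_add[of j i T] unfolding G_def by (metis (mono_tags, lifting) comp_apply mem_Collect_eq)
  then show ?thesis using funpow_T_Z[OF G_Z[OF z]] by (simp add: G_def)
qed

lemma climb:
  assumes "z \<in> Z" "\<And>i. 1 \<le> i \<Longrightarrow> i \<le> m \<Longrightarrow> snd ((T ^^ i) z) \<noteq> 0"
  shows "snd ((T ^^ m) z) = snd z + m"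
  using assms(2)
proof (induction m)
  case (Suc m)
  obtain y l where yl: "(T ^^ m) z = (y, l)" by (cases "(T ^^ m) z")
  have "(y, l) \<in> Z" using funpow_T_Z[OF assms(1), of m] yl by simp
  moreover have "snd (T (y, l)) \<noteq> 0" using Suc.prems[of "Suc m"] yl by simp
  ultimately have "snd (T (y, l)) = Suc l" by (cases rule: T_cases) auto
  then show ?case using Suc yl by simp
qed simp

text \<open>An orbit that stops returning climbs one level at each step and so leaves the first K
  levels.\<close>

lemma G_sub_Rec: "G K \<subseteq> Rec"
proof
  fix z assume z: "z \<in> G K"
  have "\<exists>i\<ge>j. snd ((T ^^ i) z) = 0" for j
  proof (rule ccontr)
    assume "\<not> ?thesis"
    then have *: "snd ((T ^^ i) z) \<noteq> 0" if "i \<ge> j" for i using that by auto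
    have zj: "(T ^^ j) z \<in> G K" by (rule G_T[OF z])
    have "snd ((T ^^ i) ((T ^^ j) z)) \<noteq> 0" for i using *[of "i + j"] by (simp add: funpow_add)
    then have "snd ((T ^^ K) ((T ^^ j) z)) = snd ((T ^^ j) z) + K" by (intro climb G_Z[OF zj])
    then show False using zj unfolding G_def by (metis (mono_tags, lifting) mem_Collect_eq not_add_less2)
  qed
  then show "z \<in> Rec" using G_Z[OF z] by (simp add: Rec_def)
qed

end

locale tower_inv = tower_jac +
  fixes \<nu> :: "('a \<times> nat) measure" and K :: nat
  assumes finlev: "finlev \<nu> K"
begin

lemma sets_\<nu> [measurable_cong]: "sets \<nu> = sets N"
  using finlev by (simp add: finlev_def tower_invariant_def invariant_probs_def)

lemma space_\<nu> [simp]: "space \<nu> = Z" using sets_eq_imp_space_eq[OF sets_\<nu>] by simp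

lemma K_pos: "K \<ge> 1" using finlev by (simp add: finlev_def)

sublocale invariant_prob \<nu> T
  using finlev
  by (auto simp: finlev_def tower_invariant_def invariant_probs_def invariant_prob_def invariant_prob_axioms_def)

lemma AE_lev: "AE z in \<nu>. snd z < K"
proof -
  have "AE z in \<nu>. z \<in> lev K"
    using finlev lev_sets sets_\<nu> by (subst AE_in_set_eq_1) (auto simp: finlev_def)
  then show ?thesis by eventually_elim (auto simp: lev_eq)
qed

lemma AE_G: "AE z in \<nu>. z \<in> G K"
proof -
  have "AE z in \<nu>. snd ((T ^^ i) z) < K" for i
  proof -
    have "AE z in distr \<nu> \<nu> (T ^^ i). snd z < K" unfolding funpow_inv by (rule AE_lev)
    moreover have "{z \<in> space \<nu>. snd z < K} \<in> sets \<nu>"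
      using level_sets_N[of "\<lambda>k. k < K" 0] by (simp add: sets_\<nu>)
    ultimately show ?thesis by (subst (asm) AE_distr_iff[OF funpow_meas]) auto
  qed
  then have "AE z in \<nu>. \<forall>i. snd ((T ^^ i) z) < K" by (simp add: AE_all_countable)
  moreover have "AE z in \<nu>. z \<in> space \<nu>" by (rule AE_space)
  ultimately show ?thesis by eventually_elim (auto simp: G_def)
qed

lemma lj_\<nu> [measurable]: "lj \<in> borel_measurable \<nu>"
  using lj_meas by (simp add: measurable_cong_sets[OF sets_\<nu> refl])

lemma lj_bounded: "\<exists>C\<ge>0. \<forall>z\<in>G K. \<bar>lj z\<bar> \<le> C \<and> lj z = ln (Jac z)"
proof -
  obtain C where C: "C \<ge> 0" "\<And>z. z \<in> Z \<Longrightarrow> snd z < K \<Longrightarrow> \<bar>ln (Jac z)\<bar> \<le> C"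
    using ln_Jac_bounded by blast
  have "\<bar>lj z\<bar> \<le> C \<and> lj z = ln (Jac z)" if z: "z \<in> G K" for z
  proof -
    have "snd ((T ^^ 0) z) < K" using z unfolding G_def by blast
    then show ?thesis using z C G_sub_Rec G_Z[OF z] by (auto simp: lj_def)
  qed
  then show ?thesis using C(1) by blast
qed

lemma lj_integrable: "integrable \<nu> lj"
proof -
  obtain C where "\<And>z. z \<in> G K \<Longrightarrow> \<bar>lj z\<bar> \<le> C" using lj_bounded by blast
  then show ?thesis
    by (intro integrable_const_bound[of _ C]) (use AE_G in \<open>auto elim: eventually_mono\<close>)
qed

text \<open>Off \<open>G K\<close> the Jacobian may fail to be measurable for the coding algebra,
  but that set is null, so the completion accepts every piece of it and the integral only sees
  \<open>lj\<close>.\<close>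

lemma integral_ln_Jac: "(\<integral>z. ln (Jac z) \<partial>completion \<nu>) = (\<integral>z. lj z \<partial>\<nu>)"
proof -
  have G: "G K \<in> sets \<nu>" using G_sets by (simp add: sets_\<nu>)
  have null: "Z - G K \<in> null_sets \<nu>"
    using AE_G G AE_iff_measurable[of "Z - G K" \<nu> "\<lambda>z. z \<in> G K"] sets.top[of \<nu>]
    by (auto simp: null_sets_def set_diff_eq)
  have eq: "ln (Jac z) = lj z" if "z \<in> G K" for z using lj_bounded that by auto
  have m: "(\<lambda>z. ln (Jac z)) \<in> borel_measurable (completion \<nu>)"
  proof (rule measurableI)
    fix A :: "real set" assume A: "A \<in> sets borel"
    have "(\<lambda>z. ln (Jac z)) -` A \<inter> space (completion \<nu>)
        = (lj -` A \<inter> space \<nu> \<inter> G K) \<union> ((\<lambda>z. ln (Jac z)) -` A \<inter> (Z - G K))"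
      using eq G_Z by auto
    moreover have "lj -` A \<inter> space \<nu> \<inter> G K \<in> sets \<nu>" using A G by measurable
    moreover have "(\<lambda>z. ln (Jac z)) -` A \<inter> (Z - G K) \<in> null_sets (completion \<nu>)"
      by (rule null_sets_completion_subset[of _ "Z - G K"]) (use null in \<open>auto intro: null_sets_completionI\<close>)
    ultimately show "(\<lambda>z. ln (Jac z)) -` A \<inter> space (completion \<nu>) \<in> sets (completion \<nu>)"
      by (auto intro!: sets.Un)
  qed simp
  have "(\<integral>z. ln (Jac z) \<partial>completion \<nu>) = (\<integral>z. lj z \<partial>completion \<nu>)"
    using AE_completion[OF AE_G] by (intro integral_cong_AE m measurable_completion lj_\<nu>) (auto elim!: eventually_mono simp: eq)
  also have "\<dots> = (\<integral>z. lj z \<partial>\<nu>)" by (rule integral_completion[OF lj_\<nu>])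
  finally show ?thesis .
qed

text \<open>Truncation makes the range finite. The empty set is free to mark the levels from K on,
  since blocks are nonempty.\<close>

definition symK :: "'a \<times> nat \<Rightarrow> ('a \<times> nat) set" where
  "symK z = (if snd z < K then sym z else {})"

lemma symK_simple: "simple_function \<nu> symK"
  unfolding simple_function_def
proof (intro conjI ballI)
  have "symK ` space \<nu> \<subseteq> insert {} (\<Union>k<K. (\<lambda>J. J \<times> {k}) ` I k)"
  proof clarify
    fix x k assume xk: "(x, k) \<in> space \<nu>" "symK (x, k) \<notin> (\<Union>k<K. (\<lambda>J. J \<times> {k}) ` I k)"
    then have "x \<in> X k" by (simp add: Z_iff)
    then obtain J where J: "J \<in> I k" "x \<in> J" using I_ex by blast
    have "J \<times> {k} \<in> (\<Union>k<K. (\<lambda>J. J \<times> {k}) ` I k)" if "k < K" using J(1) that by blast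
    then show "symK (x, k) = {}" using sym_eq[OF J] xk(2) unfolding symK_def by (cases "k < K") auto
  qed
  then show "finite (symK ` space \<nu>)" by (rule finite_subset) (simp add: I_finite)
  fix y
  have hd: "hd (code 1 z) = sym z" for z by (simp add: itin_def)
  have "symK -` {y} \<inter> space \<nu> = ({z\<in>Z. snd z < K} \<inter> {z\<in>Z. hd (code 1 z) = y})
      \<union> ({z\<in>Z. \<not> snd z < K \<and> y = {}})"
    unfolding hd symK_def space_\<nu> by (rule set_eqI) (simp; blast)
  moreover have "{z\<in>Z. snd z < K} \<in> sets N" "{z\<in>Z. \<not> snd z < K \<and> y = {}} \<in> sets N"
    using level_sets_N[of "\<lambda>k. k < K" 0] level_sets_N[of "\<lambda>k. \<not> k < K \<and> y = {}" 0] by auto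
  moreover have "{z\<in>Z. hd (code 1 z) = y} \<in> sets N" by (rule code_sets[of "\<lambda>l. hd l = y"])
  ultimately show "symK -` {y} \<inter> space \<nu> \<in> sets \<nu>" unfolding sets_\<nu> by auto
qed

lemma itin_symK: "z \<in> G K \<Longrightarrow> itin T symK n z = code n z"
  unfolding itin_def by (rule map_cong) (auto simp: symK_def G_def)

text \<open>The events that can be approximated form a \<sigma>-algebra. It contains the atoms of
  the codes, because on the full set \<open>G K\<close> truncated and true symbols coincide.\<close>

lemma symK_generating: "generating symK"
proof -
  define ap where "ap B \<longleftrightarrow> (\<forall>\<delta>>0. \<exists>n S. measure \<nu> (sym_diff B {z\<in>space \<nu>. itin T symK n z \<in> S}) < \<delta>)" for B
  note iss = itin_set_sets[OF symK_simple]
  have fib: "ap A" if A: "A \<in> tower_join X I g n" for A n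
    unfolding ap_def
  proof (intro allI impI)
    fix \<delta> :: real assume "\<delta> > 0"
    obtain z where A: "A = {w\<in>Z. code n w = code n z}" using A by (auto simp: tower_join_eq)
    have "AE w in \<nu>. w \<notin> sym_diff A {w\<in>space \<nu>. itin T symK n w \<in> {code n z}}"
      using AE_G by eventually_elim (auto simp: A itin_symK)
    then have "measure \<nu> (sym_diff A {w\<in>space \<nu>. itin T symK n w \<in> {code n z}}) = 0"
    proof (subst prob_eq_0)
      have "A \<in> sets \<nu>" using code_sets[of "\<lambda>l. l = code n z" n] by (simp add: A sets_\<nu>)
      then show "sym_diff A {w\<in>space \<nu>. itin T symK n w \<in> {code n z}} \<in> sets \<nu>"
        by (intro sets.Un sets.Diff iss)
    qed
    then show "\<exists>n S. measure \<nu> (sym_diff A {z\<in>space \<nu>. itin T symK n z \<in> S}) < \<delta>"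
      using \<open>\<delta> > 0\<close> by (intro exI[of _ n] exI[of _ "{code n z}"]) simp
  qed
  have "ap B" if "B \<in> sigma_sets Z (\<Union>n. tower_join X I g n)" for B
    using that
  proof induction
    case (Basic A)
    then show ?case using fib by blast
  next
    case Empty
    show ?case unfolding ap_def
    proof (intro allI impI)
      fix \<delta> :: real assume "\<delta> > 0"
      then show "\<exists>n S. measure \<nu> (sym_diff {} {z\<in>space \<nu>. itin T symK n z \<in> S}) < \<delta>"
        by (intro exI[of _ 0] exI[of _ "{}"]) simp
    qed
  next
    case (Compl A)
    show ?case unfolding ap_def
    proof (intro allI impI)
      fix \<delta> :: real assume "\<delta> > 0"
      then obtain n S where nS: "measure \<nu> (sym_diff A {z\<in>space \<nu>. itin T symK n z \<in> S}) < \<delta>"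
        using Compl.IH unfolding ap_def by blast
      have AZ: "A \<subseteq> Z" using sigma_sets_into_sp[OF tower_join_sub Compl.hyps] .
      have eq: "sym_diff (Z - A) {z\<in>space \<nu>. itin T symK n z \<in> - S} = sym_diff A {z\<in>space \<nu>. itin T symK n z \<in> S}"
        using AZ by auto
      then show "\<exists>n S. measure \<nu> (sym_diff (Z - A) {z\<in>space \<nu>. itin T symK n z \<in> S}) < \<delta>"
        using nS by (intro exI[of _ n] exI[of _ "- S"]) (simp only: eq)
    qed
  next
    case (Union a)
    have aN: "a i \<in> sets \<nu>" for i using Union.hyps by (simp add: sets_\<nu> sets_N)
    show ?case unfolding ap_def
    proof (intro allI impI)
      fix \<delta> :: real assume \<delta>: "\<delta> > 0"
      \<comment> \<open>Half of \<delta> pays for cutting the union after m sets, and the other half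
        is shared by these m sets; the successor in the denominator of \<open>\<delta>'\<close>
        covers m = 0.\<close>
      define b where "b m = (\<Union>i<m. a i)" for m
      have bU: "(\<Union>m. b m) = (\<Union>i. a i)" by (auto simp: b_def)
      have bs: "b m \<in> sets \<nu>" for m unfolding b_def using aN by auto
      have aU: "(\<Union>i. a i) \<in> sets \<nu>" using aN by auto
      have "(\<lambda>m. measure \<nu> (b m)) \<longlonglongrightarrow> measure \<nu> (\<Union>m. b m)"
      proof (rule finite_Lim_measure_incseq)
        show "incseq b" unfolding incseq_def b_def by (intro allI impI UN_mono) auto
      qed (use bs in auto)
      then obtain m where "norm (measure \<nu> (b m) - measure \<nu> (\<Union>i. a i)) < \<delta> / 2"
        unfolding bU using \<delta> by (metis LIMSEQ_D half_gt_zero order_refl)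
      then have "measure \<nu> (\<Union>i. a i) - measure \<nu> (b m) < \<delta> / 2" unfolding real_norm_def by linarith
      moreover have "measure \<nu> ((\<Union>i. a i) - b m) = measure \<nu> (\<Union>i. a i) - measure \<nu> (b m)"
        by (rule finite_measure_Diff[OF aU bs]) (auto simp: b_def)
      ultimately have m: "measure \<nu> ((\<Union>i. a i) - b m) < \<delta> / 2" by simp
      define \<delta>' where "\<delta>' = \<delta> / (2 * real (Suc m))"
      have \<delta>': "\<delta>' > 0" using \<delta> by (simp add: \<delta>'_def)
      have "\<forall>i. \<exists>p. measure \<nu> (sym_diff (a i) {z\<in>space \<nu>. itin T symK (fst p) z \<in> snd p}) < \<delta>'"
      proof
        fix i
        obtain n S where "measure \<nu> (sym_diff (a i) {z\<in>space \<nu>. itin T symK n z \<in> S}) < \<delta>'"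
          using Union.IH[of i] \<delta>' unfolding ap_def by blast
        then show "\<exists>p. measure \<nu> (sym_diff (a i) {z\<in>space \<nu>. itin T symK (fst p) z \<in> snd p}) < \<delta>'"
          by (intro exI[of _ "(n, S)"]) simp
      qed
      from choice[OF this] obtain p where
        p: "\<And>i. measure \<nu> (sym_diff (a i) {z\<in>space \<nu>. itin T symK (fst (p i)) z \<in> snd (p i)}) < \<delta>'" by blast
      define n where "n = (\<Sum>i<m. fst (p i))"
      have pn: "fst (p i) \<le> n" if "i < m" for i unfolding n_def using that by (intro member_le_sum) auto
      define S where "S = {l. \<exists>i<m. take (fst (p i)) l \<in> snd (p i)}"
      let ?d = "\<lambda>i. sym_diff (a i) {z\<in>space \<nu>. itin T symK (fst (p i)) z \<in> snd (p i)}"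
      have ds: "?d i \<in> sets \<nu>" for i using aN iss by auto
      have S_iff: "itin T symK n z \<in> S \<longleftrightarrow> (\<exists>i<m. itin T symK (fst (p i)) z \<in> snd (p i))" for z
        unfolding S_def using pn by (auto simp: take_itin)
      have sub: "sym_diff (\<Union>i. a i) {z\<in>space \<nu>. itin T symK n z \<in> S} \<subseteq> ((\<Union>i. a i) - b m) \<union> (\<Union>i<m. ?d i)"
        unfolding S_iff b_def by blast
      have "measure \<nu> (sym_diff (\<Union>i. a i) {z\<in>space \<nu>. itin T symK n z \<in> S})
          \<le> measure \<nu> (((\<Union>i. a i) - b m) \<union> (\<Union>i<m. ?d i))"
        by (rule finite_measure_mono[OF sub]) (use aU bs ds in auto)
      also have "\<dots> \<le> measure \<nu> ((\<Union>i. a i) - b m) + measure \<nu> (\<Union>i<m. ?d i)"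
        by (rule measure_Un_le) (use aU bs ds in auto)
      also have "measure \<nu> (\<Union>i<m. ?d i) \<le> (\<Sum>i<m. measure \<nu> (?d i))"
        by (rule finite_measure_subadditive_finite) (use ds in auto)
      also have "\<dots> \<le> (\<Sum>i<m. \<delta>')" by (intro sum_mono less_imp_le p)
      also have "\<dots> \<le> \<delta> / 2" using \<delta> by (simp add: \<delta>'_def field_simps)
      finally have "measure \<nu> (sym_diff (\<Union>i. a i) {z\<in>space \<nu>. itin T symK n z \<in> S}) < \<delta>" using m by simp
      then show "\<exists>n S. measure \<nu> (sym_diff (\<Union>i. a i) {z\<in>space \<nu>. itin T symK n z \<in> S}) < \<delta>" by blast
    qed
  qed
  then show ?thesis unfolding generating_def ap_def sets_\<nu> sets_N by blast
qed

lemma free_energy_eq: "free_energy X I g Jac \<nu> = ereal (ent_rate symK - (\<integral>z. lj z \<partial>\<nu>))"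
  unfolding free_energy_def integral_ln_Jac
  using metric_entropy_generator[OF symK_simple symK_generating] by simp

end

subsection \<open>Observables\<close>

locale tower_ob = tower_jac +
  fixes \<psi> :: "'a \<times> nat \<Rightarrow> real"
  assumes obs: "\<psi> \<in> observables X I g"
begin

abbreviation S where "S n z \<equiv> birkhoff_sum T n \<psi> z"

definition B where "B = (SOME B. B \<ge> 0 \<and> (\<forall>z\<in>Z. \<bar>\<psi> z\<bar> \<le> B))"

lemma B: "B \<ge> 0" "z \<in> Z \<Longrightarrow> \<bar>\<psi> z\<bar> \<le> B"
proof -
  have "bounded (\<psi> ` Z)" using obs by (simp add: observables_def)
  then obtain b where "\<forall>y\<in>\<psi> ` Z. norm y \<le> b" by (auto simp: bounded_iff)
  then have "\<exists>B. B \<ge> 0 \<and> (\<forall>z\<in>Z. \<bar>\<psi> z\<bar> \<le> B)"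
    by (intro exI[of _ "max b 0"]) (auto intro: max.coboundedI1)
  then have "B \<ge> 0 \<and> (\<forall>z\<in>Z. \<bar>\<psi> z\<bar> \<le> B)" unfolding B_def by (rule someI_ex)
  then show "B \<ge> 0" "z \<in> Z \<Longrightarrow> \<bar>\<psi> z\<bar> \<le> B" by auto
qed

lemma \<psi>_osc:
  assumes "\<delta> > 0"
  obtains m where "\<And>n z w. n \<ge> m \<Longrightarrow> z \<in> Z \<Longrightarrow> w \<in> Z \<Longrightarrow> code n z = code n w \<Longrightarrow> \<bar>\<psi> z - \<psi> w\<bar> \<le> \<delta>"
proof -
  have "(\<lambda>n. tower_var X I g \<psi> n) \<longlonglongrightarrow> 0" using obs by (simp add: observables_def)
  then have "\<forall>\<^sub>F n in sequentially. tower_var X I g \<psi> n < ereal \<delta>"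
    using assms by (intro order_tendstoD(2)) auto
  then obtain m where m: "\<And>n. n \<ge> m \<Longrightarrow> tower_var X I g \<psi> n < ereal \<delta>" by (auto simp: eventually_sequentially)
  show thesis
  proof (rule that)
    fix n z w assume n: "n \<ge> m" and zw: "z \<in> Z" "w \<in> Z" "code n z = code n w"
    have "ereal \<bar>\<psi> z - \<psi> w\<bar> \<le> tower_var X I g \<psi> n"
      unfolding tower_var_def
    proof (rule Sup_upper, intro CollectI exI conjI)
      show "\<exists>A\<in>tower_join X I g n. z \<in> A \<and> w \<in> A"
        unfolding tower_join_eq using zw by (intro bexI[of _ "{v\<in>Z. code n v = code n z}"]) auto
    qed simp
    then have "ereal \<bar>\<psi> z - \<psi> w\<bar> < ereal \<delta>" using m[OF n] by (rule le_less_trans)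
    then show "\<bar>\<psi> z - \<psi> w\<bar> \<le> \<delta>" by simp
  qed
qed

text \<open>Vanishing variation makes \<psi> the limit of its values at the code representatives, at
  every point of the tower.\<close>

lemma \<psi>_meas: "\<psi> \<in> borel_measurable N"
proof -
  have "(\<lambda>n. \<psi> (rep n z)) \<longlonglongrightarrow> \<psi> z" if z: "z \<in> Z" for z
  proof (rule LIMSEQ_I)
    fix r :: real assume r: "r > 0"
    obtain m where m: "\<And>n z w. n \<ge> m \<Longrightarrow> z \<in> Z \<Longrightarrow> w \<in> Z \<Longrightarrow> code n z = code n w \<Longrightarrow> \<bar>\<psi> z - \<psi> w\<bar> \<le> r / 2"
      using \<psi>_osc[of "r / 2"] r by auto
    show "\<exists>no. \<forall>n\<ge>no. norm (\<psi> (rep n z) - \<psi> z) < r"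
    proof (intro exI[of _ m] allI impI)
      fix n assume "n \<ge> m"
      then have "\<bar>\<psi> (rep n z) - \<psi> z\<bar> \<le> r / 2" using rep[OF z] z by (intro m) auto
      then show "norm (\<psi> (rep n z) - \<psi> z) < r" using r by simp
    qed
  qed
  from limit_meas[OF sets.top[of N, simplified] this] have "(\<lambda>z. if z \<in> Z then \<psi> z else 0) \<in> borel_measurable N"
    by simp
  then show ?thesis by (subst measurable_cong[of N _ "\<lambda>z. if z \<in> Z then \<psi> z else 0"]) auto
qed

lemma S_bound: "z \<in> Z \<Longrightarrow> \<bar>S n z\<bar> \<le> real n * B"
proof -
  assume z: "z \<in> Z"
  have "\<bar>S n z\<bar> \<le> (\<Sum>i<n. \<bar>\<psi> ((T ^^ i) z)\<bar>)" unfolding birkhoff_sum_def by (rule sum_abs)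
  also have "\<dots> \<le> (\<Sum>i<n. B)" by (intro sum_mono B(2) funpow_T_Z z)
  finally show ?thesis by simp
qed

lemma S_add: "S (m + n) z = S m z + S n ((T ^^ m) z)"
proof (induction n)
  case (Suc n)
  have "(T ^^ (m + n)) z = (T ^^ n) ((T ^^ m) z)"
    by (subst add.commute) (simp add: funpow_add)
  then show ?case using Suc by (simp add: birkhoff_sum_def)
qed (simp add: birkhoff_sum_def)

text \<open>The term at time i sees a common code of length n - i. If this is at least m, the term
  varies by at most \<delta>; fewer than m symbols remain for at most m terms, each varying by at
  most 2 B, and these make up \<open>c\<close>.\<close>

lemma S_osc:
  assumes "\<delta> > 0"
  obtains c where "c \<ge> 0" "\<And>n z w. z \<in> Z \<Longrightarrow> w \<in> Z \<Longrightarrow> code n z = code n w \<Longrightarrow> \<bar>S n z - S n w\<bar> \<le> real n * \<delta> + c"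
proof -
  obtain m where m: "\<And>n z w. n \<ge> m \<Longrightarrow> z \<in> Z \<Longrightarrow> w \<in> Z \<Longrightarrow> code n z = code n w \<Longrightarrow> \<bar>\<psi> z - \<psi> w\<bar> \<le> \<delta>"
    using \<psi>_osc[OF assms] by blast
  show thesis
  proof (rule that[of "real m * (2 * B)"])
    show "real m * (2 * B) \<ge> 0" using B(1) by simp
    fix n z w assume zw: "z \<in> Z" "w \<in> Z" "code n z = code n w"
    have tm: "\<bar>\<psi> ((T ^^ i) z) - \<psi> ((T ^^ i) w)\<bar> \<le> \<delta> + (if n - i < m then 2 * B else 0)" if i: "i < n" for i
    proof (cases "n - i < m")
      case True
      have "\<bar>\<psi> ((T ^^ i) z)\<bar> \<le> B" "\<bar>\<psi> ((T ^^ i) w)\<bar> \<le> B" by (intro B(2) funpow_T_Z zw)+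
      then show ?thesis using True assms by simp
    next
      case False
      have "code (i + (n - i)) z = code (i + (n - i)) w" using zw(3) i by simp
      then have "code (n - i) ((T ^^ i) z) = code (n - i) ((T ^^ i) w)" unfolding itin_add by simp
      then have "\<bar>\<psi> ((T ^^ i) z) - \<psi> ((T ^^ i) w)\<bar> \<le> \<delta>"
        using False by (intro m[of "n - i"] funpow_T_Z zw) auto
      then show ?thesis using False by simp
    qed
    have "\<bar>S n z - S n w\<bar> = \<bar>\<Sum>i<n. \<psi> ((T ^^ i) z) - \<psi> ((T ^^ i) w)\<bar>"
      by (simp add: birkhoff_sum_def sum_subtractf)
    also have "\<dots> \<le> (\<Sum>i<n. \<bar>\<psi> ((T ^^ i) z) - \<psi> ((T ^^ i) w)\<bar>)" by (rule sum_abs)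
    also have "\<dots> \<le> (\<Sum>i<n. \<delta> + (if n - i < m then 2 * B else 0))" by (intro sum_mono tm) simp
    also have "\<dots> = real n * \<delta> + real (card {i\<in>{..<n}. n - i < m}) * (2 * B)"
      by (simp add: sum.distrib sum.If_cases Int_def)
    also have "\<dots> \<le> real n * \<delta> + real m * (2 * B)"
    proof -
      have "card {i\<in>{..<n}. n - i < m} \<le> card {..<m}"
        by (rule card_inj_on_le[of "\<lambda>i. n - i"]) (auto simp: inj_on_def)
      then show ?thesis using B(1) by (intro add_left_mono mult_right_mono) auto
    qed
    finally show "\<bar>S n z - S n w\<bar> \<le> real n * \<delta> + real m * (2 * B)" .
  qed
qed

lemma S_base_sets: "{x\<in>space M. P (S n (x, 0))} \<in> sets M" if "Measurable.pred borel P"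
proof -
  have [measurable]: "\<psi> \<in> borel_measurable N" by (rule \<psi>_meas)
  have "(\<lambda>z. S n z) \<in> borel_measurable N" unfolding birkhoff_sum_def by measurable
  then have "{z\<in>space N. P (S n z)} \<in> sets N" using that by measurable
  then have "{x. (x, 0) \<in> {z\<in>space N. P (S n z)}} \<in> sets M" by (rule slice_sets[OF N_sub_mZ])
  also have "{x. (x, 0) \<in> {z\<in>space N. P (S n z)}} = {x\<in>space M. P (S n (x, 0))}" by (auto simp: Z_iff)
  finally show ?thesis .
qed

end

subsection \<open>The lower bound\<close>

lemma ln_mult3: "0 < a \<Longrightarrow> 0 < b \<Longrightarrow> 0 < c \<Longrightarrow> ln (a * b * c) = ln a + ln b + ln (c :: real)"
  by (simp add: ln_mult)

context tower_ob
begin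

lemma S_diff:
  assumes "z \<in> Z"
  shows "\<bar>S n z - S k z\<bar> \<le> \<bar>real n - real k\<bar> * B"
proof -
  have *: "\<bar>S n z - S k z\<bar> \<le> \<bar>real n - real k\<bar> * B" if "k \<le> n" for k n
  proof -
    have "S (k + (n - k)) z - S k z = S (n - k) ((T ^^ k) z)" by (simp add: S_add)
    then show ?thesis using S_bound[OF funpow_T_Z[OF assms], of "n - k" k] that by (simp add: of_nat_diff)
  qed
  show ?thesis
  proof (cases "k \<le> n")
    case False
    then show ?thesis using *[of n k] by (simp add: abs_minus_commute)
  qed (rule *)
qed

definition cat_words :: "('c \<Rightarrow> 'a set list) \<Rightarrow> 'c list \<Rightarrow> 'a set list" where
  "cat_words W ys = concat (map W ys)"

lemma cat_words_simps [simp]: "cat_words W [] = []" "cat_words W (y # ys) = W y @ cat_words W ys"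
  by (simp_all add: cat_words_def)

lemma cat_words_in: "(\<And>y. y \<in> C \<Longrightarrow> W y \<in> lists E) \<Longrightarrow> set ys \<subseteq> C \<Longrightarrow> cat_words W ys \<in> lists E"
  by (induction ys) auto

lemma S_cat_words:
  assumes W: "\<And>y. y \<in> C \<Longrightarrow> W y \<in> lists E"
    and s: "\<And>y x. y \<in> C \<Longrightarrow> x \<in> cyl (W y) \<Longrightarrow> s y \<le> S (len (W y)) (x, 0)"
    and ys: "set ys \<subseteq> C" and x: "x \<in> cyl (cat_words W ys)"
  shows "sum_list (map s ys) \<le> S (len (cat_words W ys)) (x, 0)"
  using ys x
proof (induction ys arbitrary: x)
  case (Cons y ys)
  have y: "y \<in> C" "set ys \<subseteq> C" using Cons.prems by auto
  have cw: "cat_words W ys \<in> lists E" by (rule cat_words_in[OF W y(2)])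
  have x: "x \<in> cyl (W y)" "ret (W y) x \<in> cyl (cat_words W ys)"
    using Cons.prems(2) by (simp_all add: cyl_append[OF W[OF y(1)] cw])
  show ?case
    using s[OF y(1) x(1)] Cons.IH[OF y(2) x(2)] funpow_T_cyl[OF W[OF y(1)] x(1)]
    by (simp add: S_add)
qed (simp add: birkhoff_sum_def)

text \<open>The concatenation is read letter by letter: at most K letters have a cylinder containing
  the current point, and the return map hands the count on to the remaining letters.\<close>

lemma multiplicity_cat_words:
  fixes K :: nat
  assumes C: "finite C" and W: "\<And>y. y \<in> C \<Longrightarrow> W y \<in> lists E"
    and mult: "\<And>x. x \<in> space M \<Longrightarrow> card {y\<in>C. x \<in> cyl (W y)} \<le> K"
    and x: "x \<in> space M"
  shows "(\<Sum>ys\<in>words_of_length C m. indicator (cyl (cat_words W ys)) x) \<le> real K ^ m"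
  using x
proof (induction m arbitrary: x)
  case (Suc m)
  have "(\<Sum>ys\<in>words_of_length C (Suc m). indicator (cyl (cat_words W ys)) x)
      = (\<Sum>y\<in>C. \<Sum>ys\<in>words_of_length C m. indicator (cyl (W y @ cat_words W ys)) x :: real)"
    by (simp add: sum_words_Suc)
  also have "\<dots> = (\<Sum>y\<in>C. indicator (cyl (W y)) x * (\<Sum>ys\<in>words_of_length C m. indicator (cyl (cat_words W ys)) (ret (W y) x)))"
  proof (intro sum.cong refl)
    fix y assume y: "y \<in> C"
    have "indicator (cyl (W y @ cat_words W ys)) x
        = (indicator (cyl (W y)) x * indicator (cyl (cat_words W ys)) (ret (W y) x) :: real)"
      if ys: "ys \<in> words_of_length C m" for ys
    proof -
      have "cat_words W ys \<in> lists E"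
        by (rule cat_words_in[OF W]) (use ys in \<open>auto simp: words_of_length_def\<close>)
      from cyl_append[OF W[OF y] this] show ?thesis by (simp add: indicator_def)
    qed
    then show "(\<Sum>ys\<in>words_of_length C m. indicator (cyl (W y @ cat_words W ys)) x)
        = indicator (cyl (W y)) x * (\<Sum>ys\<in>words_of_length C m. indicator (cyl (cat_words W ys)) (ret (W y) x) :: real)"
      by (simp add: sum_distrib_left)
  qed
  also have "\<dots> \<le> (\<Sum>y\<in>C. indicator (cyl (W y)) x * real K ^ m)"
  proof (intro sum_mono)
    fix y assume y: "y \<in> C"
    show "indicator (cyl (W y)) x * (\<Sum>ys\<in>words_of_length C m. indicator (cyl (cat_words W ys)) (ret (W y) x))
        \<le> indicator (cyl (W y)) x * real K ^ m"
      using Suc.IH[OF ret_in[OF W[OF y]]] by (cases "x \<in> cyl (W y)") auto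
  qed
  also have "\<dots> = real (card {y\<in>C. x \<in> cyl (W y)}) * real K ^ m"
    using C by (simp add: sum_distrib_right[symmetric] indicator_def sum.If_cases Int_def)
  also have "\<dots> \<le> real K * real K ^ m" using mult[OF Suc.prems] by (intro mult_right_mono) auto
  finally show ?case by simp
qed (use cyl_sub in \<open>auto simp: indicator_def\<close>)

text \<open>Each concatenation loses at most the factor from \<open>measure_cyl_append\<close>.
  Putting that factor into the weight of the letter gives a clean product.\<close>

lemma measure_cat_words:
  assumes W: "\<And>y. y \<in> C \<Longrightarrow> W y \<in> lists E" and ys: "set ys \<subseteq> C"
  shows "measure M (space M) * prod_list (map (\<lambda>y. measure M (cyl (W y)) / (D\<^sup>2 * measure M (space M))) ys)
    \<le> measure M (cyl (cat_words W ys))"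
  using ys
proof (induction ys)
  case (Cons y ys)
  let ?m = "measure M (space M)" and ?q = "\<lambda>y. measure M (cyl (W y)) / (D\<^sup>2 * measure M (space M))"
  have y: "y \<in> C" "set ys \<subseteq> C" using Cons.prems by auto
  have "?m * prod_list (map ?q (y # ys)) = ?q y * (?m * prod_list (map ?q ys))" by simp
  also have "\<dots> \<le> ?q y * measure M (cyl (cat_words W ys))"
    using D_pos by (intro mult_left_mono Cons.IH y) (auto intro!: divide_nonneg_nonneg)
  also have "\<dots> \<le> measure M (cyl (W y @ cat_words W ys))"
    using measure_cyl_append[OF W[OF y(1)] cat_words_in[OF W y(2)]] D_pos space_M_pos
    by (simp add: field_simps)
  finally show ?case by simp
qed simp

text \<open>Up to constants, the mean of \<open>f\<close> is the entropy of \<open>p\<close> plus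
  the mean log mass of the letters. The law of large numbers for \<open>f\<close> and
  \<open>s\<close> selects words whose masses add up to about the exponential of m times that mean;
  the factor K inside \<open>f\<close> anticipates the division by the overlap K^m.\<close>

lemma concatenation_bound:
  fixes K n :: nat and C :: "'c set"
  assumes p: "prob_weights C p" and W: "\<And>y. y \<in> C \<Longrightarrow> W y \<in> lists E"
    and len: "\<And>y. y \<in> C \<Longrightarrow> n \<le> len (W y) \<and> len (W y) \<le> n + 2 * K"
    and mult: "\<And>x. x \<in> space M \<Longrightarrow> card {y\<in>C. x \<in> cyl (W y)} \<le> K" and K: "K \<ge> 1"
    and s: "\<And>y x. y \<in> C \<Longrightarrow> x \<in> cyl (W y) \<Longrightarrow> s y \<le> S (len (W y)) (x, 0)"
    and f: "\<And>y. y \<in> C \<Longrightarrow> f y = ln (measure M (cyl (W y)) / (D\<^sup>2 * measure M (space M) * real K * p y))"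
  shows "\<exists>m0. \<forall>m\<ge>m0. \<exists>A\<in>sets M.
    A \<subseteq> {x\<in>space M. \<exists>k. m * n \<le> k \<and> k \<le> m * (n + 2 * K) \<and> real m * ((\<Sum>y\<in>C. p y * s y) - 1) \<le> S k (x, 0)} \<and>
    measure M (space M) / 2 * exp (real m * ((\<Sum>y\<in>C. p y * f y) - 1)) \<le> measure M A"
proof -
  interpret prob_weights C p by (rule p)
  obtain m0 where m0: "\<And>m. m \<ge> m0 \<Longrightarrow> 1 / 2 \<le> (\<Sum>xs\<in>{xs\<in>words_of_length C m.
    real m * (mean f - 1) \<le> sum_list (map f xs) \<and> real m * (mean s - 1) \<le> sum_list (map s xs)}. wt xs)"
    using typical_words[of 1 f s] by auto
  show ?thesis
  proof (intro exI[of _ m0] allI impI)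
    fix m assume m: "m \<ge> m0"
    define Typ where "Typ = {xs\<in>words_of_length C m.
      real m * (mean f - 1) \<le> sum_list (map f xs) \<and> real m * (mean s - 1) \<le> sum_list (map s xs)}"
    have finT: "finite Typ" unfolding Typ_def using finite_A by simp
    have TypC: "set ys \<subseteq> C" "length ys = m" if "ys \<in> Typ" for ys
      using that by (auto simp: Typ_def words_of_length_def)
    define A where "A = (\<Union>ys\<in>Typ. cyl (cat_words W ys))"
    have cE: "cat_words W ys \<in> lists E" if "ys \<in> Typ" for ys by (rule cat_words_in[OF W TypC(1)[OF that]])
    have A: "A \<in> sets M" unfolding A_def using finT cE by (intro sets.finite_UN cyl_sets) auto
    have lb: "m * n \<le> len (cat_words W ys) \<and> len (cat_words W ys) \<le> m * (n + 2 * K)" if "set ys \<subseteq> C" "length ys = m" for ys m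
      using that
    proof (induction ys arbitrary: m)
      case (Cons y ys)
      then have "length ys * n \<le> len (cat_words W ys) \<and> len (cat_words W ys) \<le> length ys * (n + 2 * K)" by auto
      moreover have "n \<le> len (W y) \<and> len (W y) \<le> n + 2 * K" using len Cons.prems by auto
      ultimately show ?case using Cons.prems by (auto simp: algebra_simps)
    qed simp
    have sub: "A \<subseteq> {x\<in>space M. \<exists>k. m * n \<le> k \<and> k \<le> m * (n + 2 * K) \<and> real m * (mean s - 1) \<le> S k (x, 0)}"
    proof
      fix x assume "x \<in> A"
      then obtain ys where ys: "ys \<in> Typ" "x \<in> cyl (cat_words W ys)" by (auto simp: A_def)
      have "real m * (mean s - 1) \<le> sum_list (map s ys)" using ys(1) by (auto simp: Typ_def)
      also have "\<dots> \<le> S (len (cat_words W ys)) (x, 0)" by (rule S_cat_words[OF W s TypC(1)[OF ys(1)] ys(2)])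
      finally show "x \<in> {x\<in>space M. \<exists>k. m * n \<le> k \<and> k \<le> m * (n + 2 * K) \<and> real m * (mean s - 1) \<le> S k (x, 0)}"
        using lb[OF TypC[OF ys(1)]] ys cyl_sub[OF cE[OF ys(1)]] by blast
    qed
    let ?mX = "measure M (space M)"
    let ?q = "\<lambda>y. measure M (cyl (W y)) / (D\<^sup>2 * ?mX)"
    have qp: "?q y = real K * p y * exp (f y)" if y: "y \<in> C" for y
    proof -
      have pos: "measure M (cyl (W y)) > 0" "p y > 0" using measure_cyl_pos[OF W[OF y]] p_pos[OF y] by auto
      then have "exp (f y) = measure M (cyl (W y)) / (D\<^sup>2 * ?mX * real K * p y)"
        using f[OF y] D_pos space_M_pos K by simp
      then show ?thesis using pos K by (simp add: field_simps)
    qed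
    have prod: "prod_list (map ?q ys) = real K ^ length ys * wt ys * exp (sum_list (map f ys))" if "set ys \<subseteq> C" for ys
      using that
    proof (induction ys)
      case (Cons y ys)
      have "prod_list (map ?q (y # ys)) = ?q y * prod_list (map ?q ys)" by simp
      also have "\<dots> = (real K * p y * exp (f y)) * (real K ^ length ys * wt ys * exp (sum_list (map f ys)))"
        using Cons qp[of y] by simp
      finally show ?case by (simp add: exp_add algebra_simps)
    qed simp
    have "real K ^ m * (?mX / 2 * exp (real m * (mean f - 1)))
        = real K ^ m * ?mX * exp (real m * (mean f - 1)) * (1 / 2)" by simp
    also have "\<dots> \<le> real K ^ m * ?mX * exp (real m * (mean f - 1)) * (\<Sum>ys\<in>Typ. wt ys)"
      unfolding Typ_def by (intro mult_left_mono m0[OF m]) auto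
    also have "\<dots> = (\<Sum>ys\<in>Typ. ?mX * (real K ^ m * wt ys * exp (real m * (mean f - 1))))"
      by (subst sum_distrib_left) (intro sum.cong refl; simp only: mult_ac)
    also have "\<dots> \<le> (\<Sum>ys\<in>Typ. ?mX * prod_list (map ?q ys))"
    proof (intro sum_mono mult_left_mono)
      fix ys assume ys: "ys \<in> Typ"
      have "0 < wt ys" using ys by (intro wt_pos[of _ m]) (auto simp: Typ_def)
      then show "real K ^ m * wt ys * exp (real m * (mean f - 1)) \<le> prod_list (map ?q ys)"
        unfolding prod[OF TypC(1)[OF ys]] TypC(2)[OF ys]
        using ys by (intro mult_left_mono) (auto simp: Typ_def)
    qed auto
    also have "\<dots> \<le> (\<Sum>ys\<in>Typ. measure M (cyl (cat_words W ys)))"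
      by (intro sum_mono measure_cat_words[OF W TypC(1)])
    also have "\<dots> = (\<Sum>ys\<in>Typ. (\<integral>x. indicator (cyl (cat_words W ys)) x \<partial>M))"
    proof (intro sum.cong refl)
      fix ys assume "ys \<in> Typ"
      then show "measure M (cyl (cat_words W ys)) = (\<integral>x. indicator (cyl (cat_words W ys)) x \<partial>M)"
        using cyl_sub[OF cE] by (simp add: Int_absorb2)
    qed
    also have "\<dots> = (\<integral>x. (\<Sum>ys\<in>Typ. indicator (cyl (cat_words W ys)) x) \<partial>M)"
      using cE by (intro Bochner_Integration.integral_sum[symmetric] integrable_real_indicator cyl_sets)
        (auto simp: emeasure_eq_measure)
    \<comment> \<open>A point of the union is counted at most K^m times; this is the factor with
      which the chain of inequalities started.\<close>
    also have "\<dots> \<le> (\<integral>x. real K ^ m * indicator A x \<partial>M)"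
    proof (rule integral_mono)
      show "integrable M (\<lambda>x. \<Sum>ys\<in>Typ. indicator (cyl (cat_words W ys)) x :: real)"
        using cE by (intro Bochner_Integration.integrable_sum integrable_real_indicator cyl_sets)
          (auto simp: emeasure_eq_measure)
      show "integrable M (\<lambda>x. real K ^ m * indicator A x)"
        using A by (intro integrable_mult_right integrable_real_indicator) (auto simp: emeasure_eq_measure)
      fix x assume x: "x \<in> space M"
      show "(\<Sum>ys\<in>Typ. indicator (cyl (cat_words W ys)) x) \<le> real K ^ m * indicator A x"
      proof (cases "x \<in> A")
        case True
        have "(\<Sum>ys\<in>Typ. indicator (cyl (cat_words W ys)) x)
            \<le> (\<Sum>ys\<in>words_of_length C m. indicator (cyl (cat_words W ys)) x :: real)"
          using finite_A by (intro sum_mono2) (auto simp: Typ_def)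
        also have "\<dots> \<le> real K ^ m" by (rule multiplicity_cat_words[OF finite_A W mult x])
        finally show ?thesis using True by simp
      next
        case False
        then have "x \<notin> cyl (cat_words W ys)" if "ys \<in> Typ" for ys using that by (auto simp: A_def)
        then show ?thesis using False by simp
      qed
    qed
    also have "\<dots> = real K ^ m * measure M A" using sets.sets_into_space[OF A] by (simp add: Int_absorb2)
    finally have "?mX / 2 * exp (real m * (mean f - 1)) \<le> measure M A" using K by simp
    then show "\<exists>A\<in>sets M.
      A \<subseteq> {x\<in>space M. \<exists>k. m * n \<le> k \<and> k \<le> m * (n + 2 * K) \<and> real m * (mean s - 1) \<le> S k (x, 0)} \<and>
      ?mX / 2 * exp (real m * (mean f - 1)) \<le> measure M A"
      using A sub by blast
  qed
qed

end

section \<open>Return words from the orbit segments of an invariant measure\<close>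

locale tower_inv_ob = tower_ob + tower_inv
begin

lemma climb_base: "x \<in> X k \<Longrightarrow> (T ^^ k) (x, 0) = (x, k)"
proof (induction k)
  case (Suc k)
  then show ?case using X_Suc[of k] by (auto simp: T_up)
qed simp

text \<open>The orbit is followed for K steps beyond the segment. It is then at a level below K, so
  its last return happened strictly after the end of the segment.\<close>

lemma extend_to_word:
  assumes "(x, k) \<in> G K"
  shows "\<exists>w\<in>lists E. x \<in> cyl w \<and> n + k < len w \<and> len w \<le> n + k + K"
proof -
  have xk: "x \<in> X k" using G_Z[OF assms] by (simp add: Z_iff)
  then have x: "x \<in> space M" using X_antimono[of 0 k] by auto
  obtain w k' where w: "w \<in> lists E" "len w + k' = k + (n + K)" "x \<in> cyl w"
    "(T ^^ (k + (n + K))) (x, 0) = (ret w x, k')"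
    using parse[OF x, of "k + (n + K)"] by blast
  have "(T ^^ (k + (n + K))) (x, 0) = (T ^^ (n + K)) (x, k)"
    using climb_base[OF xk] by (subst add.commute) (simp add: funpow_add)
  then have "(ret w x, k') \<in> G K" using G_T[OF assms, of "n + K"] w(4) by simp
  then have "snd ((T ^^ 0) (ret w x, k')) < K" unfolding G_def by blast
  then have "k' < K" by simp
  then show ?thesis using w by (intro bexI[of _ w]) auto
qed

lemma integral_birkhoff:
  fixes h :: "'a \<times> nat \<Rightarrow> real"
  assumes "integrable \<nu> h"
  shows "integrable \<nu> (\<lambda>z. \<Sum>i<n. h ((T ^^ i) z))" "(\<integral>z. (\<Sum>i<n. h ((T ^^ i) z)) \<partial>\<nu>) = real n * (\<integral>z. h z \<partial>\<nu>)"
proof -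
  have i: "integrable \<nu> (\<lambda>z. h ((T ^^ i) z))" for i
  proof -
    have "integrable (distr \<nu> \<nu> (T ^^ i)) h" unfolding funpow_inv by (rule assms)
    from integrable_distr[OF funpow_meas this] show ?thesis .
  qed
  have e: "(\<integral>z. h ((T ^^ i) z) \<partial>\<nu>) = (\<integral>z. h z \<partial>\<nu>)" for i
    using integral_distr[OF funpow_meas borel_measurable_integrable[OF assms], of i]
    unfolding funpow_inv by simp
  show "integrable \<nu> (\<lambda>z. \<Sum>i<n. h ((T ^^ i) z))" using i by simp
  show "(\<integral>z. (\<Sum>i<n. h ((T ^^ i) z)) \<partial>\<nu>) = real n * (\<integral>z. h z \<partial>\<nu>)"
    using i by (simp add: Bochner_Integration.integral_sum e)
qed

lemma \<psi>_integrable: "integrable \<nu> \<psi>"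
proof (rule integrable_const_bound[of _ B])
  show "AE z in \<nu>. norm (\<psi> z) \<le> B" using B(2) by (intro AE_I2) simp
  show "\<psi> \<in> borel_measurable \<nu>" using \<psi>_meas by (simp add: measurable_cong_sets[OF sets_\<nu> refl])
qed

text \<open>Itineraries of probability zero are dropped: the weights have to be positive, and each
  remaining itinerary is realised by a point of \<open>G K\<close>.\<close>

definition Cyls :: "nat \<Rightarrow> ('a \<times> nat) set list set" where
  "Cyls n = {l\<in>itin T symK n ` space \<nu>. 0 < measure \<nu> (itin T symK n -` {l} \<inter> space \<nu>)}"

abbreviation prb :: "nat \<Rightarrow> ('a \<times> nat) set list \<Rightarrow> real" where
  "prb n l \<equiv> measure \<nu> (itin T symK n -` {l} \<inter> space \<nu>)"

lemma finite_Cyls: "finite (Cyls n)"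
  using simple_functionD(1)[OF simple_function_itin[OF symK_simple], of n] by (simp add: Cyls_def)

lemma sum_Cyls: "(\<Sum>l\<in>Cyls n. prb n l * \<phi> l) = (\<integral>z. \<phi> (itin T symK n z) \<partial>\<nu>)"
  unfolding integral_simple_comp(2)[OF finite_measure_axioms simple_function_itin[OF symK_simple]]
  by (rule sum.mono_neutral_left)
    (use simple_functionD(1)[OF simple_function_itin[OF symK_simple], of n] in \<open>auto simp: Cyls_def zero_less_measure_iff\<close>)

lemma Cyls_mean_ge:
  assumes "integrable \<nu> h" "\<And>z. z \<in> G K \<Longrightarrow> code n z \<in> Cyls n \<Longrightarrow> h z \<le> \<phi> (code n z)"
  shows "(\<integral>z. h z \<partial>\<nu>) \<le> (\<Sum>l\<in>Cyls n. prb n l * \<phi> l)"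
proof -
  have fin: "finite (itin T symK n ` space \<nu>)" by (rule simple_functionD(1)[OF simple_function_itin[OF symK_simple]])
  have "AE z in \<nu>. itin T symK n z \<in> Cyls n"
  proof -
    have "AE z in \<nu>. \<forall>l\<in>itin T symK n ` space \<nu> - Cyls n. itin T symK n z \<noteq> l"
    proof (subst AE_finite_all)
      show "finite (itin T symK n ` space \<nu> - Cyls n)" using fin by simp
      show "\<forall>l\<in>itin T symK n ` space \<nu> - Cyls n. AE z in \<nu>. itin T symK n z \<noteq> l"
      proof
        fix l assume l: "l \<in> itin T symK n ` space \<nu> - Cyls n"
        then have 0: "prb n l = 0" by (auto simp: Cyls_def zero_less_measure_iff)
        have "itin T symK n -` {l} \<inter> space \<nu> \<in> null_sets \<nu>"
          using 0 simple_functionD(2)[OF simple_function_itin[OF symK_simple], of n "{l}"]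
          by (auto simp: null_sets_def emeasure_eq_measure)
        then show "AE z in \<nu>. itin T symK n z \<noteq> l" by (rule AE_I'[of _]) auto
      qed
    qed
    with AE_space show ?thesis by eventually_elim auto
  qed
  with AE_G have "AE z in \<nu>. h z \<le> \<phi> (itin T symK n z)"
    by eventually_elim (use assms(2) itin_symK in auto)
  then have "(\<integral>z. h z \<partial>\<nu>) \<le> (\<integral>z. \<phi> (itin T symK n z) \<partial>\<nu>)"
    by (intro integral_mono_AE assms(1) integral_simple_comp(1)[OF finite_measure_axioms simple_function_itin[OF symK_simple]])
  then show ?thesis unfolding sum_Cyls .
qed

lemma prob_weights_Cyls: "prob_weights (Cyls n) (prb n)"
proof
  show "(\<Sum>l\<in>Cyls n. prb n l) = 1" using sum_Cyls[of n "\<lambda>_. 1"] prob_space by simp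
qed (simp add: finite_Cyls, simp add: Cyls_def)

lemma fin_ent_Cyls: "fin_ent \<nu> (itin T symK n) = - (\<Sum>l\<in>Cyls n. prb n l * ln (prb n l))"
  unfolding sum_Cyls
  by (rule fin_ent_integral[OF finite_measure_axioms simple_function_itin[OF symK_simple]])

lemma Cyls_point:
  assumes "l \<in> Cyls n"
  shows "\<exists>z\<in>G K. code n z = l"
proof (rule ccontr)
  assume "\<not> ?thesis"
  then have "AE z in \<nu>. z \<notin> itin T symK n -` {l} \<inter> space \<nu>"
    using AE_G by (auto elim!: eventually_mono simp: itin_symK)
  then have "prb n l = 0"
    using simple_functionD(2)[OF simple_function_itin[OF symK_simple], of n "{l}"]
    by (subst prob_eq_0) auto
  then show False using assms by (simp add: Cyls_def)
qed

lemma sum_ln_Jac: "z \<in> Z \<Longrightarrow> ln (jprod n z) = (\<Sum>i<n. ln (Jac ((T ^^ i) z)))"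
proof -
  assume "z \<in> Z"
  then have "Jac ((T ^^ i) z) > 0" for i by (intro Jac_pos funpow_T_Z)
  then show ?thesis unfolding jprod_def by (subst ln_prod) (auto simp: less_le)
qed

text \<open>A point of \<open>G K\<close> is chosen for each segment, its climb from the base is
  prepended and its orbit is completed to a return. Both additions take at most K steps, whence the
  errors 2 K B and 2 K C. Oscillation enters twice, from the cylinder to the chosen point and from
  there to z; so does \<open>D\<close>, for the Jacobian product and for the mass of the
  cylinder.\<close>

lemma word_estimates:
  assumes n: "n \<ge> 1" and \<delta>: "\<delta> > 0"
    and osc: "\<And>n z w. z \<in> Z \<Longrightarrow> w \<in> Z \<Longrightarrow> code n z = code n w \<Longrightarrow> \<bar>S n z - S n w\<bar> \<le> real n * \<delta> + c"
    and C: "\<And>z. z \<in> Z \<Longrightarrow> snd z < K \<Longrightarrow> \<bar>ln (Jac z)\<bar> \<le> C"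
  obtains W s where
    "\<And>l. l \<in> Cyls n \<Longrightarrow> W l \<in> lists E"
    "\<And>l. l \<in> Cyls n \<Longrightarrow> n \<le> len (W l) \<and> len (W l) \<le> n + 2 * K"
    "\<And>x. x \<in> space M \<Longrightarrow> card {l\<in>Cyls n. x \<in> cyl (W l)} \<le> K"
    "\<And>l x. l \<in> Cyls n \<Longrightarrow> x \<in> cyl (W l) \<Longrightarrow> s l \<le> S (len (W l)) (x, 0)"
    "\<And>z. z \<in> G K \<Longrightarrow> code n z \<in> Cyls n \<Longrightarrow> S n z - 2 * (real n * \<delta> + c) - 2 * real K * B \<le> s (code n z)"
    "\<And>z. z \<in> G K \<Longrightarrow> code n z \<in> Cyls n \<Longrightarrow>
      ln (measure M (space M)) - 2 * ln D - 2 * real K * C - (\<Sum>i<n. lj ((T ^^ i) z)) \<le> ln (measure M (cyl (W (code n z))))"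
proof -
  have "\<forall>l\<in>Cyls n. \<exists>p. p \<in> G K \<and> code n p = l" using Cyls_point by blast
  from bchoice[OF this] obtain zc where zc: "\<And>l. l \<in> Cyls n \<Longrightarrow> zc l \<in> G K" "\<And>l. l \<in> Cyls n \<Longrightarrow> code n (zc l) = l"
    by blast
  have "\<forall>l\<in>Cyls n. \<exists>w. w \<in> lists E \<and> fst (zc l) \<in> cyl w \<and> n + snd (zc l) < len w \<and> len w \<le> n + snd (zc l) + K"
    using extend_to_word zc(1) by (metis prod.collapse)
  from bchoice[OF this] obtain W where W: "\<And>l. l \<in> Cyls n \<Longrightarrow>
    W l \<in> lists E \<and> fst (zc l) \<in> cyl (W l) \<and> n + snd (zc l) < len (W l) \<and> len (W l) \<le> n + snd (zc l) + K"
    by blast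
  have kK: "snd (zc l) < K" if "l \<in> Cyls n" for l
  proof -
    have "snd ((T ^^ 0) (zc l)) < K" using zc(1)[OF that] unfolding G_def by blast
    then show ?thesis by simp
  qed
  have zcZ: "zc l \<in> Z" if "l \<in> Cyls n" for l using zc(1)[OF that] by (rule G_Z)
  have climbx: "(T ^^ snd (zc l)) (fst (zc l), 0) = zc l" if "l \<in> Cyls n" for l
    using climb_base[of "fst (zc l)" "snd (zc l)"] zcZ[OF that] by (cases "zc l") (simp add: Z_iff)
  \<comment> \<open>All points of the cylinder make the same climb as the chosen point and have code
    l when they reach its level. A point and a starting level thus determine l, so at most K words
    cover a point.\<close>
  have key: "(T ^^ snd (zc l)) (x, 0) = (x, snd (zc l)) \<and> (x, snd (zc l)) \<in> Z \<and> code n (x, snd (zc l)) = l"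
    if l: "l \<in> Cyls n" and x: "x \<in> cyl (W l)" for l x
  proof -
    let ?k = "snd (zc l)" and ?y = "fst (zc l)"
    have x0: "(x, 0) \<in> Z" using cyl_sub[of "W l"] W[OF l] x by (auto simp: Z_iff)
    have y0: "(?y, 0) \<in> Z" using cyl_sub[of "W l"] W[OF l] by (auto simp: Z_iff)
    have "code (len (W l)) (x, 0) = code (len (W l)) (?y, 0)"
      using W[OF l] x by (intro code_cyl) auto
    then have "take (?k + n) (code (len (W l)) (x, 0)) = take (?k + n) (code (len (W l)) (?y, 0))" by simp
    then have c: "code (?k + n) (x, 0) = code (?k + n) (?y, 0)" using W[OF l] by (simp add: take_itin)
    then have "sym ((T ^^ ?k) (x, 0)) = sym ((T ^^ ?k) (?y, 0))" using n by (simp add: itin_eq_iff)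
    then have "snd ((T ^^ ?k) (x, 0)) = snd ((T ^^ ?k) (?y, 0))"
      by (intro level_of_sym funpow_T_Z x0 y0)
    then have xk: "(T ^^ ?k) (x, 0) = (x, ?k)" using funpow_T_level(2)[OF x0, of ?k] climbx[OF l] by simp
    have "code n ((T ^^ ?k) (x, 0)) = code n ((T ^^ ?k) (?y, 0))" using c by (simp add: itin_add)
    then have "code n (x, ?k) = l" using xk climbx[OF l] zc(2)[OF l] by simp
    moreover have "(x, ?k) \<in> Z" using funpow_T_Z[OF x0, of ?k] xk by simp
    ultimately show ?thesis using xk by blast
  qed
  define s where "s l = S n (zc l) - (real n * \<delta> + c) - 2 * real K * B" for l
  show thesis
  proof (rule that[of W s])
    show "W l \<in> lists E" if "l \<in> Cyls n" for l using W[OF that] by blast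
    show "n \<le> len (W l) \<and> len (W l) \<le> n + 2 * K" if "l \<in> Cyls n" for l using W[OF that] kK[OF that] by auto
    show "card {l\<in>Cyls n. x \<in> cyl (W l)} \<le> K" if "x \<in> space M" for x
    proof -
      have "inj_on (\<lambda>l. snd (zc l)) {l\<in>Cyls n. x \<in> cyl (W l)}"
      proof (rule inj_onI)
        fix l l' assume l: "l \<in> {l\<in>Cyls n. x \<in> cyl (W l)}" "l' \<in> {l\<in>Cyls n. x \<in> cyl (W l)}"
          "snd (zc l) = snd (zc l')"
        have "code n (x, snd (zc l)) = l" using key[of l x] l(1) by blast
        moreover have "code n (x, snd (zc l')) = l'" using key[of l' x] l(2) by blast
        ultimately show "l = l'" unfolding l(3) by (rule trans[OF sym])
      qed
      then have "card {l\<in>Cyls n. x \<in> cyl (W l)} \<le> card {..<K}"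
        by (rule card_inj_on_le) (use kK in auto)
      then show ?thesis by simp
    qed
    show "s l \<le> S (len (W l)) (x, 0)" if l: "l \<in> Cyls n" and x: "x \<in> cyl (W l)" for l x
    proof -
      let ?k = "snd (zc l)" and ?r = "len (W l) - n - snd (zc l)"
      note k = key[OF l x]
      have x0: "(x, 0) \<in> Z" using cyl_sub[of "W l"] W[OF l] x by (auto simp: Z_iff)
      have len: "len (W l) = ?k + (n + ?r)" and r: "?r \<le> K" using W[OF l] by auto
      have "S (len (W l)) (x, 0) = S ?k (x, 0) + S n (x, ?k) + S ?r ((T ^^ n) (x, ?k))"
        using k by (subst len) (simp only: S_add)
      moreover have "\<bar>S ?k (x, 0)\<bar> \<le> real K * B"
        using S_bound[OF x0, of ?k] mult_right_mono[of "real ?k" "real K" B] kK[OF l] B(1) by linarith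
      moreover have "\<bar>S ?r ((T ^^ n) (x, ?k))\<bar> \<le> real K * B"
        using S_bound[OF funpow_T_Z, of "(x, ?k)" ?r n] k mult_right_mono[of "real ?r" "real K" B] r B(1) by linarith
      moreover have "\<bar>S n (x, ?k) - S n (zc l)\<bar> \<le> real n * \<delta> + c"
        using k zc(2)[OF l] zcZ[OF l] by (intro osc) auto
      ultimately show ?thesis unfolding s_def by linarith
    qed
    fix z assume z: "z \<in> G K" "code n z \<in> Cyls n"
    let ?l = "code n z"
    let ?w = "zc ?l"
    show "S n z - 2 * (real n * \<delta> + c) - 2 * real K * B \<le> s ?l"
    proof -
      have "S n z - S n (zc (code n z)) \<le> real n * \<delta> + c"
        using osc[OF G_Z[OF z(1)] zcZ[OF z(2)] zc(2)[OF z(2), symmetric]] unfolding abs_le_iff by blast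
      then show ?thesis unfolding s_def by (simp add: algebra_simps)
    qed
    let ?k = "snd ?w" and ?y = "fst ?w"
    let ?r = "len (W ?l) - n - ?k"
    note Wl = W[OF z(2)]
    have y0: "(?y, 0) \<in> Z" using cyl_sub[of "W ?l"] Wl by (auto simp: Z_iff)
    have len: "len (W ?l) = ?k + (n + ?r)" and r: "?r \<le> K" using Wl by auto
    have C0: "C \<ge> 0" using C[OF zcZ[OF z(2)] kK[OF z(2)]] by linarith
    have "jprod (len (W ?l)) (?y, 0) = jprod ?k (?y, 0) * jprod n ?w * jprod ?r ((T ^^ n) ?w)"
      by (subst len) (simp only: jprod_add climbx[OF z(2)] mult.assoc)
    then have lnj: "ln (jprod (len (W ?l)) (?y, 0)) = ln (jprod ?k (?y, 0)) + ln (jprod n ?w) + ln (jprod ?r ((T ^^ n) ?w))"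
      by (simp only:) (intro ln_mult3 jprod_pos y0 zcZ z(2) funpow_T_Z)
    have "ln (jprod ?k (?y, 0)) \<le> (\<Sum>i<?k. C)"
      unfolding sum_ln_Jac[OF y0]
    proof (intro sum_mono)
      fix i assume i: "i \<in> {..<?k}"
      have "snd ((T ^^ i) (?y, 0)) < K" using funpow_T_level(1)[OF y0, of i] i kK[OF z(2)] by simp
      then show "ln (Jac ((T ^^ i) (?y, 0))) \<le> C" using C[OF funpow_T_Z[OF y0, of i]] by linarith
    qed
    also have "\<dots> \<le> real K * C" using kK[OF z(2)] C0 by (simp add: mult_right_mono)
    finally have b1: "ln (jprod ?k (?y, 0)) \<le> real K * C" .
    have "ln (jprod ?r ((T ^^ n) ?w)) \<le> (\<Sum>i<?r. C)"
      unfolding sum_ln_Jac[OF funpow_T_Z[OF zcZ[OF z(2)]]]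
    proof (intro sum_mono)
      fix i assume i: "i \<in> {..<?r}"
      have g: "(T ^^ i) ((T ^^ n) ?w) \<in> G K" by (intro G_T zc(1) z(2))
      then have "snd ((T ^^ 0) ((T ^^ i) ((T ^^ n) ?w))) < K" unfolding G_def by blast
      then show "ln (Jac ((T ^^ i) ((T ^^ n) ?w))) \<le> C" using C[OF G_Z[OF g]] by simp
    qed
    also have "\<dots> \<le> real K * C" using r C0 by (simp add: mult_right_mono)
    finally have b2: "ln (jprod ?r ((T ^^ n) ?w)) \<le> real K * C" .
    have "jprod n ?w \<le> D * jprod n z"
      using zc(2)[OF z(2)] by (intro distortion_code zcZ z(2) G_Z[OF z(1)]) auto
    then have "ln (jprod n ?w) \<le> ln (D * jprod n z)"
      using jprod_pos[OF zcZ[OF z(2)], of n] by (intro ln_mono) auto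
    also have "\<dots> = ln D + ln (jprod n z)" using jprod_pos[OF G_Z[OF z(1)], of n] D_pos by (simp add: ln_mult)
    also have "ln (jprod n z) = (\<Sum>i<n. lj ((T ^^ i) z))"
      unfolding sum_ln_Jac[OF G_Z[OF z(1)]]
    proof (intro sum.cong refl)
      fix i
      have "(T ^^ i) z \<in> Rec" using G_sub_Rec G_T[OF z(1)] by blast
      then show "ln (Jac ((T ^^ i) z)) = lj ((T ^^ i) z)" by (simp add: lj_def)
    qed
    finally have b3: "ln (jprod n ?w) \<le> ln D + (\<Sum>i<n. lj ((T ^^ i) z))" .
    have WE: "W ?l \<in> lists E" and yc: "?y \<in> cyl (W ?l)" using Wl by auto
    have "measure M (space M) \<le> D * jprod (len (W ?l)) (?y, 0) * measure M (cyl (W ?l))"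
      using measure_pre_bounds(1)[OF WE yc sets.top] by (simp add: pre_space[OF WE])
    then have "ln (measure M (space M)) \<le> ln (D * jprod (len (W ?l)) (?y, 0) * measure M (cyl (W ?l)))"
      using space_M_pos by (intro ln_mono) auto
    also have "\<dots> = ln D + ln (jprod (len (W ?l)) (?y, 0)) + ln (measure M (cyl (W ?l)))"
      using D_pos jprod_pos[OF y0, of "len (W ?l)"] measure_cyl_pos[OF WE] by (simp add: ln_mult)
    finally show "ln (measure M (space M)) - 2 * ln D - 2 * real K * C - (\<Sum>i<n. lj ((T ^^ i) z)) \<le> ln (measure M (cyl (W ?l)))"
      using lnj b1 b2 b3 by linarith
  qed
qed

theorem lower_bound:
  assumes a: "a < (\<integral>z. \<psi> z \<partial>\<nu>)" and \<eta>: "\<eta> > 0"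
  shows "\<forall>\<^sub>F n in sequentially. exp (real n * (ent_rate symK - (\<integral>z. lj z \<partial>\<nu>) - \<eta>))
    \<le> measure M {x\<in>space M. 1 / real n * S n (x, 0) > a}"
proof -
  define J where "J = (\<integral>z. \<psi> z \<partial>\<nu>)"
  define F where "F = ent_rate symK - (\<integral>z. lj z \<partial>\<nu>)"
  \<comment> \<open>The averages are aimed at \<open>a'\<close>, midway between a and J. Oscillation
    takes 2 b \<delta>, which is half of the gap from \<open>a'\<close> to J for a block of length
    b; the other half is left for the constants in \<open>C2\<close>.\<close>
  define \<delta> where "\<delta> = (J - a) / 8"
  have \<delta>: "\<delta> > 0" using a by (simp add: \<delta>_def J_def)
  obtain c where c: "c \<ge> 0" "\<And>n z w. z \<in> Z \<Longrightarrow> w \<in> Z \<Longrightarrow> code n z = code n w \<Longrightarrow> \<bar>S n z - S n w\<bar> \<le> real n * \<delta> + c"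
    using S_osc[OF \<delta>] by blast
  obtain C where C: "C \<ge> 0" "\<And>z. z \<in> Z \<Longrightarrow> snd z < K \<Longrightarrow> \<bar>ln (Jac z)\<bar> \<le> C"
    using ln_Jac_bounded by blast
  \<comment> \<open>\<open>C1\<close> and \<open>C2\<close> collect the costs per word that do not
    grow with the block length; b is chosen so large that they become negligible. The summands 1
    accompanying them are the deviation from the mean that typical words are allowed.\<close>
  define C1 where "C1 = 2 * ln D + 2 * real K * C + ln (D\<^sup>2 * real K)"
  define C2 where "C2 = 2 * c + 4 * real K * B + 1"
  obtain b0 :: nat where b0: "real b0 > max (2 * (C1 + 1) / \<eta>) (C2 / (2 * \<delta>))" using reals_Archimedean2 by blast
  define b where "b = max b0 1"
  have b: "b \<ge> 1" "real b \<ge> 2 * (C1 + 1) / \<eta>" "real b \<ge> C2 / (2 * \<delta>)" using b0 by (auto simp: b_def)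
  show ?thesis
  proof (rule word_estimates[where n = b and \<delta> = \<delta> and c = c and C = C, OF b(1) \<delta>])
    show "\<bar>S n z - S n w\<bar> \<le> real n * \<delta> + c" if "z \<in> Z" "w \<in> Z" "code n z = code n w" for n z w
      by (rule c(2)[OF that])
    show "\<bar>ln (Jac z)\<bar> \<le> C" if "z \<in> Z" "snd z < K" for z by (rule C(2)[OF that])
    fix W s
    assume W: "\<And>l. l \<in> Cyls b \<Longrightarrow> W l \<in> lists E"
      "\<And>l. l \<in> Cyls b \<Longrightarrow> b \<le> len (W l) \<and> len (W l) \<le> b + 2 * K"
      "\<And>x. x \<in> space M \<Longrightarrow> card {l\<in>Cyls b. x \<in> cyl (W l)} \<le> K"
    and s: "\<And>l x. l \<in> Cyls b \<Longrightarrow> x \<in> cyl (W l) \<Longrightarrow> s l \<le> S (len (W l)) (x, 0)"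
      "\<And>z. z \<in> G K \<Longrightarrow> code b z \<in> Cyls b \<Longrightarrow> S b z - 2 * (real b * \<delta> + c) - 2 * real K * B \<le> s (code b z)"
    and mW: "\<And>z. z \<in> G K \<Longrightarrow> code b z \<in> Cyls b \<Longrightarrow>
      ln (measure M (space M)) - 2 * ln D - 2 * real K * C - (\<Sum>i<b. lj ((T ^^ i) z)) \<le> ln (measure M (cyl (W (code b z))))"
  define f where "f l = ln (measure M (cyl (W l)) / (D\<^sup>2 * measure M (space M) * real K * prb b l))" for l
  interpret pw: prob_weights "Cyls b" "prb b" by (rule prob_weights_Cyls)
  let ?mX = "measure M (space M)"
  have Es: "real b * J - 2 * (real b * \<delta> + c) - 2 * real K * B \<le> (\<Sum>l\<in>Cyls b. prb b l * s l)"
  proof -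
    have "(\<integral>z. S b z - (2 * (real b * \<delta> + c) + 2 * real K * B) \<partial>\<nu>) \<le> (\<Sum>l\<in>Cyls b. prb b l * s l)"
      using integral_birkhoff(1)[OF \<psi>_integrable, of b] s(2)
      by (intro Cyls_mean_ge) (auto simp: birkhoff_sum_def algebra_simps)
    moreover have "(\<integral>z. S b z - (2 * (real b * \<delta> + c) + 2 * real K * B) \<partial>\<nu>)
        = real b * J - (2 * (real b * \<delta> + c) + 2 * real K * B)"
      using integral_birkhoff[OF \<psi>_integrable, of b] prob_space by (simp add: birkhoff_sum_def J_def)
    ultimately show ?thesis by linarith
  qed
  have Ef: "real b * F - C1 \<le> (\<Sum>l\<in>Cyls b. prb b l * f l)"
  proof -
    have "(\<integral>z. ln ?mX - 2 * ln D - 2 * real K * C - (\<Sum>i<b. lj ((T ^^ i) z)) \<partial>\<nu>)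
        \<le> (\<Sum>l\<in>Cyls b. prb b l * ln (measure M (cyl (W l))))"
      using integral_birkhoff(1)[OF lj_integrable, of b] mW by (intro Cyls_mean_ge) auto
    moreover have "(\<integral>z. ln ?mX - 2 * ln D - 2 * real K * C - (\<Sum>i<b. lj ((T ^^ i) z)) \<partial>\<nu>)
        = ln ?mX - 2 * ln D - 2 * real K * C - real b * (\<integral>z. lj z \<partial>\<nu>)"
      using integral_birkhoff[OF lj_integrable, of b] prob_space by simp
    moreover have "(\<Sum>l\<in>Cyls b. prb b l * f l)
        = (\<Sum>l\<in>Cyls b. prb b l * ln (measure M (cyl (W l))) - prb b l * ln (prb b l) - prb b l * ln (D\<^sup>2 * ?mX * real K))"
    proof (intro sum.cong refl)
      fix l assume l: "l \<in> Cyls b"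
      have "f l = ln (measure M (cyl (W l))) - ln (prb b l) - ln (D\<^sup>2 * ?mX * real K)"
        unfolding f_def using measure_cyl_pos[OF W(1)[OF l]] pw.p_pos[OF l] D_pos space_M_pos K_pos
        by (subst ln_div; (subst ln_mult)?) (auto simp: ln_mult)
      then show "prb b l * f l = prb b l * ln (measure M (cyl (W l))) - prb b l * ln (prb b l) - prb b l * ln (D\<^sup>2 * ?mX * real K)"
        by (simp only: right_diff_distrib)
    qed
    moreover have "\<dots> = (\<Sum>l\<in>Cyls b. prb b l * ln (measure M (cyl (W l)))) + fin_ent \<nu> (itin T symK b) - ln (D\<^sup>2 * ?mX * real K)"
      using pw.p_sum by (simp add: sum_subtractf fin_ent_Cyls sum_distrib_right[symmetric])
    moreover have "real b * ent_rate symK \<le> fin_ent \<nu> (itin T symK b)"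
      using ent_rate_le[OF symK_simple b(1)] b(1) by (simp add: field_simps)
    moreover have "ln (D\<^sup>2 * ?mX * real K) = ln (D\<^sup>2 * real K) + ln ?mX"
      using D_pos space_M_pos K_pos by (simp add: ln_mult)
    ultimately show ?thesis unfolding F_def C1_def by (simp add: algebra_simps)
  qed
  have "real b * \<eta> \<ge> 2 * (C1 + 1)" using b(2) \<eta> by (simp add: field_simps)
  then have Ef': "real b * (F - \<eta> / 2) \<le> (\<Sum>l\<in>Cyls b. prb b l * f l) - 1"
    using Ef by (simp add: algebra_simps)
  define a' where "a' = a + (J - a) / 2"
  have "real b * (2 * \<delta>) \<ge> C2" using b(3) \<delta> by (simp add: field_simps)
  \<comment> \<open>The term 2 K B pays for the mismatch of times: each of the m words is longer
    than b by at most 2 K steps.\<close>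
  then have Es': "real b * a' + 2 * real K * B \<le> (\<Sum>l\<in>Cyls b. prb b l * s l) - 1"
  proof -
    define t where "t = real b * (J - a)"
    have "real b * \<delta> = t / 8" "real b * a' = real b * a + t / 2" "real b * J = real b * a + t"
      by (simp_all add: t_def \<delta>_def a'_def algebra_simps)
    moreover have "C2 \<le> 2 * (real b * \<delta>)" using \<open>real b * (2 * \<delta>) \<ge> C2\<close> by simp
    moreover have "2 * real K * B = 2 * (real K * B)" "4 * real K * B = 4 * (real K * B)" by simp_all
    ultimately show ?thesis using Es unfolding C2_def by (simp only:) (simp add: field_simps)
  qed
  obtain m0 where m0: "\<And>m. m \<ge> m0 \<Longrightarrow> \<exists>A\<in>sets M.
    A \<subseteq> {x\<in>space M. \<exists>k. m * b \<le> k \<and> k \<le> m * (b + 2 * K) \<and> real m * ((\<Sum>y\<in>Cyls b. prb b y * s y) - 1) \<le> S k (x, 0)} \<and>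
    ?mX / 2 * exp (real m * ((\<Sum>y\<in>Cyls b. prb b y * f y) - 1)) \<le> measure M A"
    using concatenation_bound[OF prob_weights_Cyls W K_pos s(1) f_def] by blast
  \<comment> \<open>Rounding n down to m b changes the time by less than b; \<open>c3\<close> bounds
    the effect of this on n a and on the Birkhoff sum.\<close>
  define c3 where "c3 = real b * \<bar>a\<bar> + B * real b"
  obtain n1 :: nat where n1: "real n1 > real b + c3 / (a' - a)" using reals_Archimedean2 by blast
  obtain n2 :: nat where n2: "real n2 > (real b * \<bar>F - \<eta> / 2\<bar> - ln (?mX / 2)) / (\<eta> / 2)" using reals_Archimedean2 by blast
  show ?thesis
  proof (rule eventually_sequentiallyI)
    fix n assume n: "n \<ge> max (max (b * (m0 + 1)) n1) (max n2 1)"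
    define m where "m = n div b"
    have mb: "m * b \<le> n" "n < m * b + b"
      unfolding m_def using b(1) div_mult_mod_eq[of n b] mod_less_divisor[of b n] by linarith+
    have "b * m0 \<le> n" using n by simp
    then have "m \<ge> m0" unfolding m_def using b(1) by (simp add: less_eq_div_iff_mult_less_eq mult.commute)
    then obtain A where A: "A \<in> sets M"
      "A \<subseteq> {x\<in>space M. \<exists>k. m * b \<le> k \<and> k \<le> m * (b + 2 * K) \<and> real m * ((\<Sum>y\<in>Cyls b. prb b y * s y) - 1) \<le> S k (x, 0)}"
      "?mX / 2 * exp (real m * ((\<Sum>y\<in>Cyls b. prb b y * f y) - 1)) \<le> measure M A"
      using m0 by blast
    have mbr: "real m * real b \<le> real n" "real n < real m * real b + real b"
      using mb by (metis of_nat_le_iff of_nat_mult, metis of_nat_add of_nat_less_iff of_nat_mult)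
    have A_sub: "A \<subseteq> {x\<in>space M. 1 / real n * S n (x, 0) > a}"
    proof
      fix x assume "x \<in> A"
      then obtain k where x: "x \<in> space M" and k: "m * b \<le> k" "k \<le> m * (b + 2 * K)"
        and Sk: "real m * ((\<Sum>y\<in>Cyls b. prb b y * s y) - 1) \<le> S k (x, 0)" using A(2) by blast
      have x0: "(x, 0) \<in> Z" using x by (simp add: Z_iff)
      have "real (m * b) \<le> real k" "real k \<le> real (m * (b + 2 * K))"
        using k by (simp_all only: of_nat_le_iff)
      then have kr: "real m * real b \<le> real k" "real k \<le> real m * real b + 2 * real K * real m"
        by (simp_all add: algebra_simps)
      have "\<bar>real n - real k\<bar> \<le> real b + 2 * real K * real m"
        using mbr kr unfolding abs_le_iff by (auto simp: mult_nonneg_nonneg)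
      then have "\<bar>S n (x, 0) - S k (x, 0)\<bar> \<le> (real b + 2 * real K * real m) * B"
        using S_diff[OF x0, of n k] mult_right_mono[OF _ B(1)] by (meson order_trans)
      moreover have "real m * (real b * a' + 2 * real K * B) \<le> real m * ((\<Sum>y\<in>Cyls b. prb b y * s y) - 1)"
        using Es' by (intro mult_left_mono) auto
      ultimately have "real m * real b * a' - real b * B \<le> S n (x, 0)"
        using Sk by (simp add: algebra_simps abs_le_iff)
      moreover have "real n * a < real m * real b * a' - real b * B"
      proof -
        have aa: "a' - a > 0" using a by (simp add: a'_def J_def)
        have "c3 / (a' - a) < real m * real b" using n1 n mbr by linarith
        then have "c3 < real m * real b * (a' - a)" using aa by (simp add: field_simps)
        moreover have "(real n - real m * real b) * a \<le> real b * \<bar>a\<bar>"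
        proof -
          have "(real n - real m * real b) * a \<le> (real n - real m * real b) * \<bar>a\<bar>" using mbr by (intro mult_left_mono) auto
          also have "\<dots> \<le> real b * \<bar>a\<bar>" using mbr by (intro mult_right_mono) auto
          finally show ?thesis .
        qed
        ultimately show ?thesis unfolding c3_def by (simp add: algebra_simps)
      qed
      ultimately have "real n * a < S n (x, 0)" by linarith
      then show "x \<in> {x\<in>space M. 1 / real n * S n (x, 0) > a}" using x n by (simp add: field_simps)
    qed
    have sets: "{x\<in>space M. 1 / real n * S n (x, 0) > a} \<in> sets M"
      by (rule S_base_sets[of "\<lambda>y. 1 / real n * y > a"]) measurable
    have "exp (real n * (F - \<eta>)) \<le> exp (ln (?mX / 2) + real m * (real b * (F - \<eta> / 2)))"
    proof -
      have "real n * (F - \<eta> / 2) - real b * \<bar>F - \<eta> / 2\<bar> \<le> real m * real b * (F - \<eta> / 2)"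
      proof -
        have "(real n - real m * real b) * (F - \<eta> / 2) \<le> (real n - real m * real b) * \<bar>F - \<eta> / 2\<bar>" using mbr by (intro mult_left_mono) auto
        also have "\<dots> \<le> real b * \<bar>F - \<eta> / 2\<bar>" using mbr by (intro mult_right_mono) auto
        finally show ?thesis by (simp add: algebra_simps)
      qed
      moreover have "real b * \<bar>F - \<eta> / 2\<bar> - ln (?mX / 2) \<le> real n * (\<eta> / 2)"
      proof -
        have "(real b * \<bar>F - \<eta> / 2\<bar> - ln (?mX / 2)) / (\<eta> / 2) \<le> real n" using n2 n by linarith
        then show ?thesis using \<eta> by (simp add: field_simps)
      qed
      ultimately show ?thesis by (simp add: algebra_simps)
    qed
    also have "\<dots> = ?mX / 2 * exp (real m * (real b * (F - \<eta> / 2)))"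
      using space_M_pos by (simp add: exp_add)
    also have "\<dots> \<le> ?mX / 2 * exp (real m * ((\<Sum>y\<in>Cyls b. prb b y * f y) - 1))"
      using Ef' by (intro mult_left_mono) (auto intro!: mult_left_mono)
    also have "\<dots> \<le> measure M A" by (rule A(3))
    also have "\<dots> \<le> measure M {x\<in>space M. 1 / real n * S n (x, 0) > a}"
      by (rule finite_measure.finite_measure_mono[OF finite_measure_M A_sub sets])
    finally show "exp (real n * (ent_rate symK - (\<integral>z. lj z \<partial>\<nu>) - \<eta>)) \<le> measure M {x\<in>space M. 1 / real n * S n (x, 0) > a}"
      unfolding F_def .
  qed
  qed
qed

end

subsection \<open>Mixtures and Bernoulli streams\<close>

lemma (in prob_weights) A_ne: "A \<noteq> {}"
  using p_sum by auto

lemma (in prob_weights) weights_pmf: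
  obtains P :: "'c pmf" where "\<And>x. pmf P x = (if x \<in> A then p x else 0)" "set_pmf P = A"
proof -
  let ?f = "\<lambda>x. if x \<in> A then p x else 0"
  have nn: "0 \<le> ?f x" for x using p_pos by (auto intro: less_imp_le)
  have "(\<integral>\<^sup>+x. ennreal (?f x) \<partial>count_space UNIV) = (\<Sum>x\<in>A. ennreal (?f x))"
    by (rule nn_integral_count_space'[OF finite_A]) auto
  also have "\<dots> = ennreal (\<Sum>x\<in>A. p x)" using p_pos by (subst sum_ennreal) (auto intro: less_imp_le)
  finally have 1: "(\<integral>\<^sup>+x. ennreal (?f x) \<partial>count_space UNIV) = 1" by (simp add: p_sum)
  show thesis
  proof (rule that[of "embed_pmf ?f"])
    show "pmf (embed_pmf ?f) x = ?f x" for x by (rule pmf_embed_pmf[OF nn 1])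
    show "set_pmf (embed_pmf ?f) = A"
      using p_pos by (subst set_embed_pmf[OF nn 1]) (auto simp: less_le)
  qed
qed

text \<open>The mixture is the bind of a distribution on the index set. Integrals of bounded
  functions of either sign are obtained from nonnegative ones by adding the constant C.\<close>

lemma (in prob_weights) mixture:
  fixes \<kappa> :: "'c \<Rightarrow> 'z measure"
  assumes \<kappa>: "\<And>i. i \<in> A \<Longrightarrow> prob_space (\<kappa> i)" "\<And>i. i \<in> A \<Longrightarrow> sets (\<kappa> i) = sets N0"
  obtains \<nu> where "sets \<nu> = sets N0" "prob_space \<nu>"
    "\<And>B. B \<in> sets N0 \<Longrightarrow> measure \<nu> B = (\<Sum>i\<in>A. p i * measure (\<kappa> i) B)"
    "\<And>f C. f \<in> borel_measurable N0 \<Longrightarrow> (\<And>z. z \<in> space N0 \<Longrightarrow> \<bar>f z\<bar> \<le> C) \<Longrightarrow>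
      (\<integral>z. f z \<partial>\<nu>) = (\<Sum>i\<in>A. p i * (\<integral>z. f z \<partial>\<kappa> i) :: real)"
proof -
  obtain P :: "'c pmf" where P: "\<And>x. pmf P x = (if x \<in> A then p x else 0)" "set_pmf P = A"
    using weights_pmf by blast
  obtain i0 where i0: "i0 \<in> A" using A_ne by blast
  \<comment> \<open>A kernel must give a probability measure for every index of the type, so indices
    outside \<open>A\<close> get a default member.\<close>
  define k where "k i = (if i \<in> A then \<kappa> i else \<kappa> i0)" for i
  have k: "prob_space (k i)" "sets (k i) = sets N0" for i using \<kappa> i0 by (auto simp: k_def)
  have km: "k \<in> measure_pmf P \<rightarrow>\<^sub>M subprob_algebra N0"
    using k by (auto simp: space_subprob_algebra prob_space_imp_subprob_space)
  define \<nu> where "\<nu> = measure_pmf P \<bind> k"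
  have sets: "sets \<nu> = sets N0" unfolding \<nu>_def by (rule sets_bind) (auto simp: k)
  have space: "space \<nu> = space N0" "space (\<kappa> i) = space N0" if "i \<in> A" for i
    using sets \<kappa>(2)[OF that] by (auto dest: sets_eq_imp_space_eq)
  have nn: "(\<integral>\<^sup>+z. f z \<partial>\<nu>) = (\<Sum>i\<in>A. ennreal (p i) * (\<integral>\<^sup>+z. f z \<partial>\<kappa> i))" if "f \<in> borel_measurable N0" for f
  proof -
    have "(\<integral>\<^sup>+z. f z \<partial>\<nu>) = (\<integral>\<^sup>+i. (\<integral>\<^sup>+z. f z \<partial>k i) \<partial>measure_pmf P)"
      unfolding \<nu>_def by (rule nn_integral_bind[OF that km])
    also have "\<dots> = (\<Sum>i\<in>A. (\<integral>\<^sup>+z. f z \<partial>k i) * ennreal (pmf P i))"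
      using nn_integral_measure_pmf_finite[of P] finite_A P(2) by simp
    finally show ?thesis by (simp add: P(1) k_def mult.commute)
  qed
  have em: "emeasure \<nu> B = (\<Sum>i\<in>A. ennreal (p i) * emeasure (\<kappa> i) B)" if B: "B \<in> sets N0" for B
    using nn[of "indicator B"] B sets \<kappa>(2) by (simp cong: sum.cong)
  have "emeasure \<nu> (space \<nu>) = (\<Sum>i\<in>A. ennreal (p i) * emeasure (\<kappa> i) (space (\<kappa> i)))"
    using em[OF sets.top] space i0 by (simp cong: sum.cong)
  also have "\<dots> = (\<Sum>i\<in>A. ennreal (p i))"
    using prob_space.emeasure_space_1[OF \<kappa>(1)] by (simp cong: sum.cong)
  also have "\<dots> = 1" using p_pos p_sum by (subst sum_ennreal) (auto intro: less_imp_le)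
  finally have prob: "prob_space \<nu>" by (rule prob_spaceI)
  interpret \<nu>: prob_space \<nu> by (rule prob)
  show thesis
  proof (rule that[OF sets prob])
    fix B assume B: "B \<in> sets N0"
    have "ennreal (measure \<nu> B) = (\<Sum>i\<in>A. ennreal (p i) * ennreal (measure (\<kappa> i) B))"
      using em[OF B] finite_measure.emeasure_eq_measure[OF prob_space.finite_measure[OF \<kappa>(1)]]
      by (simp add: \<nu>.emeasure_eq_measure cong: sum.cong)
    also have "\<dots> = (\<Sum>i\<in>A. ennreal (p i * measure (\<kappa> i) B))"
      using p_pos by (intro sum.cong refl) (simp add: ennreal_mult less_imp_le)
    also have "\<dots> = ennreal (\<Sum>i\<in>A. p i * measure (\<kappa> i) B)"
      using p_pos by (intro sum_ennreal) (simp add: less_imp_le)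
    finally show "measure \<nu> B = (\<Sum>i\<in>A. p i * measure (\<kappa> i) B)"
      using p_pos by (subst (asm) ennreal_inj) (auto intro!: sum_nonneg simp: less_imp_le)
  next
    fix f :: "'z \<Rightarrow> real" and C assume f: "f \<in> borel_measurable N0" "\<And>z. z \<in> space N0 \<Longrightarrow> \<bar>f z\<bar> \<le> C"
    have f\<nu>: "f \<in> borel_measurable \<nu>" using f(1) by (simp add: measurable_cong_sets[OF sets refl])
    have f\<kappa>: "f \<in> borel_measurable (\<kappa> i)" if "i \<in> A" for i
      using f(1) by (simp add: measurable_cong_sets[OF \<kappa>(2)[OF that] refl])
    have int\<nu>: "integrable \<nu> f"
      by (rule \<nu>.integrable_const_bound[of _ C]) (use f f\<nu> space i0 in auto)
    have int\<kappa>: "integrable (\<kappa> i) f" if "i \<in> A" for i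
      by (rule finite_measure.integrable_const_bound[of _ _ C])
        (use f f\<kappa> space(2) that \<kappa>(1) in \<open>auto intro: prob_space.finite_measure\<close>)
    have g0: "0 \<le> f z + C" if "z \<in> space N0" for z using f(2)[OF that] by linarith
    have "ennreal (\<integral>z. f z + C \<partial>\<nu>) = (\<integral>\<^sup>+z. ennreal (f z + C) \<partial>\<nu>)"
      by (rule nn_integral_eq_integral[symmetric]) (use int\<nu> g0 space i0 in auto)
    also have "\<dots> = (\<Sum>i\<in>A. ennreal (p i) * (\<integral>\<^sup>+z. ennreal (f z + C) \<partial>\<kappa> i))"
      using f(1) by (intro nn) simp
    also have "\<dots> = (\<Sum>i\<in>A. ennreal (p i * (\<integral>z. f z + C \<partial>\<kappa> i)))"
    proof (intro sum.cong refl)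
      fix i assume i: "i \<in> A"
      interpret \<kappa>: prob_space "\<kappa> i" by (rule \<kappa>(1)[OF i])
      have "(\<integral>\<^sup>+z. ennreal (f z + C) \<partial>\<kappa> i) = ennreal (\<integral>z. f z + C \<partial>\<kappa> i)"
        by (rule nn_integral_eq_integral) (use int\<kappa>[OF i] g0 space(2)[OF i] in auto)
      moreover have "0 \<le> (\<integral>z. f z + C \<partial>\<kappa> i)"
        by (rule integral_nonneg_AE) (use g0 space(2)[OF i] in auto)
      ultimately show "ennreal (p i) * (\<integral>\<^sup>+z. ennreal (f z + C) \<partial>\<kappa> i) = ennreal (p i * (\<integral>z. f z + C \<partial>\<kappa> i))"
        using p_pos[OF i] by (simp add: ennreal_mult less_imp_le)
    qed
    also have "\<dots> = ennreal (\<Sum>i\<in>A. p i * (\<integral>z. f z + C \<partial>\<kappa> i))"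
    proof (rule sum_ennreal)
      fix i assume i: "i \<in> A"
      show "0 \<le> p i * (\<integral>z. f z + C \<partial>\<kappa> i)"
        using p_pos[OF i] g0 space(2)[OF i] by (intro mult_nonneg_nonneg integral_nonneg_AE) (auto intro: less_imp_le)
    qed
    finally have "(\<integral>z. f z + C \<partial>\<nu>) = (\<Sum>i\<in>A. p i * (\<integral>z. f z + C \<partial>\<kappa> i))"
    proof (subst (asm) ennreal_inj)
      show "0 \<le> (\<integral>z. f z + C \<partial>\<nu>)" using g0 space i0 by (intro integral_nonneg_AE) auto
      show "0 \<le> (\<Sum>i\<in>A. p i * (\<integral>z. f z + C \<partial>\<kappa> i))"
        using p_pos g0 space(2) by (intro sum_nonneg mult_nonneg_nonneg integral_nonneg_AE) (auto intro: less_imp_le)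
    qed
    moreover have "(\<integral>z. f z + C \<partial>\<nu>) = (\<integral>z. f z \<partial>\<nu>) + C"
      using int\<nu> by (simp add: \<nu>.prob_space)
    moreover have "(\<integral>z. f z + C \<partial>\<kappa> i) = (\<integral>z. f z \<partial>\<kappa> i) + C" if "i \<in> A" for i
    proof -
      interpret \<kappa>: prob_space "\<kappa> i" by (rule \<kappa>(1)[OF that])
      show ?thesis using int\<kappa>[OF that] by (simp add: \<kappa>.prob_space)
    qed
    ultimately have "(\<integral>z. f z \<partial>\<nu>) + C = (\<Sum>i\<in>A. p i * ((\<integral>z. f z \<partial>\<kappa> i) + C))"
      by (simp cong: sum.cong)
    also have "\<dots> = (\<Sum>i\<in>A. p i * (\<integral>z. f z \<partial>\<kappa> i)) + C"
      by (simp add: algebra_simps sum.distrib sum_distrib_left[symmetric] p_sum)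
    finally show "(\<integral>z. f z \<partial>\<nu>) = (\<Sum>i\<in>A. p i * (\<integral>z. f z \<partial>\<kappa> i))" by simp
  qed
qed

text \<open>Streams over a countable index type, since arbitrary sets of finite words over an uncountable
  type need not be measurable.\<close>

lemma (in prob_weights) countable_index:
  obtains P :: "nat pmf" and r :: "nat \<Rightarrow> 'c"
  where "\<And>i. r i \<in> A" "\<And>x. x \<in> A \<Longrightarrow> measure (measure_pmf P) (r -` {x}) = p x"
proof -
  obtain Q :: "'c pmf" where Q: "\<And>x. pmf Q x = (if x \<in> A then p x else 0)" "set_pmf Q = A"
    using weights_pmf by blast
  have cA: "countable A" using finite_A by (rule countable_finite)
  show thesis
  proof (rule that[of "from_nat_into A" "map_pmf (to_nat_on A) Q"])
    show "from_nat_into A i \<in> A" for i by (rule from_nat_into[OF A_ne])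
    fix x assume x: "x \<in> A"
    have "measure (measure_pmf (map_pmf (to_nat_on A) Q)) (from_nat_into A -` {x})
        = measure (measure_pmf Q) {y. from_nat_into A (to_nat_on A y) = x}"
      by (simp add: vimage_def)
    also have "\<dots> = measure (measure_pmf Q) {x}"
      using Q(2) x cA by (intro measure_pmf.finite_measure_eq_AE) (auto simp: AE_measure_pmf_iff from_nat_into_to_nat_on)
    also have "\<dots> = p x" using Q(1) x by (simp add: measure_pmf_single)
    finally show "measure (measure_pmf (map_pmf (to_nat_on A) Q)) (from_nat_into A -` {x}) = p x" .
  qed
qed

text \<open>The naturals merely name letters: a stream of independent draws from \<open>P\<close>,
  read through \<open>r\<close>, is a stream of independent letters with law
  \<open>p\<close>.\<close>

locale bern_stream = prob_weights A p for A :: "'c set" and p +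
  fixes P :: "nat pmf" and r :: "nat \<Rightarrow> 'c"
  assumes r_in: "r i \<in> A" and r_prob: "x \<in> A \<Longrightarrow> measure (measure_pmf P) (r -` {x}) = p x"
begin

definition \<Omega> where "\<Omega> = stream_space (measure_pmf P)"

lemma sets_\<Omega>: "sets \<Omega> = sets (stream_space (count_space UNIV))"
  unfolding \<Omega>_def by (rule sets_stream_space_cong) simp

lemma space_\<Omega> [simp]: "space \<Omega> = UNIV"
  by (simp add: \<Omega>_def space_stream_space)

lemma prob_space_\<Omega>: "prob_space \<Omega>"
  unfolding \<Omega>_def by (rule prob_space.prob_space_stream_space[OF measure_pmf.prob_space_axioms])

lemma stake_sets: "{\<omega>. Q (stake n \<omega>)} \<in> sets \<Omega>"
proof -
  have "stake n -` {xs. Q xs} \<inter> space (stream_space (count_space (UNIV :: nat set)))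
      \<in> sets (stream_space (count_space (UNIV :: nat set)))"
    by (rule measurable_sets[OF measurable_stake]) simp
  then show ?thesis unfolding sets_\<Omega> by (simp add: vimage_def space_stream_space)
qed

lemma stl_meas: "stl \<in> \<Omega> \<rightarrow>\<^sub>M \<Omega>"
  unfolding \<Omega>_def by (rule measurable_stl)

lemma stl_inv: "distr \<Omega> \<Omega> stl = \<Omega>"
proof (rule measure_eqI)
  fix B assume "B \<in> sets (distr \<Omega> \<Omega> stl)"
  then have B: "B \<in> sets \<Omega>" by simp
  have "emeasure (distr \<Omega> \<Omega> stl) B = emeasure \<Omega> (stl -` B)"
    using B by (subst emeasure_distr[OF stl_meas]) auto
  also have "\<dots> = (\<integral>\<^sup>+t. emeasure \<Omega> {\<omega>\<in>space \<Omega>. t ## \<omega> \<in> stl -` B} \<partial>measure_pmf P)"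
    unfolding \<Omega>_def
    by (rule prob_space.emeasure_stream_space[OF measure_pmf.prob_space_axioms])
      (use measurable_sets[OF stl_meas B] in \<open>simp add: \<Omega>_def[symmetric]\<close>)
  also have "\<dots> = emeasure \<Omega> B" by (simp add: measure_pmf.emeasure_space_1)
  finally show "emeasure (distr \<Omega> \<Omega> stl) B = emeasure \<Omega> B" .
qed simp

sublocale \<Omega>: invariant_prob \<Omega> stl
  by (intro invariant_prob.intro invariant_prob_axioms.intro prob_space_\<Omega> stl_meas stl_inv)

definition words :: "nat \<Rightarrow> nat stream \<Rightarrow> 'c list" where "words m \<omega> = map r (stake m \<omega>)"

lemma words_simps [simp]: "words 0 \<omega> = []" "words (Suc m) \<omega> = r (shd \<omega>) # words m (stl \<omega>)"
  by (simp_all add: words_def)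

lemma words_in: "words m \<omega> \<in> words_of_length A m"
  using r_in by (auto simp: words_def words_of_length_def)

lemma words_simple: "simple_function \<Omega> (words m)"
  unfolding simple_function_def
proof (intro conjI ballI)
  show "finite (words m ` space \<Omega>)"
    by (rule finite_subset[OF _ finite_words_of_length[OF finite_A, of m]]) (use words_in in auto)
  show "words m -` {x} \<inter> space \<Omega> \<in> sets \<Omega>" for x
    using stake_sets[of "\<lambda>xs. map r xs = x" m] by (simp add: vimage_def words_def)
qed

lemma measure_words: "l \<in> words_of_length A m \<Longrightarrow> measure \<Omega> {\<omega>. words m \<omega> = l} = wt l"
proof (induction m arbitrary: l)
  case 0
  then show ?case using \<Omega>.prob_space by simp
next
  case (Suc m)
  then obtain x l' where l: "l = x # l'" "x \<in> A" "l' \<in> words_of_length A m"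
    by (auto simp: words_of_length_def length_Suc_conv)
  have meas: "{\<omega>. words k \<omega> = l} \<in> sets \<Omega>" for k l using stake_sets[of "\<lambda>xs. map r xs = l" k] by (simp add: words_def)
  have "emeasure \<Omega> {\<omega>. words (Suc m) \<omega> = l}
      = (\<integral>\<^sup>+t. emeasure \<Omega> {\<omega>\<in>space \<Omega>. t ## \<omega> \<in> {\<omega>. words (Suc m) \<omega> = l}} \<partial>measure_pmf P)"
    unfolding \<Omega>_def
    by (rule prob_space.emeasure_stream_space[OF measure_pmf.prob_space_axioms]) (use meas[of "Suc m" l] in \<open>simp add: \<Omega>_def[symmetric]\<close>)
  also have "\<dots> = (\<integral>\<^sup>+t. emeasure \<Omega> {\<omega>. words m \<omega> = l'} * indicator (r -` {x}) t \<partial>measure_pmf P)"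
    by (intro nn_integral_cong) (auto simp: l indicator_def)
  also have "\<dots> = emeasure \<Omega> {\<omega>. words m \<omega> = l'} * emeasure (measure_pmf P) (r -` {x})"
    by (simp add: nn_integral_cmult)
  also have "\<dots> = ennreal (wt l' * p x)"
    using Suc.IH[OF l(3)] r_prob[OF l(2)] wt_pos[OF l(3)] p_pos[OF l(2)]
    by (simp add: \<Omega>.emeasure_eq_measure measure_pmf.emeasure_eq_measure ennreal_mult less_imp_le)
  finally show ?case
    using wt_pos[OF l(3)] p_pos[OF l(2)] by (simp add: l \<Omega>.emeasure_eq_measure mult.commute less_imp_le)
qed

text \<open>The logarithm of a product weight is a sum over letters, so the entropy of m independent
  letters is m times that of one.\<close>

lemma fin_ent_words: "fin_ent \<Omega> (words m) = - (real m * mean (\<lambda>x. ln (p x)))"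
proof -
  have ln_wt: "ln (wt xs) = sum_list (map (\<lambda>x. ln (p x)) xs)" if "set xs \<subseteq> A" for xs
    using that
  proof (induction xs)
    case (Cons x xs)
    have "0 < p x" using Cons.prems p_pos by simp
    moreover have "0 < wt xs" using Cons.prems by (intro wt_pos[of _ "length xs"]) (simp add: words_of_length_def)
    ultimately show ?case using Cons by (simp add: ln_mult_pos)
  qed simp
  have "fin_ent \<Omega> (words m) = - (\<Sum>l\<in>words_of_length A m. wt l * ln (wt l))"
    using words_in measure_words
    by (subst fin_ent_superset[OF finite_words_of_length[OF finite_A, of m]]) (auto simp: vimage_def)
  also have "\<dots> = - (\<Sum>l\<in>words_of_length A m. wt l * sum_list (map (\<lambda>x. ln (p x)) l))"
    by (intro arg_cong[of _ _ uminus] sum.cong refl) (simp add: ln_wt words_of_length_def)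
  finally show ?thesis by (simp add: sum_wt_sum_list)
qed

lemma integral_first_word: "(\<integral>\<omega>. \<phi> (r (shd \<omega>)) \<partial>\<Omega>) = mean \<phi>" for \<phi> :: "'c \<Rightarrow> real"
proof -
  have eq: "{\<omega>. words 1 \<omega> = [x]} = (\<lambda>\<omega>. r (shd \<omega>)) -` {x} \<inter> space \<Omega>" for x by auto
  have s: "simple_function \<Omega> (\<lambda>\<omega>. r (shd \<omega>))"
    using simple_function_compose[OF words_simple[of 1], of hd] by (simp add: comp_def)
  have "(\<integral>\<omega>. \<phi> (r (shd \<omega>)) \<partial>\<Omega>)
      = (\<Sum>v\<in>(\<lambda>\<omega>. r (shd \<omega>)) ` space \<Omega>. measure \<Omega> ((\<lambda>\<omega>. r (shd \<omega>)) -` {v} \<inter> space \<Omega>) * \<phi> v)"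
    by (rule integral_simple_comp(2)[OF \<Omega>.finite_measure_axioms s])
  also have "\<dots> = (\<Sum>v\<in>A. measure \<Omega> ((\<lambda>\<omega>. r (shd \<omega>)) -` {v} \<inter> space \<Omega>) * \<phi> v)"
  proof (rule sum.mono_neutral_left[OF finite_A])
    show "\<forall>v\<in>A - (\<lambda>\<omega>. r (shd \<omega>)) ` space \<Omega>. measure \<Omega> ((\<lambda>\<omega>. r (shd \<omega>)) -` {v} \<inter> space \<Omega>) * \<phi> v = 0"
    proof
      fix v assume "v \<in> A - (\<lambda>\<omega>. r (shd \<omega>)) ` space \<Omega>"
      then have "(\<lambda>\<omega>. r (shd \<omega>)) -` {v} \<inter> space \<Omega> = {}" by auto
      then show "measure \<Omega> ((\<lambda>\<omega>. r (shd \<omega>)) -` {v} \<inter> space \<Omega>) * \<phi> v = 0" by simp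
    qed
  qed (use r_in in auto)
  also have "\<dots> = mean \<phi>"
  proof (intro sum.cong refl)
    fix x assume "x \<in> A"
    then have "measure \<Omega> {\<omega>. words 1 \<omega> = [x]} = p x"
      by (subst measure_words) (auto simp: words_of_length_def)
    then show "measure \<Omega> ((\<lambda>\<omega>. r (shd \<omega>)) -` {x} \<inter> space \<Omega>) * \<phi> x = p x * \<phi> x" unfolding eq by simp
  qed
  finally show ?thesis .
qed

end

subsection \<open>Bernoulli measures on return words of equal length\<close>

text \<open>The common length L makes \<open>T ^^ L\<close> correspond to the shift of streams, so
  every time splits as m L + i with a word boundary at m L.\<close>

locale bern_tower = tower_ob M X I g Jac D eps \<psi> + bern_stream A p P r
  for M :: "'a measure" and X I g Jac D eps \<psi> and A :: "'a set list set" and p :: "'a set list \<Rightarrow> real" and P :: "nat pmf" and r :: "nat \<Rightarrow> 'a set list" +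
  fixes L :: nat
  assumes A_words: "A \<subseteq> lists E" and A_len: "\<And>w. w \<in> A \<Longrightarrow> len w = L" and L_pos: "L \<ge> 1"
begin

lemma r_words: "r i \<in> lists E" "len (r i) = L" using r_in A_words A_len by auto

lemma r_ne: "r i \<noteq> []" using r_words(2)[of i] L_pos by auto

definition ex :: "nat stream \<Rightarrow> 'a set stream" where "ex \<omega> = flat (smap r \<omega>)"

lemma ex_unfold: "ex \<omega> = r (shd \<omega>) @- ex (stl \<omega>)"
  unfolding ex_def using flat_unfold[of "smap r \<omega>"] r_ne by simp

lemma ex_streams: "ex \<omega> \<in> streams E"
proof -
  have "sset (ex \<omega>) = (\<Union>xs\<in>sset (smap r \<omega>). set xs)"
    unfolding ex_def by (rule sset_flat) (use r_ne in \<open>auto simp: stream.set_map\<close>)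
  then show ?thesis using r_words(1) by (auto simp: streams_iff_sset stream.set_map)
qed

definition \<pi> :: "nat stream \<Rightarrow> 'a \<times> nat" where "\<pi> \<omega> = (pt (ex \<omega>), 0)"

lemma pt_ex_cyl: "pt (ex \<omega>) \<in> cyl (r (shd \<omega>))" and ret_pt_ex: "ret (r (shd \<omega>)) (pt (ex \<omega>)) = pt (ex (stl \<omega>))"
  using pt_shift[OF r_words(1) ex_streams] by (simp_all add: ex_unfold[of \<omega>])

lemma \<pi>_Z: "\<pi> \<omega> \<in> Z"
  using pt_ex_cyl[of \<omega>] cyl_sub[OF r_words(1)] by (auto simp: \<pi>_def Z_iff)

lemma \<pi>_stl: "(T ^^ L) (\<pi> \<omega>) = \<pi> (stl \<omega>)"
  using funpow_T_cyl[OF r_words(1) pt_ex_cyl[of \<omega>]] r_words(2) by (simp add: \<pi>_def ret_pt_ex)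

lemma funpow_\<pi>: "(T ^^ (m * L + i)) (\<pi> \<omega>) = (T ^^ i) (\<pi> (sdrop m \<omega>))"
proof (induction m arbitrary: \<omega>)
  case (Suc m)
  have "(T ^^ (Suc m * L + i)) (\<pi> \<omega>) = (T ^^ (m * L + i)) ((T ^^ L) (\<pi> \<omega>))"
    by (simp add: funpow_add[symmetric, THEN fun_cong, unfolded comp_def] add.commute add.left_commute)
  then show ?case by (simp add: \<pi>_stl Suc)
qed simp

lemma code_of_words: "words m \<omega> = words m \<omega>' \<Longrightarrow> code (m * L) (\<pi> \<omega>) = code (m * L) (\<pi> \<omega>')"
proof (induction m arbitrary: \<omega> \<omega>')
  case (Suc m)
  have "code L (\<pi> \<omega>) = code L (\<pi> \<omega>')"
    using code_cyl[OF r_words(1), of "pt (ex \<omega>)" "shd \<omega>" "pt (ex \<omega>')"] pt_ex_cyl[of \<omega>] pt_ex_cyl[of \<omega>']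
      Suc.prems r_words(2) by (simp add: \<pi>_def)
  moreover have "code (m * L) (\<pi> (stl \<omega>)) = code (m * L) (\<pi> (stl \<omega>'))"
    by (rule Suc.IH) (use Suc.prems in simp)
  ultimately show ?case by (simp add: itin_add \<pi>_stl)
qed (simp add: itin_def)

text \<open>Words of one length have disjoint cylinders, so each stretch of L symbols identifies its
  word. Passing from streams to the tower therefore loses no entropy.\<close>

lemma words_of_code: "code (m * L) (\<pi> \<omega>) = code (m * L) (\<pi> \<omega>') \<Longrightarrow> words m \<omega> = words m \<omega>'"
proof (induction m arbitrary: \<omega> \<omega>')
  case (Suc m)
  have c: "code L (\<pi> \<omega>) = code L (\<pi> \<omega>')" "code (m * L) (\<pi> (stl \<omega>)) = code (m * L) (\<pi> (stl \<omega>'))"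
    using Suc.prems by (simp_all add: itin_add \<pi>_stl)
  have "pt (ex \<omega>') \<in> cyl (r (shd \<omega>))"
    by (rule cyl_of_code[OF r_words(1) pt_ex_cyl[of \<omega>], of _ L])
      (use c(1) \<pi>_Z[of \<omega>'] r_words(2) in \<open>auto simp: \<pi>_def Z_iff\<close>)
  then have "r (shd \<omega>) = r (shd \<omega>')"
    by (intro cyl_disjoint[OF r_words(1) r_words(1) _ _ pt_ex_cyl[of \<omega>']]) (simp_all add: r_words(2))
  then show ?case using Suc.IH[OF c(2)] by simp
qed simp

text \<open>Every word lasts at least one step, so i + n letters determine i + n symbols of the
  orbit and measurability reduces to finite prefixes of the stream.\<close>

lemma orbit_meas: "(\<lambda>\<omega>. (T ^^ i) (\<pi> \<omega>)) \<in> \<Omega> \<rightarrow>\<^sub>M N"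
proof (rule measurable_into_N)
  show "(\<lambda>\<omega>. (T ^^ i) (\<pi> \<omega>)) \<in> space \<Omega> \<rightarrow> Z" using funpow_T_Z[OF \<pi>_Z] by auto
  fix n l
  define m where "m = i + n"
  have det: "code n ((T ^^ i) (\<pi> \<omega>)) = code n ((T ^^ i) (\<pi> \<omega>'))" if "stake m \<omega> = stake m \<omega>'" for \<omega> \<omega>'
  proof -
    have "code (m * L) (\<pi> \<omega>) = code (m * L) (\<pi> \<omega>')" using that by (intro code_of_words) (simp add: words_def)
    moreover have "i + n \<le> m * L" using L_pos by (simp add: m_def)
    ultimately have "code (i + n) (\<pi> \<omega>) = code (i + n) (\<pi> \<omega>')" by (metis take_itin)
    then show ?thesis by (simp add: itin_add)
  qed
  have "{\<omega>\<in>space \<Omega>. code n ((T ^^ i) (\<pi> \<omega>)) = l}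
      = {\<omega>. \<exists>\<omega>'. stake m \<omega>' = stake m \<omega> \<and> code n ((T ^^ i) (\<pi> \<omega>')) = l}"
  proof (intro equalityI subsetI; unfold mem_Collect_eq)
    fix \<omega> assume "\<omega> \<in> space \<Omega> \<and> code n ((T ^^ i) (\<pi> \<omega>)) = l"
    then show "\<exists>\<omega>'. stake m \<omega>' = stake m \<omega> \<and> code n ((T ^^ i) (\<pi> \<omega>')) = l" by blast
  next
    fix \<omega> assume "\<exists>\<omega>'. stake m \<omega>' = stake m \<omega> \<and> code n ((T ^^ i) (\<pi> \<omega>')) = l"
    then obtain \<omega>' where "stake m \<omega>' = stake m \<omega>" "code n ((T ^^ i) (\<pi> \<omega>')) = l" by blast
    then show "\<omega> \<in> space \<Omega> \<and> code n ((T ^^ i) (\<pi> \<omega>)) = l" using det[of \<omega> \<omega>'] by simp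
  qed
  then show "{\<omega>\<in>space \<Omega>. code n ((T ^^ i) (\<pi> \<omega>)) = l} \<in> sets \<Omega>"
    using stake_sets[of "\<lambda>xs. \<exists>\<omega>'. stake m \<omega>' = xs \<and> code n ((T ^^ i) (\<pi> \<omega>')) = l" m] by simp
qed

lemma orbit_G: "(T ^^ i) (\<pi> \<omega>) \<in> G L"
proof -
  have "snd ((T ^^ j) (\<pi> \<omega>)) < L" for j
  proof -
    have "(T ^^ j) (\<pi> \<omega>) = (T ^^ (j mod L)) (\<pi> (sdrop (j div L) \<omega>))"
      using funpow_\<pi>[of "j div L" "j mod L" \<omega>] by (simp only: div_mult_mod_eq)
    then have "snd ((T ^^ j) (\<pi> \<omega>)) \<le> j mod L"
      using funpow_T_level(1)[of "pt (ex (sdrop (j div L) \<omega>))" 0 "j mod L"] \<pi>_Z[of "sdrop (j div L) \<omega>"]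
      by (simp add: \<pi>_def)
    then show ?thesis using mod_less_divisor[of L j] L_pos by linarith
  qed
  then have "\<pi> \<omega> \<in> G L" using \<pi>_Z by (simp add: G_def)
  then show ?thesis by (rule G_T)
qed

text \<open>The law at time i of the orbit coded by a random stream. A single one need not be
  invariant under \<open>T\<close>, but the average over one period of length L is.\<close>

definition \<mu> :: "nat \<Rightarrow> ('a \<times> nat) measure" where "\<mu> i = distr \<Omega> N (\<lambda>\<omega>. (T ^^ i) (\<pi> \<omega>))"

lemma prob_space_\<mu>: "prob_space (\<mu> i)"
  unfolding \<mu>_def by (rule \<Omega>.prob_space_distr[OF orbit_meas])

lemma measure_\<mu>: "U \<in> sets N \<Longrightarrow> measure (\<mu> i) U = measure \<Omega> {\<omega>. (T ^^ i) (\<pi> \<omega>) \<in> U}"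
  unfolding \<mu>_def by (subst measure_distr[OF orbit_meas]) (auto simp: vimage_def)

lemma measure_\<mu>_Suc: "U \<in> sets N \<Longrightarrow> measure (\<mu> i) (T -` U \<inter> Z) = measure (\<mu> (Suc i)) U"
  using measurable_sets[OF T_N, of U] \<pi>_Z funpow_T_Z
  by (subst measure_\<mu>) (auto simp: measure_\<mu> intro!: arg_cong[where f = "measure \<Omega>"])

lemma measure_\<mu>_L: "U \<in> sets N \<Longrightarrow> measure (\<mu> L) U = measure (\<mu> 0) U"
proof -
  assume U: "U \<in> sets N"
  have "{\<omega>. \<pi> \<omega> \<in> U} \<in> sets \<Omega>"
    using measurable_sets[OF orbit_meas[of 0] U] by (simp add: vimage_def)
  from \<Omega>.measure_funpow_vimage[OF this, of 1] show ?thesis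
    using U by (simp add: measure_\<mu> \<pi>_stl vimage_def)
qed

lemma weights_L: "prob_weights {..<L} (\<lambda>_. 1 / real L)"
  by unfold_locales (use L_pos in auto)

text \<open>Weights proportional to the masses are the ones that maximise entropy plus mean log
  mass: \<open>ln (p w)\<close> then differs from the log mass of the cylinder by the constant
  \<open>ln Sm\<close>, which is what remains in the free energy per word.\<close>

lemma bernoulli_measure:
  assumes p_mass: "\<And>w. w \<in> A \<Longrightarrow> p w = measure M (cyl w) / Sm" and Sm: "Sm > 0"
    and s: "\<And>w x. w \<in> A \<Longrightarrow> x \<in> cyl w \<Longrightarrow> s \<le> S L (x, 0)"
  shows "\<exists>\<nu>. finlev \<nu> L \<and> s / real L \<le> (\<integral>z. \<psi> z \<partial>\<nu>) \<and>
    ereal ((ln Sm - ln (D * measure M (space M))) / real L) \<le> free_energy X I g Jac \<nu>"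
proof -
  interpret w: prob_weights "{..<L}" "\<lambda>_. 1 / real L" by (rule weights_L)
  obtain \<nu> where \<nu>: "sets \<nu> = sets N" "prob_space \<nu>"
    "\<And>B. B \<in> sets N \<Longrightarrow> measure \<nu> B = (\<Sum>i<L. 1 / real L * measure (\<mu> i) B)"
    "\<And>f C. f \<in> borel_measurable N \<Longrightarrow> (\<And>z. z \<in> space N \<Longrightarrow> \<bar>f z\<bar> \<le> C) \<Longrightarrow>
      (\<integral>z. f z \<partial>\<nu>) = (\<Sum>i<L. 1 / real L * (\<integral>z. f z \<partial>\<mu> i) :: real)"
  proof (rule w.mixture[of \<mu> N])
    show "prob_space (\<mu> i)" for i by (rule prob_space_\<mu>)
    show "sets (\<mu> i) = sets N" for i by (simp add: \<mu>_def)
  qed blast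
  interpret \<nu>: prob_space \<nu> by (rule \<nu>(2))
  have sp: "space \<nu> = Z" using sets_eq_imp_space_eq[OF \<nu>(1)] by simp
  have Tm: "T \<in> \<nu> \<rightarrow>\<^sub>M \<nu>" using T_N by (simp add: measurable_cong_sets[OF \<nu>(1) \<nu>(1)])
  have inv: "distr \<nu> \<nu> T = \<nu>"
  proof (rule measure_eqI)
    fix B assume "B \<in> sets (distr \<nu> \<nu> T)"
    then have B: "B \<in> sets N" by (simp add: \<nu>(1))
    have TB: "T -` B \<inter> Z \<in> sets N" using measurable_sets[OF T_N B] by simp
    have "measure \<nu> (T -` B \<inter> Z) = (\<Sum>i<L. 1 / real L * measure (\<mu> (Suc i)) B)"
      using \<nu>(3)[OF TB] by (simp add: measure_\<mu>_Suc[OF B])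
    also have "\<dots> = (\<Sum>i<L. 1 / real L * measure (\<mu> i) B)"
    proof -
      \<comment> \<open>Advancing the time by one replaces \<open>\<mu> 0\<close> by
        \<open>\<mu> L\<close> in the average, and these agree because the law of the stream is
        shift invariant.\<close>
      have "(\<Sum>i<L. measure (\<mu> (Suc i)) B) + measure (\<mu> 0) B = (\<Sum>i<L. measure (\<mu> i) B) + measure (\<mu> L) B"
        using sum.lessThan_Suc_shift[of "\<lambda>i. measure (\<mu> i) B" L] by (simp add: add.commute)
      then have "(\<Sum>i<L. measure (\<mu> (Suc i)) B) = (\<Sum>i<L. measure (\<mu> i) B)" by (simp add: measure_\<mu>_L[OF B])
      then show ?thesis by (simp add: sum_divide_distrib[symmetric])
    qed
    also have "\<dots> = measure \<nu> B" by (rule \<nu>(3)[OF B, symmetric])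
    finally show "emeasure (distr \<nu> \<nu> T) B = emeasure \<nu> B"
      using B by (subst emeasure_distr[OF Tm]) (auto simp: \<nu>(1) sp \<nu>.emeasure_eq_measure)
  qed simp
  have "measure (\<mu> i) (lev L) = 1" for i
  proof -
    have "(T ^^ i) (\<pi> \<omega>) \<in> lev L" for \<omega>
    proof -
      have "snd ((T ^^ 0) ((T ^^ i) (\<pi> \<omega>))) < L" using orbit_G[of i \<omega>] unfolding G_def by blast
      then show ?thesis using funpow_T_Z[OF \<pi>_Z] by (simp add: lev_eq)
    qed
    then show ?thesis using \<Omega>.prob_space by (simp add: measure_\<mu>[OF lev_sets])
  qed
  then have "measure \<nu> (lev L) = 1" using \<nu>(3)[OF lev_sets] L_pos by simp
  then have fin: "finlev \<nu> L"
    using L_pos Tm inv \<nu>(1,2) by (simp add: finlev_def tower_invariant_def invariant_probs_def)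
  interpret \<nu>i: tower_inv_ob M X I g Jac D eps \<psi> \<nu> L
    by (intro tower_inv_ob.intro tower_ob_axioms tower_inv.intro tower_jac_axioms tower_inv_axioms.intro fin)
  have int_avg: "(\<integral>z. f z \<partial>\<nu>) = (\<integral>\<omega>. (\<Sum>i<L. f ((T ^^ i) (\<pi> \<omega>))) \<partial>\<Omega>) / real L"
    if f: "f \<in> borel_measurable N" "\<And>z. z \<in> Z \<Longrightarrow> \<bar>f z\<bar> \<le> C" for f :: "'a \<times> nat \<Rightarrow> real" and C
  proof -
    have "(\<integral>z. f z \<partial>\<nu>) = (\<Sum>i<L. 1 / real L * (\<integral>z. f z \<partial>\<mu> i))" using f by (intro \<nu>(4)) auto
    also have "\<dots> = (\<Sum>i<L. (\<integral>\<omega>. f ((T ^^ i) (\<pi> \<omega>)) \<partial>\<Omega>)) / real L"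
      by (simp add: \<mu>_def integral_distr[OF orbit_meas f(1)] sum_divide_distrib)
    also have "(\<Sum>i<L. (\<integral>\<omega>. f ((T ^^ i) (\<pi> \<omega>)) \<partial>\<Omega>)) = (\<integral>\<omega>. (\<Sum>i<L. f ((T ^^ i) (\<pi> \<omega>))) \<partial>\<Omega>)"
    proof (rule Bochner_Integration.integral_sum[symmetric])
      fix i
      show "integrable \<Omega> (\<lambda>\<omega>. f ((T ^^ i) (\<pi> \<omega>)))"
      proof (rule \<Omega>.integrable_const_bound[of _ C])
        show "AE \<omega> in \<Omega>. norm (f ((T ^^ i) (\<pi> \<omega>))) \<le> C" using f(2) funpow_T_Z[OF \<pi>_Z] by simp
        show "(\<lambda>\<omega>. f ((T ^^ i) (\<pi> \<omega>))) \<in> borel_measurable \<Omega>"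
          by (rule measurable_compose[OF orbit_meas f(1)])
      qed
    qed
    finally show ?thesis .
  qed
  have int_avg_meas: "(\<lambda>\<omega>. (\<Sum>i<L. f ((T ^^ i) (\<pi> \<omega>)))) \<in> borel_measurable \<Omega>"
    if "f \<in> borel_measurable N" for f :: "'a \<times> nat \<Rightarrow> real"
    by (intro borel_measurable_sum measurable_compose[OF orbit_meas that])
  have psi: "s / real L \<le> (\<integral>z. \<psi> z \<partial>\<nu>)"
  proof -
    have "s \<le> (\<integral>\<omega>. (\<Sum>i<L. \<psi> ((T ^^ i) (\<pi> \<omega>))) \<partial>\<Omega>)"
    proof -
      have "integrable \<Omega> (\<lambda>\<omega>. \<Sum>i<L. \<psi> ((T ^^ i) (\<pi> \<omega>)))"
      proof (rule \<Omega>.integrable_const_bound[of _ "real L * B"])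
        show "AE \<omega> in \<Omega>. norm (\<Sum>i<L. \<psi> ((T ^^ i) (\<pi> \<omega>))) \<le> real L * B"
          using S_bound[OF \<pi>_Z, of L] by (simp add: birkhoff_sum_def)
      qed (rule int_avg_meas[OF \<psi>_meas])
      moreover have "s \<le> (\<Sum>i<L. \<psi> ((T ^^ i) (\<pi> \<omega>)))" for \<omega>
        using s[OF r_in pt_ex_cyl[of \<omega>]] by (simp add: birkhoff_sum_def \<pi>_def)
      ultimately have "(\<integral>\<omega>. s \<partial>\<Omega>) \<le> (\<integral>\<omega>. (\<Sum>i<L. \<psi> ((T ^^ i) (\<pi> \<omega>))) \<partial>\<Omega>)"
        by (intro integral_mono) auto
      then show ?thesis using \<Omega>.prob_space by simp
    qed
    moreover have "(\<integral>z. \<psi> z \<partial>\<nu>) = (\<integral>\<omega>. (\<Sum>i<L. \<psi> ((T ^^ i) (\<pi> \<omega>))) \<partial>\<Omega>) / real L"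
      by (rule int_avg[OF \<psi>_meas]) (rule B(2))
    ultimately show ?thesis by (simp add: divide_right_mono)
  qed
  let ?c = "ln (D * measure M (space M))"
  define \<phi> where "\<phi> w = ?c - ln (measure M (cyl w))" for w
  have ljb: "(\<integral>z. lj z \<partial>\<nu>) \<le> mean \<phi> / real L"
  proof -
    obtain C where C: "C \<ge> 0" "\<And>z. z \<in> G L \<Longrightarrow> \<bar>lj z\<bar> \<le> C" "\<And>z. z \<in> G L \<Longrightarrow> lj z = ln (Jac z)"
      using \<nu>i.lj_bounded by blast
    \<comment> \<open>The averaging formula wants a bound at every point of the tower, and the
      cutoff provides it; the coded orbits stay in \<open>G L\<close>, where nothing
      changes.\<close>
    define f where "f z = (if z \<in> G L then lj z else 0)" for z
    have f: "f \<in> borel_measurable N"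
      unfolding f_def using lj_meas G_sets[of L] G_Z by (intro measurable_If_set) (auto simp: Int_absorb2 subset_eq)
    have fC: "\<bar>f z\<bar> \<le> C" for z using C by (simp add: f_def)
    have "(\<integral>z. lj z \<partial>\<nu>) = (\<integral>z. f z \<partial>\<nu>)"
    proof (rule integral_cong_AE)
      show "AE z in \<nu>. lj z = f z" using \<nu>i.AE_G by eventually_elim (simp add: f_def)
      show "f \<in> borel_measurable \<nu>" using f by (simp add: measurable_cong_sets[OF \<nu>(1) refl])
    qed (rule \<nu>i.lj_\<nu>)
    also have "\<dots> = (\<integral>\<omega>. (\<Sum>i<L. f ((T ^^ i) (\<pi> \<omega>))) \<partial>\<Omega>) / real L" by (rule int_avg[OF f fC])
    also have "(\<integral>\<omega>. (\<Sum>i<L. f ((T ^^ i) (\<pi> \<omega>))) \<partial>\<Omega>) \<le> (\<integral>\<omega>. \<phi> (r (shd \<omega>)) \<partial>\<Omega>)"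
    proof (rule integral_mono)
      show "integrable \<Omega> (\<lambda>\<omega>. \<Sum>i<L. f ((T ^^ i) (\<pi> \<omega>)))"
      proof (rule \<Omega>.integrable_const_bound[of _ "real L * C"])
        have "\<bar>\<Sum>i<L. f ((T ^^ i) (\<pi> \<omega>))\<bar> \<le> (\<Sum>i<L. C)" for \<omega>
          by (intro order_trans[OF sum_abs] sum_mono fC)
        then show "AE \<omega> in \<Omega>. norm (\<Sum>i<L. f ((T ^^ i) (\<pi> \<omega>))) \<le> real L * C" by simp
      qed (rule int_avg_meas[OF f])
      have "simple_function \<Omega> (\<lambda>\<omega>. r (shd \<omega>))"
        using simple_function_compose[OF words_simple[of 1], of hd] by (simp add: comp_def)
      then show "integrable \<Omega> (\<lambda>\<omega>. \<phi> (r (shd \<omega>)))"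
        by (rule integral_simple_comp(1)[OF \<Omega>.finite_measure_axioms])
      fix \<omega>
      let ?w = "r (shd \<omega>)"
      have "(\<Sum>i<L. f ((T ^^ i) (\<pi> \<omega>))) = (\<Sum>i<L. ln (Jac ((T ^^ i) (\<pi> \<omega>))))"
        by (intro sum.cong refl) (simp add: f_def orbit_G C(3))
      also have "\<dots> = ln (jprod L (\<pi> \<omega>))" by (rule \<nu>i.sum_ln_Jac[OF \<pi>_Z, symmetric])
      also have "\<dots> \<le> \<phi> ?w"
      proof -
        have "jprod L (\<pi> \<omega>) * measure M (cyl ?w) \<le> D * measure M (space M)"
          using measure_pre_bounds(2)[OF r_words(1) pt_ex_cyl[of \<omega>] sets.top]
          by (simp add: pre_space[OF r_words(1)] r_words(2) \<pi>_def)
        moreover have pos: "0 < jprod L (\<pi> \<omega>)" "0 < measure M (cyl ?w)"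
          using jprod_pos[OF \<pi>_Z] measure_cyl_pos[OF r_words(1)] by auto
        ultimately have "ln (jprod L (\<pi> \<omega>) * measure M (cyl ?w)) \<le> ?c"
          by (intro ln_mono) (auto intro: mult_pos_pos)
        then show ?thesis using pos by (simp add: \<phi>_def ln_mult_pos)
      qed
      finally show "(\<Sum>i<L. f ((T ^^ i) (\<pi> \<omega>))) \<le> \<phi> ?w" .
    qed
    also have "(\<integral>\<omega>. \<phi> (r (shd \<omega>)) \<partial>\<Omega>) = mean \<phi>" by (rule integral_first_word)
    finally show ?thesis by (simp add: divide_right_mono)
  qed
  \<comment> \<open>From time i < L it takes L - i steps to the next word boundary, after which m L
    symbols spell m complete words. An itinerary of length (m + 1) L thus carries at least the
    entropy of m letters.\<close>
  have ent: "- mean (\<lambda>w. ln (p w)) / real L \<le> \<nu>i.ent_rate \<nu>i.symK"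
  proof -
    define H where "H = - mean (\<lambda>w. ln (p w))"
    have step: "real m * H \<le> fin_ent \<nu> (itin T \<nu>i.symK ((m + 1) * L))" for m
    proof -
      define n0 where "n0 = (m + 1) * L"
      let ?Y = "itin T \<nu>i.symK n0"
      note sY = \<nu>i.simple_function_itin[OF \<nu>i.symK_simple, of n0]
      have low: "real m * H \<le> fin_ent (\<mu> i) ?Y" if i: "i < L" for i
      proof -
        let ?V = "\<lambda>\<omega>. ?Y ((T ^^ i) (\<pi> \<omega>))"
        have img: "?V ` space \<Omega> \<subseteq> ?Y ` Z" using funpow_T_Z[OF \<pi>_Z] by auto
        have fin_img: "finite (?Y ` Z)" using simple_functionD(1)[OF sY] by simp
        have Ysets: "?Y -` {y} \<inter> Z \<in> sets N" for y using simple_functionD(2)[OF sY, of "{y}"] by (simp add: \<nu>(1))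
        have vim: "?V -` {y} \<inter> space \<Omega> = {\<omega>. (T ^^ i) (\<pi> \<omega>) \<in> ?Y -` {y} \<inter> Z}" for y
          using funpow_T_Z[OF \<pi>_Z] by auto
        have sV: "simple_function \<Omega> ?V"
          unfolding simple_function_def
        proof (intro conjI ballI)
          show "finite (?V ` space \<Omega>)" by (rule finite_subset[OF img fin_img])
          show "?V -` {y} \<inter> space \<Omega> \<in> sets \<Omega>" for y
            unfolding vim using measurable_sets[OF orbit_meas Ysets, of i y] by (simp add: vimage_def)
        qed
        have "fin_ent (\<mu> i) ?Y = fin_ent \<Omega> ?V"
        proof -
          have sp\<mu>: "space (\<mu> i) = Z" by (simp add: \<mu>_def)
          show ?thesis
            unfolding fin_ent_superset[OF fin_img img] vim
              fin_ent_superset[OF fin_img, of ?Y "\<mu> i", unfolded sp\<mu>, OF subset_refl]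
            by (simp only: measure_\<mu>[OF Ysets])
        qed
        moreover have "fin_ent \<Omega> (\<lambda>\<omega>. words m (stl \<omega>)) \<le> fin_ent \<Omega> ?V"
        proof (rule \<Omega>.fin_ent_le_determined(1)[OF sV])
          fix \<omega> \<omega>' assume "?V \<omega> = ?V \<omega>'"
          then have "code n0 ((T ^^ i) (\<pi> \<omega>)) = code n0 ((T ^^ i) (\<pi> \<omega>'))"
            by (simp only: \<nu>i.itin_symK[OF orbit_G])
          moreover have n: "n0 = (L - i) + (m * L + i)" using i by (simp add: n0_def)
          ultimately have "code (m * L + i) ((T ^^ (L - i)) ((T ^^ i) (\<pi> \<omega>))) = code (m * L + i) ((T ^^ (L - i)) ((T ^^ i) (\<pi> \<omega>')))"
            unfolding n by (simp only: itin_add) simp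
          moreover have "(T ^^ (L - i)) ((T ^^ i) (\<pi> \<omega>)) = \<pi> (stl \<omega>)" for \<omega>
            using i funpow_add[of "L - i" i T, THEN fun_cong, of "\<pi> \<omega>"] \<pi>_stl[of \<omega>] by simp
          ultimately have "code (m * L + i) (\<pi> (stl \<omega>)) = code (m * L + i) (\<pi> (stl \<omega>'))" by simp
          then have "code (m * L) (\<pi> (stl \<omega>)) = code (m * L) (\<pi> (stl \<omega>'))" by (simp add: itin_add)
          then show "words m (stl \<omega>) = words m (stl \<omega>')" by (rule words_of_code)
        qed
        moreover have "fin_ent \<Omega> (\<lambda>\<omega>. words m (stl \<omega>)) = real m * H"
          using \<Omega>.fin_ent_funpow[OF words_simple, of m 1] by (simp add: fin_ent_words H_def)
        ultimately show ?thesis by simp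
      qed
      have "real m * H = (\<Sum>i<L. 1 / real L * (real m * H))" using L_pos by simp
      also have "\<dots> \<le> (\<Sum>i<L. 1 / real L * fin_ent (\<mu> i) ?Y)" by (intro sum_mono mult_left_mono low) auto
      also have "\<dots> \<le> fin_ent \<nu> ?Y"
      proof (rule fin_ent_mixture[OF w.finite_A _ w.p_sum _ _ sY])
        show "space (\<mu> i) = space \<nu>" for i by (simp add: \<mu>_def sp)
        show "measure \<nu> B = (\<Sum>i<L. 1 / real L * measure (\<mu> i) B)" if "B \<in> sets \<nu>" for B
          using that by (intro \<nu>(3)) (simp add: \<nu>(1))
      qed simp
      finally show ?thesis unfolding n0_def .
    qed
    have "H / real L \<le> \<nu>i.ent_rate \<nu>i.symK"
    proof (rule LIMSEQ_le)
      \<comment> \<open>The incomplete word costs the factor m / (m + 1), which disappears in the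
        limit.\<close>
      show "(\<lambda>m. real m / (real m + 1) * (H / real L)) \<longlonglongrightarrow> H / real L"
        using tendsto_mult_right[OF LIMSEQ_n_over_Suc_n, of "H / real L"] by (simp add: add.commute)
      have "filterlim (\<lambda>m. (m + 1) * L) at_top sequentially"
      proof (rule filterlim_at_top_mono[OF filterlim_ident], intro always_eventually allI)
        show "m \<le> (m + 1) * L" for m using mult_le_mono2[OF L_pos, of "m + 1"] by simp
      qed
      from filterlim_compose[OF \<nu>i.ent_rate_LIMSEQ[OF \<nu>i.symK_simple] this]
      show "(\<lambda>m. fin_ent \<nu> (itin T \<nu>i.symK ((m + 1) * L)) / real ((m + 1) * L)) \<longlonglongrightarrow> \<nu>i.ent_rate \<nu>i.symK" .
      show "\<exists>N0. \<forall>m\<ge>N0. real m / (real m + 1) * (H / real L) \<le> fin_ent \<nu> (itin T \<nu>i.symK ((m + 1) * L)) / real ((m + 1) * L)"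
      proof (intro exI[of _ 0] allI impI)
        fix m
        have "real m / (real m + 1) * (H / real L) = real m * H / real ((m + 1) * L)" by (simp add: algebra_simps)
        also have "\<dots> \<le> fin_ent \<nu> (itin T \<nu>i.symK ((m + 1) * L)) / real ((m + 1) * L)"
          by (intro divide_right_mono step) auto
        finally show "real m / (real m + 1) * (H / real L) \<le> fin_ent \<nu> (itin T \<nu>i.symK ((m + 1) * L)) / real ((m + 1) * L)" .
      qed
    qed
    then show ?thesis by (simp add: H_def)
  qed
  have "mean \<phi> + mean (\<lambda>w. ln (p w)) = ?c - ln Sm"
  proof -
    have "mean \<phi> + mean (\<lambda>w. ln (p w)) = (\<Sum>w\<in>A. p w * (?c - ln Sm))"
      unfolding sum.distrib[symmetric]
    proof (intro sum.cong refl)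
      fix w assume w: "w \<in> A"
      have "ln (p w) = ln (measure M (cyl w)) - ln Sm"
        using measure_cyl_pos[of w] A_words w Sm by (simp add: p_mass[OF w] ln_div subset_eq)
      then have "\<phi> w + ln (p w) = ?c - ln Sm" by (simp add: \<phi>_def)
      then show "p w * \<phi> w + p w * ln (p w) = p w * (?c - ln Sm)" by (simp only: distrib_left[symmetric])
    qed
    also have "\<dots> = ?c - ln Sm" by (simp add: sum_distrib_right[symmetric] p_sum)
    finally show ?thesis .
  qed
  then have "ln Sm - ?c = - mean (\<lambda>w. ln (p w)) - mean \<phi>" by linarith
  then have "(ln Sm - ?c) / real L = - mean (\<lambda>w. ln (p w)) / real L - mean \<phi> / real L"
    by (simp only: diff_divide_distrib)
  then have "(ln Sm - ?c) / real L \<le> \<nu>i.ent_rate \<nu>i.symK - (\<integral>z. lj z \<partial>\<nu>)" using ent ljb by linarith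
  then show ?thesis using fin psi \<nu>i.free_energy_eq by auto
qed

end

subsection \<open>The upper bound\<close>

text \<open>The additive constant absorbs the finitely many small k, so that the bound holds for all
  k and may be used at every level up to n.\<close>

lemma sublinear_bound:
  fixes f :: "nat \<Rightarrow> real"
  assumes "(\<lambda>k. f k / real k) \<longlonglongrightarrow> 0" "\<delta> > 0"
  obtains C where "C \<ge> 0" "\<And>k. f k \<le> \<delta> * real k + C"
proof -
  obtain n0 where n0: "\<And>k. k \<ge> n0 \<Longrightarrow> norm (f k / real k - 0) < \<delta>"
    using LIMSEQ_D[OF assms] by blast
  define C where "C = (\<Sum>k\<le>n0. \<bar>f k\<bar>)"
  show thesis
  proof (rule that[of C])
    show "C \<ge> 0" by (simp add: C_def sum_nonneg)
    show "f k \<le> \<delta> * real k + C" for k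
    proof (cases "k \<le> n0")
      case True
      then have "\<bar>f k\<bar> \<le> C" unfolding C_def by (intro member_le_sum) auto
      moreover have "0 \<le> \<delta> * real k" using assms(2) by simp
      ultimately show ?thesis by linarith
    next
      case False
      then have "\<bar>f k / real k\<bar> < \<delta>" using n0[of k] unfolding real_norm_def diff_zero by simp
      then have "f k / real k < \<delta>" "real k > 0" using False by linarith+
      then have "f k \<le> \<delta> * real k" by (simp add: field_simps)
      then show ?thesis using \<open>C \<ge> 0\<close> by linarith
    qed
  qed
qed

context tower_ob
begin

lemma words_measure:
  assumes A: "finite A" "A \<noteq> {}" "A \<subseteq> lists E" "\<And>w. w \<in> A \<Longrightarrow> len w = L" and L: "L \<ge> 1"
    and s: "\<And>w x. w \<in> A \<Longrightarrow> x \<in> cyl w \<Longrightarrow> s \<le> S L (x, 0)"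
  shows "\<exists>\<nu>. finlev \<nu> L \<and> s / real L \<le> (\<integral>z. \<psi> z \<partial>\<nu>) \<and>
    ereal ((ln (\<Sum>w\<in>A. measure M (cyl w)) - ln (D * measure M (space M))) / real L) \<le> free_energy X I g Jac \<nu>"
proof -
  define Sm where "Sm = (\<Sum>w\<in>A. measure M (cyl w))"
  define p where "p w = measure M (cyl w) / Sm" for w
  have Sm: "Sm > 0" unfolding Sm_def using A by (intro sum_pos measure_cyl_pos) auto
  interpret pw: prob_weights A p
  proof
    show "finite A" by (rule A(1))
    show "0 < p w" if "w \<in> A" for w using measure_cyl_pos[OF subsetD[OF A(3) that]] Sm by (simp add: p_def)
    show "(\<Sum>w\<in>A. p w) = 1" using Sm by (simp add: p_def sum_divide_distrib[symmetric] Sm_def[symmetric])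
  qed
  obtain P :: "nat pmf" and r where Pr: "\<And>i. r i \<in> A" "\<And>x. x \<in> A \<Longrightarrow> measure (measure_pmf P) (r -` {x}) = p x"
    by (rule pw.countable_index) (rule that)
  interpret bt: bern_tower M X I g Jac D eps \<psi> A p P r L
    by unfold_locales (use Pr A L in auto)
  show ?thesis unfolding Sm_def[symmetric] by (rule bt.bernoulli_measure[OF _ Sm s]) (simp add: p_def)
qed

lemma climb_block:
  assumes "J \<in> I k" "x \<in> J" "y \<in> J" "i \<le> k"
  shows "(T ^^ i) (x, 0) = (x, i)" "sym ((T ^^ i) (x, 0)) = sym ((T ^^ i) (y, 0))"
proof -
  have *: "(T ^^ i) (x, 0) = (x, i)" if "x \<in> J" "i \<le> k" for x i
    using that(2)
  proof (induction i)
    case (Suc i)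
    then have "x \<in> X (Suc i)" using X_antimono[of "Suc i" k] I_sub[OF assms(1)] that(1) by blast
    then show ?case using Suc by (simp add: T_up)
  qed simp
  have "x \<in> X i" using X_antimono[OF assms(4)] I_sub[OF assms(1)] assms(2) by blast
  then obtain K where K: "K \<in> I i" "x \<in> K" using I_ex by blast
  have "J \<subseteq> K" by (rule I_nested[OF K(1) assms(4) assms(1) K(2) assms(2)])
  then have "y \<in> K" using assms(3) by blast
  then show "(T ^^ i) (x, 0) = (x, i)" "sym ((T ^^ i) (x, 0)) = sym ((T ^^ i) (y, 0))"
    using *[OF assms(2,4)] *[OF assms(3,4)] sym_eq[OF K(1) K(2)] sym_eq[OF K(1) \<open>y \<in> K\<close>] by auto
qed

text \<open>Besides the word, the block finally occupied determines the symbols of the unfinished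
  climb, by refinement of the partitions.\<close>

lemma code_pre:
  assumes w: "w \<in> lists E" and J: "J \<in> I k" and xy: "x \<in> pre w J" "y \<in> pre w J"
  shows "code (len w + k) (x, 0) = code (len w + k) (y, 0)"
proof -
  have c: "x \<in> cyl w" "y \<in> cyl w" "ret w x \<in> J" "ret w y \<in> J" using xy by (auto simp: pre_def)
  have "code k (ret w x, 0) = code k (ret w y, 0)"
    unfolding itin_eq_iff using climb_block(2)[OF J c(3,4)] by simp
  then show ?thesis
    unfolding itin_add funpow_T_cyl[OF w c(1)] funpow_T_cyl[OF w c(2)] using code_cyl[OF w c(1,2)] by simp
qed

lemma finite_words_le: "finite {w\<in>lists E. len w \<le> n}"
proof (rule finite_subset)
  show "{w\<in>lists E. len w \<le> n} \<subseteq> {w. set w \<subseteq> {J\<in>E. \<tau> J \<le> n} \<and> length w \<le> n}"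
  proof (intro subsetI CollectI)
    fix w assume "w \<in> {w\<in>lists E. len w \<le> n}"
    then have w: "w \<in> lists E" "len w \<le> n" by auto
    have "length w \<le> len w \<and> (\<forall>J\<in>set w. \<tau> J \<le> len w)"
      using w(1)
    proof (induction w rule: list.induct)
      case (Cons J w)
      then show ?case using E_D(1)[of J] by auto
    qed simp
    then show "set w \<subseteq> {J\<in>E. \<tau> J \<le> n} \<and> length w \<le> n" using w by auto
  qed
  show "finite {w. set w \<subseteq> {J\<in>E. \<tau> J \<le> n} \<and> length w \<le> n}"
    by (rule finite_lists_length_le[OF finite_E_le])
qed

text \<open>A point of the block outside \<open>X (k + l)\<close> leaves the sequence at some level
  in between, and refinement puts the exit it uses inside the block.\<close>

lemma exits_below:
  assumes J: "J \<in> I k" and y: "y \<in> J" "y \<notin> X (k + l)"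
  shows "\<exists>J'\<in>E. y \<in> J' \<and> J' \<subseteq> J \<and> k < \<tau> J' \<and> \<tau> J' \<le> k + l"
proof -
  have "\<exists>i<l. y \<in> X (k + i) \<and> y \<notin> X (Suc (k + i))"
  proof (rule ccontr)
    assume *: "\<not> ?thesis"
    have "y \<in> X (k + i)" if "i \<le> l" for i
      using that
    proof (induction i)
      case 0
      then show ?case using I_sub[OF J] y by auto
    next
      case (Suc i)
      then show ?case using * by auto
    qed
    then show False using y(2) by blast
  qed
  then obtain i where i: "i < l" "y \<in> X (k + i)" "y \<notin> X (Suc (k + i))" by blast
  obtain J' where J': "J' \<in> E" "y \<in> J'" "\<tau> J' = Suc (k + i)" using E_ex[OF i(2,3)] by blast
  have "J' \<in> I (k + i)" using E_D(2)[OF J'(1)] J'(3) by simp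
  from I_nested[OF J le_add1 this y(1) J'(2)] have "J' \<subseteq> J" .
  then show ?thesis using J' i(1) by (intro bexI[of _ J']) auto
qed

text \<open>The base is cut according to the history up to time n: a word and the block then
  occupied. By nonsteepness a fixed proportion of that block exits within l' more steps; distortion
  carries the proportion back to the piece of the base at the cost of \<open>D\<^sup>2\<close>.
  Different pieces give different words, so the masses add up.\<close>

lemma return_words_mass:
  fixes l :: "nat \<Rightarrow> nat" and \<gamma> :: "nat \<Rightarrow> real"
  assumes steep: "\<And>k J. J \<in> I k \<Longrightarrow> measure M (J - X (k + l k)) \<ge> \<gamma> k * measure M J"
    and l': "\<And>k. k \<le> n \<Longrightarrow> l k \<le> l'" and \<gamma>': "\<And>k. k \<le> n \<Longrightarrow> \<gamma>' \<le> \<gamma> k" "\<gamma>' > 0"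
    and Q: "Q \<in> sets M" "Q \<subseteq> space M"
    and U: "U = {u\<in>lists E. n < len u \<and> len u \<le> n + l' \<and> (\<forall>x\<in>cyl u. \<exists>y\<in>Q. code n (x, 0) = code n (y, 0))}"
  shows "\<gamma>' / D\<^sup>2 * measure M Q \<le> (\<Sum>u\<in>U. measure M (cyl u))"
proof -
  \<comment> \<open>Only pieces that meet \<open>Q\<close> are kept; hence every point of an
    extended cylinder shares its code of length n with some point of \<open>Q\<close>.\<close>
  define Pc where "Pc = {(w, J). w \<in> lists E \<and> len w \<le> n \<and> J \<in> I (n - len w) \<and> pre w J \<inter> Q \<noteq> {}}"
  have PcD: "w \<in> lists E" "len w \<le> n" "J \<in> I (n - len w)" "pre w J \<inter> Q \<noteq> {}" if "(w, J) \<in> Pc" for w J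
    using that by (auto simp: Pc_def)
  have fPc: "finite Pc"
  proof (rule finite_subset)
    show "Pc \<subseteq> {w\<in>lists E. len w \<le> n} \<times> (\<Union>k\<le>n. I k)"
    proof
      fix p assume "p \<in> Pc"
      then obtain w J where p: "p = (w, J)" "(w, J) \<in> Pc" by (cases p) auto
      have "J \<in> (\<Union>k\<le>n. I k)" using PcD(3)[OF p(2)] by (intro UN_I[of "n - len w"]) auto
      then show "p \<in> {w\<in>lists E. len w \<le> n} \<times> (\<Union>k\<le>n. I k)" using p PcD(1,2)[OF p(2)] by simp
    qed
    show "finite ({w\<in>lists E. len w \<le> n} \<times> (\<Union>k\<le>n. I k))"
      using finite_words_le I_finite by (intro finite_cartesian_product) auto
  qed
  define Ex where "Ex w J = {J'\<in>E. J' \<subseteq> J \<and> n - len w < \<tau> J' \<and> \<tau> J' \<le> n - len w + l (n - len w)}" for w J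
  have fEx: "finite (Ex w J)" for w J
    by (rule finite_subset[OF _ finite_E_le[of "n - len w + l (n - len w)"]]) (auto simp: Ex_def)
  have cover: "Q \<subseteq> (\<Union>(w, J)\<in>Pc. pre w J)"
  proof
    fix x assume x: "x \<in> Q"
    then obtain w k where w: "w \<in> lists E" "len w + k = n" "x \<in> cyl w" "ret w x \<in> X k"
      using parse[of x n] Q(2) by blast
    then obtain J where J: "J \<in> I k" "ret w x \<in> J" using I_ex by blast
    have "(w, J) \<in> Pc" "x \<in> pre w J" using w J x by (auto simp: Pc_def pre_def)
    then show "x \<in> (\<Union>(w, J)\<in>Pc. pre w J)" by blast
  qed
  have pm: "pre w J \<in> sets M" if "(w, J) \<in> Pc" for w J
    by (rule pre_sets[OF PcD(1)[OF that] I_sets[OF PcD(3)[OF that]]])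
  have cE: "w @ [J'] \<in> lists E" if "(w, J) \<in> Pc" "J' \<in> Ex w J" for w J J'
    using PcD(1)[OF that(1)] that(2) by (auto simp: Ex_def)
  have piece: "\<gamma>' / D\<^sup>2 * measure M (pre w J) \<le> (\<Sum>J'\<in>Ex w J. measure M (cyl (w @ [J'])))" if wJ: "(w, J) \<in> Pc" for w J
  proof -
    let ?k = "n - len w"
    let ?R = "J - X (?k + l ?k)"
    note w = PcD(1)[OF wJ] and J = PcD(3)[OF wJ]
    obtain y where y: "y \<in> cyl w" using cyl_ne[OF w] by blast
    let ?P = "jprod (len w) (y, 0)"
    have "y \<in> space M" using y cyl_sub[OF w] by blast
    then have Pp: "?P > 0" by (intro jprod_pos) (simp add: Z_iff)
    have R: "?R \<in> sets M" using I_sets[OF J] by auto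
    have "?P * (\<gamma>' * measure M (pre w J)) = \<gamma>' * (?P * measure M (pre w J))" by simp
    also have "\<dots> \<le> \<gamma>' * (D * measure M J)"
      using measure_pre_bounds(2)[OF w y I_sets[OF J]] \<gamma>'(2) by (intro mult_left_mono) auto
    also have "\<dots> \<le> D * (\<gamma> ?k * measure M J)"
      using \<gamma>'(1)[of ?k] D_pos mult_right_mono[of \<gamma>' "\<gamma> ?k" "measure M J"] by simp
    also have "\<dots> \<le> D * measure M ?R" using steep[OF J] D_pos by (intro mult_left_mono) auto
    also have "\<dots> \<le> D * (D * ?P * measure M (pre w ?R))"
      using measure_pre_bounds(1)[OF w y R] D_pos by (intro mult_left_mono) auto
    finally have "?P * (\<gamma>' * measure M (pre w J)) \<le> ?P * (D\<^sup>2 * measure M (pre w ?R))"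
      by (simp add: power2_eq_square mult_ac)
    then have "\<gamma>' * measure M (pre w J) \<le> D\<^sup>2 * measure M (pre w ?R)" using Pp by simp
    then have "\<gamma>' / D\<^sup>2 * measure M (pre w J) \<le> measure M (pre w ?R)" using D_pos by (simp add: field_simps)
    also have "\<dots> \<le> measure M (\<Union>J'\<in>Ex w J. cyl (w @ [J']))"
    proof (rule finite_measure_mono)
      show "pre w ?R \<subseteq> (\<Union>J'\<in>Ex w J. cyl (w @ [J']))"
      proof
        fix x assume x: "x \<in> pre w ?R"
        then have xc: "x \<in> cyl w" "ret w x \<in> J" "ret w x \<notin> X (?k + l ?k)" by (auto simp: pre_def)
        obtain J' where J': "J' \<in> E" "ret w x \<in> J'" "J' \<subseteq> J" "?k < \<tau> J'" "\<tau> J' \<le> ?k + l ?k"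
          using exits_below[OF J xc(2,3)] by blast
        then have "J' \<in> Ex w J" by (simp add: Ex_def)
        moreover have "x \<in> cyl (w @ [J'])" using cyl_append[OF w, of "[J']"] J' xc g_in[OF J'(1,2)] by simp
        ultimately show "x \<in> (\<Union>J'\<in>Ex w J. cyl (w @ [J']))" by blast
      qed
      show "(\<Union>J'\<in>Ex w J. cyl (w @ [J'])) \<in> sets M"
        using fEx cE[OF wJ] by (intro sets.finite_UN cyl_sets)
    qed
    also have "\<dots> \<le> (\<Sum>J'\<in>Ex w J. measure M (cyl (w @ [J'])))"
      by (intro finite_measure_subadditive_finite image_subsetI cyl_sets cE[OF wJ] fEx)
    finally show ?thesis .
  qed
  have "measure M Q \<le> measure M (\<Union>(w, J)\<in>Pc. pre w J)"
    using cover pm fPc by (intro finite_measure_mono sets.finite_UN) auto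
  also have "\<dots> \<le> (\<Sum>p\<in>Pc. measure M (case p of (w, J) \<Rightarrow> pre w J))"
    using fPc pm by (intro finite_measure_subadditive_finite) auto
  finally have "\<gamma>' / D\<^sup>2 * measure M Q \<le> \<gamma>' / D\<^sup>2 * (\<Sum>p\<in>Pc. measure M (case p of (w, J) \<Rightarrow> pre w J))"
    using \<gamma>'(2) by (intro mult_left_mono) auto
  also have "\<dots> = (\<Sum>p\<in>Pc. \<gamma>' / D\<^sup>2 * measure M (case p of (w, J) \<Rightarrow> pre w J))"
    by (rule sum_distrib_left)
  also have "\<dots> \<le> (\<Sum>p\<in>Pc. \<Sum>J'\<in>Ex (fst p) (snd p). measure M (cyl (fst p @ [J'])))"
    using piece by (intro sum_mono) auto
  also have "\<dots> = (\<Sum>(p, J')\<in>(SIGMA p:Pc. Ex (fst p) (snd p)). measure M (cyl (fst p @ [J'])))"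
    using fPc fEx by (subst sum.Sigma) auto
  also have "\<dots> = (\<Sum>u\<in>(\<lambda>(p, J'). fst p @ [J']) ` (SIGMA p:Pc. Ex (fst p) (snd p)). measure M (cyl u))"
  proof (subst sum.reindex)
    \<comment> \<open>The last letter is a nonempty subset of its block, so it singles out that
      block among those of the same level.\<close>
    show "inj_on (\<lambda>(p, J'). fst p @ [J']) (SIGMA p:Pc. Ex (fst p) (snd p))"
    proof (rule inj_onI, clarsimp)
      fix w J1 J2 J'
      assume a: "(w, J1) \<in> Pc" "(w, J2) \<in> Pc" "J' \<in> Ex w J1" "J' \<in> Ex w J2"
      then have "J' \<noteq> {}" "J' \<subseteq> J1" "J' \<subseteq> J2" using I_ne[OF E_D(2)[of J']] by (auto simp: Ex_def)
      then obtain x where "x \<in> J1" "x \<in> J2" by blast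
      then show "J1 = J2" using I_eq[OF PcD(3)[OF a(1)] PcD(3)[OF a(2)]] by blast
    qed
  qed (simp add: case_prod_unfold)
  also have "\<dots> \<le> (\<Sum>u\<in>U. measure M (cyl u))"
  proof (rule sum_mono2)
    show "finite U" by (rule finite_subset[OF _ finite_words_le[of "n + l'"]]) (auto simp: U)
    show "(\<lambda>(p, J'). fst p @ [J']) ` (SIGMA p:Pc. Ex (fst p) (snd p)) \<subseteq> U"
    proof clarsimp
      fix w J J' assume a: "(w, J) \<in> Pc" "J' \<in> Ex w J"
      note w = PcD[OF a(1)]
      have J': "J' \<in> E" "J' \<subseteq> J" "n - len w < \<tau> J'" "\<tau> J' \<le> n - len w + l (n - len w)" using a(2) by (auto simp: Ex_def)
      have "l (n - len w) \<le> l'" by (rule l') simp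
      then have len: "n < len w + \<tau> J'" "len w + \<tau> J' \<le> n + l'" using J' w(2) by auto
      obtain y where y: "y \<in> pre w J" "y \<in> Q" using w(4) by blast
      have "code n (x, 0) = code n (y, 0)" if "x \<in> cyl (w @ [J'])" for x
      proof -
        have "x \<in> pre w J" using that cyl_append[OF w(1), of "[J']"] J' by (auto simp: pre_def)
        from code_pre[OF w(1,3) this y(1)] show ?thesis using w(2) by simp
      qed
      then show "w @ [J'] \<in> U" unfolding U using cE[OF a] len y(2) by auto
    qed
  qed simp
  finally show ?thesis .
qed

end

locale tower_ld = tower_ob +
  fixes l :: "nat \<Rightarrow> nat" and \<gamma> :: "nat \<Rightarrow> real"
  assumes l_lim: "(\<lambda>k. real (l k) / real k) \<longlonglongrightarrow> 0"
    and \<gamma>_range: "0 < \<gamma> k" "\<gamma> k < 1" and \<gamma>_lim: "(\<lambda>k. ln (\<gamma> k) / real k) \<longlonglongrightarrow> 0"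
    and steep: "J \<in> I k \<Longrightarrow> measure M (J - X (k + l k)) \<ge> \<gamma> k * measure M J"
begin

lemma upper_bound:
  assumes \<delta>0: "\<delta>0 > 0"
  shows "\<forall>\<^sub>F n in sequentially. 0 < measure M {x\<in>space M. 1 / real n * S n (x, 0) \<ge> a} \<longrightarrow>
    (\<exists>\<nu> K. finlev \<nu> K \<and> a - \<delta>0 \<le> (\<integral>z. \<psi> z \<partial>\<nu>) \<and>
      ereal (ln (measure M {x\<in>space M. 1 / real n * S n (x, 0) \<ge> a}) / real n - \<delta>0) \<le> free_energy X I g Jac \<nu>)"
proof -
  \<comment> \<open>Each extra step costs |a| through the change of denominator and B through the
    Birkhoff sum; the summand 1 accounts for the oscillation. Dividing by 4 \<beta> in
    \<open>\<delta>\<close> leaves room for the constant errors.\<close>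
  define \<beta> where "\<beta> = \<bar>a\<bar> + B + 1"
  have \<beta>: "\<beta> \<ge> 1" using B(1) by (simp add: \<beta>_def)
  define \<delta> where "\<delta> = \<delta>0 / (4 * \<beta>)"
  have \<delta>: "\<delta> > 0" using \<delta>0 \<beta> by (simp add: \<delta>_def)
  obtain Cl where Cl: "Cl \<ge> 0" "\<And>k. real (l k) \<le> \<delta> * real k + Cl" using sublinear_bound[OF l_lim \<delta>] by blast
  have "(\<lambda>k. - ln (\<gamma> k) / real k) \<longlonglongrightarrow> 0" using tendsto_minus[OF \<gamma>_lim] by simp
  from sublinear_bound[OF this \<delta>] obtain C\<gamma> where C\<gamma>: "C\<gamma> \<ge> 0" "\<And>k. - ln (\<gamma> k) \<le> \<delta> * real k + C\<gamma>" by blast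
  define C where "C = Cl + C\<gamma>"
  obtain c where c: "c \<ge> 0" "\<And>n z w. z \<in> Z \<Longrightarrow> w \<in> Z \<Longrightarrow> code n z = code n w \<Longrightarrow> \<bar>S n z - S n w\<bar> \<le> real n * \<delta> + c"
    using S_osc[OF \<delta>] by blast
  let ?mX = "measure M (space M)"
  obtain n1 :: nat where n1: "real n1 > 2 * (\<beta> * C + c) / \<delta>0" using reals_Archimedean2 by blast
  obtain n2 :: nat where n2: "real n2 > 2 * (2 * C + \<bar>ln (D ^ 3 * ?mX)\<bar>) / \<delta>0" using reals_Archimedean2 by blast
  show ?thesis
  proof (rule eventually_sequentiallyI, intro impI)
    fix n assume n: "n \<ge> max (max n1 n2) 1"
    define Q where "Q = {x\<in>space M. 1 / real n * S n (x, 0) \<ge> a}"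
    assume Qp: "0 < measure M {x\<in>space M. 1 / real n * S n (x, 0) \<ge> a}"
    have n1': "n \<ge> 1" and nr: "real n > 0" using n by auto
    have Qs: "Q \<in> sets M" unfolding Q_def by (rule S_base_sets[of "\<lambda>y. 1 / real n * y \<ge> a"]) measurable
    \<comment> \<open>One bound \<delta> n + C serves twice: for the additional length, and in
      \<open>\<gamma>'\<close> for minus the logarithm of the proportion of mass that is
      kept.\<close>
    define l' where "l' = nat \<lfloor>\<delta> * real n + C\<rfloor>"
    have C0: "C \<ge> 0" using Cl(1) C\<gamma>(1) by (simp add: C_def)
    have rhs0: "0 \<le> \<delta> * real n + C" using \<delta> C0 by simp
    have l'r: "real l' \<le> \<delta> * real n + C" unfolding l'_def using rhs0 by simp
    have mono: "\<delta> * real k \<le> \<delta> * real n" if "k \<le> n" for k using that \<delta> by (intro mult_left_mono) auto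
    have lk: "l k \<le> l'" if "k \<le> n" for k
    proof -
      have "real (l k) \<le> \<delta> * real n + C" using Cl(2)[of k] mono[OF that] C\<gamma>(1) by (simp add: C_def)
      then show ?thesis unfolding l'_def by (simp add: le_nat_floor)
    qed
    define \<gamma>' where "\<gamma>' = exp (- (\<delta> * real n + C))"
    have \<gamma>k: "\<gamma>' \<le> \<gamma> k" if "k \<le> n" for k
    proof -
      have "- (\<delta> * real n + C) \<le> ln (\<gamma> k)" using C\<gamma>(2)[of k] mono[OF that] Cl(1) by (simp add: C_def)
      then show ?thesis unfolding \<gamma>'_def using \<gamma>_range(1)[of k] by (simp add: ln_ge_iff)
    qed
    have \<gamma>'0: "\<gamma>' > 0" by (simp add: \<gamma>'_def)
    define U where "U = {u\<in>lists E. n < len u \<and> len u \<le> n + l' \<and> (\<forall>x\<in>cyl u. \<exists>y\<in>Q. code n (x, 0) = code n (y, 0))}"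
    have fU: "finite U" by (rule finite_subset[OF _ finite_words_le[of "n + l'"]]) (auto simp: U_def)
    have mass: "\<gamma>' / D\<^sup>2 * measure M Q \<le> (\<Sum>u\<in>U. measure M (cyl u))"
      by (rule return_words_mass[OF steep lk \<gamma>k \<gamma>'0 Qs _ U_def]) (auto simp: Q_def)
    have Qp': "0 < measure M Q" using Qp by (simp add: Q_def)
    define \<theta> where "\<theta> = \<gamma>' / D\<^sup>2 * measure M Q"
    have \<theta>: "\<theta> > 0" using \<gamma>'0 D_pos Qp' by (simp add: \<theta>_def)
    \<comment> \<open>Pigeonhole over the l' possible lengths. It costs ln l', which is again at
      most \<delta> n + C.\<close>
    have "(\<Sum>u\<in>U. measure M (cyl u)) = (\<Sum>L\<in>{n<..n + l'}. \<Sum>u\<in>{u\<in>U. len u = L}. measure M (cyl u))"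
      by (rule sum.group[symmetric, OF fU]) (auto simp: U_def)
    then have tot: "\<theta> \<le> (\<Sum>L\<in>{n<..n + l'}. \<Sum>u\<in>{u\<in>U. len u = L}. measure M (cyl u))" using mass by (simp add: \<theta>_def)
    have l'1: "l' \<ge> 1"
    proof (rule ccontr)
      assume "\<not> ?thesis"
      then show False using tot \<theta> by simp
    qed
    have "\<exists>L\<in>{n<..n + l'}. \<theta> / real l' \<le> (\<Sum>u\<in>{u\<in>U. len u = L}. measure M (cyl u))"
    proof (rule ccontr)
      assume "\<not> ?thesis"
      then have "(\<Sum>L\<in>{n<..n + l'}. \<Sum>u\<in>{u\<in>U. len u = L}. measure M (cyl u)) < (\<Sum>L\<in>{n<..n + l'}. \<theta> / real l')"
        using l'1 by (intro sum_strict_mono) (auto simp: not_le)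
      also have "\<dots> = \<theta>" using l'1 by simp
      finally show False using tot by simp
    qed
    then obtain L where L: "n < L" "L \<le> n + l'" "\<theta> / real l' \<le> (\<Sum>u\<in>{u\<in>U. len u = L}. measure M (cyl u))" by auto
    define A where "A = {u\<in>U. len u = L}"
    define Sm where "Sm = (\<Sum>u\<in>A. measure M (cyl u))"
    have Sm: "\<theta> / real l' \<le> Sm" using L(3) by (simp add: Sm_def A_def)
    have tl: "\<theta> / real l' > 0" using \<theta> l'1 by simp
    have A_ne: "A \<noteq> {}"
    proof
      assume "A = {}"
      then show False using Sm tl by (simp add: Sm_def)
    qed
    have "finite A" using fU by (simp add: A_def)
    moreover have "A \<subseteq> lists E" unfolding A_def U_def by blast
    moreover have "len w = L" if "w \<in> A" for w using that by (simp add: A_def)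
    ultimately have A: "finite A" "A \<noteq> {}" "A \<subseteq> lists E" "\<And>w. w \<in> A \<Longrightarrow> len w = L"
      using A_ne by blast+
    have Lr: "real L - real n \<le> real l'" "real L > real n" using L(1,2) by linarith+
    define s where "s = real n * a - (real n * \<delta> + c) - real l' * B"
    have s: "s \<le> S L (x, 0)" if u: "u \<in> A" and x: "x \<in> cyl u" for u x
    proof -
      have x0: "(x, 0) \<in> Z" using x cyl_sub[of u] A(3) u by (auto simp: Z_iff)
      obtain y where y: "y \<in> Q" "code n (x, 0) = code n (y, 0)" using u x by (auto simp: A_def U_def)
      have y0: "(y, 0) \<in> Z" using y(1) by (simp add: Q_def Z_iff)
      have "real n * a \<le> S n (y, 0)" using y(1) nr by (simp add: Q_def field_simps)
      moreover have "\<bar>S n (x, 0) - S n (y, 0)\<bar> \<le> real n * \<delta> + c" by (rule c(2)[OF x0 y0 y(2)])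
      moreover have "\<bar>S L (x, 0) - S n (x, 0)\<bar> \<le> real l' * B"
        using S_diff[OF x0, of L n] Lr mult_right_mono[of "\<bar>real L - real n\<bar>" "real l'" B] B(1) by linarith
      ultimately show ?thesis unfolding s_def by linarith
    qed
    have "\<exists>\<nu>. finlev \<nu> L \<and> s / real L \<le> (\<integral>z. \<psi> z \<partial>\<nu>) \<and>
        ereal ((ln Sm - ln (D * ?mX)) / real L) \<le> free_energy X I g Jac \<nu>"
      unfolding Sm_def
    proof (rule words_measure[OF A(1,2,3)])
      show "len w = L" if "w \<in> A" for w by (rule A(4)[OF that])
      show "s \<le> S L (x, 0)" if "w \<in> A" "x \<in> cyl w" for w x by (rule s[OF that])
    qed (use L(1) in simp)
    then obtain \<nu> where \<nu>: "finlev \<nu> L" "s / real L \<le> (\<integral>z. \<psi> z \<partial>\<nu>)"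
      "ereal ((ln Sm - ln (D * ?mX)) / real L) \<le> free_energy X I g Jac \<nu>"
      by blast
    have "a - \<delta>0 \<le> s / real L"
    proof -
      have "real L * a - real n * a \<le> real l' * \<bar>a\<bar>"
      proof -
        have "(real L - real n) * a \<le> (real L - real n) * \<bar>a\<bar>" using Lr by (intro mult_left_mono) auto
        also have "\<dots> \<le> real l' * \<bar>a\<bar>" using Lr by (intro mult_right_mono) auto
        finally show ?thesis by (simp add: algebra_simps)
      qed
      then have "real L * a - s \<le> real l' * (\<beta> - 1) + real n * \<delta> + c" by (simp add: s_def \<beta>_def algebra_simps)
      also have "\<dots> \<le> (\<delta> * real n + C) * (\<beta> - 1) + real n * \<delta> + c"
        using l'r \<beta> by (intro add_right_mono mult_right_mono) auto
      also have "\<dots> = \<beta> * \<delta> * real n + ((\<beta> - 1) * C + c)" by (simp add: algebra_simps)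
      also have "\<dots> \<le> \<beta> * \<delta> * real n + (\<beta> * C + c)" using C0 by (simp add: algebra_simps)
      also have "\<dots> \<le> \<delta>0 * real n"
      proof -
        have e1: "\<beta> * \<delta> * real n = \<delta>0 * real n / 4" using \<beta> by (simp add: \<delta>_def)
        have "2 * (\<beta> * C + c) \<le> \<delta>0 * real n"
        proof -
          have "2 * (\<beta> * C + c) / \<delta>0 \<le> real n" using n1 n by linarith
          then show ?thesis using \<delta>0 by (simp add: field_simps)
        qed
        then have e2: "\<beta> * C + c \<le> \<delta>0 * real n / 2" by simp
        have "\<delta>0 * real n / 4 + \<delta>0 * real n / 2 \<le> \<delta>0 * real n"
          using mult_pos_pos[OF \<delta>0 nr] by simp
        then show ?thesis using e2 unfolding e1 by linarith
      qed
      also have "\<dots> \<le> \<delta>0 * real L" using Lr \<delta>0 by (intro mult_left_mono) auto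
      finally show ?thesis using Lr nr by (simp add: field_simps)
    qed
    then have psi: "a - \<delta>0 \<le> (\<integral>z. \<psi> z \<partial>\<nu>)" using \<nu>(2) by linarith
    have "ln (measure M Q) / real n - \<delta>0 \<le> (ln Sm - ln (D * ?mX)) / real L"
    proof -
      \<comment> \<open>Minus the logarithm of the deviation mass together with all losses; the
        exponent of \<open>D\<close> adds two from the return words and one from the Bernoulli
        measure. Since L exceeds n, replacing the denominator n by L is harmless only because
        \<open>q\<close> is nonnegative.\<close>
      define q where "q = \<delta> * real n + C + ln (real l') + ln (D ^ 3 * ?mX) - ln (measure M Q)"
      have "ln (\<theta> / real l') \<le> ln Sm" using Sm tl by (intro ln_mono) auto
      moreover have "ln (\<theta> / real l') = - (\<delta> * real n + C) - 2 * ln D + ln (measure M Q) - ln (real l')"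
        using \<gamma>'0 D_pos Qp' l'1 \<theta> by (simp add: \<theta>_def ln_div ln_mult_pos ln_realpow \<gamma>'_def)
      moreover have "ln (D ^ 3 * ?mX) = 3 * ln D + ln ?mX" "ln (D * ?mX) = ln D + ln ?mX"
        using D_pos space_M_pos by (simp_all add: ln_mult_pos ln_realpow)
      ultimately have 1: "- q \<le> ln Sm - ln (D * ?mX)" unfolding q_def by linarith
      have "q \<ge> 0"
      proof -
        have "measure M Q \<le> 1 * ?mX" using bounded_measure[of Q] by simp
        also have "\<dots> \<le> D ^ 3 * ?mX" using D_ge by (intro mult_right_mono) (auto simp: one_le_power)
        finally have "ln (measure M Q) \<le> ln (D ^ 3 * ?mX)" using Qp' by (intro ln_mono) auto
        moreover have "ln (real l') \<ge> 0" using l'1 by simp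
        ultimately show ?thesis using rhs0 unfolding q_def by linarith
      qed
      have lnl: "ln (real l') \<le> \<delta> * real n + C" using ln_le_minus_one[of "real l'"] l'1 l'r by simp
      have "q \<le> \<delta>0 * real n - ln (measure M Q)"
      proof -
        have "2 * (2 * C + \<bar>ln (D ^ 3 * ?mX)\<bar>) \<le> \<delta>0 * real n"
        proof -
          have "2 * (2 * C + \<bar>ln (D ^ 3 * ?mX)\<bar>) / \<delta>0 \<le> real n" using n2 n by linarith
          then show ?thesis using \<delta>0 by (simp add: field_simps)
        qed
        moreover have "4 * (\<delta> * real n) \<le> \<delta>0 * real n"
        proof -
          have "\<delta>0 * 1 \<le> \<delta>0 * \<beta>" using \<beta> \<delta>0 by (intro mult_left_mono) auto
          then have "4 * \<delta> \<le> \<delta>0" using \<beta> by (simp add: \<delta>_def field_simps)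
          then have "4 * \<delta> * real n \<le> \<delta>0 * real n" by (intro mult_right_mono) auto
          then show ?thesis by simp
        qed
        moreover define t where "t = \<delta> * real n"
        moreover define v where "v = \<delta>0 * real n"
        moreover define u where "u = ln (D ^ 3 * ?mX)"
        ultimately have "4 * C + 2 * \<bar>u\<bar> \<le> v" "4 * t \<le> v" "ln (real l') \<le> t + C" using lnl by simp_all
        then have "t + C + ln (real l') + u \<le> v" by linarith
        then show ?thesis unfolding q_def t_def u_def v_def by linarith
      qed
      then have "(ln (measure M Q) - \<delta>0 * real n) / real n \<le> - q / real n"
        by (intro divide_right_mono) auto
      then have "ln (measure M Q) / real n - \<delta>0 \<le> - q / real n" using nr by (simp add: diff_divide_distrib)
      also have "\<dots> \<le> - q / real L"
        using \<open>q \<ge> 0\<close> Lr nr by (simp add: divide_left_mono)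
      also have "\<dots> \<le> (ln Sm - ln (D * ?mX)) / real L" using 1 by (intro divide_right_mono) auto
      finally show ?thesis .
    qed
    then have "ereal (ln (measure M Q) / real n - \<delta>0) \<le> free_energy X I g Jac \<nu>"
      using \<nu>(3) order_trans ereal_less_eq(3) by blast
    then show "\<exists>\<nu> K. finlev \<nu> K \<and> a - \<delta>0 \<le> (\<integral>z. \<psi> z \<partial>\<nu>) \<and>
      ereal (ln (measure M {x\<in>space M. 1 / real n * S n (x, 0) \<ge> a}) / real n - \<delta>0) \<le> free_energy X I g Jac \<nu>"
      using \<nu>(1) psi unfolding Q_def by blast
  qed
qed

end

subsection \<open>Convex combinations and the rate function\<close>

context tower_ob
begin

lemma lev_mono: "K \<le> L \<Longrightarrow> lev K \<subseteq> lev L"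
  by (auto simp: lev_eq)

lemma finlev_mono:
  assumes "finlev \<nu> K" "K \<le> L" shows "finlev \<nu> L"
proof -
  interpret tower_inv M X I g Jac D eps \<nu> K
    by (intro tower_inv.intro tower_jac_axioms tower_inv_axioms.intro assms(1))
  have "lev K \<in> sets \<nu>" "lev L \<in> sets \<nu>" using lev_sets by (auto simp: sets_\<nu>)
  then have "measure \<nu> (lev K) \<le> measure \<nu> (lev L)" by (intro finite_measure_mono lev_mono assms(2))
  then have "measure \<nu> (lev L) = 1" using assms(1) by (intro antisym) (simp_all add: finlev_def)
  then show ?thesis using assms by (simp add: finlev_def)
qed

lemma tower_inv_obI: "finlev \<nu> K \<Longrightarrow> tower_inv_ob M X I g Jac D eps \<psi> \<nu> K"
  by (intro tower_inv_ob.intro tower_ob_axioms tower_inv.intro tower_jac_axioms tower_inv_axioms.intro)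

text \<open>Integrals are affine and entropy rates concave in the measure; an inequality suffices,
  as the rate function is built from suprema. Both measures are first placed below a common level,
  so that one truncated symbol generates for all three.\<close>

lemma convex_combination:
  assumes "finlev \<nu>1 K1" "finlev \<nu>2 K2" and u: "0 < u" "u < 1"
    and f: "free_energy X I g Jac \<nu>1 = ereal f1" "free_energy X I g Jac \<nu>2 = ereal f2"
  shows "\<exists>\<nu> K. finlev \<nu> K \<and>
    (\<integral>z. \<psi> z \<partial>\<nu>) = u * (\<integral>z. \<psi> z \<partial>\<nu>1) + (1 - u) * (\<integral>z. \<psi> z \<partial>\<nu>2) \<and>
    ereal (u * f1 + (1 - u) * f2) \<le> free_energy X I g Jac \<nu>"
proof -
  define K where "K = max K1 K2"
  have fl: "finlev \<nu>1 K" "finlev \<nu>2 K" using finlev_mono[OF assms(1)] finlev_mono[OF assms(2)] by (auto simp: K_def)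
  interpret n1: tower_inv_ob M X I g Jac D eps \<psi> \<nu>1 K by (rule tower_inv_obI[OF fl(1)])
  interpret n2: tower_inv_ob M X I g Jac D eps \<psi> \<nu>2 K by (rule tower_inv_obI[OF fl(2)])
  define \<kappa> where "\<kappa> b = (if b then \<nu>1 else \<nu>2)" for b
  define p where "p b = (if b then u else 1 - u)" for b
  interpret w: prob_weights "UNIV :: bool set" p
    by unfold_locales (use u in \<open>auto simp: p_def UNIV_bool\<close>)
  have sum2: "(\<Sum>b\<in>UNIV. p b * F (\<kappa> b)) = u * F \<nu>1 + (1 - u) * F \<nu>2" for F :: "_ \<Rightarrow> real"
    by (simp add: UNIV_bool p_def \<kappa>_def)
  obtain \<nu> where \<nu>: "sets \<nu> = sets N" "prob_space \<nu>"
    "\<And>B. B \<in> sets N \<Longrightarrow> measure \<nu> B = (\<Sum>b\<in>UNIV. p b * measure (\<kappa> b) B)"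
    "\<And>f C. f \<in> borel_measurable N \<Longrightarrow> (\<And>z. z \<in> space N \<Longrightarrow> \<bar>f z\<bar> \<le> C) \<Longrightarrow>
      (\<integral>z. f z \<partial>\<nu>) = (\<Sum>b\<in>UNIV. p b * (\<integral>z. f z \<partial>\<kappa> b) :: real)"
  proof (rule w.mixture[of \<kappa> N])
    show "prob_space (\<kappa> b)" for b by (simp add: \<kappa>_def n1.prob_space_axioms n2.prob_space_axioms)
    show "sets (\<kappa> b) = sets N" for b by (simp add: \<kappa>_def n1.sets_\<nu> n2.sets_\<nu>)
  qed blast
  have m2: "measure \<nu> Q = u * measure \<nu>1 Q + (1 - u) * measure \<nu>2 Q" if "Q \<in> sets N" for Q
    using \<nu>(3)[OF that] sum2[of "\<lambda>m. measure m Q"] by simp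
  have i2: "(\<integral>z. f z \<partial>\<nu>) = u * (\<integral>z. f z \<partial>\<nu>1) + (1 - u) * (\<integral>z. f z \<partial>\<nu>2)"
    if "f \<in> borel_measurable N" "\<And>z. z \<in> Z \<Longrightarrow> \<bar>f z\<bar> \<le> C" for f :: "'a \<times> nat \<Rightarrow> real" and C
    using \<nu>(4)[of f C] that sum2[of "\<lambda>m. (\<integral>z. f z \<partial>m)"] by simp
  interpret \<nu>: prob_space \<nu> by (rule \<nu>(2))
  have sp: "space \<nu> = Z" using sets_eq_imp_space_eq[OF \<nu>(1)] by simp
  have Tm: "T \<in> \<nu> \<rightarrow>\<^sub>M \<nu>" using T_N by (simp add: measurable_cong_sets[OF \<nu>(1) \<nu>(1)])
  have inv: "distr \<nu> \<nu> T = \<nu>"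
  proof (rule measure_eqI)
    fix Q assume "Q \<in> sets (distr \<nu> \<nu> T)"
    then have Q: "Q \<in> sets N" by (simp add: \<nu>(1))
    have TQ: "T -` Q \<inter> Z \<in> sets N" using measurable_sets[OF T_N Q] by simp
    have "measure \<nu>1 (T -` Q \<inter> Z) = measure \<nu>1 Q"
      using n1.measure_funpow_vimage[of Q 1] Q by (simp add: n1.sets_\<nu>)
    moreover have "measure \<nu>2 (T -` Q \<inter> Z) = measure \<nu>2 Q"
      using n2.measure_funpow_vimage[of Q 1] Q by (simp add: n2.sets_\<nu>)
    ultimately have "measure \<nu> (T -` Q \<inter> Z) = measure \<nu> Q" using m2[OF TQ] m2[OF Q] by simp
    then show "emeasure (distr \<nu> \<nu> T) Q = emeasure \<nu> Q"
      using Q by (subst emeasure_distr[OF Tm]) (auto simp: \<nu>(1) sp \<nu>.emeasure_eq_measure)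
  qed simp
  have "measure \<nu> (lev K) = 1" using m2[OF lev_sets] fl by (simp add: finlev_def)
  then have fin: "finlev \<nu> K"
    using n1.K_pos Tm inv \<nu>(1,2) by (simp add: finlev_def tower_invariant_def invariant_probs_def)
  interpret n: tower_inv_ob M X I g Jac D eps \<psi> \<nu> K by (rule tower_inv_obI[OF fin])
  have psi: "(\<integral>z. \<psi> z \<partial>\<nu>) = u * (\<integral>z. \<psi> z \<partial>\<nu>1) + (1 - u) * (\<integral>z. \<psi> z \<partial>\<nu>2)"
    by (rule i2[OF \<psi>_meas]) (rule B(2))
  have ljeq: "(\<integral>z. lj z \<partial>\<nu>) = u * (\<integral>z. lj z \<partial>\<nu>1) + (1 - u) * (\<integral>z. lj z \<partial>\<nu>2)"
  proof -
    obtain C where C: "C \<ge> 0" "\<And>z. z \<in> G K \<Longrightarrow> \<bar>lj z\<bar> \<le> C" using n.lj_bounded by blast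
    define h where "h z = (if z \<in> G K then lj z else 0)" for z
    have h: "h \<in> borel_measurable N"
      unfolding h_def using lj_meas G_sets[of K] G_Z by (intro measurable_If_set) (auto simp: Int_absorb2 subset_eq)
    have hC: "\<bar>h z\<bar> \<le> C" for z using C by (simp add: h_def)
    have e: "(\<integral>z. lj z \<partial>\<nu>') = (\<integral>z. h z \<partial>\<nu>')" if "finlev \<nu>' K" for \<nu>'
    proof -
      interpret n': tower_inv_ob M X I g Jac D eps \<psi> \<nu>' K by (rule tower_inv_obI[OF that])
      show ?thesis
      proof (rule integral_cong_AE)
        show "AE z in \<nu>'. lj z = h z" using n'.AE_G by eventually_elim (simp add: h_def)
        show "h \<in> borel_measurable \<nu>'" using h by (simp add: measurable_cong_sets[OF n'.sets_\<nu> refl])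
      qed (rule n'.lj_\<nu>)
    qed
    show ?thesis unfolding e[OF fin] e[OF fl(1)] e[OF fl(2)] by (rule i2[OF h hC])
  qed
  have ent: "u * n1.ent_rate n1.symK + (1 - u) * n2.ent_rate n1.symK \<le> n.ent_rate n1.symK"
  proof (rule LIMSEQ_le)
    show "(\<lambda>m. u * (fin_ent \<nu>1 (itin T n1.symK m) / real m) + (1 - u) * (fin_ent \<nu>2 (itin T n1.symK m) / real m))
        \<longlonglongrightarrow> u * n1.ent_rate n1.symK + (1 - u) * n2.ent_rate n1.symK"
      by (intro tendsto_intros n1.ent_rate_LIMSEQ n2.ent_rate_LIMSEQ n1.symK_simple n2.symK_simple)
    show "(\<lambda>m. fin_ent \<nu> (itin T n1.symK m) / real m) \<longlonglongrightarrow> n.ent_rate n1.symK"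
      by (rule n.ent_rate_LIMSEQ[OF n.symK_simple])
    have "u * (fin_ent \<nu>1 (itin T n1.symK m) / real m) + (1 - u) * (fin_ent \<nu>2 (itin T n1.symK m) / real m)
        \<le> fin_ent \<nu> (itin T n1.symK m) / real m" for m
    proof -
      have "(\<Sum>b\<in>UNIV. p b * fin_ent (\<kappa> b) (itin T n1.symK m)) \<le> fin_ent \<nu> (itin T n1.symK m)"
      proof (rule fin_ent_mixture[OF w.finite_A _ w.p_sum _ _ n.simple_function_itin[OF n.symK_simple]])
        show "0 \<le> p b" for b using u by (simp add: p_def)
        show "space (\<kappa> b) = space \<nu>" for b by (simp add: \<kappa>_def sp)
        show "measure \<nu> Q = (\<Sum>b\<in>UNIV. p b * measure (\<kappa> b) Q)" if "Q \<in> sets \<nu>" for Q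
          using that by (intro \<nu>(3)) (simp add: \<nu>(1))
      qed
      then have "(u * fin_ent \<nu>1 (itin T n1.symK m) + (1 - u) * fin_ent \<nu>2 (itin T n1.symK m)) / real m
          \<le> fin_ent \<nu> (itin T n1.symK m) / real m"
        unfolding sum2[of "\<lambda>m'. fin_ent m' (itin T n1.symK m)"] by (intro divide_right_mono) auto
      then show ?thesis by (simp add: add_divide_distrib)
    qed
    then show "\<exists>N0. \<forall>m\<ge>N0. u * (fin_ent \<nu>1 (itin T n1.symK m) / real m) + (1 - u) * (fin_ent \<nu>2 (itin T n1.symK m) / real m)
        \<le> fin_ent \<nu> (itin T n1.symK m) / real m" by blast
  qed
  have f12: "f1 = n1.ent_rate n1.symK - (\<integral>z. lj z \<partial>\<nu>1)" "f2 = n2.ent_rate n1.symK - (\<integral>z. lj z \<partial>\<nu>2)"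
    using f n1.free_energy_eq n2.free_energy_eq by simp_all
  have "u * f1 + (1 - u) * f2 = (u * n1.ent_rate n1.symK + (1 - u) * n2.ent_rate n1.symK) - (\<integral>z. lj z \<partial>\<nu>)"
    unfolding f12 ljeq by (simp add: algebra_simps)
  then have "u * f1 + (1 - u) * f2 \<le> n.ent_rate n1.symK - (\<integral>z. lj z \<partial>\<nu>)" using ent by linarith
  then show ?thesis using fin psi n.free_energy_eq by (intro exI[of _ \<nu>] exI[of _ K]) simp
qed

section \<open>The rate function as a limit of suprema over shrinking neighbourhoods\<close>

definition nbhd :: "real \<Rightarrow> real \<Rightarrow> ('a \<times> nat) measure set" where
  "nbhd t \<epsilon> = {\<nu>. (\<exists>K. finlev \<nu> K) \<and> \<bar>(\<integral>z. \<psi> z \<partial>\<nu>) - t\<bar> < \<epsilon>}"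

definition rate_sup :: "real \<Rightarrow> real \<Rightarrow> ereal" where
  "rate_sup t \<epsilon> = (SUP \<nu>\<in>nbhd t \<epsilon>. free_energy X I g Jac \<nu>)"

text \<open>The suprema decrease with \<epsilon>, so the infimum is also the limit at 0+. In this
  form a lower estimate of the rate has to be checked for each \<epsilon> separately.\<close>

definition rate :: "real \<Rightarrow> ereal" where
  "rate t = (INF \<epsilon>\<in>{0<..}. rate_sup t \<epsilon>)"

lemma nbhd_shift: "\<bar>t - t'\<bar> \<le> \<epsilon> - \<epsilon>' \<Longrightarrow> nbhd t' \<epsilon>' \<subseteq> nbhd t \<epsilon>"
  by (auto simp: nbhd_def)

lemma rate_sup_shift: "\<bar>t - t'\<bar> \<le> \<epsilon> - \<epsilon>' \<Longrightarrow> rate_sup t' \<epsilon>' \<le> rate_sup t \<epsilon>"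
  unfolding rate_sup_def by (intro SUP_subset_mono nbhd_shift) auto

lemma rate_le: "\<epsilon> > 0 \<Longrightarrow> rate t \<le> rate_sup t \<epsilon>"
  unfolding rate_def by (intro INF_lower) auto

text \<open>A small neighbourhood of t' fits into the given one of t. Upper semicontinuity and the
  compactness arguments rest on this.\<close>

lemma rate_le_near:
  assumes "\<bar>t' - t\<bar> < \<epsilon>" shows "rate t' \<le> rate_sup t \<epsilon>"
proof -
  have "rate t' \<le> rate_sup t' (\<epsilon> - \<bar>t - t'\<bar>)" using assms by (intro rate_le) (simp add: abs_minus_commute)
  also have "\<dots> \<le> rate_sup t \<epsilon>" by (intro rate_sup_shift) simp
  finally show ?thesis .
qed

lemma rate_tendsto: "(rate_sup t \<longlongrightarrow> rate t) (at_right 0)"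
proof (rule order_tendstoI)
  fix c assume c: "c < rate t"
  have "c < rate_sup t \<epsilon>" if "\<epsilon> > 0" for \<epsilon> using c rate_le[OF that] by (rule less_le_trans)
  then show "\<forall>\<^sub>F \<epsilon> in at_right 0. c < rate_sup t \<epsilon>"
    by (intro eventually_at_right_less[THEN eventually_mono])
next
  fix c assume "rate t < c"
  then obtain \<epsilon>0 where e: "\<epsilon>0 > 0" "rate_sup t \<epsilon>0 < c" unfolding rate_def by (auto simp: INF_less_iff)
  have "rate_sup t \<epsilon> < c" if "\<epsilon> < \<epsilon>0" for \<epsilon>
  proof -
    have "rate_sup t \<epsilon> \<le> rate_sup t \<epsilon>0" by (rule rate_sup_shift) (use that in simp)
    then show ?thesis using e(2) by (rule le_less_trans)
  qed
  then show "\<forall>\<^sub>F \<epsilon> in at_right 0. rate_sup t \<epsilon> < c"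
    unfolding eventually_at_right_field using e(1) by blast
qed

lemma rate_ge: "(\<And>\<epsilon>. \<epsilon> > 0 \<Longrightarrow> c \<le> rate_sup t \<epsilon>) \<Longrightarrow> c \<le> rate t"
  unfolding rate_def by (intro INF_greatest) auto

lemma free_energy_real: "finlev \<nu> K \<Longrightarrow> \<exists>f. free_energy X I g Jac \<nu> = ereal f"
proof -
  assume f: "finlev \<nu> K"
  interpret n: tower_inv_ob M X I g Jac D eps \<psi> \<nu> K by (rule tower_inv_obI[OF f])
  show ?thesis using n.free_energy_eq by blast
qed

lemma integral_\<psi>_bound: "finlev \<nu> K \<Longrightarrow> \<bar>\<integral>z. \<psi> z \<partial>\<nu>\<bar> \<le> B"
proof -
  assume f: "finlev \<nu> K"
  interpret n: tower_inv_ob M X I g Jac D eps \<psi> \<nu> K by (rule tower_inv_obI[OF f])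
  have "\<bar>\<integral>z. \<psi> z \<partial>\<nu>\<bar> \<le> (\<integral>z. \<bar>\<psi> z\<bar> \<partial>\<nu>)" by (rule integral_abs_bound)
  also have "\<dots> \<le> (\<integral>z. B \<partial>\<nu>)" using B(2) n.\<psi>_integrable by (intro integral_mono) auto
  also have "\<dots> = B" using n.prob_space by simp
  finally show ?thesis .
qed

lemma lower_bound':
  assumes \<nu>: "finlev \<nu> K" "free_energy X I g Jac \<nu> = ereal f" and a: "a < (\<integral>z. \<psi> z \<partial>\<nu>)" and \<eta>: "\<eta> > 0"
  shows "\<forall>\<^sub>F n in sequentially. exp (real n * (f - \<eta>)) \<le> measure M {x\<in>space M. 1 / real n * S n (x, 0) > a}"
proof -
  interpret n: tower_inv_ob M X I g Jac D eps \<psi> \<nu> K by (rule tower_inv_obI[OF \<nu>(1)])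
  have "f = n.ent_rate n.symK - (\<integral>z. lj z \<partial>\<nu>)" using \<nu>(2) n.free_energy_eq by simp
  then show ?thesis using n.lower_bound[OF a \<eta>] by simp
qed

text \<open>With a level below the mean of \<psi>, a positive free energy would by the lower bound
  give subsets of the base exponentially growing mass, against finiteness of the total mass.\<close>

lemma free_energy_le_0:
  assumes "finlev \<nu> K" shows "free_energy X I g Jac \<nu> \<le> 0"
proof -
  obtain f where f: "free_energy X I g Jac \<nu> = ereal f" using free_energy_real[OF assms] by blast
  have "f \<le> 0"
  proof (rule ccontr)
    assume "\<not> ?thesis"
    then have fp: "f / 2 > 0" by simp
    have "\<forall>\<^sub>F n in sequentially. exp (real n * (f - f / 2)) \<le> measure M (space M)"
      using lower_bound'[OF assms f _ fp, of "(\<integral>z. \<psi> z \<partial>\<nu>) - 1"]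
      by (auto elim!: eventually_mono intro: order_trans bounded_measure)
    moreover have "\<forall>\<^sub>F n in sequentially. measure M (space M) < exp (real n * (f - f / 2))"
    proof -
      have "filterlim (\<lambda>n. exp (real n * (f - f / 2))) at_top sequentially"
        using fp by (intro filterlim_compose[OF exp_at_top] filterlim_at_top_mult_tendsto_pos[OF tendsto_const] filterlim_real_sequentially) auto
      then show ?thesis by (simp add: filterlim_at_top_dense)
    qed
    ultimately have "\<forall>\<^sub>F n in sequentially. False" by eventually_elim simp
    then show False by simp
  qed
  then show ?thesis using f by simp
qed

lemma rate_le_0: "rate t \<le> 0"
proof -
  have "rate t \<le> rate_sup t 1" by (rule rate_le) simp
  also have "\<dots> \<le> 0" unfolding rate_sup_def
  proof (rule SUP_least)
    fix \<nu> assume "\<nu> \<in> nbhd t 1"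
    then show "free_energy X I g Jac \<nu> \<le> 0" using free_energy_le_0 by (auto simp: nbhd_def)
  qed
  finally show ?thesis .
qed

lemma rate_usc: "usc rate"
  unfolding usc_def
proof (intro allI rate_ge)
  fix t \<epsilon> :: real assume e: "\<epsilon> > 0"
  have "\<forall>\<^sub>F t' in at t. rate t' \<le> rate_sup t \<epsilon>"
    unfolding eventually_at using e by (intro exI[of _ \<epsilon>]) (auto simp: dist_real_def intro: rate_le_near)
  then show "Limsup (at t) rate \<le> rate_sup t \<epsilon>" by (rule Limsup_bounded)
qed

lemma rate_approx:
  assumes "rate t = ereal c" "\<epsilon> > 0" "\<eta> > 0"
  obtains \<nu> K f where "finlev \<nu> K" "\<bar>(\<integral>z. \<psi> z \<partial>\<nu>) - t\<bar> < \<epsilon>" "free_energy X I g Jac \<nu> = ereal f" "c - \<eta> < f"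
proof -
  have "ereal (c - \<eta>) < rate t" using assms(1,3) by simp
  also have "\<dots> \<le> rate_sup t \<epsilon>" by (rule rate_le[OF assms(2)])
  finally have "ereal (c - \<eta>) < rate_sup t \<epsilon>" .
  then obtain \<nu> where \<nu>: "\<nu> \<in> nbhd t \<epsilon>" "ereal (c - \<eta>) < free_energy X I g Jac \<nu>"
    unfolding rate_sup_def by (auto simp: less_SUP_iff)
  then obtain K where "finlev \<nu> K" by (auto simp: nbhd_def)
  moreover from free_energy_real[OF this] obtain f where "free_energy X I g Jac \<nu> = ereal f" by blast
  ultimately show thesis using \<nu> by (intro that[of \<nu> K f]) (auto simp: nbhd_def)
qed

lemma rate_concave: "ereal_concave rate"
  unfolding ereal_concave_def
proof (intro allI impI)
  fix s t u :: real assume u: "0 < u \<and> u < 1"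
  show "ereal u * rate s + ereal (1 - u) * rate t \<le> rate (u * s + (1 - u) * t)"
  \<comment> \<open>If one value is -\<infinity>, so is the weighted sum, as no term is \<infinity>.
    Otherwise both values are finite and can be approximated by measures.\<close>
  proof (cases "rate s = -\<infinity> \<or> rate t = -\<infinity>")
    case True
    have "ereal u * rate s \<noteq> \<infinity>" "ereal (1 - u) * rate t \<noteq> \<infinity>"
      using rate_le_0[of s] rate_le_0[of t] u by (auto simp: ereal_mult_eq_PInfty)
    then have eq: "ereal u * rate s + ereal (1 - u) * rate t = -\<infinity>" using True u by auto
    show ?thesis unfolding eq by simp
  next
    case False
    then obtain cs ct where c: "rate s = ereal cs" "rate t = ereal ct"
      using rate_le_0[of s] rate_le_0[of t] by (cases "rate s"; cases "rate t") auto
    show ?thesis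
    proof (rule rate_ge)
      fix \<epsilon> :: real assume e: "\<epsilon> > 0"
      show "ereal u * rate s + ereal (1 - u) * rate t \<le> rate_sup (u * s + (1 - u) * t) \<epsilon>"
      proof (rule ereal_le_epsilon2)
        fix \<eta> :: real assume eta: "\<eta> > 0"
        obtain \<nu>1 K1 f1 where n1: "finlev \<nu>1 K1" "\<bar>(\<integral>z. \<psi> z \<partial>\<nu>1) - s\<bar> < \<epsilon>"
          "free_energy X I g Jac \<nu>1 = ereal f1" "cs - \<eta> < f1" by (rule rate_approx[OF c(1) e eta])
        obtain \<nu>2 K2 f2 where n2: "finlev \<nu>2 K2" "\<bar>(\<integral>z. \<psi> z \<partial>\<nu>2) - t\<bar> < \<epsilon>"
          "free_energy X I g Jac \<nu>2 = ereal f2" "ct - \<eta> < f2" by (rule rate_approx[OF c(2) e eta])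
        obtain \<nu> K where n: "finlev \<nu> K"
          "(\<integral>z. \<psi> z \<partial>\<nu>) = u * (\<integral>z. \<psi> z \<partial>\<nu>1) + (1 - u) * (\<integral>z. \<psi> z \<partial>\<nu>2)"
          "ereal (u * f1 + (1 - u) * f2) \<le> free_energy X I g Jac \<nu>"
          using convex_combination[OF n1(1) n2(1) _ _ n1(3) n2(3)] u by blast
        have "\<bar>(\<integral>z. \<psi> z \<partial>\<nu>) - (u * s + (1 - u) * t)\<bar>
            = \<bar>u * ((\<integral>z. \<psi> z \<partial>\<nu>1) - s) + (1 - u) * ((\<integral>z. \<psi> z \<partial>\<nu>2) - t)\<bar>"
          unfolding n(2) by (simp add: algebra_simps)
        also have "\<dots> \<le> u * \<bar>(\<integral>z. \<psi> z \<partial>\<nu>1) - s\<bar> + (1 - u) * \<bar>(\<integral>z. \<psi> z \<partial>\<nu>2) - t\<bar>"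
          using u by (intro order_trans[OF abs_triangle_ineq]) (simp add: abs_mult)
        also have "\<dots> < u * \<epsilon> + (1 - u) * \<epsilon>"
          using u n1(2) n2(2) by (intro add_strict_mono mult_strict_left_mono) auto
        finally have "\<nu> \<in> nbhd (u * s + (1 - u) * t) \<epsilon>" using n(1) by (auto simp: nbhd_def algebra_simps)
        then have "free_energy X I g Jac \<nu> \<le> rate_sup (u * s + (1 - u) * t) \<epsilon>"
          unfolding rate_sup_def by (rule SUP_upper)
        then have le: "ereal (u * f1 + (1 - u) * f2) \<le> rate_sup (u * s + (1 - u) * t) \<epsilon>" using n(3) by (rule order_trans[rotated])
        have "u * (cs - \<eta>) + (1 - u) * (ct - \<eta>) \<le> u * f1 + (1 - u) * f2"
          using u n1(4) n2(4) by (intro add_mono mult_left_mono) auto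
        then have "u * cs + (1 - u) * ct \<le> (u * f1 + (1 - u) * f2) + \<eta>" by (simp add: algebra_simps)
        then have "ereal u * rate s + ereal (1 - u) * rate t \<le> ereal (u * f1 + (1 - u) * f2) + ereal \<eta>"
          unfolding c by simp
        also have "\<dots> \<le> rate_sup (u * s + (1 - u) * t) \<epsilon> + ereal \<eta>" by (rule add_right_mono[OF le])
        finally show "ereal u * rate s + ereal (1 - u) * rate t \<le> rate_sup (u * s + (1 - u) * t) \<epsilon> + ereal \<eta>" .
      qed
    qed
  qed
qed

lemma rate_lower:
  "(SUP t\<in>{a<..}. rate t) \<le> liminf (\<lambda>n. ereal (1 / real n) *
     elog (measure M {x\<in>space M. 1 / real n * S n (x, 0) > a}))"
proof (rule SUP_least)
  fix t assume "t \<in> {a<..}"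
  then have t: "t - a > 0" by simp
  let ?L = "liminf (\<lambda>n. ereal (1 / real n) * elog (measure M {x\<in>space M. 1 / real n * S n (x, 0) > a}))"
  have "rate t \<le> rate_sup t (t - a)" by (rule rate_le[OF t])
  also have "\<dots> \<le> ?L"
    unfolding rate_sup_def
  proof (rule SUP_least)
    fix \<nu> assume "\<nu> \<in> nbhd t (t - a)"
    then obtain K where \<nu>: "finlev \<nu> K" "a < (\<integral>z. \<psi> z \<partial>\<nu>)" by (auto simp: nbhd_def)
    obtain f where f: "free_energy X I g Jac \<nu> = ereal f" using free_energy_real[OF \<nu>(1)] by blast
    show "free_energy X I g Jac \<nu> \<le> ?L"
    proof (rule ereal_le_epsilon2)
      fix \<eta> :: real assume eta: "\<eta> > 0"
      have "ereal (f - \<eta>) \<le> ?L"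
      proof (rule Liminf_bounded)
        show "\<forall>\<^sub>F n in sequentially. ereal (f - \<eta>) \<le> ereal (1 / real n) *
            elog (measure M {x\<in>space M. 1 / real n * S n (x, 0) > a})"
          using lower_bound'[OF \<nu>(1) f \<nu>(2) eta] eventually_gt_at_top[of 0]
        proof eventually_elim
          case (elim n)
          let ?m = "measure M {x\<in>space M. 1 / real n * S n (x, 0) > a}"
          have m: "?m > 0" using elim(1) less_le_trans[OF exp_gt_zero] by blast
          then have "real n * (f - \<eta>) \<le> ln ?m" using elim(1) by (simp add: ln_ge_iff)
          then have "f - \<eta> \<le> ln ?m / real n" using elim(2) by (simp add: field_simps)
          then show ?case using m by (simp add: elog_def)
        qed
      qed
      then have "ereal (f - \<eta>) + ereal \<eta> \<le> ?L + ereal \<eta>" by (rule add_right_mono)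
      then show "free_energy X I g Jac \<nu> \<le> ?L + ereal \<eta>" using f by simp
    qed
  qed
  finally show "rate t \<le> ?L" .
qed

text \<open>A limit point of near-optimal arguments is optimal by upper semicontinuity. The
  hypothesis asks for every value below \<sigma>, which lets \<sigma> be a supremum or an upper
  limit, even -\<infinity>.\<close>

lemma rate_attained:
  assumes ab: "a \<le> b" and dense: "\<And>c. c < \<sigma> \<Longrightarrow> \<exists>t\<in>{a..b}. c \<le> rate t"
  shows "\<exists>t\<in>{a..b}. \<sigma> \<le> rate t"
proof (cases "\<sigma> = -\<infinity>")
  case True
  then show ?thesis using ab by auto
next
  case False
  then have "-\<infinity> < \<sigma>" by simp
  from approx_from_below_dense_linorder[OF this] obtain c where c: "\<And>n. c n < \<sigma>" "c \<longlonglongrightarrow> \<sigma>" by blast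
  have "\<forall>n. \<exists>t. t \<in> {a..b} \<and> c n \<le> rate t" using dense c(1) by blast
  from choice[OF this] obtain t where t: "\<And>n. t n \<in> {a..b}" "\<And>n. c n \<le> rate (t n)" by blast
  have "compact {a..b}" by (rule compact_Icc)
  then obtain t0 \<rho> where \<rho>: "t0 \<in> {a..b}" "strict_mono \<rho>" "(t \<circ> \<rho>) \<longlonglongrightarrow> t0"
    using t(1) unfolding compact_def by metis
  have "\<sigma> \<le> rate t0"
  proof (rule rate_ge)
    fix \<epsilon> :: real assume e: "\<epsilon> > 0"
    have "\<forall>\<^sub>F n in sequentially. dist ((t \<circ> \<rho>) n) t0 < \<epsilon>" using \<rho>(3) e by (rule tendstoD)
    then have "\<forall>\<^sub>F n in sequentially. (c \<circ> \<rho>) n \<le> rate_sup t0 \<epsilon>"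
    proof eventually_elim
      case (elim n)
      have "c (\<rho> n) \<le> rate (t (\<rho> n))" by (rule t(2))
      also have "\<dots> \<le> rate_sup t0 \<epsilon>" using elim by (intro rate_le_near) (simp add: dist_real_def)
      finally show ?case by simp
    qed
    then show "\<sigma> \<le> rate_sup t0 \<epsilon>"
      by (rule tendsto_upperbound[OF LIMSEQ_subseq_LIMSEQ[OF c(2) \<rho>(2)]]) simp
  qed
  then show ?thesis using \<rho>(1) by blast
qed

end

context tower_ld
begin

text \<open>The upper bound with tolerances 1 / (j + 1) yields measures whose integrals of \<psi>
  lie in a compact interval. A limit point of the integrals is at least a, and measures with free
  energy close to c accumulate there.\<close>

lemma limsup_approx:
  assumes c: "ereal c < limsup (\<lambda>n. ereal (1 / real n) *
    elog (measure M {x\<in>space M. 1 / real n * S n (x, 0) \<ge> a}))"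
  shows "\<exists>t\<in>{a..max a B}. ereal c \<le> rate t"
proof -
  let ?m = "\<lambda>n. measure M {x\<in>space M. 1 / real n * S n (x, 0) \<ge> a}"
  have freq: "\<exists>\<^sub>F n in sequentially. ereal c < ereal (1 / real n) * elog (?m n)"
  proof (rule ccontr)
    assume "\<not> ?thesis"
    then have "\<forall>\<^sub>F n in sequentially. ereal (1 / real n) * elog (?m n) \<le> ereal c"
      by (simp add: frequently_def not_less)
    then have "limsup (\<lambda>n. ereal (1 / real n) * elog (?m n)) \<le> ereal c" by (rule Limsup_bounded)
    then show False using c by simp
  qed
  have ex: "\<exists>\<nu> K. finlev \<nu> K \<and> a - \<delta> \<le> (\<integral>z. \<psi> z \<partial>\<nu>) \<and> ereal (c - \<delta>) \<le> free_energy X I g Jac \<nu>"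
    if \<delta>: "\<delta> > 0" for \<delta>
  proof -
    have "\<exists>\<^sub>F n in sequentially. ereal c < ereal (1 / real n) * elog (?m n) \<and> n > 0 \<and>
      (0 < ?m n \<longrightarrow> (\<exists>\<nu> K. finlev \<nu> K \<and> a - \<delta> \<le> (\<integral>z. \<psi> z \<partial>\<nu>) \<and>
        ereal (ln (?m n) / real n - \<delta>) \<le> free_energy X I g Jac \<nu>))"
      by (intro frequently_eventually_frequently[OF freq] eventually_conj eventually_gt_at_top upper_bound[OF \<delta>])
    then obtain n where n: "ereal c < ereal (1 / real n) * elog (?m n)" "n > 0"
      "0 < ?m n \<longrightarrow> (\<exists>\<nu> K. finlev \<nu> K \<and> a - \<delta> \<le> (\<integral>z. \<psi> z \<partial>\<nu>) \<and>
        ereal (ln (?m n) / real n - \<delta>) \<le> free_energy X I g Jac \<nu>)"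
      using frequently_ex by blast
    \<comment> \<open>A null event has logarithm -\<infinity> and could not exceed c; this supplies
      the positivity that the upper bound presupposes.\<close>
    have m: "?m n > 0"
    proof (rule ccontr)
      assume "\<not> ?thesis"
      then have "ereal (1 / real n) * elog (?m n) = -\<infinity>" using n(2) by (simp add: elog_def)
      then show False using n(1) by simp
    qed
    obtain \<nu> K where \<nu>: "finlev \<nu> K" "a - \<delta> \<le> (\<integral>z. \<psi> z \<partial>\<nu>)"
      "ereal (ln (?m n) / real n - \<delta>) \<le> free_energy X I g Jac \<nu>" using n(3) m by blast
    have "ereal c < ereal (ln (?m n) / real n)" using n(1) m by (simp add: elog_def)
    then have "ereal (c - \<delta>) \<le> ereal (ln (?m n) / real n - \<delta>)" by simp
    then show ?thesis using \<nu> order_trans by blast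
  qed
  show ?thesis
  proof (rule rate_attained)
    have "\<forall>j. \<exists>\<nu>. (\<exists>K. finlev \<nu> K) \<and> a - 1 / real (Suc j) \<le> (\<integral>z. \<psi> z \<partial>\<nu>) \<and> ereal (c - 1 / real (Suc j)) \<le> free_energy X I g Jac \<nu>"
      using ex[of "1 / real (Suc _)"] by (metis divide_pos_pos of_nat_0_less_iff zero_less_Suc zero_less_one)
    from choice[OF this] obtain \<nu> where \<nu>: "\<And>j. \<exists>K. finlev (\<nu> j) K" "\<And>j. a - 1 / real (Suc j) \<le> (\<integral>z. \<psi> z \<partial>\<nu> j)"
      "\<And>j. ereal (c - 1 / real (Suc j)) \<le> free_energy X I g Jac (\<nu> j)" by blast
    define t where "t j = (\<integral>z. \<psi> z \<partial>\<nu> j)" for j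
    have tB: "\<bar>t j\<bar> \<le> B" for j using \<nu>(1)[of j] integral_\<psi>_bound unfolding t_def by blast
    have "compact {- B..B}" by (rule compact_Icc)
    moreover have "\<forall>j. t j \<in> {- B..B}" using tB by (auto simp: abs_le_iff minus_le_iff)
    ultimately obtain t0 \<rho> where \<rho>: "t0 \<in> {- B..B}" "strict_mono \<rho>" "(t \<circ> \<rho>) \<longlonglongrightarrow> t0"
      unfolding compact_def by metis
    have inv: "(\<lambda>j. 1 / real (Suc (\<rho> j))) \<longlonglongrightarrow> 0"
      using LIMSEQ_subseq_LIMSEQ[OF LIMSEQ_Suc[OF lim_1_over_n] \<rho>(2)] by (simp add: comp_def)
    have "(\<lambda>j. a - 1 / real (Suc (\<rho> j))) \<longlonglongrightarrow> a - 0" by (intro tendsto_diff tendsto_const inv)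
    from LIMSEQ_le[OF this \<rho>(3)] have "a \<le> t0" using \<nu>(2) by (auto simp: t_def)
    then have t0: "t0 \<in> {a..max a B}" using \<rho>(1) by auto
    have "ereal c \<le> rate t0"
    proof (rule rate_ge)
      fix \<epsilon> :: real assume e: "\<epsilon> > 0"
      have "\<forall>\<^sub>F j in sequentially. dist ((t \<circ> \<rho>) j) t0 < \<epsilon>" using \<rho>(3) e by (rule tendstoD)
      then have "\<forall>\<^sub>F j in sequentially. ereal (c - 1 / real (Suc (\<rho> j))) \<le> rate_sup t0 \<epsilon>"
      proof eventually_elim
        case (elim j)
        have "\<nu> (\<rho> j) \<in> nbhd t0 \<epsilon>" using elim \<nu>(1) by (auto simp: nbhd_def t_def dist_real_def)
        then have "free_energy X I g Jac (\<nu> (\<rho> j)) \<le> rate_sup t0 \<epsilon>" unfolding rate_sup_def by (rule SUP_upper)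
        then show ?case using \<nu>(3)[of "\<rho> j"] by (rule order_trans[rotated])
      qed
      moreover have "(\<lambda>j. ereal (c - 1 / real (Suc (\<rho> j)))) \<longlonglongrightarrow> ereal (c - 0)"
        by (intro tendsto_ereal tendsto_diff tendsto_const inv)
      ultimately show "ereal c \<le> rate_sup t0 \<epsilon>" by (intro tendsto_upperbound[of _ "ereal c"]) auto
    qed
    then show "\<exists>t\<in>{a..max a B}. c' \<le> rate t" if "c' < ereal c" for c' using t0 that by (meson less_imp_le order_trans)
  qed simp
qed

lemma rate_upper:
  "\<exists>s\<ge>a. (\<forall>t\<ge>a. rate t \<le> rate s) \<and>
    limsup (\<lambda>n. ereal (1 / real n) * elog (measure M {x\<in>space M. 1 / real n * S n (x, 0) \<ge> a})) \<le> rate s"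
proof -
  let ?L = "limsup (\<lambda>n. ereal (1 / real n) * elog (measure M {x\<in>space M. 1 / real n * S n (x, 0) \<ge> a}))"
  \<comment> \<open>Taking the larger of the two quantities produces one point that both attains the
    supremum of the rate and dominates the upper limit.\<close>
  define \<sigma> where "\<sigma> = max ?L (SUP t\<in>{a..}. rate t)"
  have "\<exists>s\<in>{a..max a B}. \<sigma> \<le> rate s"
  proof (rule rate_attained)
    fix c assume c: "c < \<sigma>"
    show "\<exists>t\<in>{a..max a B}. c \<le> rate t"
    proof (cases "c < ?L")
      case True
      then show ?thesis
      proof (cases c)
        case (real c')
        then show ?thesis using limsup_approx True by simp
      next
        case MInf
        then show ?thesis by (intro bexI[of _ a]) auto
      qed simp
    next
      case False
      then have "c < (SUP t\<in>{a..}. rate t)" using c by (auto simp: \<sigma>_def less_max_iff_disj)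
      then obtain t where t: "t \<ge> a" "c < rate t" by (auto simp: less_SUP_iff)
      \<comment> \<open>No invariant measure has an integral of \<psi> beyond B, so the rate is
        -\<infinity> there and the half line may be replaced by a compact interval.\<close>
      have "t \<le> B"
      proof (rule ccontr)
        assume tB: "\<not> t \<le> B"
        have "nbhd t (t - B) = {}" using integral_\<psi>_bound by (fastforce simp: nbhd_def abs_le_iff)
        then have "rate_sup t (t - B) = -\<infinity>" by (simp add: rate_sup_def bot_ereal_def)
        then have "rate t \<le> -\<infinity>" using rate_le[of "t - B" t] tB by simp
        then show False using t(2) by simp
      qed
      then show ?thesis using t by (intro bexI[of _ t]) auto
    qed
  qed simp
  then obtain s where s: "s \<ge> a" "\<sigma> \<le> rate s" by auto
  have "rate t \<le> rate s" if "t \<ge> a" for t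
  proof -
    have "rate t \<le> (SUP t\<in>{a..}. rate t)" using that by (intro SUP_upper) auto
    also have "\<dots> \<le> \<sigma>" by (simp add: \<sigma>_def)
    finally show ?thesis using s(2) by (rule order_trans)
  qed
  moreover have "?L \<le> rate s" using s(2) by (simp add: \<sigma>_def)
  ultimately show ?thesis using s(1) by blast
qed

end

theorem theorem1:
  fixes M :: "'a measure"
    and X :: "nat \<Rightarrow> 'a set"
    and I :: "nat \<Rightarrow> 'a set set"
    and g :: "'a set \<Rightarrow> 'a \<Rightarrow> 'a"
    and Jac :: "'a \<times> nat \<Rightarrow> real"
    and \<psi> :: "'a \<times> nat \<Rightarrow> real"
  assumes "tower M X I"
    and "nonsteep M X I"
    and "\<And>J. J \<in> exits X I \<Longrightarrow> bi_nonsingular M J (g J)"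
    and "admissible X I g"
    and "bounded_distortion M X I g Jac"
    and "\<psi> \<in> observables X I g"
  shows "\<exists>q :: real \<Rightarrow> ereal.
     (\<forall>t. q t \<le> 0) \<and> usc q \<and> ereal_concave q \<and>
     (\<forall>a. (SUP t\<in>{a<..}. q t) \<le>
        liminf (\<lambda>n. ereal (1 / real n) *
          elog (measure M {x \<in> space M. 1 / real n * birkhoff_sum (tower_map X I g) n \<psi> (x, 0) > a}))) \<and>
     (\<forall>a. \<exists>s\<ge>a. (\<forall>t\<ge>a. q t \<le> q s) \<and>
        limsup (\<lambda>n. ereal (1 / real n) *
          elog (measure M {x \<in> space M. 1 / real n * birkhoff_sum (tower_map X I g) n \<psi> (x, 0) \<ge> a})) \<le> q s) \<and>
     (\<forall>t. ((\<lambda>\<epsilon>. SUP \<nu> \<in> {\<nu> \<in> tower_invariant X I g.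
              (\<exists>K\<ge>1. measure \<nu> (\<Union>k<K. X k \<times> {k}) = 1) \<and>
              \<bar>(\<integral>z. \<psi> z \<partial>\<nu>) - t\<bar> < \<epsilon>}. free_energy X I g Jac \<nu>)
        \<longlongrightarrow> q t) (at_right (0 :: real)))"
proof -
  from assms(5)[unfolded bounded_distortion_def, THEN conjunct2] obtain D eps where D: "1 \<le> D" "eps \<longlonglongrightarrow> 0"
    and dist: "\<forall>n\<ge>1. \<forall>A\<in>tower_join X I g n. \<forall>z\<in>A. \<forall>w\<in>A.
      Jac z / Jac w \<le> exp (eps (return_count X I g n A)) \<and>
      (\<Prod>i<n. Jac ((tower_map X I g ^^ i) z)) / (\<Prod>i<n. Jac ((tower_map X I g ^^ i) w)) \<le> D"
    by (elim exE conjE) (rule that, assumption+)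
  from assms(2)[unfolded nonsteep_def] obtain l :: "nat \<Rightarrow> nat" and \<gamma> :: "nat \<Rightarrow> real" where
    l: "(\<lambda>k. real (l k) / real k) \<longlonglongrightarrow> 0" and \<gamma>: "\<forall>k. 0 < \<gamma> k \<and> \<gamma> k < 1" "(\<lambda>k. ln (\<gamma> k) / real k) \<longlonglongrightarrow> 0"
    and steep: "\<forall>k. \<forall>J\<in>I k. measure M (J - X (k + l k)) \<ge> \<gamma> k * measure M J"
    by (elim exE conjE) (rule that, assumption+)
  interpret tower_ld M X I g Jac D eps \<psi> l \<gamma>
  proof unfold_locales
    show "tower M X I" "admissible X I g" "\<psi> \<in> observables X I g" by fact+
    show "bi_nonsingular M J (g J)" if "J \<in> exits X I" for J by (rule assms(3)[OF that])
    show "is_jacobian M X I g Jac" using assms(5)[unfolded bounded_distortion_def] by (rule conjunct1)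
    show "1 \<le> D" "eps \<longlonglongrightarrow> 0" by (rule D)+
    show "Jac z / Jac w \<le> exp (eps (return_count X I g n A)) \<and>
      (\<Prod>i<n. Jac ((tower_map X I g ^^ i) z)) / (\<Prod>i<n. Jac ((tower_map X I g ^^ i) w)) \<le> D"
      if "n \<ge> 1" "A \<in> tower_join X I g n" "z \<in> A" "w \<in> A" for n A z w
      using dist that by blast
    show "(\<lambda>k. real (l k) / real k) \<longlonglongrightarrow> 0" "(\<lambda>k. ln (\<gamma> k) / real k) \<longlonglongrightarrow> 0" by fact+
    show "0 < \<gamma> k" "\<gamma> k < 1" for k using \<gamma>(1) by auto
    show "\<gamma> k * measure M J \<le> measure M (J - X (k + l k))" if "J \<in> I k" for J k
      using steep that by blast
  qed
  have nb: "{\<nu> \<in> tower_invariant X I g. (\<exists>K\<ge>1. measure \<nu> (\<Union>k<K. X k \<times> {k}) = 1) \<and>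
      \<bar>(\<integral>z. \<psi> z \<partial>\<nu>) - t\<bar> < \<epsilon>} = nbhd t \<epsilon>" for t \<epsilon>
    unfolding nbhd_def finlev_def lev_def by blast
  show ?thesis
    unfolding nb
  proof (intro exI[of _ rate] conjI allI)
    show "rate t \<le> 0" for t by (rule rate_le_0)
    show "usc rate" by (rule rate_usc)
    show "ereal_concave rate" by (rule rate_concave)
    show "((\<lambda>\<epsilon>. SUP \<nu>\<in>nbhd t \<epsilon>. free_energy X I g Jac \<nu>) \<longlongrightarrow> rate t) (at_right 0)" for t
      using rate_tendsto[of t] unfolding rate_sup_def[abs_def] .
  qed (rule rate_lower rate_upper)+
qed

end
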